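(* Let $X_t$ be a process in $\mathbb{R}^d$ with additive components and let $y_t(r)$ be its associated function (see context). Let $b\in(0,\infty)$, let $\phi$ be a quasiconvex function, and let $v>0$ be a nondecreasing function with $y_{v(t)}(b)=\phi(t)$ (for $t>0$ small). Suppose that $y_{v(t)}(r)$ is quasiconvex with respect to $v$: there are $t_0>0$, $\sigma>0$ and a slow function $c:(0,b]\to(0,1)$ such that $$\frac{y_{v(t_2)}(r)}{y_{v(t_1)}(r)}\ge c(r)\Big(\frac{t_2}{t_1}\Big)^{\sigma},\qquad 0<t_1<t_2\le t_0,\ r\in(0,b].$$ Let $\delta_1,\delta_2,\beta_1,\beta_2,\delta,\beta,\delta_P,\beta_P,\delta_E$ be the indices defined in the context. Then: (1) $\delta_1=\delta_2=\delta=\delta_P=\delta_E$ and $\beta_1=\beta_2=\beta=\beta_P$. (2) If $\sum_{j=1}^d\int_{|x|\le1}|x|\,\nu_\tau^{(j)}(dx)<\infty$ and $\sum_{j=1}^dC_\tau^{(j)}=0$ for some $\tau>0$, then $\beta\le1/\sigma$. (3) If $X_t$ is drift-free initially, $\sum_{j=1}^dC_\tau^{(j)}=0$ for some $\tau>0$, and there are $t_0'>0$, $r_0>0$, a constant $\sigma'\le\sigma$ and a slow function $c'$ with $G_{v(t_2)}(r)/G_{v(t_1)}(r)\le c'(r)^{-1}(t_2/t_1)^{\sigma'}$ for $0<t_1<t_2\le t_0'$, $r\in(0,r_0)$, then $\beta=\inf\{\eta\ge0:\lim_{r\to0}r^\eta\bar n(r)^{-1}=0\}$, where $\bar n(r)=\inf\{t>0:G_{v(t)}(r)>m\}$.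 (4) If $X_t$ is drift-free initially with increasing components, then $\delta=\sup\{\eta\ge0:\lim_{r\to\infty}r^\eta\hat n(r)=0\}$ and $\beta=\inf\{\eta\ge0:\lim_{r\to\infty}r^\eta\hat n(r)=\infty\}$, where $\hat n(r)=\inf\{t>0:g_{v(t)}(r)>m\}$ and $g_t(r)=\sum_{i=1}^dg_t^{(i)}(r)$, $g_t^{(i)}(\lambda)=\int_0^\infty(1-e^{-\lambda x})\nu_t^{(i)}(dx)$.
   Context: $X_t^*=\sup_{0\le s\le t}|X_s|$. Additive process: a process with independent increments, right-continuous paths with left limits, continuous in probability, with $X_0=0$. A process $X_t=(X_t^{(1)},\dots,X_t^{(d)})$ in $\mathbb{R}^d$ has additive components if each $X_t^{(i)}$ is a real additive process (the vector process itself need not have independent increments). A real additive process has characteristics $(B_t,C_t,\nu_t)$: $E e^{i\lambda X_t}=\exp\{i\lambda B_t-\tfrac12\lambda^2C_t+\int(e^{i\lambda x}-1-i\lambda x1(|x|\le1))\nu_t(dx)\}$, with $B_t$ continuous, $B_0=0$, $C_t$ nondecreasing continuous, $C_0=0$, $\nu_t$ a Lévy measure for each $t$, nondecreasing and continuous in $t$, $\nu_0=0$. The characteristics of $X_t^{(i)}$ are $(B_t^{(i)},C_t^{(i)},\nu_t^{(i)})$. For a real additive process put, for $r>0,t\ge0$, $$G_t(r)=\int_{|x|>r}\nu_t(dx),\quad K_t(r)=r^{-2}\Big[C_t+\int_{|x|\le r}x^2\nu_t(dx)\Big],$$ $$M_t(r)=r^{-1}\Big|B_t+\int_{1<|x|\le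 r\vee1}x\,\nu_t(dx)-\int_{r\wedge1<|x|\le1}x\,\nu_t(dx)\Big|,\quad M_t^*(r)=\max_{0\le s\le t}M_s(r),$$ and $y_t(r)=G_t(r)+K_t(r)+M_t^*(r)$. For a process in $\mathbb{R}^d$ with additive components, $y_t(r)=\sum_{i=1}^dy_t^{(i)}(r)$ and $G_t(r)=\sum_{i=1}^dG_t^{(i)}(r)$, where the superscript $(i)$ refers to $X_t^{(i)}$ (if $X_t$ is additive in $\mathbb{R}^d$ with Lévy kernel $\nu_t$ on $\mathbb{R}^d$, one takes $G_t(r)=\nu_t(\{x\in\mathbb{R}^d:|x|>r\})$, which is comparable to this sum up to constants depending on $d$). Drift: when $\int_{|x|\le1}|x|\nu_t^{(j)}(dx)<\infty$, $\gamma_0^{(j)}(t)=B_t^{(j)}-\int_{|x|\le1}x\,\nu_t^{(j)}(dx)$ and $\gamma_0^{(j)*}(t)=\max_{0\le s\le t}|\gamma_0^{(j)}(s)|$. $X_t$ is drift-free initially if, for each $j$, whenever $\int_{|x|\le1}|x|\nu_\varepsilon^{(j)}(dx)<\infty$ for some $\varepsilon>0$, there is $\varepsilon_1\in(0,\varepsilon)$ with $\gamma_0^{(j)*}(\varepsilon_1)=0$. Quasiconvex function: a nondecreasing right-continuous $\phi$ with $\phi(0)=0$, $\phi(t)>0$ for $t>0$, and constants $\rho,\sigma\in(0,\infty)$ with $\phi(t_2)/\phi(t_1)\ge\rho(t_2/t_1)^\sigma$ whenever $0<t_1<t_2$. Slow function: a function $c$ with values in $(0,1)$, defined near $0$, with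 $\liminf_{r\to0}c(r)r^{-\eta}>0$ for all $\eta>0$. $\Sigma$-sequence: a sequence $\sigma_n\downarrow0$ of positive numbers with $\frac{\sigma_{n-1}}{\sigma_n}\sigma_n^\eta\to0$ for every $\eta>0$. Indices: $\delta_1=\inf\{\eta>0:\liminf_{r\to0}y_{v(r)}(r^{1/\eta})=0\}$; $\delta_2=\sup\{\eta>0:\sum_n y_{v(\sigma_n)}(\sigma_n^{1/\eta})^{-1}<\infty$ for some $\Sigma$-sequence $\sigma_n\downarrow0\}$; $\beta_1=\sup\{\eta>0:\liminf_{r\to0}y_{v(r)}(r^{1/\eta})^{-1}=0\}$; $\beta_2=\inf\{\eta>0:\sum_n y_{v(\sigma_n)}(\sigma_n^{1/\eta})<\infty$ for some $\Sigma$-sequence $\sigma_n\downarrow0\}$ (with $\sup\emptyset=0$). Fix $m\in\big(0,\ \tfrac12y_{v(t_0)}(b)\wedge(aK(d))^{-1}\big)$ with $a=\tfrac12(3+\sqrt5)$, $K(d)=3d^2$ for $d>1$, $K(1)=1$, and let $n(r)=\inf\{t>0:y_{v(t)}(r)>m\}$. Then $\delta=\inf\{\eta\ge0:\liminf_{r\to0}r^\eta n(r)^{-1}=0\}$, $\beta=\inf\{\eta\ge0:\lim_{r\to0}r^\eta n(r)^{-1}=0\}$. For any fixed $l\in(0,t_0]$, $\delta_P=\sup\{\eta\ge0:\limsup_{r\to0}r^{-\eta}\int_0^lP(X^*_{v(t)}\le r)\,dt<\infty\}$, $\beta_P=\sup\{\eta\ge0:\liminf_{r\to0}r^{-\eta}\int_0^lP(X^*_{v(t)}\le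 r)\,dt<\infty\}$, $\delta_E=\sup\{\eta\ge0:\int_0^lE(X^*_{v(t)})^{-\eta}\,dt<\infty\}$.
   Formalization: Parts (2), (3) and (4) are proved under the extra assumption v(t)→0 as t→0; without it they fail, e.g. (2) for X_t=W_{(t-1)+} (W Brownian motion), v(t)=1+t, where β=2>1/σ=1. Part (1) is proved as stated. *)

theory Defs
  imports "HOL-Probability.Probability"
begin

section \<open>Additive processes and their characteristics\<close>

text \<open>Time is the half-line of nonnegative reals; a process is a function on all of \<open>real\<close> of which
  only the values at times \<open>t \<ge> 0\<close> matter. Path properties hold for every sample point.\<close>

definition independent_increments :: "'w measure \<Rightarrow> (real \<Rightarrow> 'w \<Rightarrow> real) \<Rightarrow> bool" where
  "independent_increments P X \<longleftrightarrow>
     (\<forall>n (u :: nat \<Rightarrow> real). 0 \<le> u 0 \<longrightarrow> strict_mono_on {..n} u \<longrightarrow>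
        prob_space.indep_vars P (\<lambda>_. borel) (\<lambda>k \<omega>. X (u (Suc k)) \<omega> - X (u k) \<omega>) {..<n})"

definition cadlag :: "(real \<Rightarrow> real) \<Rightarrow> bool" where
  "cadlag f \<longleftrightarrow>
     (\<forall>t\<ge>0. continuous (at_right t) f) \<and> (\<forall>t>0. \<exists>l. (f \<longlongrightarrow> l) (at_left t))"

definition continuous_in_probability :: "'w measure \<Rightarrow> (real \<Rightarrow> 'w \<Rightarrow> real) \<Rightarrow> bool" where
  "continuous_in_probability P X \<longleftrightarrow>
     (\<forall>s\<ge>0. \<forall>\<epsilon>>0.
        ((\<lambda>t. measure P {\<omega> \<in> space P. \<bar>X t \<omega> - X s \<omega>\<bar> > \<epsilon>}) \<longlongrightarrow> 0) (at s within {0..}))"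

definition additive_process :: "'w measure \<Rightarrow> (real \<Rightarrow> 'w \<Rightarrow> real) \<Rightarrow> bool" where
  "additive_process P X \<longleftrightarrow>
     (\<forall>t\<ge>0. X t \<in> borel_measurable P) \<and>
     (\<forall>\<omega>\<in>space P. X 0 \<omega> = 0) \<and>
     independent_increments P X \<and>
     (\<forall>\<omega>\<in>space P. cadlag (\<lambda>t. X t \<omega>)) \<and>
     continuous_in_probability P X"

definition levy_measure :: "real measure \<Rightarrow> bool" where
  "levy_measure \<mu> \<longleftrightarrow>
     sets \<mu> = sets borel \<and> emeasure \<mu> {0} = 0 \<and> (\<integral>\<^sup>+ x. ennreal (min 1 (x\<^sup>2)) \<partial>\<mu>) < \<infinity>"

text \<open>Continuity of the family of Levy measures is setwise continuity away from the origin, where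
  the measures are finite.\<close>

definition has_characteristics ::
  "'w measure \<Rightarrow> (real \<Rightarrow> 'w \<Rightarrow> real) \<Rightarrow> (real \<Rightarrow> real) \<Rightarrow> (real \<Rightarrow> real) \<Rightarrow> (real \<Rightarrow> real measure) \<Rightarrow> bool"
where
  "has_characteristics P X B C \<nu> \<longleftrightarrow>
     continuous_on {0..} B \<and> B 0 = 0 \<and>
     continuous_on {0..} C \<and> mono_on {0..} C \<and> C 0 = 0 \<and>
     (\<forall>t\<ge>0. levy_measure (\<nu> t)) \<and>
     (\<forall>s t. 0 \<le> s \<longrightarrow> s \<le> t \<longrightarrow> (\<forall>A\<in>sets borel. emeasure (\<nu> s) A \<le> emeasure (\<nu> t) A)) \<and>
     (\<forall>\<epsilon>>0. \<forall>A\<in>sets borel. A \<subseteq> {x. \<bar>x\<bar> > \<epsilon>} \<longrightarrow> continuous_on {0..} (\<lambda>t. measure (\<nu> t) A)) \<and>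
     emeasure (\<nu> 0) UNIV = 0 \<and>
     (\<forall>t\<ge>0. \<forall>u::real. char (distr P borel (X t)) u =
        exp (\<i> * of_real (u * B t) - of_real (u\<^sup>2 * C t / 2)
             + (CLINT x|\<nu> t. iexp (u * x) - 1 - \<i> * of_real (u * x * indicator {-1..1} x))))"

section \<open>The function y\<close>

definition G1 :: "(real \<Rightarrow> real measure) \<Rightarrow> real \<Rightarrow> real \<Rightarrow> real" where
  "G1 \<nu> t r = measure (\<nu> t) {x. \<bar>x\<bar> > r}"

definition K1 :: "(real \<Rightarrow> real) \<Rightarrow> (real \<Rightarrow> real measure) \<Rightarrow> real \<Rightarrow> real \<Rightarrow> real" where
  "K1 C \<nu> t r = (C t + (LINT x:{x. \<bar>x\<bar> \<le> r}|\<nu> t. x\<^sup>2)) / r\<^sup>2"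

definition M1 :: "(real \<Rightarrow> real) \<Rightarrow> (real \<Rightarrow> real measure) \<Rightarrow> real \<Rightarrow> real \<Rightarrow> real" where
  "M1 B \<nu> t r =
     \<bar>B t + (LINT x:{x. 1 < \<bar>x\<bar> \<and> \<bar>x\<bar> \<le> max r 1}|\<nu> t. x)
          - (LINT x:{x. min r 1 < \<bar>x\<bar> \<and> \<bar>x\<bar> \<le> 1}|\<nu> t. x)\<bar> / r"

definition M1_star :: "(real \<Rightarrow> real) \<Rightarrow> (real \<Rightarrow> real measure) \<Rightarrow> real \<Rightarrow> real \<Rightarrow> real" where
  "M1_star B \<nu> t r = (SUP s\<in>{0..t}. M1 B \<nu> s r)"

definition y1 ::
  "(real \<Rightarrow> real) \<Rightarrow> (real \<Rightarrow> real) \<Rightarrow> (real \<Rightarrow> real measure) \<Rightarrow> real \<Rightarrow> real \<Rightarrow> real" where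
  "y1 B C \<nu> t r = G1 \<nu> t r + K1 C \<nu> t r + M1_star B \<nu> t r"

text \<open>For a process with additive components the characteristics are indexed by the components.\<close>

definition y_fun ::
  "('n::finite \<Rightarrow> real \<Rightarrow> real) \<Rightarrow> ('n \<Rightarrow> real \<Rightarrow> real) \<Rightarrow> ('n \<Rightarrow> real \<Rightarrow> real measure)
     \<Rightarrow> real \<Rightarrow> real \<Rightarrow> real" where
  "y_fun B C \<nu> t r = (\<Sum>i\<in>UNIV. y1 (B i) (C i) (\<nu> i) t r)"

definition G_fun :: "('n::finite \<Rightarrow> real \<Rightarrow> real measure) \<Rightarrow> real \<Rightarrow> real \<Rightarrow> real" where
  "G_fun \<nu> t r = (\<Sum>i\<in>UNIV. G1 (\<nu> i) t r)"

definition g_fun :: "('n::finite \<Rightarrow> real \<Rightarrow> real measure) \<Rightarrow> real \<Rightarrow> real \<Rightarrow> real" where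
  "g_fun \<nu> t r = (\<Sum>i\<in>UNIV. (LINT x:{0<..}|\<nu> i t. 1 - exp (- (r * x))))"

section \<open>Drift\<close>

definition small_jump_variation :: "(real \<Rightarrow> real measure) \<Rightarrow> real \<Rightarrow> ennreal" where
  "small_jump_variation \<nu> t = (\<integral>\<^sup>+ x\<in>{x. \<bar>x\<bar> \<le> 1}. ennreal \<bar>x\<bar> \<partial>\<nu> t)"

definition \<gamma>0 :: "(real \<Rightarrow> real) \<Rightarrow> (real \<Rightarrow> real measure) \<Rightarrow> real \<Rightarrow> real" where
  "\<gamma>0 B \<nu> t = B t - (LINT x:{x. \<bar>x\<bar> \<le> 1}|\<nu> t. x)"

definition \<gamma>0_star :: "(real \<Rightarrow> real) \<Rightarrow> (real \<Rightarrow> real measure) \<Rightarrow> real \<Rightarrow> real" where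
  "\<gamma>0_star B \<nu> t = (SUP s\<in>{0..t}. \<bar>\<gamma>0 B \<nu> s\<bar>)"

definition drift_free_initially ::
  "('n \<Rightarrow> real \<Rightarrow> real) \<Rightarrow> ('n \<Rightarrow> real \<Rightarrow> real measure) \<Rightarrow> bool" where
  "drift_free_initially B \<nu> \<longleftrightarrow>
     (\<forall>j. \<forall>\<epsilon>>0. small_jump_variation (\<nu> j) \<epsilon> < \<infinity> \<longrightarrow>
        (\<exists>\<epsilon>1. 0 < \<epsilon>1 \<and> \<epsilon>1 < \<epsilon> \<and> \<gamma>0_star (B j) (\<nu> j) \<epsilon>1 = 0))"

section \<open>Quasiconvex functions, slow functions, Sigma-sequences\<close>

definition quasiconvex :: "(real \<Rightarrow> real) \<Rightarrow> bool" where
  "quasiconvex \<phi> \<longleftrightarrow>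
     mono_on {0..} \<phi> \<and> (\<forall>t\<ge>0. continuous (at_right t) \<phi>) \<and> \<phi> 0 = 0 \<and> (\<forall>t>0. \<phi> t > 0) \<and>
     (\<exists>\<rho>>0. \<exists>\<sigma>>0. \<forall>t1 t2. 0 < t1 \<longrightarrow> t1 < t2 \<longrightarrow> \<phi> t2 / \<phi> t1 \<ge> \<rho> * (t2 / t1) powr \<sigma>)"

text \<open>\<open>S\<close> is the domain of the slow function, a one-sided neighbourhood of 0.\<close>

definition slow_on :: "real set \<Rightarrow> (real \<Rightarrow> real) \<Rightarrow> bool" where
  "slow_on S c \<longleftrightarrow>
     (\<forall>r\<in>S. 0 < c r \<and> c r < 1) \<and>
     (\<forall>\<eta>>0. Liminf (at_right 0) (\<lambda>r. ereal (c r * r powr (- \<eta>))) > 0)"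

definition Sigma_sequence :: "(nat \<Rightarrow> real) \<Rightarrow> bool" where
  "Sigma_sequence s \<longleftrightarrow>
     (\<forall>n. s n > 0) \<and> decseq s \<and> s \<longlonglongrightarrow> 0 \<and>
     (\<forall>\<eta>>0. (\<lambda>n. s n / s (Suc n) * s (Suc n) powr \<eta>) \<longlonglongrightarrow> 0)"

section \<open>Indices\<close>

text \<open>All indices are elements of \<open>[0, \<infinity>]\<close>; in the type \<open>ennreal\<close> the infimum of the empty set is
  \<open>\<infinity>\<close> and its supremum is \<open>0\<close>. The argument \<open>Y\<close> stands for the time-changed function
  \<open>\<lambda>t r. y_fun B C \<nu> (v t) r\<close>.\<close>

definition delta1 :: "(real \<Rightarrow> real \<Rightarrow> real) \<Rightarrow> ennreal" where
  "delta1 Y = Inf (ennreal ` {\<eta>. \<eta> > 0 \<and>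
     Liminf (at_right 0) (\<lambda>r. ennreal (Y r (r powr (1 / \<eta>)))) = 0})"

definition delta2 :: "(real \<Rightarrow> real \<Rightarrow> real) \<Rightarrow> ennreal" where
  "delta2 Y = Sup (ennreal ` {\<eta>. \<eta> > 0 \<and>
     (\<exists>s. Sigma_sequence s \<and> (\<Sum>n. inverse (ennreal (Y (s n) (s n powr (1 / \<eta>))))) < \<infinity>)})"

definition beta1 :: "(real \<Rightarrow> real \<Rightarrow> real) \<Rightarrow> ennreal" where
  "beta1 Y = Sup (ennreal ` {\<eta>. \<eta> > 0 \<and>
     Liminf (at_right 0) (\<lambda>r. inverse (ennreal (Y r (r powr (1 / \<eta>))))) = 0})"

definition beta2 :: "(real \<Rightarrow> real \<Rightarrow> real) \<Rightarrow> ennreal" where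
  "beta2 Y = Inf (ennreal ` {\<eta>. \<eta> > 0 \<and>
     (\<exists>s. Sigma_sequence s \<and> (\<Sum>n. ennreal (Y (s n) (s n powr (1 / \<eta>)))) < \<infinity>)})"

text \<open>\<open>passage F m\<close> is \<open>n\<close>, \<open>n\<close>-bar or \<open>n\<close>-hat according to whether \<open>F\<close> is the time-changed
  \<open>y\<close>, \<open>G\<close> or \<open>g\<close>; it is \<open>\<infinity>\<close> if the level \<open>m\<close> is never exceeded.\<close>

definition passage :: "(real \<Rightarrow> real \<Rightarrow> real) \<Rightarrow> real \<Rightarrow> real \<Rightarrow> ennreal" where
  "passage F m r = Inf (ennreal ` {t. t > 0 \<and> F t r > m})"

definition lower_index :: "(real \<Rightarrow> ennreal) \<Rightarrow> ennreal" where
  "lower_index n = Inf (ennreal ` {\<eta>. \<eta> \<ge> 0 \<and>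
     Liminf (at_right 0) (\<lambda>r. ennreal (r powr \<eta>) / n r) = 0})"

definition upper_index :: "(real \<Rightarrow> ennreal) \<Rightarrow> ennreal" where
  "upper_index n = Inf (ennreal ` {\<eta>. \<eta> \<ge> 0 \<and>
     ((\<lambda>r. ennreal (r powr \<eta>) / n r) \<longlongrightarrow> 0) (at_right 0)})"

definition run_sup :: "(real \<Rightarrow> 'w \<Rightarrow> real ^ 'n) \<Rightarrow> real \<Rightarrow> 'w \<Rightarrow> real" where
  "run_sup X t \<omega> = (SUP s\<in>{0..t}. norm (X s \<omega>))"

definition small_ball_integral ::
  "'w measure \<Rightarrow> (real \<Rightarrow> 'w \<Rightarrow> real ^ 'n) \<Rightarrow> (real \<Rightarrow> real) \<Rightarrow> real \<Rightarrow> real \<Rightarrow> ennreal" where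
  "small_ball_integral P X v l r =
     (\<integral>\<^sup>+ t\<in>{0<..l}. emeasure P {\<omega> \<in> space P. run_sup X (v t) \<omega> \<le> r} \<partial>lborel)"

definition delta_P ::
  "'w measure \<Rightarrow> (real \<Rightarrow> 'w \<Rightarrow> real ^ 'n) \<Rightarrow> (real \<Rightarrow> real) \<Rightarrow> real \<Rightarrow> ennreal" where
  "delta_P P X v l = Sup (ennreal ` {\<eta>. \<eta> \<ge> 0 \<and>
     Limsup (at_right 0) (\<lambda>r. ennreal (r powr (- \<eta>)) * small_ball_integral P X v l r) < \<infinity>})"

definition beta_P ::
  "'w measure \<Rightarrow> (real \<Rightarrow> 'w \<Rightarrow> real ^ 'n) \<Rightarrow> (real \<Rightarrow> real) \<Rightarrow> real \<Rightarrow> ennreal" where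
  "beta_P P X v l = Sup (ennreal ` {\<eta>. \<eta> \<ge> 0 \<and>
     Liminf (at_right 0) (\<lambda>r. ennreal (r powr (- \<eta>)) * small_ball_integral P X v l r) < \<infinity>})"

text \<open>The power \<open>x\<close> to the \<open>-\<eta>\<close> for \<open>x, \<eta> \<ge> 0\<close>, which is infinite at \<open>x = 0\<close> when \<open>\<eta> > 0\<close>
  (whereas \<open>0 powr a = 0\<close> in the library).\<close>

definition neg_power :: "real \<Rightarrow> real \<Rightarrow> ennreal" where
  "neg_power x \<eta> = (if x = 0 then if \<eta> = 0 then 1 else \<infinity> else ennreal (x powr (- \<eta>)))"

definition delta_E ::
  "'w measure \<Rightarrow> (real \<Rightarrow> 'w \<Rightarrow> real ^ 'n) \<Rightarrow> (real \<Rightarrow> real) \<Rightarrow> real \<Rightarrow> ennreal" where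
  "delta_E P X v l = Sup (ennreal ` {\<eta>. \<eta> \<ge> 0 \<and>
     (\<integral>\<^sup>+ t\<in>{0<..l}. (\<integral>\<^sup>+ \<omega>. neg_power (run_sup X (v t) \<omega>) \<eta> \<partial>P) \<partial>lborel) < \<infinity>})"

definition K_dim :: "nat \<Rightarrow> real" where
  "K_dim d = (if d > 1 then 3 * real d ^ 2 else 1)"

end

theory Submission
  imports Defs
begin

text \<open>
  For one real additive component everything is read off the characteristic function. Averaging
  \<open>1 - E cos (u (X\<^sub>t - X\<^sub>s))\<close> over \<open>u \<le> 8 / r\<close> bounds \<open>P(\<bar>X\<^sub>t - X\<^sub>s\<bar> > r)\<close> by a multiple of
  \<open>y\<^sub>t(r)\<close>, and Ottaviani's inequality turns this into a bound for the maximum. Conversely, if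
  \<open>y\<^sub>t(r)\<close> is large, then by continuity in time \<open>[0, t]\<close> splits into about \<open>y\<^sub>t(r)\<close> blocks over each of
  which the increment of \<open>G + K\<close> plus that of the truncated drift is a large constant. An increment
  that stays in \<open>[-2r, 2r]\<close> with probability above \<open>7/8\<close> has a characteristic function near 1 for
  \<open>u \<le> 1 / (8r)\<close>, hence, by following its logarithm, a bounded block; so each block is left with
  probability at least \<open>1/8\<close> and \<open>P(X\<^sup>*\<^sub>t \<le> r)\<close> decays exponentially in \<open>y\<^sub>t(r)\<close>. Quasiconvexity makes
  \<open>n(r)\<close> determine \<open>y\<^sub>v\<^sub>(\<^sub>t\<^sub>)(r)\<close> on the power scale, so all indices compare \<open>n(r)\<close> with \<open>r\<^sup>\<eta>\<close>.

  Parts (2) and (3) follow from the bound \<open>y\<^sub>t(r) \<le> K r\<^sup>-\<^sup>p\<close> at one fixed small time, where \<open>p\<close> is an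
  exponent for which the small jumps have a finite \<open>p\<close>-th moment. For (4), the Laplace transform of
  a nonnegative \<open>X\<^sub>t\<close> bounds \<open>\<Sum>\<^sub>k E min 1 (X(t\<^sub>k\<^sub>+\<^sub>1) - X(t\<^sub>k))\<close> uniformly over partitions; this
  forces \<open>C = 0\<close>, jumps of positive sign only, and finite variation, whence \<open>y\<^sub>t(r)\<close> and \<open>g\<^sub>t(1 / r)\<close>
  are comparable.
\<close>

section \<open>Integrals against increasing families of Levy measures\<close>

text \<open>Independence is available inside one component only. Small balls of the vector process
  are therefore bounded below by a union bound over coordinates and bounded above through a single
  coordinate, one whose \<open>y1\<close> is at least the average. Quasiconvexity holds up to a slow
  factor, hence up to \<open>r powr \<epsilon>\<close> for every \<epsilon> > 0; so each index
  statement is proved with strict gaps between exponents, and the same gaps absorb all numerical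
  constants of the probability estimates, which are never optimised. In the radius \<open>y\<close>
  is monotone only up to a factor 2, because the mass leaving the tail reappears both in the second
  moment and in the truncated drift; this factor is paid for by the 1/2 in the bound on
  \<open>m\<close>. Parts (2) to (4) work at a time \<open>v t\<close> that must lie below a
  prescribed threshold, and the limit of \<open>v\<close> at 0 provides it.\<close>

definition levy_dominated :: "(real \<Rightarrow> 'b::real_normed_vector) \<Rightarrow> bool" where
  "levy_dominated f \<longleftrightarrow> f \<in> borel_measurable borel \<and> (\<exists>K\<ge>0. \<forall>x. norm (f x) \<le> K * min 1 (x\<^sup>2))"

text \<open>The defining integral of \<open>levy_measure\<close> has integrand
  \<open>min 1 (x\<^sup>2)\<close>, so a quadratic bound near 0 and a constant bound elsewhere
  suffice. The factor \<open>c\<close> converts the bound on either side of the threshold \<rho>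
  into a multiple of that integrand.\<close>

lemma levy_dominatedI:
  fixes f :: "real \<Rightarrow> 'b::real_normed_vector"
  assumes [measurable]: "f \<in> borel_measurable borel" and "\<rho> > 0"
    and small: "\<And>x. \<bar>x\<bar> \<le> \<rho> \<Longrightarrow> norm (f x) \<le> K * x\<^sup>2"
    and large: "\<And>x. \<bar>x\<bar> > \<rho> \<Longrightarrow> norm (f x) \<le> K"
  shows "levy_dominated f"
proof -
  have "0 \<le> norm (f (\<rho> + 1))" by simp
  also have "\<dots> \<le> K" using \<open>\<rho> > 0\<close> by (intro large) auto
  finally have K: "K \<ge> 0" .
  define c where "c = max 1 (max (\<rho>\<^sup>2) (1 / \<rho>\<^sup>2))"
  have c: "c \<ge> 1" "c \<ge> \<rho>\<^sup>2" "c \<ge> 1 / \<rho>\<^sup>2" by (auto simp: c_def)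
  have "norm (f x) \<le> (K * c) * min 1 (x\<^sup>2)" for x
  proof (cases "\<bar>x\<bar> \<le> \<rho>")
    case True
    then have "x\<^sup>2 \<le> c" using c(2) power_mono[of "\<bar>x\<bar>" \<rho> 2] by simp
    moreover have "x\<^sup>2 \<le> c * x\<^sup>2" using c(1) mult_right_mono[of 1 c "x\<^sup>2"] by simp
    ultimately have "x\<^sup>2 \<le> c * min 1 (x\<^sup>2)" by (simp add: min_def)
    then have "K * x\<^sup>2 \<le> K * (c * min 1 (x\<^sup>2))" using K by (rule mult_left_mono)
    then show ?thesis using small[OF True] by (simp add: mult.assoc)
  next
    case False
    then have "\<rho>\<^sup>2 \<le> x\<^sup>2" using \<open>\<rho> > 0\<close> power_mono[of \<rho> "\<bar>x\<bar>" 2] by simp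
    then have "1 \<le> (1 / \<rho>\<^sup>2) * x\<^sup>2" using \<open>\<rho> > 0\<close> by (simp add: field_simps)
    also have "\<dots> \<le> c * x\<^sup>2" using c by (intro mult_right_mono) auto
    finally have "1 \<le> c * min 1 (x\<^sup>2)" using c by (simp add: min_def)
    then have "K * 1 \<le> K * (c * min 1 (x\<^sup>2))" using K by (rule mult_left_mono)
    then show ?thesis using large[of x] False by (simp add: mult.assoc)
  qed
  moreover have "K * c \<ge> 0" using K c by simp
  ultimately show ?thesis unfolding levy_dominated_def by auto
qed

lemma levy_dominated_diff:
  fixes f g :: "real \<Rightarrow> real"
  assumes "levy_dominated f" "levy_dominated g"
  shows "levy_dominated (\<lambda>x. f x - g x)"
proof -
  from assms obtain K L where K: "K \<ge> 0" "\<And>x. norm (f x) \<le> K * min 1 (x\<^sup>2)"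
    and L: "L \<ge> 0" "\<And>x. norm (g x) \<le> L * min 1 (x\<^sup>2)"
    unfolding levy_dominated_def by blast
  have "norm (f x - g x) \<le> (K + L) * min 1 (x\<^sup>2)" for x
    using norm_triangle_ineq4[of "f x" "g x"] K(2)[of x] L(2)[of x] by (simp add: distrib_right)
  then show ?thesis using assms K L unfolding levy_dominated_def
    by (intro conjI exI[of _ "K + L"]) auto
qed

lemma levy_dominated_scale:
  fixes f :: "real \<Rightarrow> real"
  assumes "levy_dominated f"
  shows "levy_dominated (\<lambda>x. c * f x)"
proof -
  from assms obtain K where K: "K \<ge> 0" "\<And>x. norm (f x) \<le> K * min 1 (x\<^sup>2)"
    unfolding levy_dominated_def by blast
  have "norm (c * f x) \<le> (\<bar>c\<bar> * K) * min 1 (x\<^sup>2)" for x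
    using mult_left_mono[OF K(2)[of x], of "\<bar>c\<bar>"] by (simp add: abs_mult mult.assoc)
  then show ?thesis using assms K unfolding levy_dominated_def
    by (intro conjI exI[of _ "\<bar>c\<bar> * K"]) auto
qed

lemma levy_dominated_add:
  fixes f g :: "real \<Rightarrow> real"
  assumes "levy_dominated f" "levy_dominated g"
  shows "levy_dominated (\<lambda>x. f x + g x)"
  using levy_dominated_diff[OF assms(1) levy_dominated_scale[OF assms(2), of "-1"]] by simp

text \<open>The identity cut off outside [-r, r]. It is linear at 0 and so need not be integrable
  against a Levy measure, but the difference of two truncations vanishes near 0; compensation terms
  are therefore written with such differences.\<close>

definition trunc :: "real \<Rightarrow> real \<Rightarrow> real" where
  "trunc r x = x * indicator {-r..r} x"

lemma trunc_measurable [measurable]: "trunc r \<in> borel_measurable borel"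
  unfolding trunc_def by measurable

lemma trunc_eq: "trunc r x = (if \<bar>x\<bar> \<le> r then x else 0)"
  by (auto simp: trunc_def indicator_def)

lemma one_minus_cos_le: "1 - cos x \<le> x\<^sup>2 / 2" for x :: real
proof -
  have "\<bar>sin (x/2)\<bar> \<le> \<bar>x/2\<bar>" by (rule abs_sin_x_le_abs_x)
  then have "(sin (x/2))\<^sup>2 \<le> (x/2)\<^sup>2" by (subst (asm) abs_le_square_iff)
  moreover have "cos x = 1 - 2 * (sin (x/2))\<^sup>2" using cos_double_sin[of "x/2"] by simp
  ultimately show ?thesis by (simp add: power2_eq_square)
qed

lemma abs_sin_minus_le: "\<bar>sin x - x\<bar> \<le> x\<^sup>2 / 2" for x :: real
proof -
  have "cmod (iexp x - (1 + \<i> * x)) \<le> x\<^sup>2 / 2"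
    using iexp_approx1[of x 1] by (simp add: numeral_2_eq_2)
  moreover have "\<bar>Im (iexp x - (1 + \<i> * x))\<bar> \<le> cmod (iexp x - (1 + \<i> * x))"
    by (rule abs_Im_le_cmod)
  ultimately show ?thesis by (simp add: Im_exp)
qed

lemma levy_dominated_min: "levy_dominated (\<lambda>x. min 1 (x\<^sup>2))"
  unfolding levy_dominated_def by (intro conjI exI[of _ 1]) auto

lemma levy_dominated_tail: "r > 0 \<Longrightarrow> levy_dominated (\<lambda>x. indicator {x. \<bar>x\<bar> > r} x :: real)"
  by (rule levy_dominatedI[of _ r 1]) (auto simp: indicator_def)

lemma levy_dominated_ring:
  "0 < r \<Longrightarrow> levy_dominated (\<lambda>x. indicator {x. r < \<bar>x\<bar> \<and> \<bar>x\<bar> \<le> R} x :: real)"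
  by (rule levy_dominatedI[of _ r 1]) (auto simp: indicator_def)

lemma levy_dominated_square: "r > 0 \<Longrightarrow> levy_dominated (\<lambda>x. x\<^sup>2 * indicator {x. \<bar>x\<bar> \<le> r} x :: real)"
  by (rule levy_dominatedI[of _ r 1]) (auto simp: indicator_def)

lemma levy_dominated_trunc_diff:
  assumes "r > 0" "s > 0"
  shows "levy_dominated (\<lambda>x. trunc r x - trunc s x)"
proof (rule levy_dominatedI[of _ "min r s" "r + s"])
  show "(\<lambda>x. trunc r x - trunc s x) \<in> borel_measurable borel" by measurable
qed (use assms in \<open>auto simp: trunc_eq\<close>)

lemma levy_dominated_cos: "levy_dominated (\<lambda>x. 1 - cos (u * x))" for u :: real
proof (rule levy_dominatedI[of _ 1 "2 + u\<^sup>2"])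
  fix x :: real
  have "1 - cos (u * x) \<le> (u * x)\<^sup>2 / 2" by (rule one_minus_cos_le)
  also have "\<dots> \<le> (2 + u\<^sup>2) * x\<^sup>2" by (simp add: power_mult_distrib distrib_right field_simps)
  finally show "norm (1 - cos (u * x)) \<le> (2 + u\<^sup>2) * x\<^sup>2" by simp
  have "norm (1 - cos (u * x)) \<le> 2" using cos_ge_minus_one[of "u * x"] cos_le_one[of "u*x"] by (simp add: abs_le_iff)
  then show "norm (1 - cos (u * x)) \<le> 2 + u\<^sup>2" by (simp add: add_increasing2)
qed auto

lemma levy_dominated_sin:
  fixes u :: real assumes "r > 0"
  shows "levy_dominated (\<lambda>x. sin (u * x) - u * trunc r x)"
proof (rule levy_dominatedI[of _ r "1 + u\<^sup>2"])
  show "(\<lambda>x. sin (u * x) - u * trunc r x) \<in> borel_measurable borel" by measurable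
  fix x :: real
  have "\<bar>sin (u * x) - u * x\<bar> \<le> (u * x)\<^sup>2 / 2" by (rule abs_sin_minus_le)
  also have "\<dots> \<le> (1 + u\<^sup>2) * x\<^sup>2" by (simp add: power_mult_distrib distrib_right field_simps)
  finally show "norm (sin (u * x) - u * trunc r x) \<le> (1 + u\<^sup>2) * x\<^sup>2" if "\<bar>x\<bar> \<le> r"
    using that by (simp add: trunc_eq)
  show "norm (sin (u * x) - u * trunc r x) \<le> 1 + u\<^sup>2" if "\<bar>x\<bar> > r"
    using that abs_sin_le_one[of "u * x"] by (simp add: trunc_eq add_increasing2)
qed (use assms in auto)

lemma levy_measure_integrable:
  fixes f :: "real \<Rightarrow> 'b::{banach, second_countable_topology}"
  assumes "levy_measure \<mu>" "levy_dominated f"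
  shows "integrable \<mu> f"
proof -
  from assms(1) have [measurable_cong]: "sets \<mu> = sets borel" by (simp add: levy_measure_def)
  from assms(2) obtain K where K: "K \<ge> 0" "\<And>x. norm (f x) \<le> K * min 1 (x\<^sup>2)"
    and [measurable]: "f \<in> borel_measurable borel"
    unfolding levy_dominated_def by blast
  have "integrable \<mu> (\<lambda>x. min 1 (x\<^sup>2))"
    using assms(1) by (intro integrableI_bounded) (auto simp: levy_measure_def)
  then have "integrable \<mu> (\<lambda>x. K * min 1 (x\<^sup>2))" by simp
  then show ?thesis
    by (rule Bochner_Integration.integrable_bound) (use K in \<open>auto intro: order_trans\<close>)
qed

lemma levy_measure_tail_finite:
  assumes "levy_measure \<mu>" "r > 0"
  shows "emeasure \<mu> {x. \<bar>x\<bar> > r} < \<infinity>"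
proof -
  have s: "sets \<mu> = sets borel" using assms by (simp add: levy_measure_def)
  have "integrable \<mu> (\<lambda>x. indicator {x. \<bar>x\<bar> > r} x :: real)"
    by (rule levy_measure_integrable[OF assms(1) levy_dominated_tail[OF assms(2)]])
  then show ?thesis using s by (simp add: integrable_indicator_iff sets_eq_imp_space_eq[OF s])
qed

lemma levy_measure_tail_eq:
  assumes "levy_measure \<mu>" "r > 0"
  shows "measure \<mu> {x. \<bar>x\<bar> > r} = (LINT x|\<mu>. indicator {x. \<bar>x\<bar> > r} x)"
proof -
  have s: "sets \<mu> = sets borel" using assms by (simp add: levy_measure_def)
  show ?thesis by (simp add: sets_eq_imp_space_eq[OF s])
qed

section \<open>Increasing, continuous families of Levy measures\<close>

locale levy_family =
  fixes \<nu> :: "real \<Rightarrow> real measure"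
  assumes levy: "\<And>t. 0 \<le> t \<Longrightarrow> levy_measure (\<nu> t)"
    and mono: "\<And>s t A. 0 \<le> s \<Longrightarrow> s \<le> t \<Longrightarrow> A \<in> sets borel \<Longrightarrow> emeasure (\<nu> s) A \<le> emeasure (\<nu> t) A"
    and cont: "\<And>\<epsilon> A. \<epsilon> > 0 \<Longrightarrow> A \<in> sets borel \<Longrightarrow> A \<subseteq> {x. \<bar>x\<bar> > \<epsilon>} \<Longrightarrow>
                 continuous_on {0..} (\<lambda>t. measure (\<nu> t) A)"
    and start: "emeasure (\<nu> 0) UNIV = 0"
begin

lemma sets_levy: "0 \<le> t \<Longrightarrow> sets (\<nu> t) = sets borel"
  using levy by (simp add: levy_measure_def)

lemma space_levy: "0 \<le> t \<Longrightarrow> space (\<nu> t) = UNIV"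
  using sets_eq_imp_space_eq[OF sets_levy] by simp

lemma integrable_levy:
  fixes f :: "real \<Rightarrow> 'b::{banach, second_countable_topology}"
  shows "0 \<le> t \<Longrightarrow> levy_dominated f \<Longrightarrow> integrable (\<nu> t) f"
  using levy levy_measure_integrable by blast

lemma nn_integral_levy_mono:
  assumes "0 \<le> s" "s \<le> t"
  shows "(\<integral>\<^sup>+x. f x \<partial>\<nu> s) \<le> (\<integral>\<^sup>+x. f x \<partial>\<nu> t)"
proof (rule nn_integral_mono_measure)
  show "sets (\<nu> s) = sets (\<nu> t)" using assms by (simp add: sets_levy)
  then show "\<nu> s \<le> \<nu> t" using assms mono[of s t] by (subst le_measure) (auto simp: sets_levy)
qed

lemma integral_levy_mono:
  fixes f :: "real \<Rightarrow> real"
  assumes "0 \<le> s" "s \<le> t" "levy_dominated f" "\<And>x. 0 \<le> f x"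
  shows "(LINT x|\<nu> s. f x) \<le> (LINT x|\<nu> t. f x)"
proof -
  have i: "integrable (\<nu> s) f" "integrable (\<nu> t) f" using assms(1-3) by (auto intro!: integrable_levy)
  have "ennreal (LINT x|\<nu> s. f x) = (\<integral>\<^sup>+x. ennreal (f x) \<partial>\<nu> s)"
    by (rule nn_integral_eq_integral[symmetric]) (use i assms in auto)
  also have "\<dots> \<le> (\<integral>\<^sup>+x. ennreal (f x) \<partial>\<nu> t)" by (rule nn_integral_levy_mono) (use assms in auto)
  also have "\<dots> = ennreal (LINT x|\<nu> t. f x)"
    by (rule nn_integral_eq_integral) (use i assms in auto)
  finally show ?thesis using assms by (simp add: integral_nonneg)
qed

text \<open>The difference of the measures at two times is again a measure. This is exploited
  without constructing it, by applying monotonicity in time to the nonnegative function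
  \<open>g - f\<close>.\<close>

lemma integral_increment_mono:
  fixes f g :: "real \<Rightarrow> real"
  assumes "0 \<le> s" "s \<le> t" "levy_dominated f" "levy_dominated g" "\<And>x. f x \<le> g x"
  shows "(LINT x|\<nu> t. f x) - (LINT x|\<nu> s. f x) \<le> (LINT x|\<nu> t. g x) - (LINT x|\<nu> s. g x)"
proof -
  have "(LINT x|\<nu> s. g x - f x) \<le> (LINT x|\<nu> t. g x - f x)"
    by (rule integral_levy_mono[OF assms(1,2) levy_dominated_diff]) (use assms in \<open>auto\<close>)
  then show ?thesis using assms by (simp add: integrable_levy)
qed

lemma integral_increment_abs:
  fixes f g :: "real \<Rightarrow> real"
  assumes "0 \<le> s" "s \<le> t" "levy_dominated f" "levy_dominated g" "\<And>x. \<bar>f x\<bar> \<le> g x"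
  shows "\<bar>(LINT x|\<nu> t. f x) - (LINT x|\<nu> s. f x)\<bar> \<le> (LINT x|\<nu> t. g x) - (LINT x|\<nu> s. g x)"
proof -
  have "f x \<le> g x \<and> - f x \<le> g x" for x using assms(5)[of x] by auto
  then have "(LINT x|\<nu> t. f x) - (LINT x|\<nu> s. f x) \<le> (LINT x|\<nu> t. g x) - (LINT x|\<nu> s. g x)"
    "(LINT x|\<nu> t. - f x) - (LINT x|\<nu> s. - f x) \<le> (LINT x|\<nu> t. g x) - (LINT x|\<nu> s. g x)"
    using levy_dominated_scale[OF assms(3), of "-1"]
    by (intro integral_increment_mono assms; simp)+
  then show ?thesis by auto
qed

lemma integral_start:
  assumes "f \<in> borel_measurable borel"
  shows "(LINT x|\<nu> 0. f x) = (0 :: real)"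
proof -
  have [measurable_cong]: "sets (\<nu> 0) = sets borel" by (simp add: sets_levy)
  have "AE x in \<nu> 0. f x = 0"
    using start space_levy[of 0] by (intro AE_I[of _ _ "UNIV"]) (auto simp: sets_levy)
  then show ?thesis
    using integral_cong_AE[of f "\<nu> 0" "\<lambda>_. 0"] assms by simp
qed

lemma small_square_integral_tendsto_0:
  assumes "0 \<le> t" "e > 0"
  shows "\<exists>r>0. (LINT x|\<nu> t. min 1 (x\<^sup>2) * indicator {x. \<bar>x\<bar> \<le> r} x) < e"
proof -
  have [measurable_cong]: "sets (\<nu> t) = sets borel" using assms by (simp add: sets_levy)
  define r where "r n = 1 / real (Suc n)" for n
  have r0: "r \<longlonglongrightarrow> 0" unfolding r_def by (rule LIMSEQ_Suc[OF lim_1_over_n])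
  have "(\<lambda>n. LINT x|\<nu> t. min 1 (x\<^sup>2) * indicator {x. \<bar>x\<bar> \<le> r n} x) \<longlonglongrightarrow> (LINT x|\<nu> t. 0)"
  proof (rule integral_dominated_convergence[where w = "\<lambda>x. min 1 (x\<^sup>2)"])
    show "AE x in \<nu> t. (\<lambda>n. min 1 (x\<^sup>2) * indicator {x. \<bar>x\<bar> \<le> r n} x) \<longlonglongrightarrow> 0"
    proof (rule AE_I2)
      fix x :: real
      show "(\<lambda>n. min 1 (x\<^sup>2) * indicator {x. \<bar>x\<bar> \<le> r n} x) \<longlonglongrightarrow> 0"
      proof (cases "x = 0")
        case False
        then have "eventually (\<lambda>n. r n < \<bar>x\<bar>) sequentially" using r0 by (intro order_tendstoD) auto
        then have "eventually (\<lambda>n. min 1 (x\<^sup>2) * indicator {x. \<bar>x\<bar> \<le> r n} x = 0) sequentially"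
          by eventually_elim auto
        then show ?thesis by (rule tendsto_eventually)
      qed simp
    qed
    show "integrable (\<nu> t) (\<lambda>x. min 1 (x\<^sup>2))" by (rule integrable_levy[OF assms(1) levy_dominated_min])
  qed (auto simp: indicator_def)
  then have "eventually (\<lambda>n. (LINT x|\<nu> t. min 1 (x\<^sup>2) * indicator {x. \<bar>x\<bar> \<le> r n} x) < e) sequentially"
    using assms by (intro order_tendstoD) auto
  then obtain n where "(LINT x|\<nu> t. min 1 (x\<^sup>2) * indicator {x. \<bar>x\<bar> \<le> r n} x) < e"
    by (auto simp: eventually_sequentially)
  then show ?thesis by (intro exI[of _ "r n"]) (auto simp: r_def)
qed

lemma levy_dominated_min_small:
  "levy_dominated (\<lambda>x. min 1 (x\<^sup>2) * indicator {x. \<bar>x\<bar> \<le> r} x :: real)"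
  unfolding levy_dominated_def by (intro conjI exI[of _ 1]) (auto simp: indicator_def)

text \<open>Setwise continuity is given only away from 0, so the integral is split at a radius
  \<open>r\<close>. The mass inside is made small at time \<open>t + 1\<close>, and monotonicity in
  time transfers this to all earlier times; the tail outside varies continuously.\<close>

lemma continuous_integral_min: "continuous_on {0..} (\<lambda>t. LINT x|\<nu> t. min 1 (x\<^sup>2))"
  unfolding continuous_on_iff
proof safe
  fix t e :: real assume t: "0 \<le> t" and e: "0 < e"
  let ?w = "\<lambda>x::real. min 1 (x\<^sup>2)"
  obtain r where r: "r > 0" "(LINT x|\<nu> (t+1). ?w x * indicator {x. \<bar>x\<bar> \<le> r} x) < e / 2"
    using small_square_integral_tendsto_0[of "t+1" "e/2"] t e by auto
  have "continuous_on {0..} (\<lambda>t. measure (\<nu> t) {x. \<bar>x\<bar> > r})"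
    by (rule cont[of "r"]) (use r in auto)
  then obtain d where d: "d > 0" "\<And>s. s \<ge> 0 \<Longrightarrow> dist s t < d \<Longrightarrow>
      dist (measure (\<nu> s) {x. \<bar>x\<bar> > r}) (measure (\<nu> t) {x. \<bar>x\<bar> > r}) < e / 2"
    using t e unfolding continuous_on_iff by (metis atLeast_iff half_gt_zero)
  have main: "\<bar>(LINT x|\<nu> v. ?w x) - (LINT x|\<nu> u. ?w x)\<bar> < e"
    if uv: "0 \<le> u" "u \<le> v" "v \<le> t + 1"
    and m: "\<bar>measure (\<nu> v) {x. \<bar>x\<bar> > r} - measure (\<nu> u) {x. \<bar>x\<bar> > r}\<bar> < e/2" for u v
  proof -
    let ?g = "\<lambda>x::real. indicator {x. \<bar>x\<bar> > r} x + ?w x * indicator {x. \<bar>x\<bar> \<le> r} x"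
    have g: "levy_dominated ?g"
      by (rule levy_dominated_add[OF levy_dominated_tail[OF r(1)] levy_dominated_min_small])
    have "\<bar>(LINT x|\<nu> v. ?w x) - (LINT x|\<nu> u. ?w x)\<bar> \<le> (LINT x|\<nu> v. ?g x) - (LINT x|\<nu> u. ?g x)"
      by (rule integral_increment_abs) (use uv g levy_dominated_min in \<open>auto simp: indicator_def\<close>)
    also have "\<dots> = (LINT x|\<nu> v. indicator {x. \<bar>x\<bar> > r} x) - (LINT x|\<nu> u. indicator {x. \<bar>x\<bar> > r} x)
         + (LINT x|\<nu> v. ?w x * indicator {x. \<bar>x\<bar> \<le> r} x) - (LINT x|\<nu> u. ?w x * indicator {x. \<bar>x\<bar> \<le> r} x)"
      using uv by (subst (1 2) Bochner_Integration.integral_add)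
        (auto intro!: integrable_levy levy_dominated_tail[OF r(1)] levy_dominated_min_small simp del: integral_indicator)
    also have "\<dots> \<le> (measure (\<nu> v) {x. \<bar>x\<bar> > r} - measure (\<nu> u) {x. \<bar>x\<bar> > r})
         + (LINT x|\<nu> (t+1). ?w x * indicator {x. \<bar>x\<bar> \<le> r} x)"
    proof -
      have 1: "(LINT x|\<nu> v. ?w x * indicator {x. \<bar>x\<bar> \<le> r} x) \<le> (LINT x|\<nu> (t+1). ?w x * indicator {x. \<bar>x\<bar> \<le> r} x)"
        by (rule integral_levy_mono) (use uv levy_dominated_min_small in auto)
      have 2: "0 \<le> (LINT x|\<nu> u. ?w x * indicator {x. \<bar>x\<bar> \<le> r} x)"
        by (rule Bochner_Integration.integral_nonneg) auto
      have 3: "(LINT x|\<nu> w. indicator {x. \<bar>x\<bar> > r} x) = measure (\<nu> w) {x. \<bar>x\<bar> > r}" if "w \<ge> 0" for w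
        using levy_measure_tail_eq[OF levy r(1)] that by simp
      show ?thesis using 1 2 3[of u] 3[of v] uv by linarith
    qed
    also have "\<dots> < e" using m r(2) by linarith
    finally show ?thesis .
  qed
  show "\<exists>d>0. \<forall>s\<in>{0..}. dist s t < d \<longrightarrow> dist (LINT x|\<nu> s. ?w x) (LINT x|\<nu> t. ?w x) < e"
  proof (intro exI[of _ "min d 1"] conjI ballI impI)
    fix s :: real assume s: "s \<in> {0..}" "dist s t < min d 1"
    then have "s \<le> t + 1" by (auto simp: dist_real_def)
    then show "dist (LINT x|\<nu> s. ?w x) (LINT x|\<nu> t. ?w x) < e"
      using main[of s t] main[of t s] d(2)[of s] s t by (cases "s \<le> t") (auto simp: dist_real_def abs_minus_commute)
  qed (use d in auto)
qed

text \<open>Increments of the integral of \<open>f\<close> over time are dominated by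
  \<open>K\<close> times those of the integral of \<open>min 1 (x\<^sup>2)\<close>, so continuity is
  inherited from that one function.\<close>

lemma continuous_integral_levy:
  fixes f :: "real \<Rightarrow> real"
  assumes "levy_dominated f"
  shows "continuous_on {0..} (\<lambda>t. LINT x|\<nu> t. f x)"
  unfolding continuous_on_iff
proof safe
  fix t e :: real assume t: "0 \<le> t" and e: "0 < e"
  let ?w = "\<lambda>x::real. min 1 (x\<^sup>2)"
  obtain K where K: "K \<ge> 0" "\<And>x. norm (f x) \<le> K * ?w x"
    using assms unfolding levy_dominated_def by blast
  obtain d where d: "d > 0" "\<And>s. s \<ge> 0 \<Longrightarrow> dist s t < d \<Longrightarrow>
      dist (LINT x|\<nu> s. ?w x) (LINT x|\<nu> t. ?w x) < e / (K + 1)"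
    using continuous_integral_min t e K(1) unfolding continuous_on_iff
    by (metis atLeast_iff divide_pos_pos add_nonneg_pos zero_less_one)
  have main: "\<bar>(LINT x|\<nu> v. f x) - (LINT x|\<nu> u. f x)\<bar> \<le> K * \<bar>(LINT x|\<nu> v. ?w x) - (LINT x|\<nu> u. ?w x)\<bar>"
    if uv: "0 \<le> u" "u \<le> v" for u v
  proof -
    have "\<bar>(LINT x|\<nu> v. f x) - (LINT x|\<nu> u. f x)\<bar> \<le> (LINT x|\<nu> v. K * ?w x) - (LINT x|\<nu> u. K * ?w x)"
      by (rule integral_increment_abs[OF uv assms levy_dominated_scale[OF levy_dominated_min]])
         (use K in auto)
    also have "\<dots> = K * ((LINT x|\<nu> v. ?w x) - (LINT x|\<nu> u. ?w x))" by (simp add: algebra_simps)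
    also have "\<dots> \<le> K * \<bar>(LINT x|\<nu> v. ?w x) - (LINT x|\<nu> u. ?w x)\<bar>" using K by (intro mult_left_mono) auto
    finally show ?thesis .
  qed
  show "\<exists>d>0. \<forall>s\<in>{0..}. dist s t < d \<longrightarrow> dist (LINT x|\<nu> s. f x) (LINT x|\<nu> t. f x) < e"
  proof (intro exI[of _ d] conjI ballI impI)
    fix s :: real assume s: "s \<in> {0..}" "dist s t < d"
    then have *: "\<bar>(LINT x|\<nu> s. ?w x) - (LINT x|\<nu> t. ?w x)\<bar> < e / (K+1)"
      using d(2)[of s] by (auto simp: dist_real_def)
    have "\<bar>(LINT x|\<nu> s. f x) - (LINT x|\<nu> t. f x)\<bar> \<le> K * \<bar>(LINT x|\<nu> s. ?w x) - (LINT x|\<nu> t. ?w x)\<bar>"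
      using main[of s t] main[of t s] s t by (cases "s \<le> t") (auto simp: abs_minus_commute)
    also have "\<dots> \<le> K * (e / (K+1))" using K * by (intro mult_left_mono) auto
    also have "\<dots> < e" using K e by (simp add: field_simps)
    finally show "dist (LINT x|\<nu> s. f x) (LINT x|\<nu> t. f x) < e" by (simp add: dist_real_def)
  qed (use d in auto)
qed

end

section \<open>The functions G, K, M and the exponent of a real additive process\<close>

locale char_triple = levy_family \<nu> for \<nu> +
  fixes B C :: "real \<Rightarrow> real"
  assumes B_cont: "continuous_on {0..} B" and B_0: "B 0 = 0"
    and C_cont: "continuous_on {0..} C" and C_mono: "mono_on {0..} C" and C_0: "C 0 = 0"
begin

text \<open>The drift coefficient of the same law when jumps are compensated up to size
  \<open>r\<close> instead of 1.\<close>

definition drift :: "real \<Rightarrow> real \<Rightarrow> real" where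
  "drift t r = B t + (LINT x|\<nu> t. trunc r x - trunc 1 x)"

text \<open>Together with \<open>im_exponent\<close> this fixes a logarithm of the characteristic
  function, namely \<open>- re_exponent t u + \<i> * im_exponent t u\<close>, with no choice of
  branch. The sign makes \<open>re_exponent\<close> nonnegative and increasing in time.\<close>

definition re_exponent :: "real \<Rightarrow> real \<Rightarrow> real" where
  "re_exponent t u = u\<^sup>2 * C t / 2 + (LINT x|\<nu> t. 1 - cos (u * x))"

definition im_exponent :: "real \<Rightarrow> real \<Rightarrow> real" where
  "im_exponent t u = u * B t + (LINT x|\<nu> t. sin (u * x) - u * trunc 1 x)"

text \<open>The part of \<open>y1\<close> that is increasing in time without taking a maximum. The
  drift may oscillate and is treated separately.\<close>

definition h :: "real \<Rightarrow> real \<Rightarrow> real" where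
  "h t r = G1 \<nu> t r + K1 C \<nu> t r"

lemma G1_eq: "0 \<le> t \<Longrightarrow> r > 0 \<Longrightarrow> G1 \<nu> t r = (LINT x|\<nu> t. indicator {x. \<bar>x\<bar> > r} x)"
  unfolding G1_def by (rule levy_measure_tail_eq[OF levy])

lemma K1_eq: "K1 C \<nu> t r = (C t + (LINT x|\<nu> t. x\<^sup>2 * indicator {x. \<bar>x\<bar> \<le> r} x)) / r\<^sup>2"
  unfolding K1_def set_lebesgue_integral_def by (simp add: mult.commute)

text \<open>Depending on whether r is above or below 1, one of the two rings in \<open>M1\<close> is
  empty and the other carries \<open>trunc r x - trunc 1 x\<close> up to sign.\<close>

lemma M1_eq:
  assumes "0 \<le> t" "r > 0"
  shows "M1 B \<nu> t r = \<bar>drift t r\<bar> / r"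
proof -
  have "(LINT x:{x. 1 < \<bar>x\<bar> \<and> \<bar>x\<bar> \<le> max r 1}|\<nu> t. x) - (LINT x:{x. min r 1 < \<bar>x\<bar> \<and> \<bar>x\<bar> \<le> 1}|\<nu> t. x)
     = (LINT x|\<nu> t. trunc r x - trunc 1 x)"
  proof (cases "r \<ge> 1")
    case True
    then have "min r 1 = 1" "max r 1 = r" by auto
    moreover have "{x::real. 1 < \<bar>x\<bar> \<and> \<bar>x\<bar> \<le> 1} = {}" by auto
    moreover have "indicator {x. 1 < \<bar>x\<bar> \<and> \<bar>x\<bar> \<le> r} x *\<^sub>R x = trunc r x - trunc 1 x" for x
      using True by (auto simp: trunc_eq indicator_def)
    ultimately show ?thesis unfolding set_lebesgue_integral_def by simp
  next
    case False
    then have "min r 1 = r" "max r 1 = 1" by auto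
    moreover have "{x::real. 1 < \<bar>x\<bar> \<and> \<bar>x\<bar> \<le> 1} = {}" by auto
    moreover have "(\<lambda>x. indicator {x. r < \<bar>x\<bar> \<and> \<bar>x\<bar> \<le> 1} x *\<^sub>R x) = (\<lambda>x. - (trunc r x - trunc 1 x))"
      using False by (auto simp: trunc_eq indicator_def)
    ultimately show ?thesis unfolding set_lebesgue_integral_def
      by (simp only: Bochner_Integration.integral_minus) simp
  qed
  then show ?thesis unfolding M1_def drift_def by (simp only: add_diff_eq[symmetric])
qed

lemma drift_change:
  assumes "0 \<le> t" "r > 0" "s > 0"
  shows "drift t r = drift t s + (LINT x|\<nu> t. trunc r x - trunc s x)"
proof -
  have "(LINT x|\<nu> t. trunc r x - trunc 1 x) - (LINT x|\<nu> t. trunc s x - trunc 1 x)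
    = (LINT x|\<nu> t. (trunc r x - trunc 1 x) - (trunc s x - trunc 1 x))"
    using assms by (intro Bochner_Integration.integral_diff[symmetric] integrable_levy levy_dominated_trunc_diff) auto
  then show ?thesis unfolding drift_def by (simp add: algebra_simps)
qed

lemma im_exponent_eq:
  assumes "0 \<le> t" "r > 0"
  shows "im_exponent t u = u * drift t r + (LINT x|\<nu> t. sin (u * x) - u * trunc r x)"
proof -
  have "(LINT x|\<nu> t. sin (u * x) - u * trunc 1 x) - (LINT x|\<nu> t. sin (u * x) - u * trunc r x)
    = (LINT x|\<nu> t. (sin (u * x) - u * trunc 1 x) - (sin (u * x) - u * trunc r x))"
    using assms by (intro Bochner_Integration.integral_diff[symmetric] integrable_levy levy_dominated_sin) auto
  also have "\<dots> = (LINT x|\<nu> t. u * (trunc r x - trunc 1 x))" by (simp add: algebra_simps)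
  also have "\<dots> = u * (LINT x|\<nu> t. trunc r x - trunc 1 x)" by simp
  finally show ?thesis unfolding drift_def im_exponent_def by (simp add: algebra_simps)
qed

lemma continuous_G1: "r > 0 \<Longrightarrow> continuous_on {0..} (\<lambda>t. G1 \<nu> t r)"
  unfolding G1_def by (rule cont[of r]) auto

lemma continuous_K1: "r > 0 \<Longrightarrow> continuous_on {0..} (\<lambda>t. K1 C \<nu> t r)"
  unfolding K1_eq by (intro continuous_intros C_cont continuous_integral_levy levy_dominated_square) auto

lemma continuous_h: "r > 0 \<Longrightarrow> continuous_on {0..} (\<lambda>t. h t r)"
  unfolding h_def by (intro continuous_intros continuous_G1 continuous_K1)

lemma continuous_drift: "r > 0 \<Longrightarrow> continuous_on {0..} (\<lambda>t. drift t r)"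
  unfolding drift_def by (intro continuous_intros B_cont continuous_integral_levy levy_dominated_trunc_diff) auto

lemma continuous_re_exponent: "continuous_on {0..} (\<lambda>t. re_exponent t u)"
  unfolding re_exponent_def by (intro continuous_intros C_cont continuous_integral_levy levy_dominated_cos) auto

lemma continuous_im_exponent: "continuous_on {0..} (\<lambda>t. im_exponent t u)"
  unfolding im_exponent_def by (intro continuous_intros B_cont continuous_integral_levy levy_dominated_sin) auto

lemma drift_0: "drift 0 r = 0"
  unfolding drift_def by (simp add: B_0 integral_start)

lemma re_exponent_0: "re_exponent 0 u = 0"
  unfolding re_exponent_def by (simp add: C_0 integral_start)

lemma im_exponent_0: "im_exponent 0 u = 0"
  unfolding im_exponent_def by (simp add: B_0 integral_start)

lemma h_0: "r > 0 \<Longrightarrow> h 0 r = 0"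
  unfolding h_def K1_eq using integral_start[of "indicator {x. \<bar>x\<bar> > r}"]
    G1_eq[of 0 r] by (simp add: C_0 integral_start)

lemma C_nonneg: "0 \<le> t \<Longrightarrow> 0 \<le> C t"
  using C_mono C_0 by (metis atLeast_iff mono_onD order_refl)

lemma C_le: "0 \<le> s \<Longrightarrow> s \<le> t \<Longrightarrow> C s \<le> C t"
  using C_mono by (auto simp: mono_on_def)

lemma G1_nonneg: "0 \<le> G1 \<nu> t r"
  by (simp add: G1_def)

lemma K1_nonneg: "0 \<le> t \<Longrightarrow> 0 \<le> K1 C \<nu> t r"
  unfolding K1_eq by (auto intro!: divide_nonneg_nonneg add_nonneg_nonneg C_nonneg Bochner_Integration.integral_nonneg)

lemma M1_nonneg: "0 < r \<Longrightarrow> 0 \<le> M1 B \<nu> t r"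
  unfolding M1_def by simp

lemma h_nonneg: "0 \<le> t \<Longrightarrow> 0 \<le> h t r"
  unfolding h_def using G1_nonneg K1_nonneg by (metis add_nonneg_nonneg)

lemma G1_le: "0 \<le> s \<Longrightarrow> s \<le> t \<Longrightarrow> r > 0 \<Longrightarrow> G1 \<nu> s r \<le> G1 \<nu> t r"
  using integral_levy_mono[OF _ _ levy_dominated_tail, of s t r] by (simp only: G1_eq) auto

lemma K1_le: "0 \<le> s \<Longrightarrow> s \<le> t \<Longrightarrow> r > 0 \<Longrightarrow> K1 C \<nu> s r \<le> K1 C \<nu> t r"
  unfolding K1_eq
  by (intro divide_right_mono add_mono C_le integral_levy_mono levy_dominated_square) auto

lemma h_le: "0 \<le> s \<Longrightarrow> s \<le> t \<Longrightarrow> r > 0 \<Longrightarrow> h s r \<le> h t r"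
  unfolding h_def by (intro add_mono G1_le K1_le)

lemma bdd_M1: "r > 0 \<Longrightarrow> bdd_above ((\<lambda>s. M1 B \<nu> s r) ` {0..t})"
proof -
  assume r: "r > 0"
  have "continuous_on {0..t} (\<lambda>s. \<bar>drift s r\<bar> / r)"
    using r by (intro continuous_intros continuous_on_subset[OF continuous_drift]) auto
  then have "compact ((\<lambda>s. \<bar>drift s r\<bar> / r) ` {0..t})" by (intro compact_continuous_image) auto
  then have "bdd_above ((\<lambda>s. \<bar>drift s r\<bar> / r) ` {0..t})" by (intro bounded_imp_bdd_above compact_imp_bounded)
  moreover have "(\<lambda>s. M1 B \<nu> s r) ` {0..t} = (\<lambda>s. \<bar>drift s r\<bar> / r) ` {0..t}"
    using r by (intro image_cong) (auto simp: M1_eq)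
  ultimately show ?thesis by simp
qed

lemma M1_le_star: "0 < r \<Longrightarrow> 0 \<le> s \<Longrightarrow> s \<le> t \<Longrightarrow> M1 B \<nu> s r \<le> M1_star B \<nu> t r"
  unfolding M1_star_def by (rule cSUP_upper[OF _ bdd_M1]) auto

lemma M1_star_least:
  "0 \<le> t \<Longrightarrow> (\<And>s. 0 \<le> s \<Longrightarrow> s \<le> t \<Longrightarrow> M1 B \<nu> s r \<le> c) \<Longrightarrow> M1_star B \<nu> t r \<le> c"
  unfolding M1_star_def by (rule cSUP_least) auto

lemma M1_star_le: "0 < r \<Longrightarrow> 0 \<le> s \<Longrightarrow> s \<le> t \<Longrightarrow> M1_star B \<nu> s r \<le> M1_star B \<nu> t r"
  by (rule M1_star_least) (auto intro: M1_le_star)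

lemma M1_star_nonneg: "0 < r \<Longrightarrow> 0 \<le> t \<Longrightarrow> 0 \<le> M1_star B \<nu> t r"
  using M1_le_star[of r 0 t] M1_nonneg[of r 0] by simp

lemma y1_eq: "y1 B C \<nu> t r = h t r + M1_star B \<nu> t r"
  by (simp add: y1_def h_def)

lemma y1_le: "0 < r \<Longrightarrow> 0 \<le> s \<Longrightarrow> s \<le> t \<Longrightarrow> y1 B C \<nu> s r \<le> y1 B C \<nu> t r"
  unfolding y1_eq by (intro add_mono h_le M1_star_le)

lemma M1_change:
  assumes "0 \<le> t" "r > 0" "s > 0"
  shows "\<bar>drift t r - drift t s\<bar> \<le> (LINT x|\<nu> t. \<bar>trunc r x - trunc s x\<bar>)"
  unfolding drift_change[OF assms] by simp

text \<open>Let \<open>p\<close> be the mass of the ring between s and r. Enlarging the radius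
  removes \<open>p\<close> from \<open>G1\<close> and adds at most \<open>p\<close> to each of
  \<open>K1\<close> and \<open>M1_star\<close>, a net growth of at most \<open>p\<close>, which is
  itself below \<open>G1 \<nu> t s\<close>.\<close>

lemma y1_halving:
  assumes "0 \<le> t" "0 < s" "s \<le> r"
  shows "y1 B C \<nu> t r \<le> 2 * y1 B C \<nu> t s"
proof -
  have r: "r > 0" using assms by auto
  define p :: real where "p = (LINT x|\<nu> t. indicator {x. s < \<bar>x\<bar> \<and> \<bar>x\<bar> \<le> r} x)"
  define S where "S a = (LINT x|\<nu> t. x\<^sup>2 * indicator {x. \<bar>x\<bar> \<le> a} x)" for a
  have int: "integrable (\<nu> t) (\<lambda>x. indicator {x. s < \<bar>x\<bar> \<and> \<bar>x\<bar> \<le> r} x :: real)"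
    "integrable (\<nu> t) (\<lambda>x. indicator {x. \<bar>x\<bar> > r} x :: real)"
    "integrable (\<nu> t) (\<lambda>x. x\<^sup>2 * indicator {x. \<bar>x\<bar> \<le> s} x)"
    "integrable (\<nu> t) (\<lambda>x. x\<^sup>2 * indicator {x. \<bar>x\<bar> \<le> r} x)"
    using assms r by (auto intro!: integrable_levy levy_dominated_ring levy_dominated_tail levy_dominated_square)
  have G: "G1 \<nu> t s = G1 \<nu> t r + p"
  proof -
    have "(LINT x|\<nu> t. indicator {x. \<bar>x\<bar> > s} x :: real) = (LINT x|\<nu> t. indicator {x. \<bar>x\<bar> > r} x + indicator {x. s < \<bar>x\<bar> \<and> \<bar>x\<bar> \<le> r} x)"
      using assms by (intro Bochner_Integration.integral_cong) (auto simp: indicator_def)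
    also have "\<dots> = (LINT x|\<nu> t. indicator {x. \<bar>x\<bar> > r} x) + p"
      unfolding p_def by (rule Bochner_Integration.integral_add) (use int in auto)
    finally show ?thesis using assms r by (simp only: G1_eq)
  qed
  have "S r \<le> (LINT x|\<nu> t. x\<^sup>2 * indicator {x. \<bar>x\<bar> \<le> s} x + r\<^sup>2 * indicator {x. s < \<bar>x\<bar> \<and> \<bar>x\<bar> \<le> r} x)"
    unfolding S_def
  proof (rule integral_mono)
    fix x :: real
    show "x\<^sup>2 * indicator {x. \<bar>x\<bar> \<le> r} x \<le> x\<^sup>2 * indicator {x. \<bar>x\<bar> \<le> s} x + r\<^sup>2 * indicator {x. s < \<bar>x\<bar> \<and> \<bar>x\<bar> \<le> r} x"
      using assms power_mono[of "\<bar>x\<bar>" r 2] by (auto simp: indicator_def)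
  qed (use int in auto)
  also have "\<dots> = S s + r\<^sup>2 * p" unfolding S_def p_def
    by (subst Bochner_Integration.integral_add) (use int in auto)
  finally have S: "S r \<le> S s + r\<^sup>2 * p" .
  have "K1 C \<nu> t r \<le> (C t + S s + r\<^sup>2 * p) / r\<^sup>2"
    unfolding K1_eq S_def[symmetric] using S by (intro divide_right_mono) auto
  also have "\<dots> = (C t + S s) / r\<^sup>2 + p" using r by (simp add: field_simps)
  also have "(C t + S s) / r\<^sup>2 \<le> (C t + S s) / s\<^sup>2"
  proof (rule divide_left_mono)
    show "s\<^sup>2 \<le> r\<^sup>2" using assms by (intro power_mono) auto
    show "0 \<le> C t + S s" unfolding S_def using C_nonneg[OF assms(1)]
      by (intro add_nonneg_nonneg Bochner_Integration.integral_nonneg) auto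
  qed (use assms r in auto)
  also have "(C t + S s) / s\<^sup>2 = K1 C \<nu> t s" unfolding K1_eq S_def ..
  finally have K: "K1 C \<nu> t r \<le> K1 C \<nu> t s + p" by simp
  have M: "M1_star B \<nu> t r \<le> M1_star B \<nu> t s + p"
  proof (rule M1_star_least)
    fix u assume u: "0 \<le> u" "u \<le> t"
    have "(LINT x|\<nu> u. \<bar>trunc r x - trunc s x\<bar>) \<le> (LINT x|\<nu> u. r * indicator {x. s < \<bar>x\<bar> \<and> \<bar>x\<bar> \<le> r} x)"
      using assms r u levy_dominated_trunc_diff[of r s]
      by (intro integral_mono integrable_abs integrable_levy levy_dominated_scale levy_dominated_ring)
         (auto simp: trunc_eq indicator_def)
    also have "\<dots> = r * (LINT x|\<nu> u. indicator {x. s < \<bar>x\<bar> \<and> \<bar>x\<bar> \<le> r} x)" by (rule integral_mult_right_zero)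
    also have "\<dots> \<le> r * p" unfolding p_def using assms r u
      by (intro mult_left_mono integral_levy_mono levy_dominated_ring) auto
    finally have "\<bar>drift u r\<bar> \<le> \<bar>drift u s\<bar> + r * p"
      using M1_change[of u r s] u assms r by auto
    then have "\<bar>drift u r\<bar> / r \<le> (\<bar>drift u s\<bar> + r * p) / r" using r by (intro divide_right_mono) auto
    also have "\<dots> = \<bar>drift u s\<bar> / r + p" using r by (simp add: field_simps)
    also have "\<bar>drift u s\<bar> / r \<le> \<bar>drift u s\<bar> / s" using assms by (intro divide_left_mono) auto
    finally have "M1 B \<nu> u r \<le> M1 B \<nu> u s + p" using u assms r by (simp add: M1_eq)
    also have "M1 B \<nu> u s \<le> M1_star B \<nu> t s" using u assms by (intro M1_le_star) auto
    finally show "M1 B \<nu> u r \<le> M1_star B \<nu> t s + p" by simp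
  qed (use assms in auto)
  have "K1 C \<nu> t s \<ge> 0" "M1_star B \<nu> t s \<ge> 0" "G1 \<nu> t r \<ge> 0" "p \<ge> 0"
    using assms unfolding p_def by (auto intro!: K1_nonneg M1_star_nonneg G1_nonneg Bochner_Integration.integral_nonneg)
  then show ?thesis using G K M unfolding y1_def distrib_left by linarith
qed

text \<open>The converse comparison, at a polynomial price. Chebyshev bounds the mass
  \<open>p\<close> of the ring by \<open>A\<^sup>2 * K1 C \<nu> t r\<close>; it is added once to
  \<open>G1\<close> and, multiplied by \<open>A\<close>, once to the drift term, while
  \<open>K1\<close> itself grows by at most \<open>A\<^sup>2\<close>. The coefficient of
  \<open>K1\<close> thus collects three terms, each at most \<open>A ^ 3\<close>.\<close>

lemma y1_rescale:
  assumes "0 \<le> t" "0 < s" "A \<ge> 1"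
  shows "y1 B C \<nu> t s \<le> 3 * A ^ 3 * y1 B C \<nu> t (A * s)"
proof -
  define r where "r = A * s"
  have r: "r > 0" "s \<le> r" using assms by (auto simp: r_def)
  define p :: "real \<Rightarrow> real" where "p u = (LINT x|\<nu> u. indicator {x. s < \<bar>x\<bar> \<and> \<bar>x\<bar> \<le> r} x)" for u
  define S where "S a = (LINT x|\<nu> t. x\<^sup>2 * indicator {x. \<bar>x\<bar> \<le> a} x)" for a
  have int: "integrable (\<nu> t) (\<lambda>x. indicator {x. s < \<bar>x\<bar> \<and> \<bar>x\<bar> \<le> r} x :: real)"
    "integrable (\<nu> t) (\<lambda>x. indicator {x. \<bar>x\<bar> > r} x :: real)"
    "integrable (\<nu> t) (\<lambda>x. x\<^sup>2 * indicator {x. \<bar>x\<bar> \<le> s} x)"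
    "integrable (\<nu> t) (\<lambda>x. x\<^sup>2 * indicator {x. \<bar>x\<bar> \<le> r} x)"
    using assms r by (auto intro!: integrable_levy levy_dominated_ring levy_dominated_tail levy_dominated_square)
  have S: "S s \<le> S r" unfolding S_def
    by (rule integral_mono) (use int r in \<open>auto simp: indicator_def\<close>)
  have K: "K1 C \<nu> t s \<le> A\<^sup>2 * K1 C \<nu> t r"
  proof -
    have "K1 C \<nu> t s \<le> (C t + S r) / s\<^sup>2"
      unfolding K1_eq S_def[symmetric] using S by (intro divide_right_mono) auto
    also have "\<dots> = A\<^sup>2 * ((C t + S r) / r\<^sup>2)" using assms by (simp add: r_def power_mult_distrib)
    finally show ?thesis unfolding K1_eq S_def .
  qed
  have p: "p t \<le> A\<^sup>2 * K1 C \<nu> t r"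
  proof -
    have "p t \<le> (LINT x|\<nu> t. (1 / s\<^sup>2) * (x\<^sup>2 * indicator {x. \<bar>x\<bar> \<le> r} x))"
      unfolding p_def
    proof (rule integral_mono)
      fix x :: real
      show "indicator {x. s < \<bar>x\<bar> \<and> \<bar>x\<bar> \<le> r} x \<le> (1 / s\<^sup>2) * (x\<^sup>2 * indicator {x. \<bar>x\<bar> \<le> r} x)"
        using assms power_mono[of s "\<bar>x\<bar>" 2] by (auto simp: indicator_def field_simps)
    qed (use int in auto)
    also have "\<dots> = (1 / s\<^sup>2) * S r" unfolding S_def by (rule integral_mult_right_zero)
    also have "\<dots> \<le> (1 / s\<^sup>2) * (C t + S r)" using C_nonneg[OF assms(1)] by (intro mult_left_mono) auto
    also have "\<dots> = A\<^sup>2 * ((C t + S r) / r\<^sup>2)" using assms by (simp add: r_def power_mult_distrib)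
    finally show ?thesis unfolding K1_eq S_def .
  qed
  have G: "G1 \<nu> t s = G1 \<nu> t r + p t"
  proof -
    have "(LINT x|\<nu> t. indicator {x. \<bar>x\<bar> > s} x :: real) = (LINT x|\<nu> t. indicator {x. \<bar>x\<bar> > r} x + indicator {x. s < \<bar>x\<bar> \<and> \<bar>x\<bar> \<le> r} x)"
      using r by (intro Bochner_Integration.integral_cong) (auto simp: indicator_def)
    also have "\<dots> = (LINT x|\<nu> t. indicator {x. \<bar>x\<bar> > r} x) + p t"
      unfolding p_def by (rule Bochner_Integration.integral_add) (use int in auto)
    finally show ?thesis using assms r by (simp only: G1_eq)
  qed
  have M: "M1_star B \<nu> t s \<le> A * M1_star B \<nu> t r + A * p t"
  proof (rule M1_star_least)
    fix u assume u: "0 \<le> u" "u \<le> t"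
    have "(LINT x|\<nu> u. \<bar>trunc r x - trunc s x\<bar>) \<le> (LINT x|\<nu> u. r * indicator {x. s < \<bar>x\<bar> \<and> \<bar>x\<bar> \<le> r} x)"
      using assms r u levy_dominated_trunc_diff[of r s]
      by (intro integral_mono integrable_abs integrable_levy levy_dominated_scale levy_dominated_ring)
         (auto simp: trunc_eq indicator_def)
    also have "\<dots> = r * p u" unfolding p_def by (rule integral_mult_right_zero)
    also have "\<dots> \<le> r * p t" unfolding p_def using assms r u
      by (intro mult_left_mono integral_levy_mono levy_dominated_ring) auto
    finally have "\<bar>drift u s\<bar> \<le> \<bar>drift u r\<bar> + r * p t"
      using M1_change[of u r s] u assms r by auto
    then have "\<bar>drift u s\<bar> / s \<le> (\<bar>drift u r\<bar> + r * p t) / s" using assms by (intro divide_right_mono) auto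
    also have "\<dots> = A * (\<bar>drift u r\<bar> / r) + A * p t" using assms by (simp add: r_def field_simps)
    also have "\<bar>drift u r\<bar> / r = M1 B \<nu> u r" using u r by (simp add: M1_eq)
    also have "A * M1 B \<nu> u r \<le> A * M1_star B \<nu> t r" using u r assms by (intro mult_left_mono M1_le_star) auto
    finally show "M1 B \<nu> u s \<le> A * M1_star B \<nu> t r + A * p t" using u assms by (simp add: M1_eq)
  qed (use assms in auto)
  have nn: "0 \<le> K1 C \<nu> t r" "0 \<le> M1_star B \<nu> t r" "0 \<le> G1 \<nu> t r"
    using assms r by (auto intro!: K1_nonneg M1_star_nonneg G1_nonneg)
  have A: "A \<le> A ^ 3" "A ^ 2 \<le> A ^ 3" "1 \<le> A ^ 3"
    using assms power_increasing[of 1 3 A] power_increasing[of 2 3 A] by auto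
  have "A * p t \<le> A * (A\<^sup>2 * K1 C \<nu> t r)" using p assms by (intro mult_left_mono) auto
  also have "\<dots> = A ^ 3 * K1 C \<nu> t r" by (simp add: power3_eq_cube power2_eq_square)
  finally have "A * p t \<le> A ^ 3 * K1 C \<nu> t r" .
  moreover have "A\<^sup>2 * K1 C \<nu> t r \<le> A ^ 3 * K1 C \<nu> t r" "A * M1_star B \<nu> t r \<le> A ^ 3 * M1_star B \<nu> t r"
     "1 * G1 \<nu> t r \<le> A ^ 3 * G1 \<nu> t r"
    using A nn by (intro mult_right_mono; simp)+
  moreover have "0 \<le> A ^ 3 * G1 \<nu> t r" "0 \<le> A ^ 3 * M1_star B \<nu> t r" using A nn assms by (auto intro!: mult_nonneg_nonneg)
  moreover have "3 * A ^ 3 * y1 B C \<nu> t r = 3 * (A ^ 3 * G1 \<nu> t r) + 3 * (A ^ 3 * K1 C \<nu> t r) + 3 * (A ^ 3 * M1_star B \<nu> t r)"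
    unfolding y1_def by (simp add: algebra_simps)
  ultimately have "y1 B C \<nu> t s \<le> 3 * A ^ 3 * y1 B C \<nu> t r"
    using G K M p unfolding y1_def by linarith
  then show ?thesis by (simp add: r_def)
qed

end

section \<open>Oscillatory integrals and the size of the exponent\<close>

lemma dirichlet_kernel:
  fixes a :: real
  shows "2 * sin (a / 2) * (\<Sum>k=1..N. cos (real k * a)) = sin ((real N + 1 / 2) * a) - sin (a / 2)"
proof (induction N)
  case (Suc N)
  have "2 * sin (a / 2) * cos (real (Suc N) * a)
      = sin (a / 2 + real (Suc N) * a) + sin (a / 2 - real (Suc N) * a)"
    by (simp only: sin_add sin_diff)
  also have "a / 2 + real (Suc N) * a = (real (Suc N) + 1 / 2) * a" by (simp add: field_simps)
  also have "a / 2 - real (Suc N) * a = - ((real N + 1 / 2) * a)" by (simp add: field_simps)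
  finally show ?case using Suc by (simp add: distrib_left)
qed simp

lemma sin_ge_half: "0 \<le> x \<Longrightarrow> x \<le> 1 \<Longrightarrow> x / 2 \<le> sin x" for x :: real
proof -
  assume x: "0 \<le> x" "x \<le> 1"
  have "x\<^sup>2 \<le> x" using x by (simp add: power2_eq_square mult_left_le)
  then show ?thesis using abs_le_D2[OF abs_sin_minus_le[of x]] by linarith
qed

lemma one_minus_cos_ge: "\<bar>x\<bar> \<le> 1 \<Longrightarrow> x\<^sup>2 / 4 \<le> 1 - cos x" for x :: real
proof -
  assume x: "\<bar>x\<bar> \<le> 1"
  define y where "y = \<bar>x\<bar> / 2"
  have y: "0 \<le> y" "y \<le> 1/2" using x by (auto simp: y_def)
  have "y\<^sup>2 \<le> y * (1/2)" unfolding power2_eq_square using y by (intro mult_left_mono) auto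
  then have "3 / 4 * y \<le> sin y" using abs_le_D2[OF abs_sin_minus_le[of y]] by linarith
  then have "(3 / 4 * y)\<^sup>2 \<le> (sin y)\<^sup>2" using y by (intro power_mono) auto
  moreover have "cos x = 1 - 2 * (sin y)\<^sup>2" using cos_double_sin[of y] by (simp add: y_def)
  moreover have "y\<^sup>2 = x\<^sup>2 / 4" by (simp add: y_def power2_eq_square)
  moreover have "(3 / 4 * y)\<^sup>2 = 9 / 16 * y\<^sup>2" by (simp add: power2_eq_square)
  ultimately show ?thesis using zero_le_power2[of x] by linarith
qed

text \<open>Averaging over frequencies below \<open>8 / r\<close> detects mass outside \<open>[-r, r]\<close>; a Riemann sum
  replaces the usual integral over the frequency, so that no Fubini argument is needed.\<close>

lemma ring_le_average:
  fixes x r :: real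
  assumes "r > 0"
  shows "indicator {x. r < \<bar>x\<bar> \<and> \<bar>x\<bar> \<le> r * real N / 4} x
     \<le> (2 / real N) * (\<Sum>k=1..N. 1 - cos ((8 * real k / (r * real N)) * x))"
proof (cases "r < \<bar>x\<bar> \<and> \<bar>x\<bar> \<le> r * real N / 4")
  case False
  then show ?thesis by (simp add: sum_nonneg)
next
  case True
  then have N: "N > 0" using assms by (cases "N = 0") auto
  \<comment> \<open>The grid of frequencies is tuned to the two ends of the ring: the outer radius
    \<open>r * N / 4\<close> keeps \<open>a / 2\<close> in [0, 1], where the sine has a linear lower
    bound, and the inner radius gives \<open>N * a \<ge> 8\<close>, so that the Dirichlet kernel
    bounds the cosine sum by \<open>N / 2\<close>.\<close>
  define a where "a = 8 * \<bar>x\<bar> / (r * real N)"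
  have a: "0 < a" "a \<le> 2" using True assms N by (auto simp: a_def field_simps)
  have Na: "real N * a \<ge> 8" using True assms N by (simp add: a_def field_simps)
  have c: "cos ((8 * real k / (r * real N)) * x) = cos (real k * a)" for k
  proof -
    have "real k * a = \<bar>(8 * real k / (r * real N)) * x\<bar>" using assms by (simp add: a_def abs_mult)
    then show ?thesis by (simp only: cos_abs_real)
  qed
  have s: "a / 4 \<le> sin (a / 2)" using sin_ge_half[of "a / 2"] a by auto
  have "2 * sin (a / 2) * (\<Sum>k=1..N. cos (real k * a)) \<le> 2"
    unfolding dirichlet_kernel using sin_le_one[of "(real N + 1 / 2) * a"] sin_ge_minus_one[of "a / 2"] by linarith
  then have "sin (a / 2) * (\<Sum>k=1..N. cos (real k * a)) \<le> 1" by simp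
  moreover have "sin (a / 2) * (real N / 2) \<ge> 1"
  proof -
    have "a / 4 * (real N / 2) \<le> sin (a / 2) * (real N / 2)" using s by (intro mult_right_mono) auto
    then show ?thesis using Na by (simp add: mult.commute)
  qed
  ultimately have "sin (a / 2) * (\<Sum>k=1..N. cos (real k * a)) \<le> sin (a / 2) * (real N / 2)" by linarith
  then have "(\<Sum>k=1..N. cos (real k * a)) \<le> real N / 2" using s a by (subst (asm) mult_le_cancel_left_pos) auto
  then have "(\<Sum>k=1..N. 1 - cos ((8 * real k / (r * real N)) * x)) \<ge> real N / 2"
    unfolding c by (simp add: sum_subtractf)
  then have "(2 / real N) * (real N / 2) \<le> (2 / real N) * (\<Sum>k=1..N. 1 - cos ((8 * real k / (r * real N)) * x))"
    by (intro mult_left_mono) auto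
  then show ?thesis using True N by simp
qed

lemma levy_dominated_sum:
  fixes f :: "'i \<Rightarrow> real \<Rightarrow> real"
  assumes "\<And>i. i \<in> I \<Longrightarrow> levy_dominated (f i)"
  shows "levy_dominated (\<lambda>x. \<Sum>i\<in>I. f i x)"
  using assms
proof (induction I rule: infinite_finite_induct)
  case (insert i I)
  then show ?case using levy_dominated_add[of "f i" "\<lambda>x. \<Sum>i\<in>I. f i x"] by simp
qed (auto simp: levy_dominated_def intro!: exI[of _ 0])

context char_triple
begin

text \<open>\<open>ring_le_average\<close> is integrated against the increment of the Levy measures.
  With growing \<open>N\<close> the rings exhaust the tail, and the factor 2 is the one of the
  average.\<close>

lemma tail_increment_le:
  assumes st: "0 \<le> s" "s \<le> t" and r: "r > 0"
    and c: "\<And>u. 0 \<le> u \<Longrightarrow> u \<le> 8 / r \<Longrightarrow> (LINT x|\<nu> t. 1 - cos (u * x)) - (LINT x|\<nu> s. 1 - cos (u * x)) \<le> c"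
  shows "G1 \<nu> t r - G1 \<nu> s r \<le> 2 * c"
proof -
  define R :: "nat \<Rightarrow> real \<Rightarrow> real" where "R N = indicator {x. r < \<bar>x\<bar> \<and> \<bar>x\<bar> \<le> r * real N / 4}" for N
  have R: "levy_dominated (R N)" for N
    using levy_dominated_ring[OF r, of "r * real N / 4"] by (simp add: R_def)
  have lim: "(\<lambda>N. LINT x|\<nu> w. R N x) \<longlonglongrightarrow> G1 \<nu> w r" if w: "0 \<le> w" for w
    unfolding G1_eq[OF w r]
  proof (rule integral_dominated_convergence[where w = "indicator {x. \<bar>x\<bar> > r}"])
    show "integrable (\<nu> w) (indicator {x. \<bar>x\<bar> > r} :: real \<Rightarrow> real)"
      using integrable_levy[OF w levy_dominated_tail[OF r]] by simp
    have [measurable_cong]: "sets (\<nu> w) = sets borel" using w by (rule sets_levy)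
    show "indicator {x. \<bar>x\<bar> > r} \<in> borel_measurable (\<nu> w)" by measurable
    show "R N \<in> borel_measurable (\<nu> w)" for N unfolding R_def by measurable
    show "AE x in \<nu> w. norm (R N x) \<le> indicator {x. \<bar>x\<bar> > r} x" for N
      by (auto simp: R_def indicator_def)
    show "AE x in \<nu> w. (\<lambda>N. R N x) \<longlonglongrightarrow> indicator {x. \<bar>x\<bar> > r} x"
    proof (rule AE_I2)
      fix x :: real
      obtain N0 :: nat where N0: "4 * \<bar>x\<bar> / r \<le> real N0" using real_arch_simple by blast
      have "R N x = indicator {x. \<bar>x\<bar> > r} x" if "N \<ge> N0" for N
      proof -
        have "4 * \<bar>x\<bar> / r \<le> real N" using N0 that by (meson of_nat_le_iff order_trans)
        then show ?thesis using r by (auto simp: R_def indicator_def field_simps)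
      qed
      then show "(\<lambda>N. R N x) \<longlonglongrightarrow> indicator {x. \<bar>x\<bar> > r} x"
        by (intro tendsto_eventually) (auto simp: eventually_sequentially)
    qed
  qed
  have bound: "(LINT x|\<nu> t. R N x) - (LINT x|\<nu> s. R N x) \<le> 2 * c" if N: "N \<ge> 1" for N
  proof -
    define u where "u k = 8 * real k / (r * real N)" for k
    have u: "0 \<le> u k" "u k \<le> 8 / r" if "k \<in> {1..N}" for k using that r N by (auto simp: u_def field_simps)
    define f where "f x = (2 / real N) * (\<Sum>k=1..N. 1 - cos (u k * x))" for x
    have f: "levy_dominated f" unfolding f_def by (intro levy_dominated_scale levy_dominated_sum levy_dominated_cos)
    have fi: "(LINT x|\<nu> w. f x) = (2 / real N) * (\<Sum>k=1..N. LINT x|\<nu> w. 1 - cos (u k * x))" if "w \<ge> 0" for w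
      unfolding f_def using that
      by (subst integral_mult_right_zero, subst Bochner_Integration.integral_sum) (auto intro!: integrable_levy levy_dominated_cos)
    have "(LINT x|\<nu> t. R N x) - (LINT x|\<nu> s. R N x) \<le> (LINT x|\<nu> t. f x) - (LINT x|\<nu> s. f x)"
      by (rule integral_increment_mono[OF st R f]) (use ring_le_average[OF r, of N] in \<open>simp add: R_def f_def u_def\<close>)
    also have "\<dots> = (2 / real N) * (\<Sum>k=1..N. (LINT x|\<nu> t. 1 - cos (u k * x)) - (LINT x|\<nu> s. 1 - cos (u k * x)))"
      using st by (simp add: fi sum_subtractf right_diff_distrib)
    also have "\<dots> \<le> (2 / real N) * (\<Sum>k=1..N. c)"
      by (intro mult_left_mono sum_mono c u) auto
    also have "\<dots> = 2 * c" using N by simp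
    finally show ?thesis .
  qed
  have "(\<lambda>N. (LINT x|\<nu> t. R N x) - (LINT x|\<nu> s. R N x)) \<longlonglongrightarrow> G1 \<nu> t r - G1 \<nu> s r"
    using st by (intro tendsto_diff lim) auto
  then show ?thesis by (rule LIMSEQ_le_const2) (use bound in blast)
qed

text \<open>Needed to follow the argument of a characteristic function continuously from frequency
  0. Dominated convergence applies because a convergent sequence of frequencies is bounded.\<close>

lemma im_exponent_continuous:
  assumes "0 \<le> t"
  shows "continuous_on UNIV (\<lambda>u. im_exponent t u)"
proof -
  have [measurable_cong]: "sets (\<nu> t) = sets borel" using assms by (rule sets_levy)
  have "isCont (\<lambda>u. LINT x|\<nu> t. sin (u * x) - u * trunc 1 x) u" for u
    unfolding continuous_at_sequentially
  proof safe
    fix X assume X: "X \<longlonglongrightarrow> u"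
    then have "Bseq X" by (rule convergent_imp_Bseq[OF convergentI])
    then obtain U where U: "\<And>n. \<bar>X n\<bar> \<le> U" by (auto simp: Bseq_def)
    show "((\<lambda>u. LINT x|\<nu> t. sin (u * x) - u * trunc 1 x) \<circ> X) \<longlonglongrightarrow> (LINT x|\<nu> t. sin (u * x) - u * trunc 1 x)"
      unfolding comp_def
    proof (rule integral_dominated_convergence[where w="\<lambda>x. (1 + U\<^sup>2) * min 1 (x\<^sup>2)"])
      show "integrable (\<nu> t) (\<lambda>x. (1 + U\<^sup>2) * min 1 (x\<^sup>2))"
        by (rule integrable_levy[OF assms levy_dominated_scale[OF levy_dominated_min]])
      fix n
      show "AE x in \<nu> t. norm (sin (X n * x) - X n * trunc 1 x) \<le> (1 + U\<^sup>2) * min 1 (x\<^sup>2)"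
      proof (rule AE_I2)
        fix x :: real
        have XU: "(X n)\<^sup>2 \<le> U\<^sup>2" using U[of n] power_mono[of "\<bar>X n\<bar>" U 2] by simp
        show "norm (sin (X n * x) - X n * trunc 1 x) \<le> (1 + U\<^sup>2) * min 1 (x\<^sup>2)"
        proof (cases "\<bar>x\<bar> \<le> 1")
          case True
          have "\<bar>sin (X n * x) - X n * x\<bar> \<le> (X n * x)\<^sup>2 / 2" by (rule abs_sin_minus_le)
          also have "\<dots> \<le> (X n)\<^sup>2 * x\<^sup>2" by (simp add: power_mult_distrib)
          also have "\<dots> \<le> (1 + U\<^sup>2) * x\<^sup>2" using XU by (intro mult_right_mono) auto
          finally show ?thesis using True power_mono[of "\<bar>x\<bar>" 1 2] by (simp add: trunc_eq)
        next
          case False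
          then have "min 1 (x\<^sup>2) = 1" using power_mono[of 1 "\<bar>x\<bar>" 2] by simp
          then show ?thesis using False abs_sin_le_one[of "X n * x"] by (simp add: trunc_eq add_increasing2)
        qed
      qed
    qed (auto intro!: tendsto_intros X)
  qed
  then have "continuous_on UNIV (\<lambda>u. LINT x|\<nu> t. sin (u * x) - u * trunc 1 x)"
    by (rule continuous_at_imp_continuous_on[OF ballI])
  then show ?thesis unfolding im_exponent_def by (intro continuous_intros)
qed

lemma re_exponent_increment:
  "re_exponent t u - re_exponent s u
     = u\<^sup>2 * (C t - C s) / 2 + ((LINT x|\<nu> t. 1 - cos (u * x)) - (LINT x|\<nu> s. 1 - cos (u * x)))"
  unfolding re_exponent_def by (simp add: field_simps)

lemma cos_increment_nonneg:
  assumes "0 \<le> s" "s \<le> t"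
  shows "0 \<le> (LINT x|\<nu> t. 1 - cos (u * x)) - (LINT x|\<nu> s. 1 - cos (u * x))"
  using integral_levy_mono[OF assms levy_dominated_cos[of u]] by simp

lemma re_exponent_mono:
  assumes "0 \<le> s" "s \<le> t"
  shows "re_exponent s u \<le> re_exponent t u"
proof -
  have "u\<^sup>2 * (C t - C s) / 2 \<ge> 0" using C_le[OF assms] by simp
  then show ?thesis
    using cos_increment_nonneg[OF assms, of u] re_exponent_increment[of t u s] by linarith
qed

text \<open>The Gaussian part scales by exactly 4, and
  \<open>4 * (1 - cos z) - (1 - cos (2 * z))\<close> is twice a square. Iterated, this carries a
  bound at low frequencies up to the range needed for \<open>h_increment_le\<close>.\<close>

lemma re_exponent_double:
  assumes "0 \<le> s" "s \<le> t"
  shows "re_exponent t (2 * u) - re_exponent s (2 * u) \<le> 4 * (re_exponent t u - re_exponent s u)"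
proof -
  have "1 - cos (2 * u * x) \<le> 4 * (1 - cos (u * x))" for x :: real
  proof -
    have "cos (2 * u * x) = 2 * (cos (u * x))\<^sup>2 - 1" using cos_double_cos[of "u * x"] by (simp add: mult.assoc)
    then have "4 * (1 - cos (u * x)) - (1 - cos (2 * u * x)) = 2 * (1 - cos (u * x))\<^sup>2"
      by (simp add: power2_eq_square algebra_simps)
    then show ?thesis by (metis diff_ge_0_iff_ge mult_nonneg_nonneg zero_le_power2 zero_le_numeral)
  qed
  then have "(LINT x|\<nu> t. 1 - cos (2 * u * x)) - (LINT x|\<nu> s. 1 - cos (2 * u * x))
      \<le> (LINT x|\<nu> t. 4 * (1 - cos (u * x))) - (LINT x|\<nu> s. 4 * (1 - cos (u * x)))"
    by (intro integral_increment_mono assms levy_dominated_cos levy_dominated_scale)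
  also have "\<dots> = 4 * ((LINT x|\<nu> t. 1 - cos (u * x)) - (LINT x|\<nu> s. 1 - cos (u * x)))"
    by (subst (1 2) integral_mult_right_zero) (rule right_diff_distrib[symmetric])
  finally show ?thesis unfolding re_exponent_increment by (simp add: power_mult_distrib)
qed

lemma re_exponent_double_power:
  assumes "0 \<le> s" "s \<le> t"
  shows "re_exponent t (2 ^ n * u) - re_exponent s (2 ^ n * u) \<le> 4 ^ n * (re_exponent t u - re_exponent s u)"
proof (induction n)
  case (Suc n)
  have "re_exponent t (2 * (2 ^ n * u)) - re_exponent s (2 * (2 ^ n * u))
      \<le> 4 * (re_exponent t (2 ^ n * u) - re_exponent s (2 ^ n * u))"
    by (rule re_exponent_double[OF assms])
  also have "\<dots> \<le> 4 * (4 ^ n * (re_exponent t u - re_exponent s u))"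
    using Suc by (intro mult_left_mono) auto
  finally show ?case by (simp add: mult.assoc)
qed simp

text \<open>The tail contributes 2c by averaging. The second-moment part contributes 4c and needs
  the single frequency 1 / r, where 1 - cos (x / r) is at least a quarter of (x / r)^2 on
  [-r, r].\<close>

lemma h_increment_le:
  assumes st: "0 \<le> s" "s \<le> t" and r: "r > 0"
    and c: "\<And>u. 0 \<le> u \<Longrightarrow> u \<le> 8 / r \<Longrightarrow> re_exponent t u - re_exponent s u \<le> c"
  shows "h t r - h s r \<le> 6 * c"
proof -
  have "G1 \<nu> t r - G1 \<nu> s r \<le> 2 * c"
  proof (rule tail_increment_le[OF st r])
    fix u assume u: "0 \<le> u" "u \<le> 8 / r"
    have "u\<^sup>2 * (C t - C s) / 2 \<ge> 0" using C_le[OF st] by simp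
    then show "(LINT x|\<nu> t. 1 - cos (u * x)) - (LINT x|\<nu> s. 1 - cos (u * x)) \<le> c"
      using c[OF u] unfolding re_exponent_increment by linarith
  qed
  moreover have "K1 C \<nu> t r - K1 C \<nu> s r \<le> 4 * c"
  proof -
    let ?sq = "\<lambda>x::real. x\<^sup>2 * indicator {x. \<bar>x\<bar> \<le> r} x"
    have "1 / (4 * r\<^sup>2) * ?sq x \<le> 1 - cos (1 / r * x)" for x
      using one_minus_cos_ge[of "x / r"] r by (auto simp: indicator_def power_divide field_simps)
    then have "(LINT x|\<nu> t. 1 / (4 * r\<^sup>2) * ?sq x) - (LINT x|\<nu> s. 1 / (4 * r\<^sup>2) * ?sq x)
      \<le> (LINT x|\<nu> t. 1 - cos (1 / r * x)) - (LINT x|\<nu> s. 1 - cos (1 / r * x))"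
      by (intro integral_increment_mono st levy_dominated_scale levy_dominated_square levy_dominated_cos r)
    then have "1 / (4 * r\<^sup>2) * ((LINT x|\<nu> t. ?sq x) - (LINT x|\<nu> s. ?sq x))
      \<le> (LINT x|\<nu> t. 1 - cos (1 / r * x)) - (LINT x|\<nu> s. 1 - cos (1 / r * x))"
      by (simp only: integral_mult_right_zero right_diff_distrib)
    moreover have "1 / (4 * r\<^sup>2) * (C t - C s) \<le> (1 / r)\<^sup>2 * (C t - C s) / 2"
      using C_le[OF st] r by (simp add: power_divide field_simps)
    moreover have "re_exponent t (1 / r) - re_exponent s (1 / r) \<le> c"
      by (rule c) (use r in \<open>auto simp: field_simps\<close>)
    ultimately have "1 / (4 * r\<^sup>2) * ((C t - C s) + ((LINT x|\<nu> t. ?sq x) - (LINT x|\<nu> s. ?sq x))) \<le> c"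
      unfolding re_exponent_increment distrib_left by linarith
    also have "1 / (4 * r\<^sup>2) * ((C t - C s) + ((LINT x|\<nu> t. ?sq x) - (LINT x|\<nu> s. ?sq x))) = (K1 C \<nu> t r - K1 C \<nu> s r) / 4"
      unfolding K1_eq using r by (simp add: field_simps)
    finally show ?thesis by simp
  qed
  ultimately show ?thesis unfolding h_def by linarith
qed

text \<open>For u at most 1 / r the compensated sine is bounded by (x / r)^2 inside [-r, r] and by 1
  outside, which is precisely the integrand of \<open>h\<close>. Hence the argument of the
  characteristic function follows the truncated drift up to the increment of
  \<open>h\<close>.\<close>

lemma im_remainder_increment:
  assumes st: "0 \<le> s" "s \<le> t" and r: "r > 0" and u: "0 \<le> u" "u \<le> 1 / r"
  shows "\<bar>(im_exponent t u - im_exponent s u) - u * (drift t r - drift s r)\<bar> \<le> h t r - h s r"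
proof -
  let ?g = "\<lambda>x::real. indicator {x. \<bar>x\<bar> > r} x + 1 / r\<^sup>2 * (x\<^sup>2 * indicator {x. \<bar>x\<bar> \<le> r} x)"
  have dom: "levy_dominated ?g"
    by (intro levy_dominated_add levy_dominated_tail levy_dominated_scale levy_dominated_square r)
  have "\<bar>sin (u * x) - u * trunc r x\<bar> \<le> ?g x" for x
  proof (cases "\<bar>x\<bar> \<le> r")
    case True
    have "\<bar>sin (u * x) - u * x\<bar> \<le> (u * x)\<^sup>2 / 2" by (rule abs_sin_minus_le)
    also have "\<dots> \<le> u\<^sup>2 * x\<^sup>2" by (simp add: power_mult_distrib)
    also have "\<dots> \<le> (1 / r)\<^sup>2 * x\<^sup>2" using u by (intro mult_right_mono power_mono) auto
    finally show ?thesis using True by (simp add: trunc_eq power_divide)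
  qed (simp add: trunc_eq)
  then have "\<bar>(LINT x|\<nu> t. sin (u * x) - u * trunc r x) - (LINT x|\<nu> s. sin (u * x) - u * trunc r x)\<bar>
     \<le> (LINT x|\<nu> t. ?g x) - (LINT x|\<nu> s. ?g x)"
    by (intro integral_increment_abs st dom levy_dominated_sin r)
  also have "\<dots> = (G1 \<nu> t r - G1 \<nu> s r) + 1 / r\<^sup>2 * ((LINT x|\<nu> t. x\<^sup>2 * indicator {x. \<bar>x\<bar> \<le> r} x) - (LINT x|\<nu> s. x\<^sup>2 * indicator {x. \<bar>x\<bar> \<le> r} x))"
  proof -
    have "(LINT x|\<nu> w. ?g x) = G1 \<nu> w r + 1 / r\<^sup>2 * (LINT x|\<nu> w. x\<^sup>2 * indicator {x. \<bar>x\<bar> \<le> r} x)" if w: "0 \<le> w" for w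
    proof -
      have "(LINT x|\<nu> w. ?g x) = (LINT x|\<nu> w. indicator {x. \<bar>x\<bar> > r} x) + (LINT x|\<nu> w. 1 / r\<^sup>2 * (x\<^sup>2 * indicator {x. \<bar>x\<bar> \<le> r} x))"
        by (intro Bochner_Integration.integral_add integrable_levy w r levy_dominated_tail levy_dominated_scale levy_dominated_square)
      then show ?thesis unfolding G1_eq[OF w r] by (simp only: integral_mult_right_zero)
    qed
    from this[of t] this[of s] show ?thesis using st by (simp add: right_diff_distrib)
  qed
  also have "\<dots> \<le> (G1 \<nu> t r - G1 \<nu> s r) + 1 / r\<^sup>2 * ((C t - C s) + ((LINT x|\<nu> t. x\<^sup>2 * indicator {x. \<bar>x\<bar> \<le> r} x) - (LINT x|\<nu> s. x\<^sup>2 * indicator {x. \<bar>x\<bar> \<le> r} x)))"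
    using C_le[OF st] by (intro add_left_mono mult_left_mono) auto
  also have "\<dots> = h t r - h s r" unfolding h_def K1_eq using r by (simp add: field_simps)
  finally show ?thesis using st r by (simp add: im_exponent_eq algebra_simps)
qed

end

section \<open>A maximal inequality and path regularity\<close>

text \<open>Decompose by the first index k at which the partial sum exceeds 2a. The remaining sum is
  independent of that event and stays within a with probability at least 1/2, in which case the full
  sum still exceeds a.\<close>

lemma (in prob_space) ottaviani:
  fixes V :: "nat \<Rightarrow> 'a \<Rightarrow> real"
  defines "S \<equiv> \<lambda>k \<omega>. \<Sum>i<k. V i \<omega>"
  assumes V: "indep_vars (\<lambda>_. borel) V {..<n}"
    and half: "\<And>k. k \<le> n \<Longrightarrow> prob {\<omega> \<in> space M. \<bar>S n \<omega> - S k \<omega>\<bar> > a} \<le> 1 / 2"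
  shows "prob {\<omega> \<in> space M. \<exists>k\<le>n. \<bar>S k \<omega>\<bar> > 2 * a} \<le> 2 * prob {\<omega> \<in> space M. \<bar>S n \<omega>\<bar> > a}"
proof -
  have Vm [measurable]: "V i \<in> borel_measurable M" if "i < n" for i
    using V that by (auto simp: indep_vars_def)
  have Sm [measurable]: "S k \<in> borel_measurable M" if "k \<le> n" for k
    unfolding S_def using that by (intro borel_measurable_sum Vm) auto
  define A where "A k = {\<omega> \<in> space M. (\<forall>j<k. \<bar>S j \<omega>\<bar> \<le> 2 * a) \<and> \<bar>S k \<omega>\<bar> > 2 * a}" for k
  define D where "D k = {\<omega> \<in> space M. \<bar>S n \<omega> - S k \<omega>\<bar> \<le> a}" for k
  have Sm' [measurable]: "{\<omega> \<in> space M. \<bar>S j \<omega>\<bar> \<le> 2 * a} \<in> events" "{\<omega> \<in> space M. \<bar>S j \<omega>\<bar> > c} \<in> events"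
    if "j \<le> n" for j c
    using that by measurable
  have Am: "A k \<in> events" if "k \<le> n" for k
  proof -
    have "{\<omega> \<in> space M. \<forall>j\<in>{..<k}. \<bar>S j \<omega>\<bar> \<le> 2 * a} \<in> events"
      using that by (intro sets.sets_Collect_finite_All) auto
    moreover have "A k = {\<omega> \<in> space M. \<forall>j\<in>{..<k}. \<bar>S j \<omega>\<bar> \<le> 2 * a} \<inter> {\<omega> \<in> space M. \<bar>S k \<omega>\<bar> > 2 * a}"
      by (auto simp: A_def)
    ultimately show ?thesis using Sm'(2)[OF that, of "2 * a"] by simp
  qed
  have Dm: "D k \<in> events" if "k \<le> n" for k
    unfolding D_def using that by measurable
  have indep: "prob (A k \<inter> D k) = prob (A k) * prob (D k)" if k: "k \<le> n" for k
  proof -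
    \<comment> \<open>\<open>A k\<close> depends on the variables before k and \<open>D k\<close> on
      those from k on. Both are written as preimages under the two restricted families, whose
      independence follows from that of \<open>V\<close>.\<close>
    let ?M1 = "PiM {..<k} (\<lambda>_. borel :: real measure)" and ?M2 = "PiM {k..<n} (\<lambda>_. borel :: real measure)"
    let ?X1 = "\<lambda>\<omega>. restrict (\<lambda>i. V i \<omega>) {..<k}" and ?X2 = "\<lambda>\<omega>. restrict (\<lambda>i. V i \<omega>) {k..<n}"
    have iv: "indep_var ?M1 ?X1 ?M2 ?X2"
      by (rule indep_var_restrict[OF V]) (use k in auto)
    let ?A = "{f \<in> space ?M1. (\<forall>j\<in>{..<k}. \<bar>\<Sum>i<j. f i\<bar> \<le> 2 * a) \<and> \<bar>\<Sum>i<k. f i\<bar> > 2 * a}"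
    let ?D = "{f \<in> space ?M2. \<bar>\<Sum>i=k..<n. f i\<bar> \<le> a}"
    have c1: "(\<lambda>f. \<Sum>i<j. f i) \<in> borel_measurable ?M1" if "j \<le> k" for j
      using that by (intro borel_measurable_sum measurable_component_singleton) auto
    have c2: "(\<lambda>f. \<Sum>i=k..<n. f i) \<in> borel_measurable ?M2"
      by (intro borel_measurable_sum measurable_component_singleton) auto
    have A: "?A \<in> sets ?M1"
      using c1 by (intro sets.sets_Collect_conj sets.sets_Collect_finite_All) (auto intro!: borel_measurable_le borel_measurable_less)
    have D: "?D \<in> sets ?M2"
      using c2 by measurable
    have sp: "?X1 \<omega> \<in> space ?M1" "?X2 \<omega> \<in> space ?M2" for \<omega> by (auto simp: space_PiM)
    have e1: "(\<Sum>i<j. ?X1 \<omega> i) = S j \<omega>" if "j \<le> k" for j \<omega>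
      unfolding S_def using that by (intro sum.cong) auto
    have e2: "(\<Sum>i=k..<n. ?X2 \<omega> i) = S n \<omega> - S k \<omega>" for \<omega>
    proof -
      have "(\<Sum>i<n. V i \<omega>) = (\<Sum>i<k. V i \<omega>) + (\<Sum>i=k..<n. V i \<omega>)"
        using k by (metis atLeast0LessThan le0 sum.atLeastLessThan_concat)
      then show ?thesis unfolding S_def by simp
    qed
    have "?X1 -` ?A \<inter> space M = A k" using sp e1 by (auto simp: A_def)
    moreover have "?X2 -` ?D \<inter> space M = D k" using sp by (auto simp: D_def simp del: restrict_apply) (simp_all only: e2)
    moreover have "(\<lambda>\<omega>. (?X1 \<omega>, ?X2 \<omega>)) -` (?A \<times> ?D) \<inter> space M
        = (?X1 -` ?A \<inter> space M) \<inter> (?X2 -` ?D \<inter> space M)" by auto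
    ultimately show ?thesis using indep_varD[OF iv A D] by (simp only:)
  qed
  have disj: "disjoint_family_on (\<lambda>k. A k \<inter> D k) {..n}" "disjoint_family_on A {..n}"
    unfolding disjoint_family_on_def A_def by (auto simp: not_less[symmetric]; metis linorder_neqE_nat)+
  have "{\<omega> \<in> space M. \<exists>k\<le>n. \<bar>S k \<omega>\<bar> > 2 * a} \<subseteq> (\<Union>k\<in>{..n}. A k)"
  proof
    fix \<omega> assume w: "\<omega> \<in> {\<omega> \<in> space M. \<exists>k\<le>n. \<bar>S k \<omega>\<bar> > 2 * a}"
    define k where "k = (LEAST k. \<bar>S k \<omega>\<bar> > 2 * a)"
    from w obtain k0 where k0: "k0 \<le> n" "\<bar>S k0 \<omega>\<bar> > 2 * a" by auto
    have "\<bar>S k \<omega>\<bar> > 2 * a" unfolding k_def by (rule LeastI[of _ k0]) (use k0 in auto)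
    moreover have "k \<le> k0" unfolding k_def by (rule Least_le) (use k0 in auto)
    moreover have "\<bar>S j \<omega>\<bar> \<le> 2 * a" if "j < k" for j using not_less_Least[OF that[unfolded k_def]] by simp
    ultimately have "k \<in> {..n}" "\<omega> \<in> A k" using w k0 by (auto simp: A_def)
    then show "\<omega> \<in> (\<Union>k\<in>{..n}. A k)" by blast
  qed
  then have "prob {\<omega> \<in> space M. \<exists>k\<le>n. \<bar>S k \<omega>\<bar> > 2 * a} \<le> prob (\<Union>k\<in>{..n}. A k)"
    using Am by (intro finite_measure_mono) auto
  also have "\<dots> = (\<Sum>k\<in>{..n}. prob (A k))"
    by (rule finite_measure_finite_Union) (use Am disj in auto)
  also have "\<dots> \<le> (\<Sum>k\<in>{..n}. 2 * prob (A k \<inter> D k))"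
  proof (rule sum_mono)
    fix k assume "k \<in> {..n}"
    then have k: "k \<le> n" by simp
    have "prob (D k) = 1 - prob {\<omega> \<in> space M. \<bar>S n \<omega> - S k \<omega>\<bar> > a}"
      using prob_compl[of "{\<omega> \<in> space M. \<bar>S n \<omega> - S k \<omega>\<bar> > a}"] k
      by (simp add: D_def not_less set_diff_eq conj_commute cong: conj_cong)
    then have "1 / 2 \<le> prob (D k)" using half[OF k] by simp
    then have "prob (A k) * (1 / 2) \<le> prob (A k) * prob (D k)" by (intro mult_left_mono) auto
    then show "prob (A k) \<le> 2 * prob (A k \<inter> D k)" using indep[OF k] by simp
  qed
  also have "\<dots> = 2 * prob (\<Union>k\<in>{..n}. A k \<inter> D k)"
    unfolding sum_distrib_left[symmetric]
    by (subst finite_measure_finite_Union) (use Am Dm disj in auto)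
  also have "prob (\<Union>k\<in>{..n}. A k \<inter> D k) \<le> prob {\<omega> \<in> space M. \<bar>S n \<omega>\<bar> > a}"
    by (intro finite_measure_mono) (auto simp: A_def D_def)
  finally show ?thesis by simp
qed

text \<open>Reduces a supremum over an interval to countably many finite grids, which yields both
  measurability and maximal inequalities. The endpoint t belongs to every grid, so right continuity
  is only required before it.\<close>

lemma right_continuous_exceeds_iff:
  fixes f :: "real \<Rightarrow> real"
  assumes t: "0 \<le> t" and f: "\<And>s. 0 \<le> s \<Longrightarrow> s < t \<Longrightarrow> continuous (at_right s) f"
  shows "(\<exists>s\<in>{0..t}. f s > a) \<longleftrightarrow> (\<exists>m. \<exists>k\<le>2^m. f (real k * t / 2 ^ m) > a)"
proof safe
  fix s assume s: "s \<in> {0..t}" "f s > a"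
  show "\<exists>m. \<exists>k\<le>2^m. f (real k * t / 2 ^ m) > a"
  proof (cases "s = t")
    case True
    then show ?thesis using s by (intro exI[of _ 0] exI[of _ 1]) auto
  next
    case False
    then have st: "0 \<le> s" "s < t" using s by auto
    have "(f \<longlongrightarrow> f s) (at_right s)" using f[OF st] by (simp add: continuous_within)
    then have "eventually (\<lambda>x. f x > a) (at_right s)" using s by (intro order_tendstoD)
    then obtain b where b: "b > s" "\<And>y. s < y \<Longrightarrow> y < b \<Longrightarrow> f y > a"
      using eventually_at_right[of s "s+1"] by auto
    obtain m where m: "(1/2::real) ^ m < (b - s) / t"
      using real_arch_pow_inv[of "(b-s)/t" "1/2"] b st by auto
    \<comment> \<open>The first point of the grid at or after \<open>s\<close>; the mesh is finer
      than \<open>b - s\<close>, so this point still lies where \<open>f\<close> exceeds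
      \<open>a\<close>.\<close>
    define k where "k = nat \<lceil>s * 2 ^ m / t\<rceil>"
    have rk: "real k = of_int \<lceil>s * 2 ^ m / t\<rceil>" unfolding k_def
    proof (rule of_nat_nat)
      have "0 \<le> s * 2 ^ m / t" using st by simp
      then show "0 \<le> \<lceil>s * 2 ^ m / t\<rceil>" by linarith
    qed
    have "s * 2 ^ m / t \<le> real k" "real k < s * 2 ^ m / t + 1" unfolding rk by linarith+
    then have k: "s \<le> real k * t / 2 ^ m" "real k * t / 2 ^ m < s + t / 2 ^ m"
      using st by (auto simp: field_simps)
    have "s * 2 ^ m / t \<le> 2 ^ m" using st by (simp add: field_simps)
    then have "k \<le> 2 ^ m" unfolding k_def by (simp add: ceiling_le_iff nat_le_iff)
    moreover have "t / 2 ^ m < b - s" using m st by (simp add: power_one_over field_simps)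
    then have "f (real k * t / 2 ^ m) > a"
      using b(2)[of "real k * t / 2 ^ m"] k s by (cases "s = real k * t / 2 ^ m") auto
    ultimately show ?thesis by blast
  qed
next
  fix m k assume k: "k \<le> (2::nat) ^ m" "f (real k * t / 2 ^ m) > a"
  have "real k \<le> 2 ^ m" using k(1) by (metis of_nat_le_iff of_nat_numeral of_nat_power)
  then have "real k * t \<le> 2 ^ m * t" using t by (rule mult_right_mono)
  then have "real k * t / 2 ^ m \<in> {0..t}" using t by (auto simp: field_simps)
  then show "\<exists>s\<in>{0..t}. f s > a" using k by blast
qed

text \<open>One-sided limits bound the path near every point, and compactness makes the bound
  global. It ensures that the real-valued \<open>run_sup\<close> is a genuine supremum.\<close>

lemma cadlag_bounded:
  assumes "cadlag f" "0 \<le> t"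
  shows "\<exists>K. \<forall>s\<in>{0..t}. \<bar>f s\<bar> \<le> K"
proof -
  have "\<exists>d>0. \<exists>K. \<forall>y\<in>{0..t}. \<bar>y - s\<bar> < d \<longrightarrow> \<bar>f y\<bar> \<le> K" if s: "s \<in> {0..t}" for s
  proof -
    have "(f \<longlongrightarrow> f s) (at_right s)" using assms s by (simp add: cadlag_def continuous_within)
    then have "((\<lambda>x. \<bar>f x\<bar>) \<longlongrightarrow> \<bar>f s\<bar>) (at_right s)" by (rule tendsto_rabs)
    then have "eventually (\<lambda>x. \<bar>f x\<bar> < \<bar>f s\<bar> + 1) (at_right s)" by (rule order_tendstoD) simp
    then obtain b where b: "b > s" "\<And>y. s < y \<Longrightarrow> y < b \<Longrightarrow> \<bar>f y\<bar> < \<bar>f s\<bar> + 1"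
      using eventually_at_right[of s "s+1"] by auto
    obtain c l where c: "c < s" "\<And>y. 0 \<le> y \<Longrightarrow> c < y \<Longrightarrow> y < s \<Longrightarrow> \<bar>f y\<bar> < \<bar>l\<bar> + 1"
    proof (cases "s = 0")
      case True
      then show ?thesis using that[of "-1" 0] by auto
    next
      case False
      then have "s > 0" using s by simp
      then obtain l where "(f \<longlongrightarrow> l) (at_left s)" using assms(1) unfolding cadlag_def by blast
      then have "((\<lambda>x. \<bar>f x\<bar>) \<longlongrightarrow> \<bar>l\<bar>) (at_left s)" by (rule tendsto_rabs)
      then have "eventually (\<lambda>x. \<bar>f x\<bar> < \<bar>l\<bar> + 1) (at_left s)" by (rule order_tendstoD) simp
      then obtain c where "c < s" "\<And>y. c < y \<Longrightarrow> y < s \<Longrightarrow> \<bar>f y\<bar> < \<bar>l\<bar> + 1"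
        using eventually_at_left[of "s-1" s] by auto
      then show ?thesis using that by blast
    qed
    have "\<bar>f y\<bar> \<le> max (\<bar>f s\<bar> + 1) (\<bar>l\<bar> + 1)"
      if y: "y \<in> {0..t}" "\<bar>y - s\<bar> < min (b - s) (s - c)" for y
    proof -
      consider "y = s" | "s < y" "y < b" | "c < y" "y < s" using y by force
      then show ?thesis using b(2)[of y] c(2)[of y] y by cases auto
    qed
    moreover have "min (b - s) (s - c) > 0" using b c by simp
    ultimately show ?thesis by blast
  qed
  then obtain d K where dK: "\<And>s. s \<in> {0..t} \<Longrightarrow> d s > 0"
    "\<And>s y. s \<in> {0..t} \<Longrightarrow> y \<in> {0..t} \<Longrightarrow> \<bar>y - s\<bar> < d s \<Longrightarrow> \<bar>f y\<bar> \<le> K s"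
    by metis
  have cover: "{0..t} \<subseteq> (\<Union>s\<in>{0..t}. ball s (d s))" using dK(1) by force
  obtain D where D: "D \<subseteq> {0..t}" "finite D" "{0..t} \<subseteq> (\<Union>s\<in>D. ball s (d s))"
    by (rule compactE_image[OF compact_Icc _ cover]) (auto intro: that)
  have "\<bar>f y\<bar> \<le> (\<Sum>s\<in>D. \<bar>K s\<bar>)" if y: "y \<in> {0..t}" for y
  proof -
    obtain s where s: "s \<in> D" "y \<in> ball s (d s)" using D y by blast
    then have "\<bar>f y\<bar> \<le> K s" using dK(2)[of s y] y D by (auto simp: dist_real_def abs_minus_commute)
    also have "\<dots> \<le> \<bar>K s\<bar>" by simp
    also have "\<dots> \<le> (\<Sum>s\<in>D. \<bar>K s\<bar>)" using s D by (intro member_le_sum) auto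
    finally show ?thesis .
  qed
  then show ?thesis by blast
qed

section \<open>Cutting an interval into blocks, and size of the exponents\<close>

context char_triple
begin

text \<open>Blocks are cut greedily: each ends at the first time at which the increment of
  \<open>h\<close> plus the displacement of the drift over r reaches \<kappa>. Being first, that
  time keeps \<open>h\<close> and the drift below (J + 1) \<kappa> up to it; and if it did not
  exist, both would stay below this value up to t, so that \<open>y1\<close> would be at most 2
  \<kappa> (J + 1). The bound on the drift is carried for all intermediate times because
  \<open>M1_star\<close> is a maximum over them.\<close>

lemma block_chain:
  assumes t: "0 \<le> t" and r: "r > 0" and \<kappa>: "\<kappa> > 0"
  shows "y1 B C \<nu> t r > 2 * \<kappa> * real J \<Longrightarrow>
    \<exists>u. u 0 = 0 \<and> (\<forall>j<J. u j < u (Suc j) \<and>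
        \<kappa> \<le> (h (u (Suc j)) r - h (u j) r) + \<bar>drift (u (Suc j)) r - drift (u j) r\<bar> / r)
      \<and> 0 \<le> u J \<and> u J \<le> t \<and> h (u J) r \<le> real J * \<kappa> \<and> (\<forall>w\<in>{0..u J}. \<bar>drift w r\<bar> / r \<le> real J * \<kappa>)"
proof (induction J)
  case 0
  then show ?case using t r by (intro exI[of _ "\<lambda>_. 0"]) (auto simp: h_0 drift_0)
next
  case (Suc J)
  then have "y1 B C \<nu> t r > 2 * \<kappa> * real J" using \<kappa> by (simp add: algebra_simps)
  then obtain u where u: "u 0 = 0" "\<And>j. j < J \<Longrightarrow> u j < u (Suc j) \<and>
        \<kappa> \<le> (h (u (Suc j)) r - h (u j) r) + \<bar>drift (u (Suc j)) r - drift (u j) r\<bar> / r"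
      "0 \<le> u J" "u J \<le> t" "h (u J) r \<le> real J * \<kappa>" "\<And>w. w \<in> {0..u J} \<Longrightarrow> \<bar>drift w r\<bar> / r \<le> real J * \<kappa>"
    using Suc.IH by blast
  define f where "f w = (h w r - h (u J) r) + \<bar>drift w r - drift (u J) r\<bar> / r" for w
  have f_cont: "continuous_on {u J..t} f"
    unfolding f_def using u r
    by (intro continuous_intros continuous_on_subset[OF continuous_h] continuous_on_subset[OF continuous_drift]) auto
  have fle: "h w r \<le> real (Suc J) * \<kappa> \<and> \<bar>drift w r\<bar> / r \<le> real (Suc J) * \<kappa>"
    if "f w \<le> \<kappa>" "u J \<le> w" for w
  proof -
    have "0 \<le> \<bar>drift w r - drift (u J) r\<bar> / r" "0 \<le> h w r - h (u J) r" using r u that h_le[of "u J" w r] by auto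
    then have 1: "h w r \<le> h (u J) r + \<kappa>" "\<bar>drift w r - drift (u J) r\<bar> / r \<le> \<kappa>" using that unfolding f_def by linarith+
    have "\<bar>drift w r\<bar> / r \<le> (\<bar>drift (u J) r\<bar> + \<bar>drift w r - drift (u J) r\<bar>) / r"
      using r by (intro divide_right_mono) auto
    also have "\<dots> = \<bar>drift (u J) r\<bar> / r + \<bar>drift w r - drift (u J) r\<bar> / r" by (rule add_divide_distrib)
    also have "\<dots> \<le> real J * \<kappa> + \<kappa>" using 1 u by (intro add_mono) auto
    finally show ?thesis using 1 u by (simp add: algebra_simps)
  qed
  obtain w0 where w0: "u J \<le> w0" "w0 \<le> t" "f w0 \<ge> \<kappa>"
  proof (rule ccontr)
    assume "\<not> thesis"
    then have *: "f w < \<kappa>" if "u J \<le> w" "w \<le> t" for w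
      using that \<open>\<And>w. u J \<le> w \<Longrightarrow> w \<le> t \<Longrightarrow> \<kappa> \<le> f w \<Longrightarrow> thesis\<close> not_le by blast
    have "M1_star B \<nu> t r \<le> real (Suc J) * \<kappa>"
    proof (rule M1_star_least[OF t])
      fix s assume s: "0 \<le> s" "s \<le> t"
      show "M1 B \<nu> s r \<le> real (Suc J) * \<kappa>"
      proof (cases "s \<le> u J")
        case True
        then have "M1 B \<nu> s r \<le> real J * \<kappa>" using u(6)[of s] s r by (simp add: M1_eq)
        then show ?thesis using \<kappa> by (simp add: algebra_simps)
      next
        case False
        then show ?thesis using fle[of s] *[of s] s r by (simp add: M1_eq)
      qed
    qed
    moreover have "h t r \<le> real (Suc J) * \<kappa>" using fle[of t] *[of t] u by auto
    ultimately have "y1 B C \<nu> t r \<le> 2 * \<kappa> * real (Suc J)" unfolding y1_eq by (simp add: algebra_simps)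
    then show False using Suc.prems by simp
  qed
  \<comment> \<open>The level set of \<kappa> is closed and nonempty, so its infimum is the first
    hitting time; by the intermediate value theorem \<open>f\<close> stays at or below \<kappa>
    until then.\<close>
  define S where "S = {w \<in> {u J..t}. f w = \<kappa>}"
  have "f (u J) = 0" by (simp add: f_def)
  then have "\<exists>x\<ge>u J. x \<le> w0 \<and> f x = \<kappa>"
    using w0 \<kappa> f_cont by (intro IVT') (auto intro: continuous_on_subset)
  then obtain x where "u J \<le> x" "x \<le> w0" "f x = \<kappa>" by blast
  then have "x \<in> S" using w0 by (simp add: S_def)
  then have S_ne: "S \<noteq> {}" by blast
  have "closed S" unfolding S_def using continuous_closed_preimage_constant[OF f_cont, of \<kappa>] by simp
  then have w1: "Inf S \<in> S" using S_ne by (intro closed_contains_Inf) (auto simp: S_def)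
  define w1 where "w1 = Inf S"
  have w1S: "u J \<le> w1" "w1 \<le> t" "f w1 = \<kappa>" using w1 by (auto simp: S_def w1_def)
  have w1_gt: "u J < w1" using w1S \<open>f (u J) = 0\<close> \<kappa> by (cases "u J = w1") auto
  have f_le: "f w \<le> \<kappa>" if w: "u J \<le> w" "w \<le> w1" for w
  proof (rule ccontr)
    assume "\<not> f w \<le> \<kappa>"
    then have gt: "f w > \<kappa>" by simp
    then have "\<exists>x\<ge>u J. x \<le> w \<and> f x = \<kappa>"
      using w w1S \<kappa> f_cont \<open>f (u J) = 0\<close> by (intro IVT') (auto intro: continuous_on_subset)
    then obtain x where x: "u J \<le> x" "x \<le> w" "f x = \<kappa>" by blast
    then have "x \<in> S" using w w1S by (auto simp: S_def)
    then have "w1 \<le> x" unfolding w1_def by (intro cInf_lower) (auto simp: S_def intro!: bdd_belowI)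
    then have "x = w" using x w by auto
    then show False using x gt by simp
  qed
  show ?case
  proof (intro exI[of _ "u(Suc J := w1)"] conjI allI impI ballI)
    fix j assume "j < Suc J"
    then show "(u(Suc J := w1)) j < (u(Suc J := w1)) (Suc j)"
      "\<kappa> \<le> (h ((u(Suc J := w1)) (Suc j)) r - h ((u(Suc J := w1)) j) r) + \<bar>drift ((u(Suc J := w1)) (Suc j)) r - drift ((u(Suc J := w1)) j) r\<bar> / r"
      using u(2)[of j] w1_gt w1S(3) by (auto simp: less_Suc_eq f_def)
  next
    fix w assume "w \<in> {0..(u(Suc J := w1)) (Suc J)}"
    then have w: "0 \<le> w" "w \<le> w1" by auto
    show "\<bar>drift w r\<bar> / r \<le> real (Suc J) * \<kappa>"
    proof (cases "w \<le> u J")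
      case True
      then have "\<bar>drift w r\<bar> / r \<le> real J * \<kappa>" using u(6)[of w] w by simp
      then show ?thesis using \<kappa> by (simp add: algebra_simps)
    qed (use fle[of w] f_le[of w] w in auto)
  qed (use u(1) w1S u(3) fle[of w1] in auto)
qed

lemma re_exponent_le:
  assumes "0 \<le> t" "r > 0" "0 \<le> u" "u \<le> 8 / r"
  shows "re_exponent t u \<le> 32 * h t r"
proof -
  let ?sq = "\<lambda>x::real. x\<^sup>2 * indicator {x. \<bar>x\<bar> \<le> r} x"
  let ?tl = "\<lambda>x::real. indicator {x. \<bar>x\<bar> > r} x :: real"
  \<comment> \<open>The constant 32 is half of 8 squared, from \<open>u \<le> 8 / r\<close>.\<close>
  have u2: "u\<^sup>2 / 2 \<le> 32 / r\<^sup>2" using power_mono[OF assms(4,3), of 2] by (simp add: power_divide)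
  have "1 - cos (u * x) \<le> 32 / r\<^sup>2 * ?sq x + 2 * ?tl x" for x
  proof (cases "\<bar>x\<bar> \<le> r")
    case True
    have "1 - cos (u * x) \<le> (u * x)\<^sup>2 / 2" by (rule one_minus_cos_le)
    also have "\<dots> = u\<^sup>2 / 2 * x\<^sup>2" by (simp add: power_mult_distrib)
    also have "\<dots> \<le> 32 / r\<^sup>2 * x\<^sup>2" using u2 by (rule mult_right_mono) simp
    finally show ?thesis using True by simp
  qed (use cos_ge_minus_one[of "u * x"] in simp)
  then have "(LINT x|\<nu> t. 1 - cos (u * x)) \<le> (LINT x|\<nu> t. 32 / r\<^sup>2 * ?sq x + 2 * ?tl x)"
    using assms by (intro integral_mono integrable_levy levy_dominated_cos levy_dominated_add levy_dominated_scale levy_dominated_square levy_dominated_tail)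
  also have "\<dots> = (LINT x|\<nu> t. 32 / r\<^sup>2 * ?sq x) + (LINT x|\<nu> t. 2 * ?tl x)"
    using assms by (intro Bochner_Integration.integral_add integrable_levy levy_dominated_scale levy_dominated_square levy_dominated_tail)
  also have "\<dots> = 32 / r\<^sup>2 * (LINT x|\<nu> t. ?sq x) + 2 * G1 \<nu> t r"
    using assms by (simp only: integral_mult_right_zero G1_eq)
  finally have "(LINT x|\<nu> t. 1 - cos (u * x)) \<le> 32 / r\<^sup>2 * (LINT x|\<nu> t. ?sq x) + 2 * G1 \<nu> t r" .
  moreover have "u\<^sup>2 / 2 * C t \<le> 32 / r\<^sup>2 * C t" using u2 C_nonneg[OF assms(1)] by (rule mult_right_mono)
  moreover have "32 * K1 C \<nu> t r = 32 / r\<^sup>2 * C t + 32 / r\<^sup>2 * (LINT x|\<nu> t. ?sq x)"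
    unfolding K1_eq using assms by (simp add: field_simps)
  ultimately show ?thesis using G1_nonneg[of t r] unfolding re_exponent_def h_def by simp
qed

lemma im_exponent_le:
  assumes "0 \<le> t" "r > 0" "0 \<le> u" "u \<le> 8 / r"
  shows "\<bar>im_exponent t u\<bar> \<le> 32 * h t r + 8 * M1 B \<nu> t r"
proof -
  let ?sq = "\<lambda>x::real. x\<^sup>2 * indicator {x. \<bar>x\<bar> \<le> r} x"
  let ?tl = "\<lambda>x::real. indicator {x. \<bar>x\<bar> > r} x :: real"
  have u2: "u\<^sup>2 / 2 \<le> 32 / r\<^sup>2" using power_mono[OF assms(4,3), of 2] by (simp add: power_divide)
  have "\<bar>sin (u * x) - u * trunc r x\<bar> \<le> 32 / r\<^sup>2 * ?sq x + 2 * ?tl x" for x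
  proof (cases "\<bar>x\<bar> \<le> r")
    case True
    have "\<bar>sin (u * x) - u * x\<bar> \<le> (u * x)\<^sup>2 / 2" by (rule abs_sin_minus_le)
    also have "\<dots> = u\<^sup>2 / 2 * x\<^sup>2" by (simp add: power_mult_distrib)
    also have "\<dots> \<le> 32 / r\<^sup>2 * x\<^sup>2" using u2 by (rule mult_right_mono) simp
    finally show ?thesis using True by (simp add: trunc_eq)
  qed (use order_trans[OF abs_sin_le_one[of "u * x"], of 2] in \<open>simp add: trunc_eq\<close>)
  moreover have "integrable (\<nu> t) (\<lambda>x. sin (u * x) - u * trunc r x)"
    using assms by (intro integrable_levy levy_dominated_sin)
  ultimately have "(LINT x|\<nu> t. \<bar>sin (u * x) - u * trunc r x\<bar>) \<le> (LINT x|\<nu> t. 32 / r\<^sup>2 * ?sq x + 2 * ?tl x)"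
    using assms by (intro integral_mono integrable_abs integrable_levy levy_dominated_add levy_dominated_scale levy_dominated_square levy_dominated_tail levy_dominated_sin)
  also have "\<dots> = (LINT x|\<nu> t. 32 / r\<^sup>2 * ?sq x) + (LINT x|\<nu> t. 2 * ?tl x)"
    using assms by (intro Bochner_Integration.integral_add integrable_levy levy_dominated_scale levy_dominated_square levy_dominated_tail)
  also have "\<dots> = 32 / r\<^sup>2 * (LINT x|\<nu> t. ?sq x) + 2 * G1 \<nu> t r"
    using assms by (simp only: integral_mult_right_zero G1_eq)
  finally have "(LINT x|\<nu> t. \<bar>sin (u * x) - u * trunc r x\<bar>) \<le> 32 / r\<^sup>2 * (LINT x|\<nu> t. ?sq x) + 2 * G1 \<nu> t r" .
  moreover have "\<bar>LINT x|\<nu> t. sin (u * x) - u * trunc r x\<bar> \<le> (LINT x|\<nu> t. \<bar>sin (u * x) - u * trunc r x\<bar>)"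
    by (rule integral_abs_bound)
  moreover have "0 \<le> 32 / r\<^sup>2 * C t" using C_nonneg[OF assms(1)] by simp
  moreover have "32 * K1 C \<nu> t r = 32 / r\<^sup>2 * C t + 32 / r\<^sup>2 * (LINT x|\<nu> t. ?sq x)"
    unfolding K1_eq using assms by (simp add: field_simps)
  moreover have "\<bar>u * drift t r\<bar> \<le> 8 * M1 B \<nu> t r"
    using mult_right_mono[OF assms(4), of "\<bar>drift t r\<bar>"] assms by (simp add: M1_eq abs_mult)
  ultimately show ?thesis using G1_nonneg[of t r] unfolding h_def im_exponent_eq[OF assms(1,2)] distrib_left by linarith
qed

end

section \<open>Small balls and tails of real additive processes\<close>

locale additive_component = char_triple \<nu> B C + prob_space P
  for \<nu> B C and P :: "'w measure" +
  fixes X :: "real \<Rightarrow> 'w \<Rightarrow> real"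
  assumes rv [measurable]: "\<And>t. 0 \<le> t \<Longrightarrow> X t \<in> borel_measurable P"
    and X_0: "\<And>\<omega>. \<omega> \<in> space P \<Longrightarrow> X 0 \<omega> = 0"
    and indep: "independent_increments P X"
    and paths: "\<And>\<omega>. \<omega> \<in> space P \<Longrightarrow> cadlag (\<lambda>t. X t \<omega>)"
    and char_X: "\<And>t u. 0 \<le> t \<Longrightarrow> char (distr P borel (X t)) u =
        exp (\<i> * of_real (u * B t) - of_real (u\<^sup>2 * C t / 2)
             + (CLINT x|\<nu> t. iexp (u * x) - 1 - \<i> * of_real (u * x * indicator {-1..1} x)))"
begin

lemma char_eq:
  assumes "0 \<le> t"
  shows "char (distr P borel (X t)) u = exp (Complex (- re_exponent t u) (im_exponent t u))"
proof -
  let ?c = "\<lambda>x. 1 - cos (u * x)" and ?s = "\<lambda>x. sin (u * x) - u * trunc 1 x"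
  have i: "integrable (\<nu> t) ?c" "integrable (\<nu> t) ?s"
    using assms by (auto intro!: integrable_levy levy_dominated_cos levy_dominated_sin)
  have "(CLINT x|\<nu> t. iexp (u * x) - 1 - \<i> * of_real (u * x * indicator {-1..1} x))
     = (CLINT x|\<nu> t. \<i> * of_real (?s x) - of_real (?c x))"
    by (intro Bochner_Integration.integral_cong refl) (simp add: complex_eq_iff Re_exp Im_exp trunc_def mult.assoc)
  also have "\<dots> = \<i> * (CLINT x|\<nu> t. of_real (?s x)) - (CLINT x|\<nu> t. of_real (?c x))"
    using i by (subst Bochner_Integration.integral_diff) (auto simp del: of_real_diff of_real_mult)
  also have "\<dots> = \<i> * of_real (LINT x|\<nu> t. ?s x) - of_real (LINT x|\<nu> t. ?c x)"
    by (simp only: integral_complex_of_real)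
  finally have *: "\<i> * of_real (u * B t) - of_real (u\<^sup>2 * C t / 2)
             + (CLINT x|\<nu> t. iexp (u * x) - 1 - \<i> * of_real (u * x * indicator {-1..1} x))
      = Complex (- re_exponent t u) (im_exponent t u)"
    by (simp add: complex_eq_iff re_exponent_def im_exponent_def)
  show ?thesis unfolding char_X[OF assms] * ..
qed

lemma indep_increments_Suc:
  assumes "0 \<le> u 0" "\<And>j. j < n \<Longrightarrow> u j < u (Suc j)"
  shows "indep_vars (\<lambda>_. borel) (\<lambda>k \<omega>. X (u (Suc k)) \<omega> - X (u k) \<omega>) {..<n}"
proof -
  have "strict_mono_on {..n} u"
  proof (rule strict_mono_onI)
    fix i j assume "i \<in> {..n}" "j \<in> {..n}" "i < j"
    have "i < j \<Longrightarrow> j \<le> n \<Longrightarrow> u i < u j" for j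
    proof (induction j)
      case (Suc j)
      then show ?case using assms(2)[of j] by (cases "i = j") (auto intro: less_trans)
    qed simp
    then show "u i < u j" using \<open>i < j\<close> \<open>j \<in> {..n}\<close> by simp
  qed
  then show ?thesis using indep assms(1) unfolding independent_increments_def by blast
qed

text \<open>By independence the characteristic function of \<open>X t\<close> factors over [0, s]
  and [s, t], and the first factor, an exponential, can be divided out. The degenerate cases are
  separated because independence is stated for strictly increasing times.\<close>

lemma char_increment:
  assumes st: "0 \<le> s" "s \<le> t"
  shows "char (distr P borel (\<lambda>\<omega>. X t \<omega> - X s \<omega>)) u =
    exp (Complex (- (re_exponent t u - re_exponent s u)) (im_exponent t u - im_exponent s u))"
proof -
  consider "s = t" | "s = 0" "s < t" | "0 < s" "s < t" using st by linarith
  then show ?thesis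
  proof cases
    case 1
    have "char (distr P borel (\<lambda>\<omega>. X t \<omega> - X s \<omega>)) u = 1"
      using 1 by (simp add: char_def integral_distr prob_space del: distr_const)
    then show ?thesis using 1 by (simp add: complex_eq_iff Re_exp Im_exp)
  next
    case 2
    then have "distr P borel (\<lambda>\<omega>. X t \<omega> - X s \<omega>) = distr P borel (X t)"
      by (intro distr_cong) (auto simp: X_0)
    then show ?thesis using 2 st by (simp add: char_eq re_exponent_0 im_exponent_0)
  next
    case 3
    define w where "w k = (if k = 0 then 0 else if k = 1 then s else t)" for k :: nat
    have iv: "indep_vars (\<lambda>_. borel) (\<lambda>k \<omega>. X (w (Suc k)) \<omega> - X (w k) \<omega>) {..<2}"
      by (rule indep_increments_Suc) (use 3 in \<open>auto simp: w_def\<close>)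
    have "char (distr P borel (\<lambda>\<omega>. \<Sum>k<2. X (w (Suc k)) \<omega> - X (w k) \<omega>)) u
       = (\<Prod>k<2. char (distr P borel (\<lambda>\<omega>. X (w (Suc k)) \<omega> - X (w k) \<omega>)) u)"
      by (rule char_distr_sum[OF iv])
    also have "\<dots> = char (distr P borel (\<lambda>\<omega>. X s \<omega> - X 0 \<omega>)) u * char (distr P borel (\<lambda>\<omega>. X t \<omega> - X s \<omega>)) u"
      by (simp add: lessThan_Suc w_def numeral_2_eq_2)
    also have "distr P borel (\<lambda>\<omega>. X s \<omega> - X 0 \<omega>) = distr P borel (X s)"
      by (intro distr_cong) (auto simp: X_0)
    also have "distr P borel (\<lambda>\<omega>. \<Sum>k<2. X (w (Suc k)) \<omega> - X (w k) \<omega>) = distr P borel (X t)"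
      by (intro distr_cong) (auto simp: X_0 lessThan_Suc w_def numeral_2_eq_2)
    finally have "exp (Complex (- re_exponent t u) (im_exponent t u))
       = exp (Complex (- re_exponent s u) (im_exponent s u)) * char (distr P borel (\<lambda>\<omega>. X t \<omega> - X s \<omega>)) u"
      using 3 by (simp add: char_eq)
    then have "char (distr P borel (\<lambda>\<omega>. X t \<omega> - X s \<omega>)) u
       = exp (Complex (- re_exponent t u) (im_exponent t u)) / exp (Complex (- re_exponent s u) (im_exponent s u))"
      by (simp add: field_simps)
    also have "\<dots> = exp (Complex (- re_exponent t u) (im_exponent t u) - Complex (- re_exponent s u) (im_exponent s u))"
      by (rule exp_diff[symmetric])
    finally show ?thesis by (simp add: complex_diff)
  qed
qed

lemma expectation_cos_increment:
  assumes st: "0 \<le> s" "s \<le> t"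
  shows "expectation (\<lambda>\<omega>. cos (u * (X t \<omega> - X s \<omega>)))
    = exp (- (re_exponent t u - re_exponent s u)) * cos (im_exponent t u - im_exponent s u)"
proof -
  have [measurable]: "X t \<in> borel_measurable P" "X s \<in> borel_measurable P" using st by auto
  have "char (distr P borel (\<lambda>\<omega>. X t \<omega> - X s \<omega>)) u = (CLINT \<omega>|P. iexp (u * (X t \<omega> - X s \<omega>)))"
    by (simp add: char_def integral_distr)
  moreover have "integrable P (\<lambda>\<omega>. iexp (u * (X t \<omega> - X s \<omega>)))"
    by (intro integrable_iexp) auto
  ultimately have "Re (char (distr P borel (\<lambda>\<omega>. X t \<omega> - X s \<omega>)) u) = (LINT \<omega>|P. Re (iexp (u * (X t \<omega> - X s \<omega>))))"
    by (simp only: integral_Re)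
  then show ?thesis unfolding char_increment[OF st] by (simp add: Re_exp)
qed

lemma integrable_cos [simp]:
  fixes Z :: "'w \<Rightarrow> real"
  assumes [measurable]: "Z \<in> borel_measurable P"
  shows "integrable P (\<lambda>\<omega>. cos (Z \<omega>))"
proof (rule integrable_const_bound[where B = 1])
  show "AE x in P. norm (cos (Z x)) \<le> 1" by (rule AE_I2) simp
qed measurable

lemma integrable_indicator_event [simp]: "A \<in> events \<Longrightarrow> integrable P (indicator A :: 'w \<Rightarrow> real)"
  by (rule integrable_const_bound[where B = 1]) auto

lemma block_escape:
  assumes st: "0 \<le> s" "s \<le> t" and r: "r > 0"
    and \<kappa>: "250000 \<le> (h t r - h s r) + \<bar>drift t r - drift s r\<bar> / r"
  shows "prob {\<omega> \<in> space P. \<bar>X t \<omega> - X s \<omega>\<bar> \<le> 2 * r} \<le> 7 / 8"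
proof (rule ccontr)
  assume "\<not> ?thesis"
  then have likely: "prob {\<omega> \<in> space P. \<bar>X t \<omega> - X s \<omega>\<bar> \<le> 2 * r} > 7 / 8" by simp
  define Z where "Z \<omega> = X t \<omega> - X s \<omega>" for \<omega>
  have [measurable]: "X t \<in> borel_measurable P" "X s \<in> borel_measurable P" using st by auto
  have Zm [measurable]: "Z \<in> borel_measurable P" unfolding Z_def by measurable
  have unlikely: "prob {\<omega> \<in> space P. \<bar>Z \<omega>\<bar> > 2 * r} < 1 / 8"
  proof -
    have "{\<omega> \<in> space P. \<bar>Z \<omega>\<bar> > 2 * r} = space P - {\<omega> \<in> space P. \<bar>Z \<omega>\<bar> \<le> 2 * r}" by auto
    then show ?thesis using likely prob_compl[of "{\<omega> \<in> space P. \<bar>Z \<omega>\<bar> \<le> 2 * r}"] by (simp add: Z_def)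
  qed
  define q where "q u = re_exponent t u - re_exponent s u" for u
  define p where "p u = im_exponent t u - im_exponent s u" for u
  \<comment> \<open>Where \<open>\<bar>Z\<bar> \<le> 2 * r\<close> the phase is at most 1/4 and 1 -
    cos is below 1/4; the remaining event has probability below 1/8 and contributes at most 2 / 8.
    Together this leaves a mean cosine of at least 1/2.\<close>
  have half: "1 / 2 \<le> exp (- q u) * cos (p u)" if u: "0 \<le> u" "u \<le> 1 / (8 * r)" for u
  proof -
    have "expectation (\<lambda>\<omega>. 1 - cos (u * Z \<omega>)) \<le> expectation (\<lambda>\<omega>. 1 / 4 + 2 * indicator {\<omega> \<in> space P. \<bar>Z \<omega>\<bar> > 2 * r} \<omega>)"
    proof (rule integral_mono)
      fix \<omega> assume w: "\<omega> \<in> space P"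
      show "1 - cos (u * Z \<omega>) \<le> 1 / 4 + 2 * indicator {\<omega> \<in> space P. \<bar>Z \<omega>\<bar> > 2 * r} \<omega>"
      proof (cases "\<bar>Z \<omega>\<bar> > 2 * r")
        case False
        have "\<bar>u * Z \<omega>\<bar> \<le> 1 / (8 * r) * (2 * r)" unfolding abs_mult using u False r by (intro mult_mono) auto
        then have "\<bar>u * Z \<omega>\<bar> \<le> 1 / 4" using r by simp
        then have "(u * Z \<omega>)\<^sup>2 \<le> (1 / 4)\<^sup>2" using power_mono[of "\<bar>u * Z \<omega>\<bar>" "1/4" 2] by simp
        then show ?thesis using one_minus_cos_le[of "u * Z \<omega>"] False by (simp add: power2_eq_square)
      next
        case True
        then have "indicator {\<omega> \<in> space P. \<bar>Z \<omega>\<bar> > 2 * r} \<omega> = (1 :: real)" using w by simp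
        then show ?thesis using cos_ge_minus_one[of "u * Z \<omega>"] by linarith
      qed
    qed auto
    also have "\<dots> = 1 / 4 + 2 * prob {\<omega> \<in> space P. \<bar>Z \<omega>\<bar> > 2 * r}"
      by (subst Bochner_Integration.integral_add) (auto simp: prob_space)
    also have "\<dots> \<le> 1 / 2" using unlikely by simp
    finally have "1 / 2 \<le> expectation (\<lambda>\<omega>. cos (u * Z \<omega>))"
      by (simp add: Bochner_Integration.integral_diff prob_space)
    then show ?thesis unfolding Z_def expectation_cos_increment[OF st] q_def p_def .
  qed
  have q_le: "q u \<le> 1" if u: "0 \<le> u" "u \<le> 1 / (8 * r)" for u
  proof -
    have "exp (- q u) * cos (p u) \<le> exp (- q u) * 1" by (intro mult_left_mono) auto
    then have "1 / 2 \<le> exp (- q u)" using half[OF u] by linarith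
    then have "exp (q u) \<le> 2" by (simp add: exp_minus field_simps)
    then show ?thesis using exp_ge_add_one_self[of "q u"] by linarith
  qed
  \<comment> \<open>Six doublings lead from 1 / (8 r) to 8 / r, at the price
    \<open>4 ^ 6 = 4096\<close>.\<close>
  have q_le2: "q u \<le> 4096" if u: "0 \<le> u" "u \<le> 8 / r" for u
  proof -
    have "q (2 ^ 6 * (u / 64)) \<le> 4 ^ 6 * q (u / 64)"
      unfolding q_def by (rule re_exponent_double_power[OF st])
    also have "\<dots> \<le> 4 ^ 6 * 1" using u r by (intro mult_left_mono q_le) (auto simp: field_simps)
    finally show ?thesis by simp
  qed
  have h: "h t r - h s r \<le> 24576"
    using h_increment_le[OF st r, of 4096] q_le2 unfolding q_def by simp
  \<comment> \<open>The argument starts at 0 and is continuous in the frequency. If it reached \<pi>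
    / 2, which is below 2, the cosine would vanish there, against \<open>half\<close>.\<close>
  have p_lt: "\<bar>p (1 / (8 * r))\<bar> < 2"
  proof (rule ccontr)
    assume "\<not> ?thesis"
    then have big: "pi / 2 \<le> \<bar>p (1 / (8 * r))\<bar>" using pi_less_4 by simp
    have pc: "continuous_on UNIV p"
      unfolding p_def using st by (intro continuous_intros im_exponent_continuous) auto
    have "\<exists>u\<ge>0. u \<le> 1 / (8 * r) \<and> \<bar>p u\<bar> = pi / 2"
    proof (rule IVT')
      show "\<bar>p 0\<bar> \<le> pi / 2" by (simp add: p_def im_exponent_def)
    qed (use big r in \<open>auto intro!: continuous_intros continuous_on_subset[OF pc]\<close>)
    then obtain u where u: "0 \<le> u" "u \<le> 1 / (8 * r)" "\<bar>p u\<bar> = pi / 2" by blast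
    then have "cos (p u) = 0" by (metis cos_abs_real cos_pi_half)
    then show False using half[OF u(1,2)] by simp
  qed
  have "\<bar>p (1 / (8 * r)) - 1 / (8 * r) * (drift t r - drift s r)\<bar> \<le> h t r - h s r"
    unfolding p_def by (rule im_remainder_increment[OF st r]) (use r in \<open>auto simp: field_simps\<close>)
  \<comment> \<open>Here 24578 is 24576 + 2. The displacement of the drift over r is therefore at
    most 8 * 24578 = 196624, and adding 24576 for \<open>h\<close> stays below the assumed
    250000.\<close>
  then have "\<bar>1 / (8 * r) * (drift t r - drift s r)\<bar> \<le> 24578" using p_lt h by linarith
  then have "\<bar>drift t r - drift s r\<bar> / r \<le> 8 * 24578" using r by (simp add: abs_mult field_simps)
  then show False using \<kappa> h by linarith
qed

text \<open>A path confined to [-r, r] has all its block increments in [-2r, 2r], and these events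
  are independent with probability at most 7/8 each. The threshold 500000 is twice the block size.
  The event \<open>A\<close> is left general so that it can be a small ball of the whole
  vector.\<close>

lemma small_ball_upper:
  assumes t: "0 \<le> t" and r: "r > 0" and y: "y1 B C \<nu> t r > 500000 * real J"
    and A: "A \<in> events" "\<And>\<omega> s. \<omega> \<in> A \<Longrightarrow> 0 \<le> s \<Longrightarrow> s \<le> t \<Longrightarrow> \<bar>X s \<omega>\<bar> \<le> r"
  shows "prob A \<le> (7 / 8) ^ J"
proof (cases "J = 0")
  case False
  obtain u where u: "u 0 = 0" "\<And>j. j < J \<Longrightarrow> u j < u (Suc j)"
     "\<And>j. j < J \<Longrightarrow> 250000 \<le> (h (u (Suc j)) r - h (u j) r) + \<bar>drift (u (Suc j)) r - drift (u j) r\<bar> / r"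
     "u J \<le> t"
    using block_chain[OF t r, of 250000 J] y by auto
  have u_mono: "j \<le> J \<Longrightarrow> i \<le> j \<Longrightarrow> u i \<le> u j" for i j
  proof (induction j)
    case (Suc j)
    then show ?case using u(2)[of j] by (cases "i = Suc j") auto
  qed simp
  have u_range: "0 \<le> u j" "u j \<le> t" if "j \<le> J" for j
    using u_mono[of j 0] u_mono[of J j] that u(1,4) by auto
  let ?V = "\<lambda>k \<omega>. X (u (Suc k)) \<omega> - X (u k) \<omega>"
  have iv: "indep_vars (\<lambda>_. borel) ?V {..<J}"
    by (rule indep_increments_Suc) (use u in auto)
  have "prob A \<le> prob (\<Inter>j\<in>{..<J}. ?V j -` {-(2 * r)..2 * r} \<inter> space P)"
  proof (rule finite_measure_mono)
    show "A \<subseteq> (\<Inter>j\<in>{..<J}. ?V j -` {-(2 * r)..2 * r} \<inter> space P)"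
    proof (intro subsetI INT_I IntI)
      fix \<omega> j assume w: "\<omega> \<in> A" and j: "j \<in> {..<J}"
      show "\<omega> \<in> space P" using w A(1) sets.sets_into_space by blast
      have "\<bar>X (u j) \<omega>\<bar> \<le> r" "\<bar>X (u (Suc j)) \<omega>\<bar> \<le> r"
        using A(2)[OF w, of "u j"] A(2)[OF w, of "u (Suc j)"] u_range[of j] u_range[of "Suc j"] j by auto
      then show "\<omega> \<in> ?V j -` {-(2 * r)..2 * r}" by auto
    qed
    show "(\<Inter>j\<in>{..<J}. ?V j -` {-(2 * r)..2 * r} \<inter> space P) \<in> events"
    proof (rule sets.finite_INT)
      fix j assume "j \<in> {..<J}"
      then have "?V j \<in> borel_measurable P" using iv by (auto simp: indep_vars_def)
      then show "?V j -` {-(2 * r)..2 * r} \<inter> space P \<in> events" by (rule measurable_sets) simp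
    qed (use False in auto)
  qed
  also have "\<dots> = (\<Prod>j\<in>{..<J}. prob (?V j -` {-(2 * r)..2 * r} \<inter> space P))"
    by (rule indep_varsD[OF iv]) (use False in auto)
  also have "\<dots> \<le> (\<Prod>j\<in>{..<J}. 7 / 8)"
  proof (rule prod_mono)
    fix j assume j: "j \<in> {..<J}"
    have "?V j -` {-(2 * r)..2 * r} \<inter> space P = {\<omega> \<in> space P. \<bar>?V j \<omega>\<bar> \<le> 2 * r}" by auto
    moreover have "prob {\<omega> \<in> space P. \<bar>?V j \<omega>\<bar> \<le> 2 * r} \<le> 7 / 8"
      by (rule block_escape) (use u_range[of j] u(2)[of j] u(3)[of j] j r in auto)
    ultimately show "0 \<le> prob (?V j -` {-(2 * r)..2 * r} \<inter> space P) \<and> prob (?V j -` {-(2 * r)..2 * r} \<inter> space P) \<le> 7 / 8"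
      by simp
  qed
  finally show ?thesis by simp
qed simp

text \<open>The averaging argument again, now under the probability measure. The exponents at times
  s and t are bounded separately, since \<open>M1_star\<close> controls the drift at each time; this
  gives 1 - E cos at most 96 \<open>h\<close> + 16 \<open>M1_star\<close>, hence at most 112
  \<open>y1\<close>, and averaging doubles it.\<close>

lemma increment_tail:
  assumes st: "0 \<le> s" "s \<le> t" and r: "r > 0"
  shows "prob {\<omega> \<in> space P. \<bar>X t \<omega> - X s \<omega>\<bar> > r} \<le> 224 * y1 B C \<nu> t r"
proof -
  define Z where "Z \<omega> = X t \<omega> - X s \<omega>" for \<omega>
  define c where "c = 112 * y1 B C \<nu> t r"
  have [measurable]: "X t \<in> borel_measurable P" "X s \<in> borel_measurable P" using st by auto
  have Zm [measurable]: "Z \<in> borel_measurable P" unfolding Z_def by measurable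
  have c: "expectation (\<lambda>\<omega>. 1 - cos (u * Z \<omega>)) \<le> c" if u: "0 \<le> u" "u \<le> 8 / r" for u
  proof -
    define q where "q = re_exponent t u - re_exponent s u"
    define p where "p = im_exponent t u - im_exponent s u"
    have t0: "0 \<le> t" using st by simp
    have "0 \<le> re_exponent s u" using re_exponent_mono[of 0 s u] st re_exponent_0 by simp
    then have q: "0 \<le> q" "q \<le> 32 * h t r"
      using re_exponent_mono[OF st, of u] re_exponent_le[OF t0 r u] unfolding q_def by auto
    have hs: "h s r \<le> h t r" using h_le[OF st r] .
    have "\<bar>p\<bar> \<le> (32 * h t r + 8 * M1 B \<nu> t r) + (32 * h s r + 8 * M1 B \<nu> s r)"
      using im_exponent_le[OF t0 r u] im_exponent_le[OF st(1) r u] unfolding p_def by linarith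
    also have "\<dots> \<le> 64 * h t r + 16 * M1_star B \<nu> t r"
      using hs M1_le_star[OF r st] M1_le_star[OF r t0, of t] by linarith
    finally have p: "\<bar>p\<bar> \<le> 64 * h t r + 16 * M1_star B \<nu> t r" .
    have "1 - cos p \<le> \<bar>p\<bar>"
    proof (cases "\<bar>p\<bar> \<le> 2")
      case True
      then have "p\<^sup>2 / 2 \<le> \<bar>p\<bar>" using mult_left_mono[of "\<bar>p\<bar>" 2 "\<bar>p\<bar>"] by (simp add: power2_eq_square flip: abs_mult)
      then show ?thesis using one_minus_cos_le[of p] by linarith
    qed (use cos_ge_minus_one[of p] in linarith)
    moreover have "1 - exp (- q) \<le> q" using exp_ge_add_one_self[of "- q"] by simp
    moreover have "exp (- q) * (1 - cos p) \<le> 1 * (1 - cos p)" using q by (intro mult_right_mono) auto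
    ultimately have "1 - exp (- q) * cos p \<le> q + \<bar>p\<bar>" unfolding right_diff_distrib by linarith
    also have "\<dots> \<le> c"
      using p q M1_star_nonneg[OF r t0] h_nonneg[OF t0, of r] unfolding c_def y1_eq by (simp add: algebra_simps)
    finally have "1 - exp (- q) * cos p \<le> c" .
    moreover have "expectation (\<lambda>\<omega>. cos (u * Z \<omega>)) = exp (- q) * cos p"
      unfolding Z_def q_def p_def by (rule expectation_cos_increment[OF st])
    ultimately show ?thesis by (simp add: Bochner_Integration.integral_diff prob_space)
  qed
  define E where "E N = {\<omega> \<in> space P. r < \<bar>Z \<omega>\<bar> \<and> \<bar>Z \<omega>\<bar> \<le> r * real N / 4}" for N
  have Em: "E N \<in> events" for N unfolding E_def by measurable
  have bound: "prob (E N) \<le> 2 * c" if N: "N \<ge> 1" for N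
  proof -
    define u where "u k = 8 * real k / (r * real N)" for k
    have u: "0 \<le> u k" "u k \<le> 8 / r" if "k \<in> {1..N}" for k using that r N by (auto simp: u_def field_simps)
    have "prob (E N) = expectation (indicator (E N))" using Em by simp
    also have "\<dots> \<le> expectation (\<lambda>\<omega>. (2 / real N) * (\<Sum>k=1..N. 1 - cos (u k * Z \<omega>)))"
    proof (rule integral_mono)
      fix \<omega> assume "\<omega> \<in> space P"
      then show "indicator (E N) \<omega> \<le> (2 / real N) * (\<Sum>k=1..N. 1 - cos (u k * Z \<omega>))"
        using ring_le_average[OF r, of N "Z \<omega>"] by (simp add: E_def u_def indicator_def)
    qed (use Em in auto)
    also have "\<dots> = (2 / real N) * (\<Sum>k=1..N. expectation (\<lambda>\<omega>. 1 - cos (u k * Z \<omega>)))"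
      by (subst integral_mult_right_zero, subst Bochner_Integration.integral_sum) auto
    also have "\<dots> \<le> (2 / real N) * (\<Sum>k=1..N. c)"
      by (intro mult_left_mono sum_mono c u) auto
    finally show ?thesis using N by simp
  qed
  have "(\<lambda>N. prob (E N)) \<longlonglongrightarrow> prob (\<Union>N. E N)"
  proof (rule finite_Lim_measure_incseq)
    show "incseq E" unfolding incseq_def E_def
    proof safe
      fix m n \<omega> assume "m \<le> n" "\<bar>Z \<omega>\<bar> \<le> r * real m / 4"
      moreover have "r * real m / 4 \<le> r * real n / 4" using \<open>m \<le> n\<close> r by auto
      ultimately show "\<bar>Z \<omega>\<bar> \<le> r * real n / 4" by linarith
    qed
  qed (use Em in auto)
  also have "(\<Union>N. E N) = {\<omega> \<in> space P. \<bar>Z \<omega>\<bar> > r}"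
  proof safe
    fix \<omega> assume w: "\<omega> \<in> space P" "\<bar>Z \<omega>\<bar> > r"
    obtain N :: nat where "4 * \<bar>Z \<omega>\<bar> / r \<le> real N" using real_arch_simple by blast
    then have "\<omega> \<in> E N" using w r by (auto simp: E_def field_simps)
    then show "\<omega> \<in> (\<Union>N. E N)" by blast
  qed (auto simp: E_def)
  finally have "prob {\<omega> \<in> space P. \<bar>Z \<omega>\<bar> > r} \<le> 2 * c"
    by (rule LIMSEQ_le_const2) (use bound in blast)
  then show ?thesis by (simp add: Z_def c_def)
qed

text \<open>Ottaviani's inequality asks that remaining increments exceed r with probability at most
  1/2. When \<open>increment_tail\<close> does not guarantee this, the asserted bound is larger than
  1.\<close>

lemma grid_tail:
  assumes t: "0 < t" and r: "r > 0" and n: "n \<ge> 1"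
  shows "prob {\<omega> \<in> space P. \<exists>k\<le>n. \<bar>X (real k * t / real n) \<omega>\<bar> > 2 * r} \<le> 448 * y1 B C \<nu> t r"
proof (cases "224 * y1 B C \<nu> t r \<le> 1 / 2")
  case False
  then show ?thesis using prob_le_1[of "{\<omega> \<in> space P. \<exists>k\<le>n. \<bar>X (real k * t / real n) \<omega>\<bar> > 2 * r}"] by linarith
next
  case True
  define u where "u k = real k * t / real n" for k
  define V where "V k \<omega> = X (u (Suc k)) \<omega> - X (u k) \<omega>" for k \<omega>
  have u: "0 \<le> u k" "k \<le> n \<Longrightarrow> u k \<le> t" for k using t n by (auto simp: u_def field_simps)
  have un: "u n = t" using n by (simp add: u_def)
  have iv: "indep_vars (\<lambda>_. borel) V {..<n}"
    unfolding V_def by (rule indep_increments_Suc) (use t n in \<open>auto simp: u_def field_simps\<close>)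
  have S: "(\<Sum>i<k. V i \<omega>) = X (u k) \<omega>" if "\<omega> \<in> space P" for k \<omega>
    unfolding V_def by (subst sum_lessThan_telescope) (simp add: u_def X_0[OF that])
  have tail: "prob {\<omega> \<in> space P. \<bar>(\<Sum>i<n. V i \<omega>) - (\<Sum>i<k. V i \<omega>)\<bar> > r} \<le> 224 * y1 B C \<nu> t r" if "k \<le> n" for k
  proof -
    have "{\<omega> \<in> space P. \<bar>(\<Sum>i<n. V i \<omega>) - (\<Sum>i<k. V i \<omega>)\<bar> > r} = {\<omega> \<in> space P. \<bar>X t \<omega> - X (u k) \<omega>\<bar> > r}"
      by (auto simp: S un)
    then show ?thesis using increment_tail[of "u k" t r] u that r by simp
  qed
  have "prob {\<omega> \<in> space P. \<exists>k\<le>n. \<bar>\<Sum>i<k. V i \<omega>\<bar> > 2 * r} \<le> 2 * prob {\<omega> \<in> space P. \<bar>\<Sum>i<n. V i \<omega>\<bar> > r}"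
    by (rule ottaviani[OF iv]) (use tail True in \<open>force intro: order_trans\<close>)
  also have "\<dots> \<le> 2 * (224 * y1 B C \<nu> t r)" using tail[of 0] by simp
  also have "{\<omega> \<in> space P. \<exists>k\<le>n. \<bar>\<Sum>i<k. V i \<omega>\<bar> > 2 * r} = {\<omega> \<in> space P. \<exists>k\<le>n. \<bar>X (real k * t / real n) \<omega>\<bar> > 2 * r}"
    by (auto simp: S u_def)
  finally show ?thesis by simp
qed

lemma right_continuous_abs: "\<omega> \<in> space P \<Longrightarrow> 0 \<le> s \<Longrightarrow> continuous (at_right s) (\<lambda>s. \<bar>X s \<omega>\<bar>)"
proof -
  assume "\<omega> \<in> space P" "0 \<le> s"
  then have "continuous (at_right s) (\<lambda>s. X s \<omega>)" using paths unfolding cadlag_def by simp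
  then show ?thesis by (rule continuous_rabs)
qed

lemma exceed_event:
  assumes "0 \<le> t"
  shows "{\<omega> \<in> space P. \<exists>s\<in>{0..t}. \<bar>X s \<omega>\<bar> > a}
     = (\<Union>m. {\<omega> \<in> space P. \<exists>k\<le>2^m. \<bar>X (real k * t / 2 ^ m) \<omega>\<bar> > a})"
proof -
  have "(\<exists>s\<in>{0..t}. \<bar>X s \<omega>\<bar> > a) \<longleftrightarrow> (\<exists>m. \<exists>k\<le>2^m. \<bar>X (real k * t / 2 ^ m) \<omega>\<bar> > a)"
    if "\<omega> \<in> space P" for \<omega>
    by (rule right_continuous_exceeds_iff[of t "\<lambda>s. \<bar>X s \<omega>\<bar>" a, OF assms right_continuous_abs[OF that]])
  then have "{\<omega> \<in> space P. \<exists>s\<in>{0..t}. \<bar>X s \<omega>\<bar> > a}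
     = {\<omega> \<in> space P. \<exists>m. \<exists>k\<le>2^m. \<bar>X (real k * t / 2 ^ m) \<omega>\<bar> > a}"
    by (intro Collect_cong conj_cong refl)
  also have "\<dots> = (\<Union>m. {\<omega> \<in> space P. \<exists>k\<le>2^m. \<bar>X (real k * t / 2 ^ m) \<omega>\<bar> > a})"
    by (simp only: Collect_conj_eq UN_extend_simps Collect_ex_eq simp_thms)
  finally show ?thesis .
qed

lemma grid_event:
  assumes "0 \<le> t"
  shows "{\<omega> \<in> space P. \<exists>k\<le>2^m. \<bar>X (real k * t / 2 ^ m) \<omega>\<bar> > a} \<in> events"
proof -
  have "{\<omega> \<in> space P. \<bar>X (real k * t / 2 ^ m) \<omega>\<bar> > a} \<in> events" for k
  proof -
    have [measurable]: "X (real k * t / 2 ^ m) \<in> borel_measurable P" using assms by (intro rv) auto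
    show ?thesis by measurable
  qed
  then have "{\<omega> \<in> space P. \<exists>k\<in>{..2^m}. \<bar>X (real k * t / 2 ^ m) \<omega>\<bar> > a} \<in> events"
    by (intro sets.sets_Collect_finite_Ex) auto
  also have "{\<omega> \<in> space P. \<exists>k\<in>{..2^m}. \<bar>X (real k * t / 2 ^ m) \<omega>\<bar> > a}
     = {\<omega> \<in> space P. \<exists>k\<le>2^m. \<bar>X (real k * t / 2 ^ m) \<omega>\<bar> > a}" by blast
  finally show ?thesis .
qed

text \<open>Dyadic grids are nested, so the event is an increasing union of grid events whose
  probabilities share the bound of \<open>grid_tail\<close>.\<close>

lemma maximal_tail:
  assumes t: "0 < t" and r: "r > 0"
  shows "{\<omega> \<in> space P. \<exists>s\<in>{0..t}. \<bar>X s \<omega>\<bar> > 2 * r} \<in> events"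
    and "prob {\<omega> \<in> space P. \<exists>s\<in>{0..t}. \<bar>X s \<omega>\<bar> > 2 * r} \<le> 448 * y1 B C \<nu> t r"
proof -
  define E where "E m = {\<omega> \<in> space P. \<exists>k\<le>2^m. \<bar>X (real k * t / 2 ^ m) \<omega>\<bar> > 2 * r}" for m :: nat
  have Em: "E m \<in> events" for m unfolding E_def using t by (intro grid_event) auto
  have eq: "{\<omega> \<in> space P. \<exists>s\<in>{0..t}. \<bar>X s \<omega>\<bar> > 2 * r} = (\<Union>m. E m)"
    unfolding E_def by (rule exceed_event) (use t in simp)
  show "{\<omega> \<in> space P. \<exists>s\<in>{0..t}. \<bar>X s \<omega>\<bar> > 2 * r} \<in> events" unfolding eq using Em by auto
  have "(\<lambda>m. prob (E m)) \<longlonglongrightarrow> prob (\<Union>m. E m)"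
  proof (rule finite_Lim_measure_incseq)
    show "incseq E"
    proof (rule incseq_SucI)
      fix m show "E m \<subseteq> E (Suc m)"
      proof
        fix \<omega> assume "\<omega> \<in> E m"
        then obtain k where k: "k \<le> 2 ^ m" "\<bar>X (real k * t / 2 ^ m) \<omega>\<bar> > 2 * r" "\<omega> \<in> space P" by (auto simp: E_def)
        moreover have "real (2 * k) * t / 2 ^ Suc m = real k * t / 2 ^ m" by simp
        ultimately show "\<omega> \<in> E (Suc m)" unfolding E_def by (auto intro!: exI[of _ "2 * k"])
      qed
    qed
  qed (use Em in auto)
  moreover have "prob (E m) \<le> 448 * y1 B C \<nu> t r" for m
    using grid_tail[OF t r, of "2 ^ m"] by (simp add: E_def)
  ultimately have "prob (\<Union>m. E m) \<le> 448 * y1 B C \<nu> t r"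
    by (intro LIMSEQ_le_const2[of "\<lambda>m. prob (E m)"]) auto
  then show "prob {\<omega> \<in> space P. \<exists>s\<in>{0..t}. \<bar>X s \<omega>\<bar> > 2 * r} \<le> 448 * y1 B C \<nu> t r" unfolding eq .
qed

end

section \<open>Power indices\<close>

lemma Liminf_eq_0_iff:
  fixes f :: "'a \<Rightarrow> ennreal"
  shows "Liminf F f = 0 \<longleftrightarrow> (\<forall>e>0. \<exists>\<^sub>F x in F. f x < ennreal e)"
proof safe
  fix e :: real assume L: "Liminf F f = 0" and e: "e > 0"
  show "\<exists>\<^sub>F x in F. f x < ennreal e"
  proof (rule ccontr)
    assume "\<not> ?thesis"
    then have "eventually (\<lambda>x. ennreal e \<le> f x) F" by (simp add: not_frequently not_less)
    then have "ennreal e \<le> Liminf F f" by (rule Liminf_bounded)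
    then show False using L e by simp
  qed
next
  assume *: "\<forall>e>0. \<exists>\<^sub>F x in F. f x < ennreal e"
  show "Liminf F f = 0"
  proof (rule ccontr)
    assume "Liminf F f \<noteq> 0"
    then have "0 < Liminf F f" by (simp add: zero_less_iff_neq_zero)
    then obtain y where y: "0 < y" "y < Liminf F f" using dense by blast
    then have "y < top" using less_top_ennreal order_less_le_trans top_greatest by (metis)
    then obtain e where e: "y = ennreal e" "e > 0" using y by (cases y) auto
    have "eventually (\<lambda>x. y < f x) F" using y by (intro less_LiminfD)
    then have "\<not> (\<exists>\<^sub>F x in F. f x < ennreal e)" unfolding not_frequently e(1) by (rule eventually_mono) auto
    then show False using * e by blast
  qed
qed

lemma tendsto_ennreal_0_iff:
  fixes f :: "'a \<Rightarrow> ennreal"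
  shows "(f \<longlongrightarrow> 0) F \<longleftrightarrow> (\<forall>e>0. eventually (\<lambda>x. f x < ennreal e) F)"
proof safe
  fix e :: real assume "(f \<longlongrightarrow> 0) F" "e > 0"
  then show "eventually (\<lambda>x. f x < ennreal e) F" by (intro order_tendstoD) auto
next
  assume *: "\<forall>e>0. eventually (\<lambda>x. f x < ennreal e) F"
  show "(f \<longlongrightarrow> 0) F"
  proof (rule order_tendstoI)
    fix a :: ennreal assume "0 < a"
    then obtain y where y: "0 < y" "y < a" using dense by blast
    then have "y < top" using order_less_le_trans top_greatest by metis
    then obtain e where e: "y = ennreal e" "e > 0" using y by (cases y) auto
    have "eventually (\<lambda>x. f x < ennreal e) F" using * e by blast
    then show "eventually (\<lambda>x. f x < a) F" by eventually_elim (use e y in \<open>auto intro: less_trans\<close>)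
  qed simp
qed

lemma Limsup_less_top_iff:
  fixes f :: "'a \<Rightarrow> ennreal"
  shows "Limsup F f < \<infinity> \<longleftrightarrow> (\<exists>M\<ge>0. eventually (\<lambda>x. f x \<le> ennreal M) F)"
proof safe
  assume "Limsup F f < \<infinity>"
  then obtain y where y: "Limsup F f < y" "y < \<infinity>" using dense by blast
  then obtain M where "y = ennreal M" "M \<ge> 0" by (cases y) auto
  moreover have "eventually (\<lambda>x. f x < y) F" using y by (intro Limsup_lessD)
  ultimately show "\<exists>M\<ge>0. eventually (\<lambda>x. f x \<le> ennreal M) F" by (auto elim!: eventually_mono intro!: exI[of _ M])
next
  fix M assume "eventually (\<lambda>x. f x \<le> ennreal M) F"
  then have "Limsup F f \<le> ennreal M" by (rule Limsup_bounded)
  then show "Limsup F f < \<infinity>" using order_le_less_trans by fastforce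
qed

lemma Liminf_less_top_iff:
  fixes f :: "'a \<Rightarrow> ennreal"
  shows "Liminf F f < \<infinity> \<longleftrightarrow> (\<exists>M\<ge>0. \<exists>\<^sub>F x in F. f x \<le> ennreal M)"
proof safe
  assume L: "Liminf F f < \<infinity>"
  show "\<exists>M\<ge>0. \<exists>\<^sub>F x in F. f x \<le> ennreal M"
  proof (rule ccontr)
    assume *: "\<not> ?thesis"
    obtain y where y: "Liminf F f < y" "y < \<infinity>" using L dense by blast
    then obtain M where M: "y = ennreal M" "M \<ge> 0" by (cases y) auto
    have "eventually (\<lambda>x. \<not> f x \<le> ennreal M) F" using * M by (simp add: not_frequently)
    then have "eventually (\<lambda>x. y \<le> f x) F" by eventually_elim (use M in auto)
    then have "y \<le> Liminf F f" by (rule Liminf_bounded)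
    then show False using y by simp
  qed
next
  fix M :: real assume M: "\<exists>\<^sub>F x in F. f x \<le> ennreal M"
  show "Liminf F f < \<infinity>"
  proof (rule ccontr)
    assume "\<not> ?thesis"
    then have "ennreal M < Liminf F f" by (simp add: not_less top_unique)
    then have "eventually (\<lambda>x. ennreal M < f x) F" by (rule less_LiminfD)
    then have "\<not> (\<exists>\<^sub>F x in F. f x \<le> ennreal M)" unfolding not_frequently by (rule eventually_mono) auto
    then show False using M by blast
  qed
qed

lemma ennreal_real_between:
  assumes "x < (y :: ennreal)"
  obtains z where "z > 0" "x < ennreal z" "ennreal z < y"
proof -
  obtain w where w: "x < w" "w < y" using assms dense by blast
  then have "w < top" using order_less_le_trans top_greatest by metis
  then obtain z where "w = ennreal z" "z \<ge> 0" by (cases w) auto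
  moreover have "w > 0" using w(1) by (metis not_gr_zero not_less_zero)
  ultimately show ?thesis using w that[of z] by auto
qed

text \<open>Only exponents strictly below \<open>L\<close> have to be exhibited. This covers
  \<open>L = 0\<close> and \<open>L = \<infinity>\<close> and leaves the borderline exponent
  undecided.\<close>

lemma Sup_ennreal_eqI:
  assumes "\<And>\<eta>. 0 < \<eta> \<Longrightarrow> ennreal \<eta> < L \<Longrightarrow> \<eta> \<in> S" "\<And>\<eta>. \<eta> \<in> S \<Longrightarrow> ennreal \<eta> \<le> L"
  shows "Sup (ennreal ` S) = L"
proof (rule antisym)
  show "Sup (ennreal ` S) \<le> L" using assms(2) by (auto intro!: Sup_least)
  show "L \<le> Sup (ennreal ` S)"
  proof (rule ccontr)
    assume "\<not> ?thesis"
    then obtain z where z: "z > 0" "Sup (ennreal ` S) < ennreal z" "ennreal z < L"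
      using ennreal_real_between by (metis not_le)
    then have "ennreal z \<le> Sup (ennreal ` S)" using assms(1) by (intro Sup_upper) auto
    then show False using z by simp
  qed
qed

lemma Inf_ennreal_eqI:
  assumes "\<And>\<eta>. 0 < \<eta> \<Longrightarrow> L < ennreal \<eta> \<Longrightarrow> \<eta> \<in> S" "\<And>\<eta>. \<eta> \<in> S \<Longrightarrow> L \<le> ennreal \<eta>"
  shows "Inf (ennreal ` S) = L"
proof (rule antisym)
  show "L \<le> Inf (ennreal ` S)" using assms(2) by (auto intro!: Inf_greatest)
  show "Inf (ennreal ` S) \<le> L"
  proof (rule ccontr)
    assume "\<not> ?thesis"
    then obtain z where z: "z > 0" "L < ennreal z" "ennreal z < Inf (ennreal ` S)"
      using ennreal_real_between by (metis not_le)
    then have "Inf (ennreal ` S) \<le> ennreal z" using assms(1) by (intro Inf_lower) auto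
    then show False using z by simp
  qed
qed

text \<open>The conventions that a / 0 is infinite and a / \<infinity> is 0 make the equivalence
  uniform in \<open>x\<close>. It turns the quotients in the definitions of the indices into
  comparisons of a passage time with a power.\<close>

lemma ennreal_divide_less_iff:
  assumes "a > 0" "e > 0"
  shows "ennreal a / x < ennreal e \<longleftrightarrow> ennreal (a / e) < x"
proof (cases x)
  case (real y)
  show ?thesis
  proof (cases "y = 0")
    case False
    then have y: "y > 0" using real by simp
    then have "ennreal a / x = ennreal (a / y)" using real assms by (simp add: divide_ennreal)
    then show ?thesis using real y assms by (simp add: ennreal_less_iff field_simps)
  qed (use real assms in \<open>simp add: ennreal_zero_divide divide_ennreal_def\<close>)
qed (use assms in simp)

section \<open>Powers near 0 and reformulations of the indices\<close>

abbreviation at_0 :: "real filter" where "at_0 \<equiv> at_right 0"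

lemma eventually_pos: "eventually (\<lambda>r. 0 < r) at_0"
  by (simp add: eventually_at_right_less)

lemma eventually_unit: "eventually (\<lambda>r::real. 0 < r \<and> r < 1) at_0"
  using eventually_at_right[of 0 "1::real"] by (auto intro!: exI[of _ 1])

lemma eventually_below: "c > 0 \<Longrightarrow> eventually (\<lambda>r. r < c) at_0" for c :: real
  using eventually_at_right[of 0 c] by auto

lemma powr_tendsto_0: "a > 0 \<Longrightarrow> ((\<lambda>r. r powr a) \<longlongrightarrow> 0) at_0" for a :: real
proof (rule tendsto_zero_powrI[OF tendsto_ident_at tendsto_const])
  show "eventually (\<lambda>x::real. 0 \<le> x) at_0" using eventually_pos by eventually_elim simp
qed

lemma eventually_powr_less: "a > 0 \<Longrightarrow> c > 0 \<Longrightarrow> eventually (\<lambda>r. r powr a < c) at_0" for a c :: real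
  using order_tendstoD(2)[OF powr_tendsto_0] by blast

lemma filterlim_powr_at_0: "a > 0 \<Longrightarrow> filterlim (\<lambda>r. r powr a) at_0 at_0" for a :: real
  unfolding filterlim_at
proof (rule conjI)
  show "eventually (\<lambda>r. r powr a \<in> {0<..} \<and> r powr a \<noteq> 0) at_0" using eventually_pos by eventually_elim simp
qed (rule powr_tendsto_0)

lemma eventually_powr_at_0: "a > 0 \<Longrightarrow> eventually Q at_0 \<Longrightarrow> eventually (\<lambda>r. Q (r powr a)) at_0" for a :: real
  using filterlim_powr_at_0[of a] unfolding filterlim_iff by blast

lemma eventually_powr_iff:
  assumes "a > (0 :: real)"
  shows "eventually (\<lambda>r. Q (r powr a)) at_0 \<longleftrightarrow> eventually Q at_0"
proof
  assume "eventually (\<lambda>r. Q (r powr a)) at_0"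
  with assms have "eventually (\<lambda>r. Q ((r powr (1 / a)) powr a)) at_0"
    by (intro eventually_powr_at_0[of "1 / a" "\<lambda>r. Q (r powr a)"]) simp_all
  then show "eventually Q at_0" using eventually_pos
    by eventually_elim (use assms in \<open>simp add: powr_powr\<close>)
qed (rule eventually_powr_at_0[OF assms])

lemma frequently_powr_iff:
  assumes "a > (0 :: real)"
  shows "(\<exists>\<^sub>F r in at_0. Q (r powr a)) \<longleftrightarrow> (\<exists>\<^sub>F r in at_0. Q r)"
  unfolding frequently_def by (subst eventually_powr_iff[OF assms]) rule

lemma frequently_eventually_contradiction:
  "\<exists>\<^sub>F x in F. P x \<Longrightarrow> eventually (\<lambda>x. \<not> P x) F \<Longrightarrow> False"
  by (simp add: frequently_def)

text \<open>The strict inequality leaves room for an exponent \<open>c\<close> between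
  \<open>a\<close> and the index; failure at \<open>c\<close> gives a bound with some constant,
  which \<open>r powr (c - a)\<close> absorbs. The next three lemmas are the corresponding
  statements for the other side and for the upper index.\<close>

lemma lower_index_lt:
  assumes "0 \<le> a" "ennreal a < lower_index n"
  shows "eventually (\<lambda>r. n r \<le> ennreal (r powr a)) at_0"
proof -
  obtain c where c: "c > 0" "ennreal a < ennreal c" "ennreal c < lower_index n"
    using assms ennreal_real_between by blast
  then have ac: "a < c" using assms by (simp add: ennreal_less_iff)
  have "c \<notin> {\<eta>. \<eta> \<ge> 0 \<and> Liminf at_0 (\<lambda>r. ennreal (r powr \<eta>) / n r) = 0}"
    using c(3) Inf_lower[of "ennreal c"] unfolding lower_index_def by (metis (no_types, lifting) image_eqI not_less)
  then obtain e where e: "e > 0" "eventually (\<lambda>r. \<not> ennreal (r powr c) / n r < ennreal e) at_0"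
    using c(1) by (auto simp: Liminf_eq_0_iff not_frequently)
  note e(2)
  moreover have "eventually (\<lambda>r. r powr (c - a) < e) at_0" using ac e by (intro eventually_powr_less) auto
  ultimately show ?thesis using eventually_pos
  proof eventually_elim
    case (elim r)
    then have "n r \<le> ennreal (r powr c / e)" using e ennreal_divide_less_iff[of "r powr c" e "n r"] by (simp add: not_less)
    also have "r powr c / e \<le> r powr a"
    proof -
      have "r powr c = r powr (c - a) * r powr a" by (simp flip: powr_add)
      also have "\<dots> \<le> e * r powr a" using elim by (intro mult_right_mono) auto
      finally show ?thesis using e by (simp add: field_simps)
    qed
    finally show ?case by (simp add: ennreal_leI)
  qed
qed

lemma lower_index_gt:
  assumes "lower_index n < ennreal a"
  shows "\<exists>\<^sub>F r in at_0. n r > ennreal (r powr a)"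
proof -
  obtain c where c: "0 \<le> c" "ennreal c < ennreal a" "Liminf at_0 (\<lambda>r. ennreal (r powr c) / n r) = 0"
    using assms unfolding lower_index_def Inf_less_iff by auto
  then have ca: "c < a" by (metis ennreal_leI not_less)
  have "\<exists>\<^sub>F r in at_0. ennreal (r powr c) / n r < ennreal 1"
    using c(3) unfolding Liminf_eq_0_iff by (metis zero_less_one)
  then show ?thesis
  proof (rule frequently_rev_mp)
    show "eventually (\<lambda>r. ennreal (r powr c) / n r < ennreal 1 \<longrightarrow> ennreal (r powr a) < n r) at_0"
      using eventually_unit
    proof eventually_elim
      case (elim r)
      show ?case
      proof
        assume "ennreal (r powr c) / n r < ennreal 1"
        then have "ennreal (r powr c) < n r" using ennreal_divide_less_iff[of "r powr c" 1 "n r"] elim by simp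
        then show "ennreal (r powr a) < n r"
          using powr_less_mono'[of r c a] elim ca by (meson ennreal_leI less_imp_le order_le_less_trans)
      qed
    qed
  qed
qed

lemma upper_index_lt:
  assumes "0 \<le> a" "ennreal a < upper_index n"
  shows "\<exists>\<^sub>F r in at_0. n r \<le> ennreal (r powr a)"
proof -
  obtain c where c: "c > 0" "ennreal a < ennreal c" "ennreal c < upper_index n"
    using assms ennreal_real_between by blast
  then have ac: "a < c" using assms by (simp add: ennreal_less_iff)
  have "c \<notin> {\<eta>. \<eta> \<ge> 0 \<and> ((\<lambda>r. ennreal (r powr \<eta>) / n r) \<longlongrightarrow> 0) at_0}"
    using c(3) Inf_lower[of "ennreal c"] unfolding upper_index_def by (metis (no_types, lifting) image_eqI not_less)
  then obtain e where e: "e > 0" "\<exists>\<^sub>F r in at_0. \<not> ennreal (r powr c) / n r < ennreal e"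
    using c(1) by (auto simp: tendsto_ennreal_0_iff not_eventually)
  from e(2) show ?thesis
  proof (rule frequently_rev_mp)
    have "eventually (\<lambda>r. r powr (c - a) < e) at_0" using ac e by (intro eventually_powr_less) auto
    then show "eventually (\<lambda>r. \<not> ennreal (r powr c) / n r < ennreal e \<longrightarrow> n r \<le> ennreal (r powr a)) at_0"
      using eventually_pos
    proof eventually_elim
      case (elim r)
      show ?case
      proof
        assume "\<not> ennreal (r powr c) / n r < ennreal e"
        then have "n r \<le> ennreal (r powr c / e)" using elim e ennreal_divide_less_iff[of "r powr c" e "n r"] by (simp add: not_less)
        also have "r powr c / e \<le> r powr a"
        proof -
          have "r powr c = r powr (c - a) * r powr a" by (simp flip: powr_add)
          also have "\<dots> \<le> e * r powr a" using elim by (intro mult_right_mono) auto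
          finally show ?thesis using e by (simp add: field_simps)
        qed
        finally show "n r \<le> ennreal (r powr a)" by (simp add: ennreal_leI)
      qed
    qed
  qed
qed

lemma upper_index_gt:
  assumes "upper_index n < ennreal a"
  shows "eventually (\<lambda>r. n r > ennreal (r powr a)) at_0"
proof -
  obtain c where c: "0 \<le> c" "ennreal c < ennreal a" "((\<lambda>r. ennreal (r powr c) / n r) \<longlongrightarrow> 0) at_0"
    using assms unfolding upper_index_def Inf_less_iff by auto
  then have ca: "c < a" by (metis ennreal_leI not_less)
  have "eventually (\<lambda>r. ennreal (r powr c) / n r < ennreal 1) at_0"
    using c(3) unfolding tendsto_ennreal_0_iff by (metis zero_less_one)
  then show ?thesis using eventually_unit
  proof eventually_elim
    case (elim r)
    then have "ennreal (r powr c) < n r" using ennreal_divide_less_iff[of "r powr c" 1 "n r"] elim by simp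
    then show "ennreal (r powr a) < n r"
      using powr_less_mono'[of r c a] elim ca by (meson ennreal_leI less_imp_le order_le_less_trans)
  qed
qed

lemma upper_index_le:
  assumes "0 \<le> a" "eventually (\<lambda>r. n r \<ge> ennreal (r powr a)) at_0"
  shows "upper_index n \<le> ennreal a"
proof (rule ccontr)
  assume "\<not> ?thesis"
  then obtain c where c: "c > 0" "ennreal a < ennreal c" "ennreal c < upper_index n"
    using ennreal_real_between by (metis not_le)
  then have ac: "a < c" using assms by (simp add: ennreal_less_iff)
  have "\<exists>\<^sub>F r in at_0. n r \<le> ennreal (r powr c)" using c by (intro upper_index_lt) auto
  moreover have "eventually (\<lambda>r. \<not> n r \<le> ennreal (r powr c)) at_0"
    using assms(2) eventually_unit
  proof eventually_elim
    case (elim r)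
    then have "ennreal (r powr c) < ennreal (r powr a)" using powr_less_mono'[of r a c] ac by (simp add: ennreal_less_iff)
    then show ?case using elim by (auto simp: not_le intro: less_le_trans)
  qed
  ultimately show False by (rule frequently_eventually_contradiction)
qed

lemma passage_below: "0 < t \<Longrightarrow> ennreal t < passage F m r \<Longrightarrow> F t r \<le> m"
  unfolding passage_def by (metis (mono_tags, lifting) Inf_lower image_eqI mem_Collect_eq not_le)

lemma passage_le: "0 < t \<Longrightarrow> m < F t r \<Longrightarrow> passage F m r \<le> ennreal t"
  unfolding passage_def by (rule Inf_lower) auto

lemma passage_ge: "(\<And>t. 0 < t \<Longrightarrow> t < a \<Longrightarrow> F t r \<le> m) \<Longrightarrow> ennreal a \<le> passage F m r"
  unfolding passage_def by (rule Inf_greatest) (auto intro!: ennreal_leI; force)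

lemma exponent_between_below:
  assumes "ennreal a < L" "0 \<le> a"
  obtains c where "a < c" "ennreal c < L"
  using ennreal_real_between[OF assms(1)] assms(2) by (metis ennreal_less_iff)

lemma exponent_between_above:
  assumes "L < ennreal a"
  obtains c where "0 < c" "c < a" "L < ennreal c"
  using ennreal_real_between[OF assms(1)] by (metis ennreal_leI not_le)

lemma inverse_ennreal_less_iff: "y > 0 \<Longrightarrow> e > 0 \<Longrightarrow> inverse (ennreal y) < ennreal e \<longleftrightarrow> 1 / e < y"
  by (simp add: inverse_ennreal ennreal_less_iff field_simps)

text \<open>The witness for \<open>delta2\<close> and \<open>beta2\<close>. Its ratio is constant,
  the exponent \<eta> makes the 1/\<eta>-th power of each term a dyadic radius, and the shift
  \<open>N\<close> starts it where an eventual estimate already holds.\<close>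

lemma Sigma_sequence_geometric:
  assumes "\<eta> > 0"
  shows "Sigma_sequence (\<lambda>k. (1 / 2 ^ (k + N)) powr \<eta>)"
proof -
  let ?s = "\<lambda>k. (1 / 2 ^ (k + N) :: real) powr \<eta>"
  have lim: "(\<lambda>k. (1 / 2 ^ (k + N) :: real) powr a) \<longlonglongrightarrow> 0" if "a > 0" for a
  proof (rule tendsto_zero_powrI[OF _ tendsto_const])
    show "(\<lambda>k. 1 / 2 ^ (k + N) :: real) \<longlonglongrightarrow> 0"
      using LIMSEQ_ignore_initial_segment[OF LIMSEQ_realpow_zero[of "1/2"], of N] by (simp add: power_one_over)
  qed (use that in auto)
  have ratio: "?s k / ?s (Suc k) = 2 powr \<eta>" for k
    by (simp add: powr_divide powr_mult)
  have "(\<lambda>k. ?s k / ?s (Suc k) * ?s (Suc k) powr \<epsilon>) \<longlonglongrightarrow> 0" if "\<epsilon> > 0" for \<epsilon>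
  proof -
    have "(\<lambda>k. (1 / 2 ^ (k + N) :: real) powr (\<eta> * \<epsilon>)) \<longlonglongrightarrow> 0" using that assms by (intro lim) auto
    then have "(\<lambda>k. (1 / 2 ^ (Suc k + N) :: real) powr (\<eta> * \<epsilon>)) \<longlonglongrightarrow> 0" by (rule LIMSEQ_Suc)
    then have "(\<lambda>k. 2 powr \<eta> * (1 / 2 ^ (Suc k + N) :: real) powr (\<eta> * \<epsilon>)) \<longlonglongrightarrow> 0" by (rule tendsto_mult_right_zero)
    then show ?thesis unfolding ratio by (simp only: powr_powr)
  qed
  moreover have "decseq ?s"
    by (intro decseq_SucI powr_mono2) (use assms in \<open>auto simp: field_simps\<close>)
  ultimately show ?thesis unfolding Sigma_sequence_def using lim[OF assms] by auto
qed

text \<open>A \<open>\<Sigma>\<close>-sequence has no gaps on the power scale: every small \<open>x\<close> lies between consecutive terms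
  which agree up to an arbitrarily small power.\<close>

lemma Sigma_sequence_bracket:
  assumes s: "Sigma_sequence s" and \<epsilon>: "0 < \<epsilon>" "\<epsilon> < 1" and ev: "eventually Q sequentially"
  shows "eventually (\<lambda>x. \<exists>k. Q k \<and> Q (Suc k) \<and> s (Suc k) < x \<and> x \<le> s k \<and> s k \<le> s (Suc k) powr (1 - \<epsilon>)) at_0"
proof -
  have pos: "s k > 0" for k using s by (simp add: Sigma_sequence_def)
  have "eventually (\<lambda>k. s k / s (Suc k) * s (Suc k) powr \<epsilon> < 1) sequentially"
    using s \<epsilon> unfolding Sigma_sequence_def by (intro order_tendstoD[of _ 0]) auto
  then have "eventually (\<lambda>k. s k / s (Suc k) * s (Suc k) powr \<epsilon> < 1 \<and> Q k) sequentially"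
    using ev by eventually_elim auto
  then obtain K where K: "\<And>k. k \<ge> K \<Longrightarrow> s k / s (Suc k) * s (Suc k) powr \<epsilon> < 1 \<and> Q k"
    by (auto simp: eventually_sequentially)
  have step: "s k \<le> s (Suc k) powr (1 - \<epsilon>)" if "k \<ge> K" for k
    using K[OF that] pos[of "Suc k"] by (simp add: powr_diff field_simps)
  show ?thesis using eventually_pos eventually_below[OF pos[of K]]
  proof eventually_elim
    case (elim x)
    have "s \<longlonglongrightarrow> 0" using s by (simp add: Sigma_sequence_def)
    then have "eventually (\<lambda>k. s k < x) sequentially" using elim by (intro order_tendstoD) auto
    then obtain j where j: "s j < x" by (auto simp: eventually_sequentially)
    \<comment> \<open>The first term from \<open>K\<close> on that lies below \<open>x\<close>. As
      \<open>x\<close> is below \<open>s K\<close>, the index is positive and its predecessor closes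
      the bracket.\<close>
    define i where "i = (LEAST i. s (K + i) < x)"
    have "s (K + j) < x" using j s by (meson Sigma_sequence_def decseqD le_add2 order_le_less_trans)
    then have i: "s (K + i) < x" unfolding i_def by (rule LeastI)
    then have "i \<noteq> 0" using elim by (intro notI) auto
    then obtain i' where i': "i = Suc i'" by (cases i) auto
    have "\<not> s (K + i') < x" using not_less_Least[of i' "\<lambda>i. s (K + i) < x"] i' unfolding i_def by simp
    then show ?case using i i' K[of "K + i'"] K[of "Suc (K + i')"] step[of "K + i'"] by (intro exI[of _ "K + i'"]) auto
  qed
qed

lemma suminf_finite_tendsto_0:
  fixes f :: "nat \<Rightarrow> ennreal"
  assumes "(\<Sum>k. f k) < \<infinity>" "e > 0"
  shows "eventually (\<lambda>k. f k < ennreal e) sequentially"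
proof -
  have fin: "f k < \<infinity>" for k
    using assms(1) sum_le_suminf[of f "{k}"] by (simp add: order_le_less_trans)
  then have f: "f k = ennreal (enn2real (f k))" for k by simp
  have "(\<Sum>k. ennreal (enn2real (f k))) \<noteq> top" using assms(1) f by (simp flip: f)
  then have "summable (\<lambda>k. enn2real (f k))" by (intro summable_suminf_not_top) auto
  then have "(\<lambda>k. enn2real (f k)) \<longlonglongrightarrow> 0" by (rule summable_LIMSEQ_zero)
  then have "eventually (\<lambda>k. enn2real (f k) < e) sequentially" using assms by (intro order_tendstoD)
  then show ?thesis by eventually_elim (subst f, simp add: ennreal_less_iff assms)
qed

lemma geometric_suminf_finite:
  fixes f :: "nat \<Rightarrow> ennreal"
  assumes \<kappa>: "\<kappa> > 0" and f: "\<And>k. f k \<le> ennreal ((1 / 2 ^ (k + N)) powr \<kappa>)"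
  shows "(\<Sum>k. f k) < \<infinity>"
proof -
  have eq: "(1 / 2 ^ (k + N) :: real) powr \<kappa> = (1 / 2 powr \<kappa>) ^ N * (1 / 2 powr \<kappa>) ^ k" for k
  proof -
    have "(1 / 2 ^ (k + N) :: real) powr \<kappa> = (1 / 2 powr real (k + N)) powr \<kappa>"
      by (subst powr_realpow) simp_all
    also have "\<dots> = 1 / (2 powr \<kappa>) powr real (k + N)" by (simp add: powr_divide powr_powr mult.commute)
    also have "\<dots> = 1 / (2 powr \<kappa>) ^ (k + N)" by (subst powr_realpow) simp_all
    finally show ?thesis by (simp add: power_add power_one_over)
  qed
  have "summable (\<lambda>k. (1 / 2 powr \<kappa> :: real) ^ k)" using \<kappa> by (intro summable_geometric) (simp add: gr_one_powr)
  then have "summable (\<lambda>k. (1 / 2 ^ (k + N) :: real) powr \<kappa>)" unfolding eq by (rule summable_mult)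
  then have "(\<Sum>k. ennreal ((1 / 2 ^ (k + N)) powr \<kappa>)) \<noteq> \<infinity>" by (subst suminf_ennreal2) auto
  moreover have "(\<Sum>k. f k) \<le> (\<Sum>k. ennreal ((1 / 2 ^ (k + N)) powr \<kappa>))" by (intro suminf_le f) auto
  ultimately show ?thesis by (metis infinity_ennreal_def le_less_trans less_top)
qed

lemma eventually_at_0_geometric:
  assumes "eventually Q at_0"
  obtains N :: nat where "\<And>k. Q (1 / 2 ^ (k + N))"
proof -
  obtain d where d: "d > 0" "\<And>r. 0 < r \<Longrightarrow> r < d \<Longrightarrow> Q r"
    using assms eventually_at_right[of 0 "1::real" Q] by auto
  obtain N where N: "(1 / 2 :: real) ^ N < d" using real_arch_pow_inv[of d "1/2"] d by auto
  have "(1 / 2 ^ (k + N) :: real) < d" for k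
  proof -
    have "(1 / 2 :: real) ^ (k + N) \<le> (1 / 2) ^ N" by (intro power_decreasing) auto
    then show ?thesis using N by (simp add: power_one_over)
  qed
  then have "Q (1 / 2 ^ (k + N))" for k using d(2)[of "1 / 2 ^ (k + N)"] by simp
  then show ?thesis by (rule that)
qed

section \<open>Indices of a growth function\<close>

text \<open>The properties of the time-changed \<open>y\<close> from which the indices are computed.
  \<open>Y_growth\<close> is quasiconvexity with the slow factor weakened to an arbitrary small
  power, \<open>Y_halving\<close> is the substitute for monotonicity in the radius, and
  \<open>Y_reach\<close> makes the passage time at most \<open>t0\<close>.\<close>

locale growth_function =
  fixes Y :: "real \<Rightarrow> real \<Rightarrow> real" and b t0 \<sigma> m :: real
  assumes b_pos: "b > 0" and t0_pos: "t0 > 0" and \<sigma>_pos: "\<sigma> > 0" and m_pos: "m > 0"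
    and Y_mono: "\<And>t1 t2 r. 0 < t1 \<Longrightarrow> t1 \<le> t2 \<Longrightarrow> 0 < r \<Longrightarrow> r \<le> b \<Longrightarrow> Y t1 r \<le> Y t2 r"
    and Y_pos: "\<And>t r. 0 < t \<Longrightarrow> 0 < r \<Longrightarrow> r \<le> b \<Longrightarrow> 0 < Y t r"
    and Y_halving: "\<And>t r s. 0 < t \<Longrightarrow> 0 < s \<Longrightarrow> s \<le> r \<Longrightarrow> r \<le> b \<Longrightarrow> Y t r \<le> 2 * Y t s"
    and Y_growth: "\<And>\<epsilon>. \<epsilon> > 0 \<Longrightarrow> eventually (\<lambda>r. \<forall>t1 t2. 0 < t1 \<longrightarrow> t1 < t2 \<longrightarrow> t2 \<le> t0 \<longrightarrow>
         r powr \<epsilon> * (t2 / t1) powr \<sigma> * Y t1 r \<le> Y t2 r) at_0"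
    and Y_reach: "\<And>r. 0 < r \<Longrightarrow> r \<le> b \<Longrightarrow> m < Y t0 r"
begin

abbreviation n :: "real \<Rightarrow> ennreal" where "n \<equiv> passage Y m"

lemma eventually_le_b: "eventually (\<lambda>r. 0 < r \<and> r < 1 \<and> r \<le> b) at_0"
  using eventually_unit eventually_below[OF b_pos] by eventually_elim auto

lemma n_le: "0 < r \<Longrightarrow> r \<le> b \<Longrightarrow> n r \<le> ennreal t0"
  using passage_le[of t0 m Y r] t0_pos Y_reach by blast

lemma above:
  assumes "0 < t" "n r < ennreal t" "0 < r" "r \<le> b" shows "m < Y t r"
proof -
  obtain s where "0 < s" "m < Y s r" "ennreal s < ennreal t"
    using assms(2) unfolding passage_def Inf_less_iff by auto
  then show ?thesis using Y_mono[of s t r] assms by (simp add: ennreal_less_iff)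
qed

lemma powr_between: "0 < r \<Longrightarrow> (r powr a / r powr c) powr \<sigma> = r powr ((a - c) * \<sigma>)" for r :: real
  by (simp add: powr_diff[symmetric] powr_powr)

text \<open>At the intermediate exponent d the level m has been passed, and growth from
  \<open>r powr d\<close> to the later time \<open>r powr a\<close> multiplies by
  \<open>r powr (- (3 * \<kappa>))\<close>. One \<kappa> is lost to the slow factor and one to the
  constant m.\<close>

lemma large_value:
  assumes a: "0 < a" "a < c"
  shows "\<exists>\<kappa>>0. eventually (\<lambda>r. n r \<le> ennreal (r powr c) \<longrightarrow> r powr (- \<kappa>) \<le> Y (r powr a) r) at_0"
proof -
  define d where "d = (a + c) / 2"
  define \<kappa> where "\<kappa> = (d - a) * \<sigma> / 3"
  have d: "a < d" "d < c" using a by (auto simp: d_def)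
  have "3 * \<kappa> = (d - a) * \<sigma>" by (simp add: \<kappa>_def)
  moreover have "\<kappa> > 0" using d \<sigma>_pos by (simp add: \<kappa>_def)
  ultimately have \<kappa>: "\<kappa> > 0" "(a - d) * \<sigma> = - (3 * \<kappa>)" by (auto simp: algebra_simps)
  have "eventually (\<lambda>r. n r \<le> ennreal (r powr c) \<longrightarrow> r powr (- \<kappa>) \<le> Y (r powr a) r) at_0"
    using eventually_le_b Y_growth[OF \<kappa>(1)] eventually_powr_less[OF a(1) t0_pos] eventually_powr_less[OF \<kappa>(1) m_pos]
  proof eventually_elim
    case (elim r)
    then have r: "0 < r" "r < 1" "r \<le> b" by auto
    show ?case
    proof
      assume n: "n r \<le> ennreal (r powr c)"
      also have "\<dots> < ennreal (r powr d)" using powr_less_mono'[of r d c] r d by (simp add: ennreal_less_iff)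
      finally have m: "m < Y (r powr d) r" using r by (intro above) auto
      have "r powr d < r powr a" using powr_less_mono'[of r a d] r d by simp
      then have "r powr \<kappa> * (r powr a / r powr d) powr \<sigma> * Y (r powr d) r \<le> Y (r powr a) r"
        using elim r by auto
      also have "r powr \<kappa> * (r powr a / r powr d) powr \<sigma> = r powr (- (2 * \<kappa>))"
        unfolding powr_between[OF r(1)] \<kappa>(2) by (simp flip: powr_add)
      finally have 1: "r powr (- (2 * \<kappa>)) * Y (r powr d) r \<le> Y (r powr a) r" .
      have "r powr (- \<kappa>) = r powr (- (2 * \<kappa>)) * r powr \<kappa>" by (simp flip: powr_add)
      also have "\<dots> \<le> r powr (- (2 * \<kappa>)) * Y (r powr d) r" using elim m by (intro mult_left_mono) auto
      finally show "r powr (- \<kappa>) \<le> Y (r powr a) r" using 1 by simp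
    qed
  qed
  then show ?thesis using \<kappa> by blast
qed

text \<open>The mirror image of \<open>large_value\<close>: at the intermediate exponent d the level
  has not been passed, and growth is read backwards from \<open>r powr d\<close> to
  \<open>r powr a\<close>.\<close>

lemma small_value:
  assumes a: "0 \<le> c" "c < a"
  shows "\<exists>\<kappa>>0. eventually (\<lambda>r. ennreal (r powr c) \<le> n r \<longrightarrow> Y (r powr a) r \<le> r powr \<kappa>) at_0"
proof -
  define d where "d = (a + c) / 2"
  define \<kappa> where "\<kappa> = (a - d) * \<sigma> / 3"
  have d: "c < d" "d < a" "d > 0" using a by (auto simp: d_def)
  have "3 * \<kappa> = (a - d) * \<sigma>" by (simp add: \<kappa>_def)
  moreover have "\<kappa> > 0" using d \<sigma>_pos by (simp add: \<kappa>_def)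
  ultimately have \<kappa>: "\<kappa> > 0" "(d - a) * \<sigma> = - (3 * \<kappa>)" by (auto simp: algebra_simps)
  have "1 / m > 0" using m_pos by simp
  have "eventually (\<lambda>r. ennreal (r powr c) \<le> n r \<longrightarrow> Y (r powr a) r \<le> r powr \<kappa>) at_0"
    using eventually_le_b Y_growth[OF \<kappa>(1)] eventually_powr_less[OF d(3) t0_pos] eventually_powr_less[OF \<kappa>(1) \<open>1 / m > 0\<close>]
  proof eventually_elim
    case (elim r)
    then have r: "0 < r" "r < 1" "r \<le> b" by auto
    show ?case
    proof
      assume n: "ennreal (r powr c) \<le> n r"
      have "ennreal (r powr d) < ennreal (r powr c)" using powr_less_mono'[of r c d] r d by (simp add: ennreal_less_iff)
      also note n
      finally have m: "Y (r powr d) r \<le> m" using r by (intro passage_below) auto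
      have "r powr a < r powr d" using powr_less_mono'[of r d a] r d by simp
      then have "r powr \<kappa> * (r powr d / r powr a) powr \<sigma> * Y (r powr a) r \<le> Y (r powr d) r"
        using elim r by auto
      also have "r powr \<kappa> * (r powr d / r powr a) powr \<sigma> = r powr (- (2 * \<kappa>))"
        unfolding powr_between[OF r(1)] \<kappa>(2) by (simp flip: powr_add)
      finally have "r powr (2 * \<kappa>) * (r powr (- (2 * \<kappa>)) * Y (r powr a) r) \<le> r powr (2 * \<kappa>) * m"
        using m by (intro mult_left_mono) auto
      also have "r powr (2 * \<kappa>) * (r powr (- (2 * \<kappa>)) * Y (r powr a) r) = Y (r powr a) r"
        using r by (simp add: powr_minus)
      also have "r powr (2 * \<kappa>) * m = r powr \<kappa> * (r powr \<kappa> * m)" by (simp flip: powr_add mult.assoc)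
      also have "\<dots> \<le> r powr \<kappa> * 1" using elim m_pos by (intro mult_left_mono) (auto simp: field_simps)
      finally show "Y (r powr a) r \<le> r powr \<kappa>" by simp
    qed
  qed
  then show ?thesis using \<kappa> by blast
qed

text \<open>The substitution \<open>r = s powr \<eta>\<close> puts the power on the time instead of
  the radius, which is the form of \<open>large_value\<close> and
  \<open>small_value\<close>.\<close>

lemma liminf_Y_iff:
  assumes "\<eta> > 0"
  shows "Liminf at_0 (\<lambda>r. ennreal (Y r (r powr (1 / \<eta>)))) = 0
    \<longleftrightarrow> (\<forall>e>0. \<exists>\<^sub>F s in at_0. ennreal (Y (s powr \<eta>) s) < ennreal e)"
proof -
  have "(\<exists>\<^sub>F r in at_0. ennreal (Y r (r powr (1 / \<eta>))) < ennreal e) \<longleftrightarrow>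
        (\<exists>\<^sub>F s in at_0. ennreal (Y (s powr \<eta>) s) < ennreal e)" for e
  proof -
    have "(\<exists>\<^sub>F r in at_0. ennreal (Y r (r powr (1 / \<eta>))) < ennreal e) \<longleftrightarrow>
       (\<exists>\<^sub>F s in at_0. ennreal (Y (s powr \<eta>) ((s powr \<eta>) powr (1 / \<eta>))) < ennreal e)"
      by (rule frequently_powr_iff[OF assms, symmetric])
    also have "\<dots> \<longleftrightarrow> (\<exists>\<^sub>F s in at_0. ennreal (Y (s powr \<eta>) s) < ennreal e)"
      by (rule frequently_cong[OF eventually_pos]) (use assms in \<open>simp add: powr_powr\<close>)
    finally show ?thesis .
  qed
  then show ?thesis by (simp add: Liminf_eq_0_iff)
qed

lemma liminf_inverse_Y_iff:
  assumes "\<eta> > 0"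
  shows "Liminf at_0 (\<lambda>r. inverse (ennreal (Y r (r powr (1 / \<eta>))))) = 0
    \<longleftrightarrow> (\<forall>e>0. \<exists>\<^sub>F s in at_0. inverse (ennreal (Y (s powr \<eta>) s)) < ennreal e)"
proof -
  have "(\<exists>\<^sub>F r in at_0. inverse (ennreal (Y r (r powr (1 / \<eta>)))) < ennreal e) \<longleftrightarrow>
        (\<exists>\<^sub>F s in at_0. inverse (ennreal (Y (s powr \<eta>) s)) < ennreal e)" for e
  proof -
    have "(\<exists>\<^sub>F r in at_0. inverse (ennreal (Y r (r powr (1 / \<eta>)))) < ennreal e) \<longleftrightarrow>
       (\<exists>\<^sub>F s in at_0. inverse (ennreal (Y (s powr \<eta>) ((s powr \<eta>) powr (1 / \<eta>)))) < ennreal e)"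
      by (rule frequently_powr_iff[OF assms, symmetric])
    also have "\<dots> \<longleftrightarrow> (\<exists>\<^sub>F s in at_0. inverse (ennreal (Y (s powr \<eta>) s)) < ennreal e)"
      by (rule frequently_cong[OF eventually_pos]) (use assms in \<open>simp add: powr_powr\<close>)
    finally show ?thesis .
  qed
  then show ?thesis by (simp add: Liminf_eq_0_iff)
qed

text \<open>Above the index, the passage time infinitely often exceeds a larger power of s, and
  \<open>small_value\<close> makes Y small there. Below it, the level \<open>m\<close> is eventually
  passed before time \<open>s powr \<eta>\<close>, so Y cannot come close to 0.\<close>

lemma delta1_eq: "delta1 Y = lower_index n"
  unfolding delta1_def
proof (rule Inf_ennreal_eqI)
  fix \<eta> :: real assume \<eta>: "0 < \<eta>" "lower_index n < ennreal \<eta>"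
  then obtain c where c: "0 < c" "c < \<eta>" "lower_index n < ennreal c" using exponent_between_above by blast
  obtain \<kappa> where \<kappa>: "\<kappa> > 0" "eventually (\<lambda>r. ennreal (r powr c) \<le> n r \<longrightarrow> Y (r powr \<eta>) r \<le> r powr \<kappa>) at_0"
    using small_value[of c \<eta>] c by auto
  have "\<exists>\<^sub>F s in at_0. ennreal (Y (s powr \<eta>) s) < ennreal e" if e: "e > 0" for e
    using lower_index_gt[OF c(3)]
  proof (rule frequently_rev_mp)
    show "eventually (\<lambda>s. ennreal (s powr c) < n s \<longrightarrow> ennreal (Y (s powr \<eta>) s) < ennreal e) at_0"
      using \<kappa>(2) eventually_powr_less[OF \<kappa>(1) e] by eventually_elim (use e in \<open>auto simp: ennreal_less_iff intro!: ennreal_lessI\<close>)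
  qed
  then show "\<eta> \<in> {\<eta>. 0 < \<eta> \<and> Liminf at_0 (\<lambda>r. ennreal (Y r (r powr (1 / \<eta>)))) = 0}"
    using \<eta> liminf_Y_iff by blast
next
  fix \<eta> assume "\<eta> \<in> {\<eta>. 0 < \<eta> \<and> Liminf at_0 (\<lambda>r. ennreal (Y r (r powr (1 / \<eta>)))) = 0}"
  then have \<eta>: "0 < \<eta>" and "\<forall>e>0. \<exists>\<^sub>F s in at_0. ennreal (Y (s powr \<eta>) s) < ennreal e" using liminf_Y_iff by blast+
  then have f: "\<exists>\<^sub>F s in at_0. ennreal (Y (s powr \<eta>) s) < ennreal m" using m_pos by blast
  show "lower_index n \<le> ennreal \<eta>"
  proof (rule ccontr)
    assume "\<not> ?thesis"
    then obtain c where c: "\<eta> < c" "ennreal c < lower_index n" using exponent_between_below \<eta> by (metis not_le less_imp_le)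
    have "0 \<le> c" using \<eta> c by simp
    have "eventually (\<lambda>s. \<not> ennreal (Y (s powr \<eta>) s) < ennreal m) at_0"
      using lower_index_lt[OF \<open>0 \<le> c\<close> c(2)] eventually_le_b
    proof eventually_elim
      case (elim s)
      have "n s < ennreal (s powr \<eta>)"
        using elim powr_less_mono'[of s \<eta> c] c by (auto simp: ennreal_less_iff elim!: order_le_less_trans)
      then show ?case using above[of "s powr \<eta>" s] elim m_pos by (auto simp: ennreal_less_iff)
    qed
    then show False using f by (rule frequently_eventually_contradiction[rotated])
  qed
qed

lemma beta1_eq: "beta1 Y = upper_index n"
  unfolding beta1_def
proof (rule Sup_ennreal_eqI)
  fix \<eta> :: real assume \<eta>: "0 < \<eta>" "ennreal \<eta> < upper_index n"
  then obtain c where c: "\<eta> < c" "ennreal c < upper_index n" using exponent_between_below by (metis less_imp_le)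
  obtain \<kappa> where \<kappa>: "\<kappa> > 0" "eventually (\<lambda>r. n r \<le> ennreal (r powr c) \<longrightarrow> r powr (- \<kappa>) \<le> Y (r powr \<eta>) r) at_0"
    using large_value[of \<eta> c] c \<eta> by auto
  have "\<exists>\<^sub>F s in at_0. inverse (ennreal (Y (s powr \<eta>) s)) < ennreal e" if e: "e > 0" for e
  proof (rule frequently_rev_mp)
    show "\<exists>\<^sub>F s in at_0. n s \<le> ennreal (s powr c)" using c \<eta> by (intro upper_index_lt) auto
    show "eventually (\<lambda>s. n s \<le> ennreal (s powr c) \<longrightarrow> inverse (ennreal (Y (s powr \<eta>) s)) < ennreal e) at_0"
      using \<kappa>(2) eventually_powr_less[OF \<kappa>(1) e] eventually_le_b
    proof eventually_elim
      case (elim s)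
      have "1 / e < s powr (- \<kappa>)" using elim e by (simp add: powr_minus field_simps)
      then show ?case using elim inverse_ennreal_less_iff[OF Y_pos[of "s powr \<eta>" s] e] by auto
    qed
  qed
  then show "\<eta> \<in> {\<eta>. 0 < \<eta> \<and> Liminf at_0 (\<lambda>r. inverse (ennreal (Y r (r powr (1 / \<eta>))))) = 0}"
    using \<eta> liminf_inverse_Y_iff by blast
next
  fix \<eta> assume "\<eta> \<in> {\<eta>. 0 < \<eta> \<and> Liminf at_0 (\<lambda>r. inverse (ennreal (Y r (r powr (1 / \<eta>))))) = 0}"
  then have \<eta>: "0 < \<eta>" and "\<forall>e>0. \<exists>\<^sub>F s in at_0. inverse (ennreal (Y (s powr \<eta>) s)) < ennreal e" using liminf_inverse_Y_iff by blast+
  then have f: "\<exists>\<^sub>F s in at_0. inverse (ennreal (Y (s powr \<eta>) s)) < ennreal (1 / m)" using m_pos by simp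
  show "ennreal \<eta> \<le> upper_index n"
  proof (rule ccontr)
    assume "\<not> ?thesis"
    then obtain c where c: "c < \<eta>" "upper_index n < ennreal c" using exponent_between_above by (metis not_le)
    have "eventually (\<lambda>s. \<not> inverse (ennreal (Y (s powr \<eta>) s)) < ennreal (1 / m)) at_0"
      using upper_index_gt[OF c(2)] eventually_le_b
    proof eventually_elim
      case (elim s)
      have "ennreal (s powr \<eta>) < n s"
        using elim powr_less_mono'[of s c \<eta>] c by (meson ennreal_leI less_imp_le order_le_less_trans)
      then have "Y (s powr \<eta>) s \<le> m" using elim by (intro passage_below) auto
      then show ?case using inverse_ennreal_less_iff[OF Y_pos[of "s powr \<eta>" s], of "1 / m"] elim m_pos by auto
    qed
    then show False using f by (rule frequently_eventually_contradiction[rotated])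
  qed
qed

text \<open>Below the index the inverse terms are geometrically small along dyadic radii.
  Conversely, summability speaks about the sequence only; since a \<Sigma>-sequence has no gaps on
  the power scale and Y is almost monotone in the radius, it forces
  \<open>n r \<le> ennreal (r powr c)\<close> for all small r.\<close>

lemma delta2_eq: "delta2 Y = lower_index n"
  unfolding delta2_def
proof (rule Sup_ennreal_eqI)
  fix \<eta> :: real assume \<eta>: "0 < \<eta>" "ennreal \<eta> < lower_index n"
  then obtain c where c: "\<eta> < c" "ennreal c < lower_index n" using exponent_between_below by (metis less_imp_le)
  obtain \<kappa> where \<kappa>: "\<kappa> > 0" "eventually (\<lambda>r. n r \<le> ennreal (r powr c) \<longrightarrow> r powr (- \<kappa>) \<le> Y (r powr \<eta>) r) at_0"
    using large_value[of \<eta> c] c \<eta> by auto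
  have "eventually (\<lambda>r. n r \<le> ennreal (r powr c)) at_0" using c \<eta> by (intro lower_index_lt) auto
  with \<kappa>(2) have "eventually (\<lambda>r. 0 < r \<and> r powr (- \<kappa>) \<le> Y (r powr \<eta>) r) at_0" using eventually_pos by eventually_elim auto
  then obtain N :: nat where N: "\<And>k. 0 < (1 / 2 ^ (k + N) :: real) \<and> (1 / 2 ^ (k + N)) powr (- \<kappa>) \<le> Y ((1 / 2 ^ (k + N)) powr \<eta>) (1 / 2 ^ (k + N))"
    using eventually_at_0_geometric by blast
  let ?s = "\<lambda>k. (1 / 2 ^ (k + N) :: real) powr \<eta>"
  have "inverse (ennreal (Y (?s k) (?s k powr (1 / \<eta>)))) \<le> ennreal ((1 / 2 ^ (k + N)) powr \<kappa>)" for k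
  proof -
    define x :: real where "x = 1 / 2 ^ (k + N)"
    have x: "x > 0" "x powr (- \<kappa>) \<le> Y (x powr \<eta>) x" using N[of k] by (auto simp: x_def)
    then have p: "Y (x powr \<eta>) x > 0" by (metis less_le_trans powr_gt_zero order_less_irrefl)
    have "inverse (Y (x powr \<eta>) x) \<le> inverse (x powr (- \<kappa>))" using x by (intro le_imp_inverse_le) auto
    then have "inverse (ennreal (Y (x powr \<eta>) x)) \<le> ennreal (x powr \<kappa>)"
      using p x by (simp add: inverse_ennreal powr_minus ennreal_leI)
    moreover have "(x powr \<eta>) powr (1 / \<eta>) = x" using x \<eta> by (simp add: powr_powr)
    ultimately show ?thesis unfolding x_def[symmetric] by simp
  qed
  then have "(\<Sum>k. inverse (ennreal (Y (?s k) (?s k powr (1 / \<eta>))))) < \<infinity>"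
    by (rule geometric_suminf_finite[OF \<kappa>(1)])
  then show "\<eta> \<in> {\<eta>. \<eta> > 0 \<and>
     (\<exists>s. Sigma_sequence s \<and> (\<Sum>n. inverse (ennreal (Y (s n) (s n powr (1 / \<eta>))))) < \<infinity>)}"
    using \<eta> Sigma_sequence_geometric[OF \<eta>(1), of N] by blast
next
  fix \<eta> assume "\<eta> \<in> {\<eta>. \<eta> > 0 \<and>
     (\<exists>s. Sigma_sequence s \<and> (\<Sum>n. inverse (ennreal (Y (s n) (s n powr (1 / \<eta>))))) < \<infinity>)}"
  then obtain s where \<eta>: "0 < \<eta>" and s: "Sigma_sequence s"
    and sum: "(\<Sum>n. inverse (ennreal (Y (s n) (s n powr (1 / \<eta>))))) < \<infinity>" by blast
  have pos: "s k > 0" for k using s by (simp add: Sigma_sequence_def)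
  show "ennreal \<eta> \<le> lower_index n"
  proof (rule ccontr)
    assume "\<not> ?thesis"
    then obtain c where c: "0 < c" "c < \<eta>" "lower_index n < ennreal c" using exponent_between_above by (metis not_le)
    \<comment> \<open>With this choice \<eta> (1 - \<epsilon>) is the midpoint of c and
      \<eta>.\<close>
    define \<epsilon> where "\<epsilon> = (1 - c / \<eta>) / 2"
    have \<epsilon>: "0 < \<epsilon>" "\<epsilon> < 1" "c < \<eta> * (1 - \<epsilon>)" using c by (auto simp: \<epsilon>_def field_simps)
    have "(\<lambda>k. s k powr (1 / \<eta>)) \<longlonglongrightarrow> 0"
      using s \<eta> by (intro tendsto_zero_powrI[OF _ tendsto_const]) (auto simp: Sigma_sequence_def less_imp_le)
    then have "eventually (\<lambda>k. s k powr (1 / \<eta>) < b) sequentially" using b_pos by (intro order_tendstoD)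
    \<comment> \<open>The level is 2 m because \<open>Y_halving\<close> loses a factor 2 in passing
      to the radius \<open>r\<close> inside the bracket.\<close>
    moreover have "eventually (\<lambda>k. inverse (ennreal (Y (s k) (s k powr (1 / \<eta>)))) < ennreal (1 / (2 * m))) sequentially"
      using m_pos by (intro suminf_finite_tendsto_0[OF sum]) auto
    ultimately have Q: "eventually (\<lambda>k. s k powr (1 / \<eta>) < b \<and> 2 * m < Y (s k) (s k powr (1 / \<eta>))) sequentially"
    proof eventually_elim
      case (elim k)
      then show ?case using inverse_ennreal_less_iff[OF Y_pos[of "s k" "s k powr (1/\<eta>)"], of "1 / (2 * m)"] pos[of k] m_pos by auto
    qed
    have "eventually (\<lambda>r. \<not> ennreal (r powr c) < n r) at_0"
      using eventually_powr_at_0[OF \<eta> Sigma_sequence_bracket[OF s \<epsilon>(1,2) Q]] eventually_le_b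
    proof eventually_elim
      case (elim r)
      then have r: "0 < r" "r < 1" "r \<le> b" by auto
      obtain k where k: "s k powr (1 / \<eta>) < b" "2 * m < Y (s k) (s k powr (1 / \<eta>))" "s (Suc k) < r powr \<eta>"
         "r powr \<eta> \<le> s k" "s k \<le> s (Suc k) powr (1 - \<epsilon>)" using elim by blast
      have "(r powr \<eta>) powr (1 / \<eta>) \<le> s k powr (1 / \<eta>)" using k \<eta> by (intro powr_mono2) auto
      then have "r \<le> s k powr (1 / \<eta>)" using r \<eta> by (simp add: powr_powr)
      then have "Y (s k) (s k powr (1 / \<eta>)) \<le> 2 * Y (s k) r" using pos[of k] r k by (intro Y_halving) auto
      then have "n r \<le> ennreal (s k)" using k pos[of k] by (intro passage_le) auto
      also have "s k \<le> r powr c"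
      proof -
        have "s k \<le> (r powr \<eta>) powr (1 - \<epsilon>)"
          using k(5) powr_mono2[of "1 - \<epsilon>" "s (Suc k)" "r powr \<eta>"] pos[of "Suc k"] k(3) \<epsilon> by auto
        also have "\<dots> = r powr (\<eta> * (1 - \<epsilon>))" by (simp add: powr_powr)
        also have "\<dots> \<le> r powr c" using r \<epsilon> powr_less_mono'[of r c "\<eta> * (1 - \<epsilon>)"] by simp
        finally show ?thesis .
      qed
      finally show ?case by (simp add: not_less ennreal_leI)
    qed
    then show False using lower_index_gt[OF c(3)] by (rule frequently_eventually_contradiction[rotated])
  qed
qed

text \<open>Dual to \<open>delta2_eq\<close>. In the converse direction the later term of the
  bracket is used: Y is small at that term, so the passage time is at least
  \<open>s (Suc k)\<close>, which exceeds \<open>r powr c\<close>.\<close>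

lemma beta2_eq: "beta2 Y = upper_index n"
  unfolding beta2_def
proof (rule Inf_ennreal_eqI)
  fix \<eta> :: real assume \<eta>: "0 < \<eta>" "upper_index n < ennreal \<eta>"
  then obtain c where c: "0 < c" "c < \<eta>" "upper_index n < ennreal c" using exponent_between_above by blast
  obtain \<kappa> where \<kappa>: "\<kappa> > 0" "eventually (\<lambda>r. ennreal (r powr c) \<le> n r \<longrightarrow> Y (r powr \<eta>) r \<le> r powr \<kappa>) at_0"
    using small_value[of c \<eta>] c by auto
  have "eventually (\<lambda>r. 0 < r \<and> Y (r powr \<eta>) r \<le> r powr \<kappa>) at_0"
    using \<kappa>(2) upper_index_gt[OF c(3)] eventually_pos by eventually_elim auto
  then obtain N :: nat where N: "\<And>k. 0 < (1 / 2 ^ (k + N) :: real) \<and> Y ((1 / 2 ^ (k + N)) powr \<eta>) (1 / 2 ^ (k + N)) \<le> (1 / 2 ^ (k + N)) powr \<kappa>"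
    using eventually_at_0_geometric by blast
  let ?s = "\<lambda>k. (1 / 2 ^ (k + N) :: real) powr \<eta>"
  have "ennreal (Y (?s k) (?s k powr (1 / \<eta>))) \<le> ennreal ((1 / 2 ^ (k + N)) powr \<kappa>)" for k
  proof -
    define x :: real where "x = 1 / 2 ^ (k + N)"
    have x: "x > 0" "Y (x powr \<eta>) x \<le> x powr \<kappa>" using N[of k] by (auto simp: x_def)
    moreover have "(x powr \<eta>) powr (1 / \<eta>) = x" using x \<eta> by (simp add: powr_powr)
    ultimately show ?thesis unfolding x_def[symmetric] by (simp add: ennreal_leI)
  qed
  then have "(\<Sum>k. ennreal (Y (?s k) (?s k powr (1 / \<eta>)))) < \<infinity>"
    by (rule geometric_suminf_finite[OF \<kappa>(1)])
  then show "\<eta> \<in> {\<eta>. \<eta> > 0 \<and>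
     (\<exists>s. Sigma_sequence s \<and> (\<Sum>n. ennreal (Y (s n) (s n powr (1 / \<eta>)))) < \<infinity>)}"
    using \<eta> Sigma_sequence_geometric[OF \<eta>(1), of N] by blast
next
  fix \<eta> assume "\<eta> \<in> {\<eta>. \<eta> > 0 \<and>
     (\<exists>s. Sigma_sequence s \<and> (\<Sum>n. ennreal (Y (s n) (s n powr (1 / \<eta>)))) < \<infinity>)}"
  then obtain s where \<eta>: "0 < \<eta>" and s: "Sigma_sequence s"
    and sum: "(\<Sum>n. ennreal (Y (s n) (s n powr (1 / \<eta>)))) < \<infinity>" by blast
  have pos: "s k > 0" for k using s by (simp add: Sigma_sequence_def)
  show "upper_index n \<le> ennreal \<eta>"
  proof (rule ccontr)
    assume "\<not> ?thesis"
    then obtain c where c: "\<eta> < c" "ennreal c < upper_index n" using exponent_between_below \<eta> by (metis not_le less_imp_le)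
    \<comment> \<open>Makes c (1 - \<epsilon>) the midpoint of \<eta> and c, hence larger than
      \<eta>.\<close>
    define \<epsilon> where "\<epsilon> = (1 - \<eta> / c) / 2"
    have \<epsilon>: "0 < \<epsilon>" "\<epsilon> < 1" using c \<eta> by (auto simp: \<epsilon>_def field_simps)
    have "c * (1 - \<epsilon>) = (c + \<eta>) / 2" using c \<eta> by (simp add: \<epsilon>_def field_simps)
    then have \<epsilon>2: "\<eta> < c * (1 - \<epsilon>)" using c by simp
    have Q: "eventually (\<lambda>k. Y (s k) (s k powr (1 / \<eta>)) < m / 2) sequentially"
      using suminf_finite_tendsto_0[OF sum half_gt_zero[OF m_pos]]
      by eventually_elim (metis ennreal_leI not_le)
    have "eventually (\<lambda>r. \<not> n r \<le> ennreal (r powr c)) at_0"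
      using eventually_powr_at_0[OF \<eta> Sigma_sequence_bracket[OF s \<epsilon> Q]] eventually_le_b
    proof eventually_elim
      case (elim r)
      then have r: "0 < r" "r < 1" "r \<le> b" by auto
      obtain k where k: "Y (s (Suc k)) (s (Suc k) powr (1 / \<eta>)) < m / 2" "s (Suc k) < r powr \<eta>"
         "r powr \<eta> \<le> s k" "s k \<le> s (Suc k) powr (1 - \<epsilon>)" using elim by blast
      have "s (Suc k) powr (1 / \<eta>) \<le> (r powr \<eta>) powr (1 / \<eta>)" using k \<eta> pos[of "Suc k"] by (intro powr_mono2) auto
      then have "s (Suc k) powr (1 / \<eta>) \<le> r" using r \<eta> by (simp add: powr_powr)
      then have "Y (s (Suc k)) r \<le> 2 * Y (s (Suc k)) (s (Suc k) powr (1 / \<eta>))" using pos[of "Suc k"] r by (intro Y_halving) auto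
      then have "Y (s (Suc k)) r \<le> m" using k by simp
      then have "Y t r \<le> m" if "0 < t" "t < s (Suc k)" for t using Y_mono[of t "s (Suc k)" r] that r by auto
      then have "ennreal (s (Suc k)) \<le> n r" by (intro passage_ge)
      moreover have "r powr c < s (Suc k)"
      proof -
        have "(r powr c) powr (1 - \<epsilon>) = r powr (c * (1 - \<epsilon>))" by (simp add: powr_powr)
        also have "\<dots> < r powr \<eta>" using r \<epsilon>2 by (intro powr_less_mono') auto
        also have "\<dots> \<le> s (Suc k) powr (1 - \<epsilon>)" using k by simp
        finally show ?thesis using \<epsilon> pos[of "Suc k"] by (meson diff_gt_0_iff_gt less_imp_le not_le powr_ge_zero powr_mono2)
      qed
      ultimately show ?case by (meson ennreal_lessI not_le order_less_le_trans pos)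
    qed
    moreover have "\<exists>\<^sub>F r in at_0. n r \<le> ennreal (r powr c)" using c \<eta> by (intro upper_index_lt) auto
    ultimately show False by (rule frequently_eventually_contradiction[rotated])
  qed
qed

section \<open>Indices of a quantity that agrees with the passage time up to small powers\<close>

context
  fixes I :: "real \<Rightarrow> ennreal"
  assumes I_lower: "\<And>\<epsilon>. \<epsilon> > 0 \<Longrightarrow> eventually (\<lambda>r. ennreal (r powr \<epsilon>) * n r \<le> I r) at_0"
    and I_upper: "\<And>\<epsilon> k. \<epsilon> > 0 \<Longrightarrow> k > 0 \<Longrightarrow>
       eventually (\<lambda>r. I r \<le> ennreal (r powr (- \<epsilon>)) * n r + ennreal (r powr k)) at_0"
begin

text \<open>Taking the loss c - \<eta> in the upper estimate and the error exponent equal to \<eta>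
  makes both summands equal to \<open>r powr \<eta>\<close>; hence the 2.\<close>

lemma integral_le_powr:
  assumes "0 < \<eta>" "\<eta> < c"
  shows "eventually (\<lambda>r. n r \<le> ennreal (r powr c) \<longrightarrow> ennreal (r powr (- \<eta>)) * I r \<le> ennreal 2) at_0"
proof -
  have "c - \<eta> > 0" using assms by simp
  show ?thesis using I_upper[OF \<open>c - \<eta> > 0\<close> assms(1)] eventually_pos
  proof eventually_elim
    case (elim r)
    show ?case
    proof
      assume n: "n r \<le> ennreal (r powr c)"
      have "I r \<le> ennreal (r powr (- (c - \<eta>))) * ennreal (r powr c) + ennreal (r powr \<eta>)"
        using elim(1) n by (meson add_right_mono mult_left_mono order_trans zero_le)
      also have "\<dots> = ennreal (r powr (- (c - \<eta>)) * r powr c + r powr \<eta>)" by (simp add: ennreal_mult'' ennreal_plus)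
      also have "r powr (- (c - \<eta>)) * r powr c + r powr \<eta> = 2 * r powr \<eta>" by (simp flip: powr_add)
      finally have "ennreal (r powr (- \<eta>)) * I r \<le> ennreal (r powr (- \<eta>)) * ennreal (2 * r powr \<eta>)"
        by (rule mult_left_mono) simp
      also have "\<dots> = ennreal (r powr (- \<eta>) * (2 * r powr \<eta>))" by (rule ennreal_mult'[symmetric]) simp
      also have "r powr (- \<eta>) * (2 * r powr \<eta>) = 2" using elim by (simp add: powr_minus)
      finally show "ennreal (r powr (- \<eta>)) * I r \<le> ennreal 2" .
    qed
  qed
qed

lemma integral_exceeds:
  assumes "c < \<eta>" "M \<ge> 0"
  shows "eventually (\<lambda>r. ennreal (r powr c) < n r \<longrightarrow> \<not> ennreal (r powr (- \<eta>)) * I r \<le> ennreal M) at_0"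
proof -
  define \<epsilon> where "\<epsilon> = (\<eta> - c) / 2"
  have \<epsilon>: "\<epsilon> > 0" "- \<eta> + (\<epsilon> + c) = - \<epsilon>" using assms by (auto simp: \<epsilon>_def field_simps)
  have "1 / (M + 1) > 0" using assms by simp
  show ?thesis using I_lower[OF \<epsilon>(1)] eventually_pos eventually_powr_less[OF \<epsilon>(1) \<open>1 / (M + 1) > 0\<close>]
  proof eventually_elim
    case (elim r)
    show ?case
    proof
      assume n: "ennreal (r powr c) < n r"
      have "M + 1 < r powr (- \<epsilon>)" using elim assms by (simp add: powr_minus field_simps)
      then have "M < r powr (- \<epsilon>)" by simp
      also have "r powr (- \<epsilon>) = r powr (- \<eta>) * (r powr \<epsilon> * r powr c)" by (simp only: powr_add[symmetric] \<epsilon>(2))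
      finally have "ennreal M < ennreal (r powr (- \<eta>) * (r powr \<epsilon> * r powr c))" using assms by (simp add: ennreal_less_iff)
      also have "\<dots> = ennreal (r powr (- \<eta>)) * (ennreal (r powr \<epsilon>) * ennreal (r powr c))" by (simp add: ennreal_mult')
      also have "\<dots> \<le> ennreal (r powr (- \<eta>)) * I r"
        using elim(1) n by (meson less_imp_le mult_left_mono order_trans zero_le)
      finally show "\<not> ennreal (r powr (- \<eta>)) * I r \<le> ennreal M" by simp
    qed
  qed
qed

text \<open>Kept separate because the moment index \<open>delta_E\<close> reduces to it through
  Markov's inequality.\<close>

lemma limsup_exponent_le:
  assumes "Limsup at_0 (\<lambda>r. ennreal (r powr (- \<eta>)) * I r) < \<infinity>"
  shows "ennreal \<eta> \<le> lower_index n"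
proof (rule ccontr)
  assume "\<not> ?thesis"
  then obtain c where c: "c < \<eta>" "lower_index n < ennreal c" using exponent_between_above by (metis not_le)
  obtain M where M: "M \<ge> 0" "eventually (\<lambda>r. ennreal (r powr (- \<eta>)) * I r \<le> ennreal M) at_0"
    using assms unfolding Limsup_less_top_iff by blast
  have "eventually (\<lambda>r. \<not> ennreal (r powr c) < n r) at_0"
    using M(2) integral_exceeds[OF c(1) M(1)] by eventually_elim auto
  then show False using lower_index_gt[OF c(2)] by (rule frequently_eventually_contradiction[rotated])
qed

lemma limsup_exponent_eq:
  "Sup (ennreal ` {\<eta>. \<eta> \<ge> 0 \<and> Limsup at_0 (\<lambda>r. ennreal (r powr (- \<eta>)) * I r) < \<infinity>}) = lower_index n"
proof (rule Sup_ennreal_eqI)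
  fix \<eta> :: real assume \<eta>: "0 < \<eta>" "ennreal \<eta> < lower_index n"
  then obtain c where c: "\<eta> < c" "ennreal c < lower_index n" using exponent_between_below by (metis less_imp_le)
  have "0 \<le> c" using c \<eta> by simp
  have "eventually (\<lambda>r. ennreal (r powr (- \<eta>)) * I r \<le> ennreal 2) at_0"
    using lower_index_lt[OF \<open>0 \<le> c\<close> c(2)] integral_le_powr[OF \<eta>(1) c(1)] by eventually_elim auto
  then show "\<eta> \<in> {\<eta>. \<eta> \<ge> 0 \<and> Limsup at_0 (\<lambda>r. ennreal (r powr (- \<eta>)) * I r) < \<infinity>}"
    using \<eta> Limsup_less_top_iff[of at_0] by (intro CollectI conjI; (force intro: exI[of _ 2])?)
qed (auto intro: limsup_exponent_le)

lemma liminf_exponent_eq: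
  "Sup (ennreal ` {\<eta>. \<eta> \<ge> 0 \<and> Liminf at_0 (\<lambda>r. ennreal (r powr (- \<eta>)) * I r) < \<infinity>}) = upper_index n"
proof (rule Sup_ennreal_eqI)
  fix \<eta> :: real assume \<eta>: "0 < \<eta>" "ennreal \<eta> < upper_index n"
  then obtain c where c: "\<eta> < c" "ennreal c < upper_index n" using exponent_between_below by (metis less_imp_le)
  have "\<exists>\<^sub>F r in at_0. n r \<le> ennreal (r powr c)" using c \<eta> by (intro upper_index_lt) auto
  then have "\<exists>\<^sub>F r in at_0. ennreal (r powr (- \<eta>)) * I r \<le> ennreal 2"
    using integral_le_powr[OF \<eta>(1) c(1)] by (rule frequently_rev_mp)
  then show "\<eta> \<in> {\<eta>. \<eta> \<ge> 0 \<and> Liminf at_0 (\<lambda>r. ennreal (r powr (- \<eta>)) * I r) < \<infinity>}"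
    using \<eta> Liminf_less_top_iff[of at_0] by (intro CollectI conjI; (force intro: exI[of _ 2])?)
next
  fix \<eta> assume "\<eta> \<in> {\<eta>. \<eta> \<ge> 0 \<and> Liminf at_0 (\<lambda>r. ennreal (r powr (- \<eta>)) * I r) < \<infinity>}"
  then obtain M where M: "M \<ge> 0" "\<exists>\<^sub>F r in at_0. ennreal (r powr (- \<eta>)) * I r \<le> ennreal M"
    unfolding Liminf_less_top_iff by blast
  show "ennreal \<eta> \<le> upper_index n"
  proof (rule ccontr)
    assume "\<not> ?thesis"
    then obtain c where c: "c < \<eta>" "upper_index n < ennreal c" using exponent_between_above by (metis not_le)
    have "eventually (\<lambda>r. \<not> ennreal (r powr (- \<eta>)) * I r \<le> ennreal M) at_0"
      using upper_index_gt[OF c(2)] integral_exceeds[OF c(1) M(1)] by eventually_elim auto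
    then show False using M(2) by (rule frequently_eventually_contradiction[rotated])
  qed
qed

end

text \<open>Growth read backwards from \<open>t0\<close> bounds Y at time t by a multiple of
  \<open>(t / t0) powr \<sigma>\<close>, which tends to 0 with t for each fixed r; so the level is
  not passed immediately.\<close>

lemma n_pos: "eventually (\<lambda>r. 0 < n r) at_0"
  using eventually_le_b Y_growth[OF zero_less_one]
proof eventually_elim
  case (elim r)
  \<comment> \<open>The second entry is the time at which
    \<open>Y t0 r * (t / t0) powr \<sigma> / r\<close> equals m.\<close>
  define a where "a = min (t0 / 2) (t0 * (m * r / Y t0 r) powr (1 / \<sigma>))"
  have Y0: "Y t0 r > 0" using Y_pos t0_pos elim by auto
  have a: "0 < a" using t0_pos m_pos Y0 elim by (auto simp: a_def)
  have "Y t r \<le> m" if t: "0 < t" "t < a" for t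
  proof -
    have "t < t0" using t t0_pos by (auto simp: a_def)
    then have "r powr 1 * (t0 / t) powr \<sigma> * Y t r \<le> Y t0 r" using elim t by blast
    moreover have "(t0 / t) powr \<sigma> \<ge> Y t0 r / (m * r)"
    proof -
      have "t \<le> t0 * (m * r / Y t0 r) powr (1 / \<sigma>)" using t by (auto simp: a_def)
      then have "t / t0 \<le> (m * r / Y t0 r) powr (1 / \<sigma>)" using t0_pos by (simp add: field_simps)
      then have "(t / t0) powr \<sigma> \<le> ((m * r / Y t0 r) powr (1 / \<sigma>)) powr \<sigma>" using t t0_pos \<sigma>_pos by (intro powr_mono2) auto
      also have "\<dots> = m * r / Y t0 r" using \<sigma>_pos m_pos Y0 elim by (simp add: powr_powr)
      finally have "inverse (m * r / Y t0 r) \<le> inverse ((t / t0) powr \<sigma>)" using t t0_pos by (intro le_imp_inverse_le) auto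
      then show ?thesis using t t0_pos by (simp add: powr_divide inverse_eq_divide)
    qed
    ultimately have "r * (Y t0 r / (m * r)) * Y t r \<le> Y t0 r"
      using Y_pos[of t r] elim t by (smt (verit) mult_left_mono mult_right_mono powr_one)
    then show ?thesis using elim Y0 m_pos by (simp add: field_simps)
  qed
  then have "ennreal a \<le> n r" by (intro passage_ge)
  then show ?case using a by (meson ennreal_less_zero_iff less_le_trans)
qed

end

section \<open>Processes with additive components\<close>

locale additive_vector = prob_space P for P :: "'w measure" +
  fixes X :: "real \<Rightarrow> 'w \<Rightarrow> real ^ 'n::finite"
    and B C :: "'n \<Rightarrow> real \<Rightarrow> real" and \<nu> :: "'n \<Rightarrow> real \<Rightarrow> real measure"
  assumes additive: "\<And>i. additive_process P (\<lambda>t \<omega>. X t \<omega> $ i)"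
    and chars: "\<And>i. has_characteristics P (\<lambda>t \<omega>. X t \<omega> $ i) (B i) (C i) (\<nu> i)"
begin

sublocale comp: additive_component "\<nu> i" "B i" "C i" P "\<lambda>t \<omega>. X t \<omega> $ i" for i
proof unfold_locales
qed (use additive[of i] chars[of i] in \<open>auto simp: additive_process_def has_characteristics_def\<close>)

abbreviation y :: "real \<Rightarrow> real \<Rightarrow> real" where "y \<equiv> y_fun B C \<nu>"

lemma y_le: "0 < r \<Longrightarrow> 0 \<le> s \<Longrightarrow> s \<le> t \<Longrightarrow> y s r \<le> y t r"
  unfolding y_fun_def by (intro sum_mono comp.y1_le)

lemma y_halving: "0 \<le> t \<Longrightarrow> 0 < s \<Longrightarrow> s \<le> r \<Longrightarrow> y t r \<le> 2 * y t s"
  unfolding y_fun_def sum_distrib_left by (intro sum_mono comp.y1_halving)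

lemma run_sup_bounded:
  assumes "\<omega> \<in> space P" "0 \<le> t"
  shows "bdd_above ((\<lambda>s. norm (X s \<omega>)) ` {0..t})"
proof -
  have "\<exists>K. \<forall>s\<in>{0..t}. \<bar>X s \<omega> $ i\<bar> \<le> K" for i
    using cadlag_bounded[OF comp.paths[OF assms(1)] assms(2)] .
  then obtain K where K: "\<And>i s. s \<in> {0..t} \<Longrightarrow> \<bar>X s \<omega> $ i\<bar> \<le> K i" by metis
  have "norm (X s \<omega>) \<le> (\<Sum>i\<in>UNIV. K i)" if "s \<in> {0..t}" for s
    by (rule order_trans[OF norm_le_l1_cart sum_mono]) (rule K[OF that])
  then show ?thesis by (intro bdd_aboveI[of _ "\<Sum>i\<in>UNIV. K i"]) auto
qed

lemma run_sup_le_iff: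
  assumes "\<omega> \<in> space P" "0 \<le> t"
  shows "run_sup X t \<omega> \<le> a \<longleftrightarrow> (\<forall>s\<in>{0..t}. norm (X s \<omega>) \<le> a)"
  unfolding run_sup_def using assms run_sup_bounded[OF assms] by (subst cSUP_le_iff) auto

lemma run_sup_mono:
  assumes "\<omega> \<in> space P" "0 \<le> s" "s \<le> t"
  shows "run_sup X s \<omega> \<le> run_sup X t \<omega>"
  unfolding run_sup_def using assms run_sup_bounded[of \<omega> t] by (intro cSUP_subset_mono) auto

lemma run_sup_nonneg:
  assumes "\<omega> \<in> space P" "0 \<le> t"
  shows "0 \<le> run_sup X t \<omega>"
proof -
  have "norm (X 0 \<omega>) \<le> run_sup X t \<omega>"
    using run_sup_le_iff[OF assms, of "run_sup X t \<omega>"] assms by auto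
  then show ?thesis using norm_ge_zero order_trans by blast
qed

lemma run_sup_measurable [measurable]:
  assumes "0 \<le> t"
  shows "run_sup X t \<in> borel_measurable P"
proof (rule borel_measurableI_le)
  fix a
  have rc: "continuous (at_right s) (\<lambda>s. norm (X s \<omega>))" if "\<omega> \<in> space P" "0 \<le> s" for \<omega> s
  proof -
    have "((\<lambda>s. X s \<omega> $ i) \<longlongrightarrow> X s \<omega> $ i) (at_right s)" for i
      using comp.paths[OF that(1), of i] that(2) by (simp add: cadlag_def continuous_within)
    then have "((\<lambda>s. X s \<omega>) \<longlongrightarrow> X s \<omega>) (at_right s)" by (rule vec_tendstoI)
    then show ?thesis unfolding continuous_within by (rule tendsto_norm)
  qed
  have ev: "{\<omega> \<in> space P. norm (X s \<omega>) > a} \<in> events" if "0 \<le> s" for s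
  proof -
    have [measurable]: "(\<lambda>\<omega>. X s \<omega> $ i) \<in> borel_measurable P" for i using comp.rv[OF that, of i] .
    have [measurable]: "(\<lambda>\<omega>. norm (X s \<omega>)) \<in> borel_measurable P"
      unfolding norm_vec_def L2_set_def by measurable
    show ?thesis by measurable
  qed
  have "{\<omega> \<in> space P. run_sup X t \<omega> \<le> a} = space P - (\<Union>m. \<Union>k\<in>{..2^m}. {\<omega> \<in> space P. norm (X (real k * t / 2 ^ m) \<omega>) > a})"
  proof (intro set_eqI)
    fix \<omega>
    show "\<omega> \<in> {\<omega> \<in> space P. run_sup X t \<omega> \<le> a} \<longleftrightarrow> \<omega> \<in> space P - (\<Union>m. \<Union>k\<in>{..2^m}. {\<omega> \<in> space P. norm (X (real k * t / 2 ^ m) \<omega>) > a})"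
    proof (cases "\<omega> \<in> space P")
      case True
      have "(\<exists>s\<in>{0..t}. norm (X s \<omega>) > a) \<longleftrightarrow> (\<exists>m. \<exists>k\<le>2^m. norm (X (real k * t / 2 ^ m) \<omega>) > a)"
        by (rule right_continuous_exceeds_iff[of t "\<lambda>s. norm (X s \<omega>)" a, OF assms rc[OF True]])
      moreover have "run_sup X t \<omega> \<le> a \<longleftrightarrow> \<not> (\<exists>s\<in>{0..t}. norm (X s \<omega>) > a)"
        unfolding run_sup_le_iff[OF True assms] by (simp add: not_less)
      ultimately show ?thesis using True by (simp add: Ball_def)
    qed simp
  qed
  also have "\<dots> \<in> events" using ev assms by (intro sets.Diff sets.top sets.countable_UN sets.finite_UN) auto
  finally show "{\<omega> \<in> space P. run_sup X t \<omega> \<le> a} \<in> events" .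
qed

definition small_ball :: "real \<Rightarrow> real \<Rightarrow> real" where
  "small_ball t r = prob {\<omega> \<in> space P. run_sup X t \<omega> \<le> r}"

lemma small_ball_event: "0 \<le> t \<Longrightarrow> {\<omega> \<in> space P. run_sup X t \<omega> \<le> r} \<in> events"
  by measurable

lemma small_ball_le: "0 \<le> s \<Longrightarrow> s \<le> t \<Longrightarrow> small_ball t r \<le> small_ball s r"
  unfolding small_ball_def using run_sup_mono small_ball_event
  by (intro finite_measure_mono) (auto intro: order_trans)

text \<open>448 is the constant of \<open>maximal_tail\<close>; the rest is the price in
  \<open>y1_rescale\<close> of dividing the radius by twice the dimension.\<close>

definition tail_const :: real where "tail_const = 448 * (3 * (2 * real CARD('n)) ^ 3)"

text \<open>If the norm exceeds r, some coordinate exceeds r / d, which is twice the radius r / (2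
  d). A union bound over the components then needs no joint independence.\<close>

lemma small_ball_ge:
  assumes t: "0 < t" and r: "0 < r"
  shows "1 - tail_const * y t r \<le> small_ball t r"
proof -
  define d where "d = real CARD('n)"
  have d: "d \<ge> 1" unfolding d_def using zero_less_card_finite[where 'a='n] by linarith
  define E where "E i = {\<omega> \<in> space P. \<exists>s\<in>{0..t}. \<bar>X s \<omega> $ i\<bar> > 2 * (r / (2 * d))}" for i
  have Em: "E i \<in> events" for i unfolding E_def using t r d by (intro comp.maximal_tail(1)) auto
  have Ep: "prob (E i) \<le> 448 * (3 * (2 * d) ^ 3 * y1 (B i) (C i) (\<nu> i) t r)" for i
  proof -
    have "prob (E i) \<le> 448 * y1 (B i) (C i) (\<nu> i) t (r / (2 * d))"
      unfolding E_def using t r d by (intro comp.maximal_tail(2)) auto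
    also have "y1 (B i) (C i) (\<nu> i) t (r / (2 * d)) \<le> 3 * (2 * d) ^ 3 * y1 (B i) (C i) (\<nu> i) t (2 * d * (r / (2 * d)))"
      using t r d by (intro comp.y1_rescale) auto
    also have "2 * d * (r / (2 * d)) = r" using d by simp
    finally show ?thesis by simp
  qed
  have sub: "space P - {\<omega> \<in> space P. run_sup X t \<omega> \<le> r} \<subseteq> (\<Union>i\<in>UNIV. E i)"
  proof
    fix \<omega> assume "\<omega> \<in> space P - {\<omega> \<in> space P. run_sup X t \<omega> \<le> r}"
    then have w: "\<omega> \<in> space P" and "\<not> run_sup X t \<omega> \<le> r" by auto
    then have "\<exists>s\<in>{0..t}. norm (X s \<omega>) > r" using run_sup_le_iff[OF w, of t r] t by (meson less_imp_le not_le)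
    then obtain s where s: "s \<in> {0..t}" "norm (X s \<omega>) > r" by blast
    have "\<exists>i. \<bar>X s \<omega> $ i\<bar> > r / d"
    proof (rule ccontr)
      assume "\<not> ?thesis"
      then have "(\<Sum>i\<in>UNIV. \<bar>X s \<omega> $ i\<bar>) \<le> (\<Sum>i\<in>(UNIV :: 'n set). r / d)" by (intro sum_mono) (auto simp: not_less)
      also have "\<dots> = r" using d by (simp add: d_def)
      finally show False using s(2) norm_le_l1_cart[of "X s \<omega>"] by simp
    qed
    then obtain i where "\<bar>X s \<omega> $ i\<bar> > r / d" by blast
    then have "\<omega> \<in> E i" using w s d by (auto simp: E_def)
    then show "\<omega> \<in> (\<Union>i\<in>UNIV. E i)" by blast
  qed
  have "1 - small_ball t r = prob (space P - {\<omega> \<in> space P. run_sup X t \<omega> \<le> r})"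
    unfolding small_ball_def using t by (subst prob_compl) (auto intro: small_ball_event)
  also have "\<dots> \<le> prob (\<Union>i\<in>UNIV. E i)" using sub Em by (intro finite_measure_mono) auto
  also have "\<dots> \<le> (\<Sum>i\<in>UNIV. prob (E i))" using Em by (intro finite_measure_subadditive_finite) auto
  also have "\<dots> \<le> (\<Sum>i\<in>UNIV. 448 * (3 * (2 * d) ^ 3 * y1 (B i) (C i) (\<nu> i) t r))" by (intro sum_mono Ep)
  also have "\<dots> = tail_const * y t r" unfolding tail_const_def d_def[symmetric] y_fun_def by (simp add: sum_distrib_left mult.assoc)
  finally show ?thesis by linarith
qed

text \<open>Some component carries at least the average share of \<open>y\<close>, and a small ball
  of the vector confines that component, whose increments are independent.\<close>

lemma small_ball_upper_step:
  assumes t: "0 \<le> t" and r: "0 < r" and y: "y t r > 500000 * real CARD('n) * real J"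
  shows "small_ball t r \<le> (7 / 8) ^ J"
proof -
  have "\<exists>i. y1 (B i) (C i) (\<nu> i) t r > 500000 * real J"
  proof (rule ccontr)
    assume "\<not> ?thesis"
    then have "y t r \<le> (\<Sum>i\<in>(UNIV :: 'n set). 500000 * real J)" unfolding y_fun_def by (intro sum_mono) (auto simp: not_less)
    then show False using y by simp
  qed
  then obtain i where i: "y1 (B i) (C i) (\<nu> i) t r > 500000 * real J" by blast
  show ?thesis unfolding small_ball_def
  proof (rule comp.small_ball_upper[OF t r i small_ball_event[OF t]])
    fix \<omega> s assume w: "\<omega> \<in> {\<omega> \<in> space P. run_sup X t \<omega> \<le> r}" and s: "0 \<le> s" "s \<le> t"
    have "\<bar>X s \<omega> $ i\<bar> \<le> norm (X s \<omega>)" by (rule component_le_norm_cart)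
    also have "\<dots> \<le> r" using w s run_sup_le_iff[of \<omega> t r] t by auto
    finally show "\<bar>X s \<omega> $ i\<bar> \<le> r" .
  qed
qed

lemma small_ball_decay:
  assumes t: "0 \<le> t" and r: "0 < r" and y: "y t r > 0"
  shows "small_ball t r \<le> 8 / 7 * (7 / 8) powr (y t r / (500000 * real CARD('n)))"
proof -
  define D where "D = 500000 * real CARD('n)"
  have D: "D > 0" by (simp add: D_def)
  define x where "x = y t r / D"
  have x: "x > 0" using y D by (simp add: x_def)
  \<comment> \<open>The largest integer strictly below \<open>x\<close>, since the block count
    requires a strict inequality. Rounding down loses at most one block and costs the factor 8 /
    7.\<close>
  define J where "J = nat (\<lceil>x\<rceil> - 1)"
  have J: "real J = of_int \<lceil>x\<rceil> - 1" unfolding J_def using x by (subst of_nat_nat) (auto simp: le_ceiling_iff)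
  then have Jx: "real J < x" "x \<le> real J + 1" by linarith+
  then have "D * real J < y t r" using D by (simp add: x_def field_simps)
  then have "small_ball t r \<le> (7 / 8) ^ J" by (intro small_ball_upper_step[OF t r]) (simp add: D_def)
  also have "\<dots> = 8 / 7 * (7 / 8) powr (real J + 1)" by (simp add: powr_add powr_realpow)
  also have "\<dots> \<le> 8 / 7 * (7 / 8) powr x" using Jx by (intro mult_left_mono powr_mono') auto
  finally show ?thesis by (simp add: x_def D_def)
qed

end

text \<open>\<open>exp (- x)\<close> is at most \<open>fact j / x ^ j\<close>. The degree j is
  chosen to give one power of r more than required, and that power absorbs the constants.\<close>

lemma super_polynomial_decay:
  assumes "a > 0" "D > (0::real)" "k > 0" "l > 0"
  shows "eventually (\<lambda>r. l * (8 / 7 * (7 / 8) powr (r powr (- a) / D)) \<le> r powr k) at_0"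
proof -
  define j where "j = nat \<lceil>(k + 1) / a\<rceil>"
  have j: "a * real j \<ge> k + 1"
  proof -
    have "(k + 1) / a \<le> real j" unfolding j_def by (rule real_nat_ceiling_ge)
    then show ?thesis using assms by (simp add: field_simps)
  qed
  define q where "q = ln (8 / 7 :: real) / D"
  have q: "q > 0" using assms by (simp add: q_def)
  define K where "K = l * (8 / 7) * (fact j / q ^ j)"
  have K: "K > 0" using assms q by (simp add: K_def)
  have "1 / K > 0" using K by simp
  show ?thesis using eventually_unit eventually_powr_less[OF zero_less_one \<open>1 / K > 0\<close>]
  proof eventually_elim
    case (elim r)
    then have r: "0 < r" "r < 1" by auto
    define x where "x = q * r powr (- a)"
    have x: "x > 0" using q r by (simp add: x_def)
    have "(7 / 8 :: real) powr (r powr (- a) / D) = exp (- x)"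
    proof -
      have "ln (7 / 8 :: real) = - ln (8 / 7)" by (simp add: ln_div)
      then show ?thesis by (simp add: powr_def[of "7 / 8"] x_def q_def)
    qed
    also have "\<dots> \<le> fact j / x ^ j"
    proof -
      have "x ^ j / fact j \<le> exp x"
      proof -
        have "(\<Sum>i\<in>{j}. inverse (fact i) * x ^ i) \<le> (\<Sum>i. inverse (fact i) * x ^ i)"
          using x summable_exp[of x] by (intro sum_le_suminf) auto
        then show ?thesis unfolding exp_def by (simp add: field_simps)
      qed
      then show ?thesis using x by (simp add: exp_minus field_simps)
    qed
    also have "x ^ j = q ^ j * r powr (- (a * real j))"
      using r by (simp add: x_def power_mult_distrib powr_realpow[symmetric] powr_powr)
    also have "fact j / (q ^ j * r powr (- (a * real j))) = fact j / q ^ j * r powr (a * real j)"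
      by (simp add: powr_minus field_simps)
    finally have "(l * (8 / 7)) * (7 / 8) powr (r powr (- a) / D) \<le> (l * (8 / 7)) * (fact j / q ^ j * r powr (a * real j))"
      using assms by (intro mult_left_mono) auto
    then have "l * (8 / 7 * (7 / 8) powr (r powr (- a) / D)) \<le> K * r powr (a * real j)"
      by (simp add: K_def mult.assoc)
    also have "\<dots> \<le> K * r powr (k + 1)" using K r j by (intro mult_left_mono powr_mono') auto
    also have "\<dots> = (K * r powr 1) * r powr k" by (simp add: powr_add)
    also have "\<dots> \<le> 1 * r powr k" using elim K by (intro mult_right_mono) (auto simp: field_simps)
    finally show ?case by simp
  qed
qed

section \<open>The time-changed process\<close>

lemma antimono_measurable_ennreal:
  fixes f :: "real \<Rightarrow> real"
  assumes "\<And>s t. 0 < s \<Longrightarrow> s \<le> t \<Longrightarrow> f t \<le> f s" "\<And>t. 0 < t \<Longrightarrow> f t \<le> 1"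
  shows "(\<lambda>t. ennreal (f t) * indicator {0<..l} t) \<in> borel_measurable borel"
proof -
  \<comment> \<open>Nothing is assumed about \<open>f\<close> at nonpositive times; the value 1, an
    upper bound for \<open>f\<close>, makes the extension antitone on the whole line.\<close>
  define g where "g t = (if t \<le> 0 then 1 else f t)" for t
  have "mono (\<lambda>t. - g t)" using assms by (intro monoI) (auto simp: g_def)
  then have "(\<lambda>t. - g t) \<in> borel_measurable borel" by (rule borel_measurable_mono)
  then have "(\<lambda>t. - (- g t)) \<in> borel_measurable borel" by (rule borel_measurable_uminus)
  then have [measurable]: "g \<in> borel_measurable borel" by simp
  have "(\<lambda>t. ennreal (f t) * indicator {0<..l} t) = (\<lambda>t. ennreal (g t) * indicator {0<..l} t)"
    by (auto simp: g_def indicator_def)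
  also have "\<dots> \<in> borel_measurable borel" by measurable
  finally show ?thesis .
qed

lemma dyadic_bracket:
  assumes "0 < x" "x \<le> 1 / 2 ^ N"
  shows "\<exists>k. 1 / 2 ^ (Suc k + N) < x \<and> x \<le> (1 / 2 ^ (k + N) :: real)"
proof -
  obtain j where "(1 / 2 :: real) ^ j < x" using real_arch_pow_inv[of x "1/2"] assms by auto
  then have j: "1 / 2 ^ (j + N) < x"
    using power_decreasing[of j "j + N" "1 / 2 :: real"] by (simp add: power_one_over)
  define i where "i = (LEAST i. 1 / 2 ^ (i + N) < x)"
  have i: "1 / 2 ^ (i + N) < x" unfolding i_def by (rule LeastI) (rule j)
  then have "i \<noteq> 0" using assms by (intro notI) auto
  then obtain k where k: "i = Suc k" by (cases i) auto
  have "\<not> 1 / 2 ^ (k + N) < x" using not_less_Least[of k "\<lambda>i. 1 / 2 ^ (i + N) < x"] k unfolding i_def by simp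
  then show ?thesis using i k by (intro exI[of _ k]) auto
qed

text \<open>A layer-cake bound: the weight of each dyadic ring is taken at its lower end, and the
  first summand covers the values above the largest ring. At x = 0 every indicator is 1 and every
  weight at least 1, so the series diverges, in accordance with \<open>neg_power\<close>.\<close>

lemma neg_power_le_dyadic:
  assumes "0 < \<eta>" "0 \<le> x"
  shows "neg_power x \<eta> \<le> ennreal ((1 / 2 ^ N) powr (- \<eta>))
     + (\<Sum>k. ennreal ((1 / 2 ^ (Suc k + N)) powr (- \<eta>)) * indicator {..1 / 2 ^ (k + N)} x)"
proof -
  let ?f = "\<lambda>k. ennreal ((1 / 2 ^ (Suc k + N)) powr (- \<eta>)) * indicator {..1 / 2 ^ (k + N)} x"
  consider "x = 0" | "0 < x" "x \<le> 1 / 2 ^ N" | "x > 1 / 2 ^ N" using assms by linarith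
  then show ?thesis
  proof cases
    case 1
    have "1 \<le> ?f k" for k
    proof -
      have "(1 / 2 ^ (Suc k + N) :: real) powr 0 \<le> (1 / 2 ^ (Suc k + N)) powr (- \<eta>)"
        using assms one_le_power[of "2::real" "Suc k + N"] by (intro powr_mono') (auto simp: field_simps)
      then have "ennreal 1 \<le> ennreal ((1 / 2 ^ (Suc k + N)) powr (- \<eta>))" by (intro ennreal_leI) simp
      then show ?thesis using 1 by simp
    qed
    then have "(\<Sum>k::nat. 1 :: ennreal) \<le> (\<Sum>k. ?f k)" by (intro suminf_le) auto
    moreover have "(\<Sum>k::nat. 1 :: ennreal) = \<infinity>"
    proof (rule ccontr)
      assume "(\<Sum>k::nat. 1 :: ennreal) \<noteq> \<infinity>"
      then have "summable (\<lambda>k::nat. 1 :: real)" using summable_suminf_not_top[of "\<lambda>_. 1"] by simp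
      then show False using summable_LIMSEQ_zero[of "\<lambda>k::nat. 1::real"] LIMSEQ_unique[OF tendsto_const] by fastforce
    qed
    ultimately have "(\<Sum>k. ?f k) = \<infinity>" by (simp add: top_unique)
    then show ?thesis by simp
  next
    case 2
    obtain k where k: "1 / 2 ^ (Suc k + N) < x" "x \<le> 1 / 2 ^ (k + N)" using dyadic_bracket[OF 2] by blast
    have "neg_power x \<eta> = ennreal (x powr (- \<eta>))" using 2 by (simp add: neg_power_def)
    also have "\<dots> \<le> ?f k"
      using k assms powr_mono2'[of "- \<eta>" "1 / 2 ^ (Suc k + N)" x] by (auto intro: ennreal_leI)
    also have "?f k = sum ?f {k}" by (subst sum.insert) (simp_all only: finite.emptyI empty_iff sum.empty add_0_right not_False_eq_True)
    also have "\<dots> \<le> (\<Sum>k. ?f k)" by (rule sum_le_suminf) auto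
    finally show ?thesis by (simp add: add_increasing)
  next
    case 3
    have "0 < x" by (rule less_trans[OF _ 3]) simp
    then have "neg_power x \<eta> = ennreal (x powr (- \<eta>))" by (simp add: neg_power_def)
    also have "\<dots> \<le> ennreal ((1 / 2 ^ N) powr (- \<eta>))"
      using 3 assms powr_mono2'[of "- \<eta>" "1 / 2 ^ N" x] by (auto intro: ennreal_leI)
    finally show ?thesis by (simp add: add_increasing2)
  qed
qed

lemma neg_power_ge:
  assumes "0 \<le> \<eta>" "0 < r" "0 \<le> x"
  shows "ennreal (r powr (- \<eta>)) * indicator {..r} x \<le> neg_power x \<eta>"
proof (cases "x = 0")
  case True
  then show ?thesis using assms by (auto simp: neg_power_def)
next
  case False
  then have "x \<le> r \<Longrightarrow> r powr (- \<eta>) \<le> x powr (- \<eta>)" using assms by (intro powr_mono2') auto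
  then show ?thesis using False by (auto simp: neg_power_def indicator_def intro: ennreal_leI)
qed

locale time_changed_vector = additive_vector P X B C \<nu>
  for P :: "'w measure" and X :: "real \<Rightarrow> 'w \<Rightarrow> real ^ 'n::finite" and B C \<nu> +
  fixes v c :: "real \<Rightarrow> real" and b t0 \<sigma> m :: real
  assumes b_pos: "b > 0" and t0_pos: "t0 > 0" and \<sigma>_pos: "\<sigma> > 0" and m_pos: "m > 0"
    and v_pos: "\<And>t. t > 0 \<Longrightarrow> v t > 0"
    and v_mono: "mono_on {0<..} v"
    and y_pos: "\<And>t. t > 0 \<Longrightarrow> 0 < y (v t) b"
    and c_slow: "slow_on {0<..b} c"
    and y_quasiconvex: "\<And>t1 t2 r. 0 < t1 \<Longrightarrow> t1 < t2 \<Longrightarrow> t2 \<le> t0 \<Longrightarrow> r \<in> {0<..b} \<Longrightarrow>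
           y (v t2) r / y (v t1) r \<ge> c r * (t2 / t1) powr \<sigma>"
    and m_less: "m < y (v t0) b / 2"

text \<open>The positive lower limit is used at exponent \<epsilon> / 2; the other half of the
  exponent absorbs its unknown value.\<close>

lemma slow_on_ge_powr:
  assumes c: "slow_on S c" and ev: "eventually (\<lambda>r. r \<in> S) at_0" and \<epsilon>: "\<epsilon> > 0"
  shows "eventually (\<lambda>r. r powr \<epsilon> \<le> c r) at_0"
proof -
  have "0 < Liminf at_0 (\<lambda>r. ereal (c r * r powr (- (\<epsilon> / 2))))" using c \<epsilon> by (simp add: slow_on_def)
  then obtain x where x: "0 < ereal x" "ereal x < Liminf at_0 (\<lambda>r. ereal (c r * r powr (- (\<epsilon> / 2))))"
    using ereal_dense2 by blast
  have "eventually (\<lambda>r. ereal x < ereal (c r * r powr (- (\<epsilon> / 2)))) at_0" using x(2) by (rule less_LiminfD)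
  moreover have "eventually (\<lambda>r. r powr (\<epsilon> / 2) < x) at_0" using x \<epsilon> by (intro eventually_powr_less) auto
  ultimately show ?thesis using eventually_pos
  proof eventually_elim
    case (elim r)
    have "r powr \<epsilon> = r powr (\<epsilon> / 2) * r powr (\<epsilon> / 2)" by (simp flip: powr_add)
    also have "\<dots> \<le> r powr (\<epsilon> / 2) * (c r * r powr (- (\<epsilon> / 2)))" using elim by (intro mult_left_mono) auto
    also have "\<dots> = c r" using elim by (simp add: powr_minus)
    finally show ?case .
  qed
qed

context time_changed_vector
begin

abbreviation Y :: "real \<Rightarrow> real \<Rightarrow> real" where "Y \<equiv> \<lambda>t r. y (v t) r"

lemma v_le: "0 < s \<Longrightarrow> s \<le> t \<Longrightarrow> v s \<le> v t"
  using v_mono by (auto simp: mono_on_def)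

lemma v_nonneg: "0 < t \<Longrightarrow> 0 \<le> v t"
  using v_pos by (simp add: less_imp_le)

lemma Y_positive: "0 < t \<Longrightarrow> 0 < r \<Longrightarrow> r \<le> b \<Longrightarrow> 0 < Y t r"
  using y_halving[of "v t" r b] y_pos[of t] v_nonneg[of t] by auto

sublocale growth_function Y b t0 \<sigma> m
proof
  fix t1 t2 r :: real assume "0 < t1" "t1 \<le> t2" "0 < r" "r \<le> b"
  then show "Y t1 r \<le> Y t2 r" using v_le v_nonneg by (intro y_le) auto
next
  fix \<epsilon> :: real assume \<epsilon>: "0 < \<epsilon>"
  have "eventually (\<lambda>r. r \<in> {0<..b}) at_0"
    using eventually_pos eventually_below[OF b_pos] by eventually_elim auto
  with slow_on_ge_powr[OF c_slow this \<epsilon>]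
  show "eventually (\<lambda>r. \<forall>t1 t2. 0 < t1 \<longrightarrow> t1 < t2 \<longrightarrow> t2 \<le> t0 \<longrightarrow>
         r powr \<epsilon> * (t2 / t1) powr \<sigma> * Y t1 r \<le> Y t2 r) at_0"
  proof eventually_elim
    case (elim r)
    show ?case
    proof (intro allI impI)
      fix t1 t2 :: real assume t: "0 < t1" "t1 < t2" "t2 \<le> t0"
      have p: "0 < Y t1 r" using elim t by (intro Y_positive) auto
      have "r powr \<epsilon> * (t2 / t1) powr \<sigma> * Y t1 r \<le> c r * (t2 / t1) powr \<sigma> * Y t1 r"
        using elim p by (intro mult_right_mono) auto
      also have "\<dots> \<le> Y t2 r" using y_quasiconvex[OF t elim(2)] p by (simp add: field_simps)
      finally show "r powr \<epsilon> * (t2 / t1) powr \<sigma> * Y t1 r \<le> Y t2 r" .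
    qed
  qed
next
  fix r :: real assume r: "0 < r" "r \<le> b"
  \<comment> \<open>The 1/2 in the bound on \<open>m\<close> compensates the factor of
    \<open>y_halving\<close> between the radii \<open>r\<close> and \<open>b\<close>.\<close>
  then show "m < Y t0 r" using y_halving[of "v t0" r b] m_less v_nonneg[OF t0_pos] by linarith
qed (use b_pos t0_pos \<sigma>_pos m_pos Y_positive y_halving v_nonneg in auto)

lemma emeasure_small_ball: "0 < t \<Longrightarrow> emeasure P {\<omega> \<in> space P. run_sup X (v t) \<omega> \<le> r} = ennreal (small_ball (v t) r)"
  unfolding small_ball_def by (rule emeasure_eq_measure)

lemma small_ball_integral_eq:
  "small_ball_integral P X v l r = (\<integral>\<^sup>+t. ennreal (small_ball (v t) r) * indicator {0<..l} t \<partial>lborel)"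
  unfolding small_ball_integral_def
  by (intro nn_integral_cong) (auto simp: indicator_def emeasure_small_ball)

lemma small_ball_le_1: "small_ball t r \<le> 1"
  unfolding small_ball_def by simp

lemma small_ball_measurable [measurable]:
  "(\<lambda>t. ennreal (small_ball (v t) r) * indicator {0<..l} t) \<in> borel_measurable borel"
  by (rule antimono_measurable_ennreal) (auto intro!: small_ball_le small_ball_le_1 v_le v_nonneg)

lemma nn_integral_const_interval:
  assumes "0 \<le> a" "0 \<le> x"
  shows "(\<integral>\<^sup>+t. ennreal a * indicator {0<..x} t \<partial>lborel) = ennreal (a * x)"
  using assms by (simp add: nn_integral_cmult_indicator ennreal_mult')

text \<open>Up to a time slightly below the passage time, backward growth makes Y so small that the
  maximal inequality leaves the small ball with probability at least 1/2.\<close>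

lemma small_ball_integral_lower:
  assumes l: "0 < l" and \<epsilon>: "\<epsilon> > 0"
  shows "eventually (\<lambda>r. ennreal (r powr \<epsilon>) * n r \<le> small_ball_integral P X v l r) at_0"
proof -
  define \<epsilon>' where "\<epsilon>' = \<epsilon> * \<sigma> / 2"
  have \<epsilon>': "\<epsilon>' > 0" "\<epsilon> * \<sigma> - \<epsilon>' = \<epsilon>'" using \<epsilon> \<sigma>_pos by (auto simp: \<epsilon>'_def)
  have A: "tail_const > 0" unfolding tail_const_def by simp
  \<comment> \<open>Solves \<open>m * 4 powr \<sigma> * e = 1 / (2 * tail_const)\<close>, the value
    of Y at which \<open>small_ball_ge\<close> yields 1/2.\<close>
  define e where "e = 1 / (2 * tail_const * m * 4 powr \<sigma>)"
  have e: "e > 0" "l / (2 * t0) > 0" "1 / 4 > (0::real)" using A m_pos l t0_pos by (auto simp: e_def)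
  show ?thesis
    using eventually_le_b Y_growth[OF \<epsilon>'(1)] n_pos eventually_powr_less[OF \<epsilon>'(1) e(1)]
      eventually_powr_less[OF \<epsilon> e(2)] eventually_powr_less[OF \<epsilon> e(3)]
  proof eventually_elim
    case (elim r)
    then have r: "0 < r" "r < 1" "r \<le> b" by auto
    have "n r < top" using n_le[of r] r by (simp add: order_le_less_trans)
    then obtain N where N: "n r = ennreal N" "N > 0" using elim by (cases "n r") auto
    have Nt0: "N \<le> t0" using n_le[of r] r N t0_pos by simp
    \<comment> \<open>The factor 2 makes half of \<open>T\<close> equal to the asserted lower bound.
      \<open>T\<close> stays below \<open>N / 2\<close> once \<open>r powr \<epsilon>\<close> is
      below 1/4.\<close>
    define T where "T = 2 * r powr \<epsilon> * N"
    have T: "0 < T" "T < N / 2" using r N elim by (auto simp: T_def)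
    have "T \<le> 2 * r powr \<epsilon> * t0" unfolding T_def using Nt0 by (intro mult_left_mono) auto
    then have Tl: "T \<le> l" using elim t0_pos by (simp add: field_simps)
    have half: "1 / 2 \<le> small_ball (v t) r" if t: "0 < t" "t \<le> T" for t
    proof -
      have "ennreal (N / 2) < n r" using N by (simp add: ennreal_less_iff)
      then have m: "Y (N / 2) r \<le> m" using N by (intro passage_below) auto
      have "r powr \<epsilon>' * ((N / 2) / t) powr \<sigma> * Y t r \<le> Y (N / 2) r"
      proof -
        have "t < N / 2" "N / 2 \<le> t0" using t T Nt0 N by auto
        then show ?thesis using elim(2) t(1) by blast
      qed
      then have 1: "r powr \<epsilon>' * ((N / 2) / t) powr \<sigma> * Y t r \<le> m" using m by simp
      have "(1 / (4 * r powr \<epsilon>)) powr \<sigma> \<le> ((N / 2) / t) powr \<sigma>"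
        using t T r N \<sigma>_pos unfolding T_def by (intro powr_mono2) (auto simp: field_simps)
      then have "r powr \<epsilon>' * (1 / (4 * r powr \<epsilon>)) powr \<sigma> * Y t r \<le> r powr \<epsilon>' * ((N / 2) / t) powr \<sigma> * Y t r"
        using Y_positive[of t r] t r by (intro mult_right_mono mult_left_mono) auto
      also note 1
      also have "(1 / (4 * r powr \<epsilon>)) powr \<sigma> = 1 / (4 powr \<sigma> * r powr (\<epsilon> * \<sigma>))"
        by (simp add: powr_divide powr_mult powr_powr)
      finally have "Y t r \<le> m * 4 powr \<sigma> * (r powr (\<epsilon> * \<sigma>) / r powr \<epsilon>')" using r by (simp add: field_simps)
      also have "r powr (\<epsilon> * \<sigma>) / r powr \<epsilon>' = r powr \<epsilon>'" by (simp add: powr_diff[symmetric] \<epsilon>'(2))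
      also have "m * 4 powr \<sigma> * r powr \<epsilon>' \<le> m * 4 powr \<sigma> * e" using elim m_pos by (intro mult_left_mono) auto
      also have "\<dots> = 1 / (2 * tail_const)" using m_pos by (simp add: e_def)
      finally have "tail_const * Y t r \<le> 1 / 2" using A by (simp add: field_simps)
      then show ?thesis using small_ball_ge[of "v t" r] v_pos[of t] t r by linarith
    qed
    have "ennreal (r powr \<epsilon>) * n r = ennreal (1 / 2 * T)" using N by (simp add: T_def ennreal_mult')
    also have "\<dots> = (\<integral>\<^sup>+t. ennreal (1 / 2) * indicator {0<..T} t \<partial>lborel)"
      using T by (intro nn_integral_const_interval[symmetric]) auto
    also have "\<dots> \<le> (\<integral>\<^sup>+t. ennreal (small_ball (v t) r) * indicator {0<..l} t \<partial>lborel)"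
    proof (rule nn_integral_mono)
      fix t
      have "ennreal (1 / 2) \<le> ennreal (small_ball (v t) r)" if "t \<in> {0<..T}"
        using half[of t] that by (intro ennreal_leI) auto
      then show "ennreal (1 / 2) * indicator {0<..T} t \<le> ennreal (small_ball (v t) r) * indicator {0<..l} t"
        using Tl by (auto simp: indicator_def)
    qed
    finally show ?case unfolding small_ball_integral_eq .
  qed
qed

text \<open>Split at a time \<open>T\<close> slightly above the passage time. Before it the
  probability is bounded by 1; after it Y exceeds a negative power of r, so the probability decays
  faster than any power.\<close>

lemma small_ball_integral_upper:
  assumes l: "0 < l" "l \<le> t0" and \<epsilon>: "\<epsilon> > 0" and k: "k > 0"
  shows "eventually (\<lambda>r. small_ball_integral P X v l r \<le> ennreal (r powr (- \<epsilon>)) * n r + ennreal (r powr k)) at_0"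
proof -
  \<comment> \<open>The gain \<epsilon> \<sigma> from growth is divided into three: the slow factor,
    the constant \<open>e\<close>, and the power of 1 / r that remains.\<close>
  define \<epsilon>' where "\<epsilon>' = \<epsilon> * \<sigma> / 3"
  have "3 * \<epsilon>' = \<epsilon> * \<sigma>" by (simp add: \<epsilon>'_def)
  then have \<epsilon>': "\<epsilon>' > 0" "\<epsilon>' - \<epsilon> * \<sigma> = - (2 * \<epsilon>')" using \<epsilon> \<sigma>_pos by (auto simp: \<epsilon>'_def)
  define D where "D = 500000 * real CARD('n)"
  have D: "D > 0" by (simp add: D_def)
  define e where "e = m / 2 powr \<sigma>"
  have e: "e > 0" "1 / 2 > (0::real)" using m_pos by (auto simp: e_def)
  show ?thesis
    using eventually_le_b Y_growth[OF \<epsilon>'(1)] n_pos eventually_powr_less[OF \<epsilon>'(1) e(1)]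
      eventually_powr_less[OF \<epsilon> e(2)] super_polynomial_decay[OF \<epsilon>'(1) D k l(1)]
  proof eventually_elim
    case (elim r)
    then have r: "0 < r" "r < 1" "r \<le> b" by auto
    have "n r < top" using n_le[of r] r by (simp add: order_le_less_trans)
    then obtain N where N: "n r = ennreal N" "N > 0" using elim by (cases "n r") auto
    define T where "T = r powr (- \<epsilon>) * N"
    have T: "0 < T" "2 * N < T" using r N elim by (auto simp: T_def powr_minus field_simps)
    define p where "p = 8 / 7 * (7 / 8 :: real) powr (r powr (- \<epsilon>') / D)"
    have p0: "p \<ge> 0" by (simp add: p_def)
    have small: "small_ball (v t) r \<le> p" if t: "T < t" "t \<le> l" for t
    proof -
      have m: "m < Y (2 * N) r" using N r by (intro above) (auto simp: ennreal_less_iff)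
      have "r powr (- \<epsilon>') = r powr (- (2 * \<epsilon>')) * r powr \<epsilon>'" by (simp flip: powr_add)
      also have "\<dots> \<le> r powr (- (2 * \<epsilon>')) * e" using elim by (intro mult_left_mono) auto
      also have "\<dots> = r powr \<epsilon>' * (r powr (- \<epsilon>) / 2) powr \<sigma> * m"
      proof -
        have "(r powr (- \<epsilon>) / 2) powr \<sigma> = r powr (- (\<epsilon> * \<sigma>)) / 2 powr \<sigma>" by (simp add: powr_divide powr_powr)
        then show ?thesis unfolding \<epsilon>'(2)[symmetric] powr_diff
          using r by (simp add: e_def powr_minus field_simps)
      qed
      also have "\<dots> \<le> r powr \<epsilon>' * (t / (2 * N)) powr \<sigma> * m"
      proof (intro mult_right_mono mult_left_mono powr_mono2)
        show "r powr (- \<epsilon>) / 2 \<le> t / (2 * N)" using t N by (simp add: T_def field_simps)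
      qed (use \<sigma>_pos m_pos in auto)
      also have "\<dots> \<le> r powr \<epsilon>' * (t / (2 * N)) powr \<sigma> * Y (2 * N) r" using m by (intro mult_left_mono) auto
      also have "\<dots> \<le> Y t r" using elim N T t l by auto
      finally have ge: "r powr (- \<epsilon>') \<le> Y t r" .
      have t0: "0 < t" using T t by simp
      have "small_ball (v t) r \<le> 8 / 7 * (7 / 8) powr (Y t r / D)"
        unfolding D_def using t0 r by (intro small_ball_decay v_nonneg Y_positive) auto
      also have "\<dots> \<le> p" unfolding p_def using ge D by (intro mult_left_mono powr_mono') (auto intro: divide_right_mono)
      finally show ?thesis .
    qed
    have "small_ball_integral P X v l r \<le> (\<integral>\<^sup>+t. ennreal 1 * indicator {0<..T} t + ennreal p * indicator {0<..l} t \<partial>lborel)"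
      unfolding small_ball_integral_eq
    proof (rule nn_integral_mono)
      fix t
      show "ennreal (small_ball (v t) r) * indicator {0<..l} t \<le> ennreal 1 * indicator {0<..T} t + ennreal p * indicator {0<..l} t"
      proof (cases "t \<le> T")
        case True
        then show ?thesis using small_ball_le_1[of "v t" r]
          by (auto simp: indicator_def intro!: add_increasing2)
      next
        case False
        then show ?thesis using small[of t] by (auto simp: indicator_def intro!: ennreal_leI)
      qed
    qed
    also have "\<dots> = (\<integral>\<^sup>+t. ennreal 1 * indicator {0<..T} t \<partial>lborel) + (\<integral>\<^sup>+t. ennreal p * indicator {0<..l} t \<partial>lborel)"
      by (rule nn_integral_add) auto
    also have "\<dots> = ennreal T + ennreal (p * l)"
      using T l p0 by (subst (1 2) nn_integral_const_interval) auto
    also have "ennreal T = ennreal (r powr (- \<epsilon>)) * n r" by (simp add: T_def N ennreal_mult')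
    also have "ennreal (p * l) \<le> ennreal (r powr k)" using elim by (intro ennreal_leI) (simp add: p_def mult.commute)
    finally show ?case by simp
  qed
qed

lemma delta_P_eq: "0 < l \<Longrightarrow> l \<le> t0 \<Longrightarrow> delta_P P X v l = lower_index n"
  unfolding delta_P_def by (rule limsup_exponent_eq[OF small_ball_integral_lower small_ball_integral_upper])

lemma beta_P_eq: "0 < l \<Longrightarrow> l \<le> t0 \<Longrightarrow> beta_P P X v l = upper_index n"
  unfolding beta_P_def by (rule liminf_exponent_eq[OF small_ball_integral_lower small_ball_integral_upper])

section \<open>Negative moments of the running supremum\<close>

definition neg_moment :: "real \<Rightarrow> real \<Rightarrow> ennreal" where
  "neg_moment l \<eta> = (\<integral>\<^sup>+ t\<in>{0<..l}. (\<integral>\<^sup>+ \<omega>. neg_power (run_sup X (v t) \<omega>) \<eta> \<partial>P) \<partial>lborel)"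

lemma nn_integral_run_sup_indicator:
  assumes "0 < t"
  shows "(\<integral>\<^sup>+ \<omega>. a * indicator {..r} (run_sup X (v t) \<omega>) \<partial>P) = a * ennreal (small_ball (v t) r)"
proof -
  have ev: "{\<omega> \<in> space P. run_sup X (v t) \<omega> \<le> r} \<in> events" using assms by (intro small_ball_event v_nonneg)
  have "(\<integral>\<^sup>+ \<omega>. a * indicator {..r} (run_sup X (v t) \<omega>) \<partial>P) = (\<integral>\<^sup>+ \<omega>. a * indicator {\<omega> \<in> space P. run_sup X (v t) \<omega> \<le> r} \<omega> \<partial>P)"
    by (intro nn_integral_cong) (auto simp: indicator_def)
  also have "\<dots> = a * ennreal (small_ball (v t) r)"
    using ev by (simp add: nn_integral_cmult_indicator emeasure_small_ball[OF assms])
  finally show ?thesis .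
qed

text \<open>Markov's inequality under the time integral.\<close>

lemma neg_moment_ge:
  assumes "0 \<le> \<eta>" "0 < r"
  shows "ennreal (r powr (- \<eta>)) * small_ball_integral P X v l r \<le> neg_moment l \<eta>"
proof -
  have "ennreal (r powr (- \<eta>)) * small_ball_integral P X v l r
     = (\<integral>\<^sup>+t. ennreal (r powr (- \<eta>)) * (ennreal (small_ball (v t) r) * indicator {0<..l} t) \<partial>lborel)"
    unfolding small_ball_integral_eq by (rule nn_integral_cmult[symmetric]) simp
  also have "\<dots> \<le> neg_moment l \<eta>" unfolding neg_moment_def
  proof (rule nn_integral_mono)
    fix t
    show "ennreal (r powr (- \<eta>)) * (ennreal (small_ball (v t) r) * indicator {0<..l} t)
       \<le> (\<integral>\<^sup>+ \<omega>. neg_power (run_sup X (v t) \<omega>) \<eta> \<partial>P) * indicator {0<..l} t"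
    proof (cases "t \<in> {0<..l}")
      case True
      then have t: "0 < t" by simp
      have "ennreal (r powr (- \<eta>)) * ennreal (small_ball (v t) r) \<le> (\<integral>\<^sup>+ \<omega>. neg_power (run_sup X (v t) \<omega>) \<eta> \<partial>P)"
        unfolding nn_integral_run_sup_indicator[OF t, symmetric]
        by (intro nn_integral_mono neg_power_ge assms run_sup_nonneg v_nonneg t)
      then show ?thesis using True by simp
    qed simp
  qed
  finally show ?thesis .
qed

text \<open>The layer-cake bound integrated over the sample space and over time; all terms are
  nonnegative, so sum and integrals may be exchanged.\<close>

lemma neg_moment_le:
  assumes "0 < \<eta>" "0 < l"
  shows "neg_moment l \<eta> \<le> ennreal ((1 / 2 ^ N) powr (- \<eta>) * l)
     + (\<Sum>k. ennreal ((1 / 2 ^ (Suc k + N)) powr (- \<eta>)) * small_ball_integral P X v l (1 / 2 ^ (k + N)))"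
proof -
  let ?a = "\<lambda>k. ennreal ((1 / 2 ^ (Suc k + N)) powr (- \<eta>))"
  have "neg_moment l \<eta> \<le> (\<integral>\<^sup>+t. ennreal ((1 / 2 ^ N) powr (- \<eta>)) * indicator {0<..l} t
      + (\<Sum>k. ?a k * (ennreal (small_ball (v t) (1 / 2 ^ (k + N))) * indicator {0<..l} t)) \<partial>lborel)"
    unfolding neg_moment_def
  proof (rule nn_integral_mono)
    fix t
    show "(\<integral>\<^sup>+ \<omega>. neg_power (run_sup X (v t) \<omega>) \<eta> \<partial>P) * indicator {0<..l} t \<le> ennreal ((1 / 2 ^ N) powr (- \<eta>)) * indicator {0<..l} t
      + (\<Sum>k. ?a k * (ennreal (small_ball (v t) (1 / 2 ^ (k + N))) * indicator {0<..l} t))"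
    proof (cases "t \<in> {0<..l}")
      case True
      then have t: "0 < t" by simp
      have [measurable]: "run_sup X (v t) \<in> borel_measurable P" using t by (intro run_sup_measurable v_nonneg)
      have "(\<integral>\<^sup>+ \<omega>. neg_power (run_sup X (v t) \<omega>) \<eta> \<partial>P)
         \<le> (\<integral>\<^sup>+ \<omega>. ennreal ((1 / 2 ^ N) powr (- \<eta>)) + (\<Sum>k. ?a k * indicator {..1 / 2 ^ (k + N)} (run_sup X (v t) \<omega>)) \<partial>P)"
        by (intro nn_integral_mono neg_power_le_dyadic assms run_sup_nonneg v_nonneg t)
      also have "\<dots> = (\<integral>\<^sup>+ \<omega>. ennreal ((1 / 2 ^ N) powr (- \<eta>)) \<partial>P) + (\<integral>\<^sup>+ \<omega>. (\<Sum>k. ?a k * indicator {..1 / 2 ^ (k + N)} (run_sup X (v t) \<omega>)) \<partial>P)"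
        by (rule nn_integral_add) measurable
      also have "(\<integral>\<^sup>+ \<omega>. (\<Sum>k. ?a k * indicator {..1 / 2 ^ (k + N)} (run_sup X (v t) \<omega>)) \<partial>P)
          = (\<Sum>k. (\<integral>\<^sup>+ \<omega>. ?a k * indicator {..1 / 2 ^ (k + N)} (run_sup X (v t) \<omega>) \<partial>P))"
        by (rule nn_integral_suminf) measurable
      also have "\<dots> = (\<Sum>k. ?a k * ennreal (small_ball (v t) (1 / 2 ^ (k + N))))"
        by (simp only: nn_integral_run_sup_indicator[OF t])
      finally show ?thesis using True by (simp add: emeasure_space_1)
    qed simp
  qed
  also have "\<dots> = (\<integral>\<^sup>+t. ennreal ((1 / 2 ^ N) powr (- \<eta>)) * indicator {0<..l} t \<partial>lborel)
      + (\<integral>\<^sup>+t. (\<Sum>k. ?a k * (ennreal (small_ball (v t) (1 / 2 ^ (k + N))) * indicator {0<..l} t)) \<partial>lborel)"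
    by (rule nn_integral_add) measurable
  also have "(\<integral>\<^sup>+t. (\<Sum>k. ?a k * (ennreal (small_ball (v t) (1 / 2 ^ (k + N))) * indicator {0<..l} t)) \<partial>lborel)
      = (\<Sum>k. (\<integral>\<^sup>+t. ?a k * (ennreal (small_ball (v t) (1 / 2 ^ (k + N))) * indicator {0<..l} t) \<partial>lborel))"
    by (rule nn_integral_suminf) measurable
  also have "\<dots> = (\<Sum>k. ?a k * small_ball_integral P X v l (1 / 2 ^ (k + N)))"
    unfolding small_ball_integral_eq by (intro suminf_cong nn_integral_cmult) measurable
  finally show ?thesis using assms by (subst (asm) nn_integral_const_interval) auto
qed

text \<open>For \<eta> below the index, \<open>small_ball_integral\<close> is of order
  \<open>r powr d\<close> with d above \<eta>, so the dyadic series of \<open>neg_moment_le\<close>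
  is geometric. Conversely, a finite moment bounds the upper limit that defines
  \<open>delta_P\<close>.\<close>

lemma delta_E_eq:
  assumes l: "0 < l" "l \<le> t0"
  shows "delta_E P X v l = lower_index n"
  unfolding delta_E_def neg_moment_def[symmetric]
proof (rule Sup_ennreal_eqI)
  fix \<eta> :: real assume \<eta>: "0 < \<eta>" "ennreal \<eta> < lower_index n"
  then obtain c where c: "\<eta> < c" "ennreal c < lower_index n" using exponent_between_below by (metis less_imp_le)
  define d where "d = (\<eta> + c) / 2"
  have d: "\<eta> < d" "d < c" "0 < d" "0 \<le> c" using c \<eta> by (auto simp: d_def)
  define \<kappa> where "\<kappa> = (d - \<eta>) / 2"
  have \<kappa>: "\<kappa> > 0" "d - \<eta> = 2 * \<kappa>" using d by (auto simp: \<kappa>_def)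
  have e: "1 / (2 * 2 powr \<eta>) > (0 :: real)" by simp
  have le2: "eventually (\<lambda>r. n r \<le> ennreal (r powr c) \<longrightarrow>
      ennreal (r powr (- d)) * small_ball_integral P X v l r \<le> ennreal 2) at_0"
    by (intro integral_le_powr small_ball_integral_lower small_ball_integral_upper l d)
  \<comment> \<open>The weight is taken at r / 2, the lower end of the dyadic ring below r.\<close>
  have "eventually (\<lambda>r. ennreal ((r / 2) powr (- \<eta>)) * small_ball_integral P X v l r \<le> ennreal (r powr \<kappa>)) at_0"
    using lower_index_lt[OF d(4) c(2)] eventually_pos eventually_powr_less[OF \<kappa>(1) e] le2
  proof eventually_elim
    case (elim r)
    have "(r / 2) powr (- \<eta>) = 2 powr \<eta> * r powr (d - \<eta>) * r powr (- d)"
      using elim by (simp add: powr_divide powr_minus powr_diff field_simps)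
    then have "ennreal ((r / 2) powr (- \<eta>)) * small_ball_integral P X v l r
      = ennreal (2 powr \<eta> * r powr (d - \<eta>)) * (ennreal (r powr (- d)) * small_ball_integral P X v l r)"
      by (simp add: ennreal_mult' mult.assoc)
    also have "\<dots> \<le> ennreal (2 powr \<eta> * r powr (d - \<eta>)) * ennreal 2"
      using elim by (intro mult_left_mono) auto
    also have "\<dots> = ennreal (2 powr \<eta> * r powr (d - \<eta>) * 2)" by (rule ennreal_mult'[symmetric]) simp
    also have "2 powr \<eta> * r powr (d - \<eta>) * 2 = (2 * 2 powr \<eta> * r powr \<kappa>) * r powr \<kappa>"
      unfolding \<kappa>(2) by (simp flip: powr_add)
    also have "ennreal \<dots> \<le> ennreal (1 * r powr \<kappa>)"
      using elim by (intro ennreal_leI mult_right_mono) (auto simp: field_simps)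
    finally show ?case by simp
  qed
  then obtain N :: nat where N: "\<And>k. ennreal ((1 / 2 ^ (k + N) / 2) powr (- \<eta>)) * small_ball_integral P X v l (1 / 2 ^ (k + N))
       \<le> ennreal ((1 / 2 ^ (k + N)) powr \<kappa>)"
    using eventually_at_0_geometric by blast
  have "(\<Sum>k. ennreal ((1 / 2 ^ (Suc k + N)) powr (- \<eta>)) * small_ball_integral P X v l (1 / 2 ^ (k + N))) < \<infinity>"
  proof (rule geometric_suminf_finite[OF \<kappa>(1)])
    fix k show "ennreal ((1 / 2 ^ (Suc k + N)) powr (- \<eta>)) * small_ball_integral P X v l (1 / 2 ^ (k + N)) \<le> ennreal ((1 / 2 ^ (k + N)) powr \<kappa>)"
      using N[of k] by (simp add: mult.commute)
  qed
  then have "neg_moment l \<eta> < \<infinity>"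
    by (intro le_less_trans[OF neg_moment_le[OF \<eta>(1) l(1)]]) (simp add: less_top[symmetric])
  then show "\<eta> \<in> {\<eta>. \<eta> \<ge> 0 \<and> neg_moment l \<eta> < \<infinity>}" using \<eta> by simp
next
  fix \<eta> assume "\<eta> \<in> {\<eta>. \<eta> \<ge> 0 \<and> neg_moment l \<eta> < \<infinity>}"
  then have \<eta>: "0 \<le> \<eta>" "neg_moment l \<eta> < \<infinity>" by auto
  have "Limsup at_0 (\<lambda>r. ennreal (r powr (- \<eta>)) * small_ball_integral P X v l r) \<le> neg_moment l \<eta>"
    using eventually_pos by (intro Limsup_bounded) (auto elim!: eventually_mono intro: neg_moment_ge[OF \<eta>(1)])
  then have "Limsup at_0 (\<lambda>r. ennreal (r powr (- \<eta>)) * small_ball_integral P X v l r) < \<infinity>"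
    using \<eta>(2) by (rule le_less_trans)
  then show "ennreal \<eta> \<le> lower_index n"
    by (intro limsup_exponent_le[OF small_ball_integral_lower small_ball_integral_upper]) (use l in auto)
qed

end

section \<open>Moments of the small jumps\<close>

definition small_power :: "real \<Rightarrow> real \<Rightarrow> real" where
  "small_power p x = \<bar>x\<bar> powr p * indicator {-1..1} x"

lemma small_power_measurable [measurable]: "small_power p \<in> borel_measurable borel"
  unfolding small_power_def by measurable

lemma small_power_nonneg: "0 \<le> small_power p x"
  by (simp add: small_power_def)

lemma small_power_eq: "\<bar>x\<bar> \<le> 1 \<Longrightarrow> small_power p x = \<bar>x\<bar> powr p"
  by (auto simp: small_power_def indicator_def abs_le_iff)

lemma integrable_small_power_mono:
  assumes sets [measurable_cong]: "sets \<mu> = sets borel"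
    and int: "integrable \<mu> (small_power p)" and pq: "p \<le> q"
  shows "integrable \<mu> (small_power q)"
proof (rule Bochner_Integration.integrable_bound[OF int])
  show "small_power q \<in> borel_measurable \<mu>" by measurable
  show "AE x in \<mu>. norm (small_power q x) \<le> norm (small_power p x)"
  proof (rule AE_I2)
    fix x :: real
    have "\<bar>x\<bar> powr q \<le> \<bar>x\<bar> powr p" if "\<bar>x\<bar> \<le> 1" using pq that by (intro powr_mono') auto
    then show "norm (small_power q x) \<le> norm (small_power p x)" by (auto simp: small_power_def indicator_def abs_le_iff)
  qed
qed

lemma powr_split_le:
  assumes "0 < r" "\<bar>x\<bar> \<le> r" "q \<ge> (0 :: real)" "p > 0"
  shows "\<bar>x\<bar> powr (q + p) \<le> r powr q * \<bar>x\<bar> powr p"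
proof (cases "x = 0")
  case False
  then have "\<bar>x\<bar> powr q \<le> r powr q" using assms by (intro powr_mono2) auto
  then show ?thesis unfolding powr_add by (rule mult_right_mono) simp
qed (use assms in simp)

text \<open>A tail of order \<open>r powr (- p)\<close> has finite moments of every order above p:
  the integrand is summed over dyadic rings, each ring is bounded by the tail beyond its lower end,
  and the gap p' - p makes the series geometric.\<close>

lemma levy_measure_integrable_power:
  assumes \<mu>: "levy_measure \<mu>" and p: "p < p'" "p' > 0"
    and ev: "eventually (\<lambda>r. measure \<mu> {x. \<bar>x\<bar> > r} \<le> r powr (- p)) at_0"
  shows "integrable \<mu> (small_power p')"
proof -
  have sets [measurable_cong]: "sets \<mu> = sets borel" using \<mu> by (simp add: levy_measure_def)
  define \<kappa> where "\<kappa> = (p' - p) / 2"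
  have \<kappa>: "\<kappa> > 0" "p' - p = 2 * \<kappa>" using p by (auto simp: \<kappa>_def)
  have tail: "emeasure \<mu> {x. \<bar>x\<bar> > r} = ennreal (measure \<mu> {x. \<bar>x\<bar> > r})" if "r > 0" for r
    using levy_measure_tail_finite[OF \<mu> that] by (intro emeasure_eq_ennreal_measure) auto
  have half: "(1 / 2 :: real) > 0" by simp
  have "eventually (\<lambda>r. ennreal (r powr p') * emeasure \<mu> {x. \<bar>x\<bar> > r / 2} \<le> ennreal (r powr \<kappa>)) at_0"
  proof -
    have "filterlim (\<lambda>r. r / 2) at_0 (at_0 :: real filter)"
      unfolding filterlim_at
    proof (rule conjI)
      show "eventually (\<lambda>r. r / 2 \<in> {0<..} \<and> r / 2 \<noteq> (0::real)) at_0" using eventually_pos by eventually_elim simp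
      show "((\<lambda>r. r / 2) \<longlongrightarrow> (0::real)) at_0" by (rule tendsto_eq_intros refl | simp)+
    qed
    then have ev2: "eventually (\<lambda>r. measure \<mu> {x. \<bar>x\<bar> > r / 2} \<le> (r / 2) powr (- p)) at_0"
      using ev unfolding filterlim_iff by blast
    have e: "1 / 2 powr p > (0 :: real)" by simp
    show ?thesis using ev2 eventually_pos eventually_powr_less[OF \<kappa>(1) e]
    proof eventually_elim
      case (elim r)
      have "ennreal (r powr p') * emeasure \<mu> {x. \<bar>x\<bar> > r / 2} = ennreal (r powr p' * measure \<mu> {x. \<bar>x\<bar> > r / 2})"
        using elim tail[of "r / 2"] by (simp add: ennreal_mult' del: less_divide_eq_numeral1)
      also have "\<dots> \<le> ennreal (r powr \<kappa>)"
      proof (rule ennreal_leI)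
        have "r powr p' * measure \<mu> {x. \<bar>x\<bar> > r / 2} \<le> r powr p' * (r / 2) powr (- p)"
          using elim by (intro mult_left_mono) auto
        also have "\<dots> = 2 powr p * r powr (p' - p)" using elim by (simp add: powr_divide powr_minus powr_diff field_simps)
        also have "\<dots> = (2 powr p * r powr \<kappa>) * r powr \<kappa>" unfolding \<kappa>(2) by (simp flip: powr_add)
        also have "\<dots> \<le> 1 * r powr \<kappa>" using elim by (intro mult_right_mono) (auto simp: field_simps)
        finally show "r powr p' * measure \<mu> {x. \<bar>x\<bar> > r / 2} \<le> r powr \<kappa>" by simp
      qed
      finally show ?case .
    qed
  qed
  then obtain N :: nat where N: "\<And>k. ennreal ((1 / 2 ^ (k + N)) powr p') * emeasure \<mu> {x. \<bar>x\<bar> > 1 / 2 ^ (k + N) / 2} \<le> ennreal ((1 / 2 ^ (k + N)) powr \<kappa>)"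
    using eventually_at_0_geometric by blast
  let ?A = "\<lambda>k. {x::real. \<bar>x\<bar> > 1 / 2 ^ (k + N) / 2}"
  let ?a = "\<lambda>k. ennreal ((1 / 2 ^ (k + N)) powr p')"
  have bound: "ennreal (small_power p' x) \<le> indicator {x. \<bar>x\<bar> > 1 / 2 ^ N} x + (\<Sum>k. ?a k * indicator (?A k) x)" for x
  proof -
    consider "x = 0" | "x \<noteq> 0" "\<bar>x\<bar> \<le> 1 / 2 ^ N" | "\<bar>x\<bar> > 1 / 2 ^ N" by linarith
    then show ?thesis
    proof cases
      case 1
      then show ?thesis by (simp add: small_power_def)
    next
      case 2
      then obtain k where k: "1 / 2 ^ (Suc k + N) < \<bar>x\<bar>" "\<bar>x\<bar> \<le> 1 / 2 ^ (k + N)"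
        using dyadic_bracket[of "\<bar>x\<bar>" N] by auto
      have "(1 / 2 ^ N :: real) \<le> 1" by simp
      then have le1: "\<bar>x\<bar> \<le> 1" using 2 by linarith
      have A: "x \<in> ?A k" using k by (simp add: mult.commute)
      have "ennreal (small_power p' x) \<le> ?a k * indicator (?A k) x"
        using A k p le1 by (simp add: small_power_eq powr_mono2 ennreal_leI)
      also have "\<dots> = (\<Sum>k\<in>{k}. ?a k * indicator (?A k) x)" by (subst sum.insert) (simp_all only: finite.emptyI empty_iff sum.empty add_0_right not_False_eq_True)
      also have "\<dots> \<le> (\<Sum>k. ?a k * indicator (?A k) x)" by (rule sum_le_suminf) auto
      finally show ?thesis by (simp add: add_increasing)
    next
      case 3
      have "small_power p' x \<le> 1"
        using p powr_mono2[of p' "\<bar>x\<bar>" 1] by (auto simp: small_power_def indicator_def abs_le_iff)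
      then show ?thesis using 3 by (simp add: add_increasing2 ennreal_le_1)
    qed
  qed
  have "(\<integral>\<^sup>+x. ennreal (small_power p' x) \<partial>\<mu>) \<le> (\<integral>\<^sup>+x. indicator {x. \<bar>x\<bar> > 1 / 2 ^ N} x + (\<Sum>k. ?a k * indicator (?A k) x) \<partial>\<mu>)"
    by (intro nn_integral_mono bound)
  also have "\<dots> = (\<integral>\<^sup>+x. indicator {x. \<bar>x\<bar> > 1 / 2 ^ N} x \<partial>\<mu>) + (\<integral>\<^sup>+x. (\<Sum>k. ?a k * indicator (?A k) x) \<partial>\<mu>)"
    by (rule nn_integral_add) measurable
  also have "(\<integral>\<^sup>+x. (\<Sum>k. ?a k * indicator (?A k) x) \<partial>\<mu>) = (\<Sum>k. (\<integral>\<^sup>+x. ?a k * indicator (?A k) x \<partial>\<mu>))"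
    by (rule nn_integral_suminf) measurable
  also have "\<dots> = (\<Sum>k. ?a k * emeasure \<mu> (?A k))"
    using sets by (intro suminf_cong nn_integral_cmult_indicator) simp
  also have "(\<integral>\<^sup>+x. indicator {x. \<bar>x\<bar> > 1 / 2 ^ N} x \<partial>\<mu>) = emeasure \<mu> {x. \<bar>x\<bar> > 1 / 2 ^ N}"
    using sets by (intro nn_integral_indicator) simp
  finally have le: "(\<integral>\<^sup>+x. ennreal (small_power p' x) \<partial>\<mu>) \<le> emeasure \<mu> {x. \<bar>x\<bar> > 1 / 2 ^ N} + (\<Sum>k. ?a k * emeasure \<mu> (?A k))" .
  have "(\<Sum>k. ?a k * emeasure \<mu> (?A k)) < \<infinity>" by (rule geometric_suminf_finite[OF \<kappa>(1) N])
  moreover have "emeasure \<mu> {x. \<bar>x\<bar> > 1 / 2 ^ N} < \<infinity>" by (rule levy_measure_tail_finite[OF \<mu>]) simp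
  ultimately have "(\<integral>\<^sup>+x. ennreal (small_power p' x) \<partial>\<mu>) < \<infinity>"
    by (intro le_less_trans[OF le]) (simp add: less_top[symmetric])
  then show ?thesis by (intro integrableI_nonneg) (auto simp: small_power_nonneg)
qed

lemma levy_measure_integrable_square:
  assumes "levy_measure \<mu>" "p \<ge> 2"
  shows "integrable \<mu> (small_power p)"
proof (rule levy_measure_integrable[OF assms(1)], rule levy_dominatedI[of _ 1 1])
  fix x :: real assume "\<bar>x\<bar> \<le> 1"
  then have "\<bar>x\<bar> powr p \<le> \<bar>x\<bar> powr 2" using assms by (intro powr_mono') simp_all
  also have "\<dots> = x\<^sup>2" by (cases "x = 0") (auto simp: powr_numeral)
  finally show "norm (small_power p x) \<le> 1 * x\<^sup>2" using \<open>\<bar>x\<bar> \<le> 1\<close> by (simp add: small_power_eq)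
qed (auto simp: small_power_def indicator_def)

lemma small_jump_variation_finite_iff:
  assumes "levy_measure (\<nu> t)"
  shows "small_jump_variation \<nu> t < \<infinity> \<longleftrightarrow> integrable (\<nu> t) (small_power 1)"
proof -
  have [measurable_cong]: "sets (\<nu> t) = sets borel" using assms by (simp add: levy_measure_def)
  have "small_jump_variation \<nu> t = (\<integral>\<^sup>+x. ennreal (norm (small_power 1 x)) \<partial>\<nu> t)"
    unfolding small_jump_variation_def by (intro nn_integral_cong) (auto simp: small_power_def indicator_def abs_le_iff)
  then show ?thesis by (simp add: integrable_iff_bounded)
qed

section \<open>Power bounds for y at a fixed time\<close>

context char_triple
begin

lemma B_bounded: "\<exists>b. \<forall>s. 0 \<le> s \<longrightarrow> s \<le> t \<longrightarrow> \<bar>B s\<bar> \<le> b"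
proof -
  have "compact (B ` {0..t})" by (intro compact_continuous_image continuous_on_subset[OF B_cont]) auto
  then have "bounded (B ` {0..t})" by (rule compact_imp_bounded)
  then obtain b where "\<forall>x\<in>B ` {0..t}. norm x \<le> b" unfolding bounded_iff by blast
  then show ?thesis by (intro exI[of _ b]) auto
qed

lemma integrable_mono_time:
  fixes f :: "real \<Rightarrow> real"
  assumes "0 \<le> s" "s \<le> t" "integrable (\<nu> t) f" "f \<in> borel_measurable borel"
  shows "integrable (\<nu> s) f"
proof -
  have [measurable_cong]: "sets (\<nu> s) = sets borel" using assms by (simp add: sets_levy)
  have "(\<integral>\<^sup>+x. ennreal (norm (f x)) \<partial>\<nu> s) \<le> (\<integral>\<^sup>+x. ennreal (norm (f x)) \<partial>\<nu> t)"
    by (rule nn_integral_levy_mono[OF assms(1,2)])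
  also have "\<dots> < \<infinity>" using assms(3) by (simp add: integrable_iff_bounded)
  finally show ?thesis using assms(4) by (simp add: integrable_iff_bounded)
qed

lemma integral_small_power_mono:
  assumes "0 \<le> s" "s \<le> t" "integrable (\<nu> t) (small_power p)"
  shows "(LINT x|\<nu> s. small_power p x) \<le> (LINT x|\<nu> t. small_power p x)"
proof -
  have i: "integrable (\<nu> s) (small_power p)" using assms by (intro integrable_mono_time[OF assms(1,2)]) auto
  have "ennreal (LINT x|\<nu> s. small_power p x) = (\<integral>\<^sup>+x. ennreal (small_power p x) \<partial>\<nu> s)"
    by (rule nn_integral_eq_integral[symmetric, OF i]) (simp add: small_power_nonneg)
  also have "\<dots> \<le> (\<integral>\<^sup>+x. ennreal (small_power p x) \<partial>\<nu> t)" by (rule nn_integral_levy_mono[OF assms(1,2)])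
  also have "\<dots> = ennreal (LINT x|\<nu> t. small_power p x)"
    by (rule nn_integral_eq_integral[OF assms(3)]) (simp add: small_power_nonneg)
  finally show ?thesis
    by (subst (asm) ennreal_le_iff) (auto intro!: Bochner_Integration.integral_nonneg simp: small_power_nonneg)
qed

lemma \<gamma>0_eq: "\<gamma>0 B \<nu> t = B t - (LINT x|\<nu> t. trunc 1 x)"
proof -
  have "indicator {x. \<bar>x\<bar> \<le> 1} x *\<^sub>R x = trunc 1 x" for x :: real by (auto simp: trunc_eq indicator_def)
  then show ?thesis unfolding \<gamma>0_def set_lebesgue_integral_def by simp
qed

lemma integrable_trunc:
  assumes "0 \<le> t" "integrable (\<nu> t) (small_power 1)" "0 < r" "r \<le> 1"
  shows "integrable (\<nu> t) (trunc r)"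
proof -
  have [measurable_cong]: "sets (\<nu> t) = sets borel" using assms by (simp add: sets_levy)
  show ?thesis
    by (rule Bochner_Integration.integrable_bound[OF assms(2)])
       (use assms in \<open>auto simp: trunc_eq small_power_def indicator_def abs_le_iff\<close>)
qed

lemma drift_eq_\<gamma>0:
  assumes "0 \<le> t" "integrable (\<nu> t) (small_power 1)" "0 < r" "r \<le> 1"
  shows "drift t r = \<gamma>0 B \<nu> t + (LINT x|\<nu> t. trunc r x)"
  unfolding drift_def \<gamma>0_eq using assms by (simp add: integrable_trunc)

text \<open>Tail and second moment are of order \<open>r powr (- p)\<close> by Chebyshev. For p at
  least 1, \<open>trunc r x - trunc 1 x\<close> is controlled by the p-th moment, and the bounded
  function \<open>B\<close> contributes at most order 1 / r. For p below 1 a constant drift would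
  leave a term of order 1 / r, which is too large; with \<open>\<gamma>0\<close> equal to 0 the
  truncated drift reduces to the integral of \<open>trunc r\<close>.\<close>

lemma y1_power_bound:
  assumes t: "0 \<le> t" and p: "0 < p" "p \<le> 2" and int: "integrable (\<nu> t) (small_power p)" and C: "C t = 0"
    and drift_free: "p < 1 \<Longrightarrow> (\<And>s. 0 \<le> s \<Longrightarrow> s \<le> t \<Longrightarrow> \<gamma>0 B \<nu> s = 0)"
  shows "\<exists>K\<ge>0. \<forall>r. 0 < r \<longrightarrow> r \<le> 1 \<longrightarrow> y1 B C \<nu> t r \<le> K * r powr (- p)"
proof -
  define F where "F = (LINT x|\<nu> t. small_power p x)"
  have F: "F \<ge> 0" unfolding F_def by (intro Bochner_Integration.integral_nonneg small_power_nonneg)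
  obtain b where b: "\<And>s. 0 \<le> s \<Longrightarrow> s \<le> t \<Longrightarrow> \<bar>B s\<bar> \<le> b"
    using B_bounded[of t] by blast
  have b0: "b \<ge> 0" using b[of t] t by linarith
  define K where "K = G1 \<nu> t 1 + 3 * F + b"
  have K: "K \<ge> 0" using F b0 G1_nonneg[of t 1] by (simp add: K_def)
  have "y1 B C \<nu> t r \<le> K * r powr (- p)" if r: "0 < r" "r \<le> 1" for r
  proof -
    have rp: "1 \<le> r powr (- p)" using powr_mono'[of "-p" 0 r] r p by simp
    have lb: "r powr p \<le> \<bar>x\<bar> powr p" if "\<bar>x\<bar> > r" for x using that r p by (intro powr_mono2) auto
    have ip: "integrable (\<nu> t) (\<lambda>x. a * small_power p x)" for a using int by simp
    have it: "integrable (\<nu> t) (\<lambda>x. indicator {x. \<bar>x\<bar> > a} x :: real)" if "a > 0" for a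
      using that by (rule integrable_levy[OF t levy_dominated_tail])
    have G: "G1 \<nu> t r \<le> G1 \<nu> t 1 + F * r powr (- p)"
    proof -
      have le: "indicator {x. \<bar>x\<bar> > r} x \<le> indicator {x. \<bar>x\<bar> > 1} x + r powr (- p) * small_power p x" for x
        using lb[of x] small_power_nonneg[of p x] r
        by (auto simp: indicator_def small_power_eq powr_minus field_simps)
      have "G1 \<nu> t r \<le> (LINT x|\<nu> t. indicator {x. \<bar>x\<bar> > 1} x + r powr (- p) * small_power p x)"
        unfolding G1_eq[OF t r(1)]
        by (rule integral_mono[OF it Bochner_Integration.integrable_add[OF it ip] le]) (use r in auto)
      also have "\<dots> = (LINT x|\<nu> t. indicator {x. \<bar>x\<bar> > 1} x) + (LINT x|\<nu> t. r powr (- p) * small_power p x)"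
        by (rule Bochner_Integration.integral_add[OF it ip]) simp
      also have "\<dots> = G1 \<nu> t 1 + r powr (- p) * F" unfolding F_def G1_eq[OF t zero_less_one] by (simp only: integral_mult_right_zero)
      finally show ?thesis by (simp add: mult.commute)
    qed
    have Kb: "K1 C \<nu> t r \<le> F * r powr (- p)"
    proof -
      have le: "x\<^sup>2 * indicator {x. \<bar>x\<bar> \<le> r} x \<le> r powr (2 - p) * small_power p x" for x
      proof (cases "\<bar>x\<bar> \<le> r")
        case True
        have "x\<^sup>2 = \<bar>x\<bar> powr ((2 - p) + p)" by (cases "x = 0") (auto simp: powr_numeral)
        also have "\<dots> \<le> r powr (2 - p) * \<bar>x\<bar> powr p" using True r p by (intro powr_split_le) auto
        finally show ?thesis using True r by (simp add: small_power_eq)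
      qed (simp add: small_power_nonneg)
      have "(LINT x|\<nu> t. x\<^sup>2 * indicator {x. \<bar>x\<bar> \<le> r} x) \<le> (LINT x|\<nu> t. r powr (2 - p) * small_power p x)"
        using le t r by (intro integral_mono ip) (auto intro!: integrable_levy levy_dominated_square)
      also have "\<dots> = r powr (2 - p) * F" unfolding F_def by (rule integral_mult_right_zero)
      finally have "K1 C \<nu> t r \<le> r powr (2 - p) * F / r\<^sup>2" unfolding K1_eq C by (intro divide_right_mono) auto
      also have "\<dots> = F * r powr (- p)" using r by (simp add: powr_diff powr_minus powr_numeral field_simps)
      finally show ?thesis .
    qed
    have M: "M1_star B \<nu> t r \<le> (b + F) * r powr (- p)"
    proof (rule M1_star_least[OF t])
      fix s assume s: "0 \<le> s" "s \<le> t"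
      have ints: "integrable (\<nu> s) (small_power p)" using int s by (intro integrable_mono_time[OF s]) auto
      have Fs: "(LINT x|\<nu> s. small_power p x) \<le> F" unfolding F_def by (rule integral_small_power_mono[OF s int])
      have rr: "r powr (1 - p) / r = r powr (- p)" using r by (simp add: powr_diff powr_minus field_simps)
      have "\<bar>drift s r\<bar> / r \<le> (b + F) * r powr (- p)"
      proof (cases "p < 1")
        case True
        have le: "\<bar>trunc r x\<bar> \<le> r powr (1 - p) * small_power p x" if "\<bar>x\<bar> \<le> r" for x
        proof -
          have "\<bar>x\<bar> = \<bar>x\<bar> powr ((1 - p) + p)" by simp
          also have "\<dots> \<le> r powr (1 - p) * \<bar>x\<bar> powr p" using that r True p by (intro powr_split_le) auto
          finally show ?thesis using that r by (simp add: small_power_eq trunc_eq)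
        qed
        have le': "\<bar>trunc r x\<bar> \<le> r powr (1 - p) * small_power p x" for x
          using le[of x] small_power_nonneg[of p x] by (cases "\<bar>x\<bar> \<le> r") (auto simp: trunc_eq)
        have [measurable_cong]: "sets (\<nu> s) = sets borel" using s by (simp add: sets_levy)
        have i1: "integrable (\<nu> s) (small_power 1)"
          by (rule integrable_small_power_mono[OF sets_levy[OF s(1)] ints]) (use True in simp)
        have "drift s r = (LINT x|\<nu> s. trunc r x)"
          using drift_free[OF True s] by (simp add: drift_eq_\<gamma>0[OF s(1) i1 r])
        then have "\<bar>drift s r\<bar> \<le> (LINT x|\<nu> s. \<bar>trunc r x\<bar>)" by simp
        also have "\<dots> \<le> (LINT x|\<nu> s. r powr (1 - p) * small_power p x)"
          using ints le' by (intro integral_mono integrable_abs integrable_trunc s i1 r integrable_mult_right) auto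
        also have "\<dots> = r powr (1 - p) * (LINT x|\<nu> s. small_power p x)" by (rule integral_mult_right_zero)
        also have "\<dots> \<le> r powr (1 - p) * F" using Fs by (rule mult_left_mono) simp
        finally have "\<bar>drift s r\<bar> / r \<le> r powr (1 - p) * F / r" using r by (intro divide_right_mono) auto
        also have "\<dots> = F * (r powr (1 - p) / r)" by simp
        also have "\<dots> = F * r powr (- p)" unfolding rr ..
        also have "\<dots> \<le> (b + F) * r powr (- p)" using b0 by (intro mult_right_mono) auto
        finally show ?thesis .
      next
        case False
        have le: "\<bar>trunc r x - trunc 1 x\<bar> \<le> r powr (1 - p) * small_power p x" for x
        proof (cases "r < \<bar>x\<bar> \<and> \<bar>x\<bar> \<le> 1")
          case True
          have "\<bar>x\<bar> = \<bar>x\<bar> powr (1 - p) * \<bar>x\<bar> powr p" using True r by (simp flip: powr_add)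
          also have "\<dots> \<le> r powr (1 - p) * \<bar>x\<bar> powr p"
            using True r False by (intro mult_right_mono powr_mono2') auto
          finally show ?thesis using True by (simp add: small_power_eq trunc_eq)
        next
          case F: False
          then have "trunc r x - trunc 1 x = 0" using r by (auto simp: trunc_eq)
          then show ?thesis by (simp add: small_power_nonneg)
        qed
        have "\<bar>drift s r\<bar> \<le> \<bar>B s\<bar> + (LINT x|\<nu> s. \<bar>trunc r x - trunc 1 x\<bar>)"
          unfolding drift_def by (rule order_trans[OF abs_triangle_ineq add_left_mono[OF integral_abs_bound]])
        also have "(LINT x|\<nu> s. \<bar>trunc r x - trunc 1 x\<bar>) \<le> (LINT x|\<nu> s. r powr (1 - p) * small_power p x)"
        proof (rule integral_mono)
          show "integrable (\<nu> s) (\<lambda>x. \<bar>trunc r x - trunc 1 x\<bar>)"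
            using r s by (intro integrable_abs integrable_levy levy_dominated_trunc_diff) auto
        qed (use ints le in auto)
        also have "\<dots> = r powr (1 - p) * (LINT x|\<nu> s. small_power p x)" by (rule integral_mult_right_zero)
        also have "\<dots> \<le> r powr (1 - p) * F" using Fs by (rule mult_left_mono) simp
        finally have "\<bar>drift s r\<bar> \<le> b + r powr (1 - p) * F" using b[OF s] by simp
        moreover have "b \<le> b * r powr (1 - p)"
          using powr_mono'[of "1 - p" 0 r] r False b0 by (intro mult_left_mono[of 1 _ b, simplified]) auto
        ultimately have "\<bar>drift s r\<bar> \<le> (b + F) * r powr (1 - p)" by (simp add: algebra_simps)
        then have "\<bar>drift s r\<bar> / r \<le> (b + F) * r powr (1 - p) / r" using r by (intro divide_right_mono) auto
        also have "\<dots> = (b + F) * (r powr (1 - p) / r)" by simp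
        also have "\<dots> = (b + F) * r powr (- p)" unfolding rr ..
        finally show ?thesis .
      qed
      then show "M1 B \<nu> s r \<le> (b + F) * r powr (- p)" using s r by (simp add: M1_eq)
    qed
    have "G1 \<nu> t 1 * 1 \<le> G1 \<nu> t 1 * r powr (- p)" using rp G1_nonneg[of t 1] by (rule mult_left_mono)
    then show ?thesis using G Kb M unfolding y1_def K_def by (simp add: algebra_simps)
  qed
  then show ?thesis using K by blast
qed

end

section \<open>Bounds for the upper index from moments of the small jumps\<close>

context time_changed_vector
begin

text \<open>Growth read backwards from the fixed time \<open>t1\<close> to \<open>r powr a\<close>
  gains \<open>r powr (a * \<sigma>)\<close>. When a \<sigma> > p this beats the bound at
  \<open>t1\<close>, so the level is not passed before \<open>r powr a\<close>.\<close>

lemma upper_index_le_of_power_bound: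
  assumes t1: "0 < t1" "t1 \<le> t0" and p: "0 \<le> p"
    and bound: "eventually (\<lambda>r. Y t1 r \<le> K * r powr (- p)) at_0"
  shows "upper_index n \<le> ennreal (p / \<sigma>)"
proof (rule ccontr)
  assume "\<not> ?thesis"
  then obtain a where a: "a > p / \<sigma>" "ennreal a < upper_index n"
    using exponent_between_below p \<sigma>_pos by (metis divide_nonneg_pos not_le)
  define \<epsilon> where "\<epsilon> = (a * \<sigma> - p) / 2"
  have \<epsilon>: "\<epsilon> > 0" "a * \<sigma> - p = 2 * \<epsilon>" using a \<sigma>_pos by (auto simp: \<epsilon>_def field_simps)
  have a0: "a > 0" using a p \<sigma>_pos by (meson divide_nonneg_pos order_le_less_trans)
  define K' where "K' = \<bar>K\<bar> + 1"
  have pos: "m * t1 powr \<sigma> / K' > 0" using m_pos t1 by (simp add: K'_def)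
  have "eventually (\<lambda>r. ennreal (r powr a) \<le> n r) at_0"
    using bound eventually_le_b Y_growth[OF \<epsilon>(1)] eventually_powr_less[OF a0 t1(1)]
      eventually_powr_less[OF \<epsilon>(1) pos]
  proof eventually_elim
    case (elim r)
    then have r: "0 < r" "r < 1" "r \<le> b" by auto
    have "Y (r powr a) r \<le> m"
    proof -
      have "r powr \<epsilon> * (t1 / r powr a) powr \<sigma> * Y (r powr a) r \<le> Y t1 r" using elim r t1 by auto
      also have "\<dots> \<le> K' * r powr (- p)"
        using elim(1) by (rule order_trans) (auto simp: K'_def intro!: mult_right_mono)
      finally have "r powr \<epsilon> * (t1 powr \<sigma> / r powr (a * \<sigma>)) * Y (r powr a) r \<le> K' * r powr (- p)"
        by (simp add: powr_divide powr_powr)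
      then have "Y (r powr a) r \<le> K' / t1 powr \<sigma> * (r powr (a * \<sigma>) * r powr (- p) * r powr (- \<epsilon>))"
        using r t1 by (simp add: field_simps powr_minus)
      also have "r powr (a * \<sigma>) * r powr (- p) * r powr (- \<epsilon>) = r powr \<epsilon>"
        using \<epsilon>(2) by (simp flip: powr_add)
      also have "K' / t1 powr \<sigma> * r powr \<epsilon> \<le> m" using elim t1 by (simp add: field_simps K'_def)
      finally show ?thesis .
    qed
    then have "Y t r \<le> m" if "0 < t" "t < r powr a" for t using Y_mono[of t "r powr a" r] that r by auto
    then show ?case by (intro passage_ge)
  qed
  then have "upper_index n \<le> ennreal a" using a0 by (intro upper_index_le) auto
  then show False using a by simp
qed

lemma y_power_bound:
  assumes t: "0 \<le> t" and p: "0 < p" "p \<le> 2" and int: "\<And>i. integrable (\<nu> i t) (small_power p)" and C: "\<And>i. C i t = 0"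
    and drift_free: "p < 1 \<Longrightarrow> (\<And>i s. 0 \<le> s \<Longrightarrow> s \<le> t \<Longrightarrow> \<gamma>0 (B i) (\<nu> i) s = 0)"
  shows "\<exists>K. \<forall>r. 0 < r \<longrightarrow> r \<le> 1 \<longrightarrow> y t r \<le> K * r powr (- p)"
proof -
  have "\<exists>K\<ge>0. \<forall>r. 0 < r \<longrightarrow> r \<le> 1 \<longrightarrow> y1 (B i) (C i) (\<nu> i) t r \<le> K * r powr (- p)" for i
    using comp.y1_power_bound[OF t p int C] drift_free by blast
  then obtain K where K: "\<And>i r. 0 < r \<Longrightarrow> r \<le> 1 \<Longrightarrow> y1 (B i) (C i) (\<nu> i) t r \<le> K i * r powr (- p)" by metis
  have "y t r \<le> (\<Sum>i\<in>UNIV. K i) * r powr (- p)" if "0 < r" "r \<le> 1" for r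
    unfolding y_fun_def sum_distrib_right using that by (intro sum_mono K)
  then show ?thesis by blast
qed

lemma small_time:
  assumes "(v \<longlongrightarrow> 0) at_0" "\<tau> > 0" "T > 0"
  shows "\<exists>t1. 0 < t1 \<and> t1 \<le> T \<and> v t1 \<le> \<tau>"
proof -
  have "eventually (\<lambda>t. v t < \<tau>) at_0" using assms by (intro order_tendstoD)
  then have "eventually (\<lambda>t. 0 < t \<and> t < T \<and> v t < \<tau>) at_0"
    using eventually_pos eventually_below[OF assms(3)] by eventually_elim auto
  then obtain t where "0 < t \<and> t < T \<and> v t < \<tau>"
    using eventually_happens trivial_limit_at_right_real by blast
  then show ?thesis by (auto intro!: exI[of _ t])
qed

lemma C_eq_0:
  assumes "(\<Sum>j\<in>UNIV. C j \<tau>) = 0" "0 \<le> t" "t \<le> \<tau>"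
  shows "C i t = 0"
proof -
  have "C i \<tau> = 0" using assms comp.C_nonneg[of \<tau>] by (subst (asm) sum_nonneg_eq_0_iff) auto
  then show ?thesis using comp.C_le[OF assms(2,3), of i] comp.C_nonneg[OF assms(2), of i] by simp
qed

text \<open>The case p = 1 of the power bound: finite variation of the small jumps and no Gaussian
  part at one small time.\<close>

lemma upper_index_le_of_finite_variation:
  assumes v0: "(v \<longlongrightarrow> 0) at_0"
    and \<tau>: "\<tau> > 0" "(\<Sum>j\<in>UNIV. small_jump_variation (\<nu> j) \<tau>) < \<infinity>" "(\<Sum>j\<in>UNIV. C j \<tau>) = 0"
  shows "upper_index n \<le> ennreal (1 / \<sigma>)"
proof -
  obtain t1 where t1: "0 < t1" "t1 \<le> t0" "v t1 \<le> \<tau>" using small_time[OF v0 \<tau>(1) t0_pos] by blast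
  have vt: "0 \<le> v t1" using v_nonneg t1 by simp
  have "integrable (\<nu> i (v t1)) (small_power 1)" for i
  proof (rule comp.integrable_mono_time[OF vt t1(3)])
    have "small_jump_variation (\<nu> i) \<tau> \<le> (\<Sum>j\<in>UNIV. small_jump_variation (\<nu> j) \<tau>)"
      by (rule member_le_sum) auto
    then have "small_jump_variation (\<nu> i) \<tau> < \<infinity>" using \<tau>(2) by (rule le_less_trans)
    then show "integrable (\<nu> i \<tau>) (small_power 1)"
      using small_jump_variation_finite_iff[of "\<nu> i" \<tau>, OF comp.levy] \<tau>(1) by simp
  qed simp
  then obtain K where K: "\<And>r. 0 < r \<Longrightarrow> r \<le> 1 \<Longrightarrow> y (v t1) r \<le> K * r powr (- 1)"
    using y_power_bound[of "v t1" 1] vt C_eq_0[OF \<tau>(3) vt t1(3)] by auto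
  have "eventually (\<lambda>r. Y t1 r \<le> K * r powr (- 1)) at_0" using eventually_unit
    by eventually_elim (rule K, auto)
  then show ?thesis using upper_index_le_of_power_bound[OF t1(1,2), of 1 K] by simp
qed

text \<open>A real supremum controls its members only if they are bounded above; finite variation of
  the small jumps and boundedness of \<open>B\<close> on compact intervals provide this.\<close>

lemma \<gamma>0_eq_0:
  assumes "\<gamma>0_star (B i) (\<nu> i) e = 0" "0 \<le> s" "s \<le> e" "integrable (\<nu> i e) (small_power 1)"
  shows "\<gamma>0 (B i) (\<nu> i) s = 0"
proof -
  have e: "0 \<le> e" using assms by simp
  obtain b where b: "\<And>s. 0 \<le> s \<Longrightarrow> s \<le> e \<Longrightarrow> \<bar>B i s\<bar> \<le> b"
    using comp.B_bounded[of e i] by blast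
  have "\<bar>\<gamma>0 (B i) (\<nu> i) u\<bar> \<le> b + (LINT x|\<nu> i e. small_power 1 x)" if u: "0 \<le> u" "u \<le> e" for u
  proof -
    have iu: "integrable (\<nu> i u) (small_power 1)" using assms by (intro comp.integrable_mono_time[OF u]) auto
    have "\<bar>LINT x|\<nu> i u. trunc 1 x\<bar> \<le> (LINT x|\<nu> i u. \<bar>trunc 1 x\<bar>)" by simp
    also have "\<dots> = (LINT x|\<nu> i u. small_power 1 x)"
      by (intro Bochner_Integration.integral_cong) (auto simp: trunc_def small_power_def abs_mult)
    also have "\<dots> \<le> (LINT x|\<nu> i e. small_power 1 x)" by (rule comp.integral_small_power_mono[OF u assms(4)])
    finally show ?thesis unfolding comp.\<gamma>0_eq using b[OF u] by linarith
  qed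
  then have "bdd_above ((\<lambda>u. \<bar>\<gamma>0 (B i) (\<nu> i) u\<bar>) ` {0..e})" by (intro bdd_aboveI2) auto
  then have "\<bar>\<gamma>0 (B i) (\<nu> i) s\<bar> \<le> \<gamma>0_star (B i) (\<nu> i) e"
    unfolding \<gamma>0_star_def using assms by (intro cSUP_upper) auto
  then show ?thesis using assms by simp
qed

lemma drift_free_time:
  assumes df: "drift_free_initially B \<nu>" and \<tau>: "\<tau> > 0" and int: "\<And>i. integrable (\<nu> i \<tau>) (small_power 1)"
  shows "\<exists>e. 0 < e \<and> e \<le> \<tau> \<and> (\<forall>i s. 0 \<le> s \<longrightarrow> s \<le> e \<longrightarrow> \<gamma>0 (B i) (\<nu> i) s = 0)"
proof -
  have "\<exists>e>0. e < \<tau> \<and> \<gamma>0_star (B i) (\<nu> i) e = 0" for i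
    using df \<tau> int[of i] small_jump_variation_finite_iff[of "\<nu> i" \<tau>, OF comp.levy] unfolding drift_free_initially_def by auto
  then obtain e where e: "\<And>i. 0 < e i" "\<And>i. e i < \<tau>" "\<And>i. \<gamma>0_star (B i) (\<nu> i) (e i) = 0" by metis
  define d where "d = Min (range e)"
  have d: "0 < d" "\<And>i. d \<le> e i" using e(1) by (auto simp: d_def)
  have "\<gamma>0 (B i) (\<nu> i) s = 0" if "0 \<le> s" "s \<le> d" for i s
  proof (rule \<gamma>0_eq_0[OF e(3)])
    show "s \<le> e i" using that d(2)[of i] by simp
    show "integrable (\<nu> i (e i)) (small_power 1)"
      using int e(1,2)[of i] by (intro comp.integrable_mono_time[of "e i" \<tau>]) auto
  qed (use that in auto)
  moreover have "d \<le> \<tau>" using d(2) e(2) by (meson less_imp_le order_trans)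
  ultimately show ?thesis using d(1) by blast
qed

lemma G1_le_y1: "0 \<le> t \<Longrightarrow> 0 < r \<Longrightarrow> G1 (\<nu> i) t r \<le> y1 (B i) (C i) (\<nu> i) t r"
  unfolding y1_def using comp.K1_nonneg[of t i r] comp.M1_star_nonneg[of r t i] by simp

text \<open>One inequality holds because G is at most y. For the other, suppose exponents a < d lie
  between the two indices. Then G is at most m at time \<open>r powr a\<close>, and the growth
  hypothesis carries this to a bound on the tail at one fixed time. The tail bound yields a jump
  moment of order q below d \<sigma>, and the resulting power bound on y puts the upper index at or
  below q / \<sigma>, which is less than d.\<close>

lemma upper_index_eq_tail_passage:
  assumes v0: "(v \<longlongrightarrow> 0) at_0" and df: "drift_free_initially B \<nu>"
    and \<tau>: "\<tau> > 0" "(\<Sum>j\<in>UNIV. C j \<tau>) = 0"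
    and t0': "t0' > 0" and r0: "r0 > 0" and \<sigma>': "\<sigma>' \<le> \<sigma>" and c': "slow_on {0<..<r0} c'"
    and G: "\<And>t1 t2 r. 0 < t1 \<Longrightarrow> t1 < t2 \<Longrightarrow> t2 \<le> t0' \<Longrightarrow> r \<in> {0<..<r0} \<Longrightarrow>
             G_fun \<nu> (v t2) r \<le> inverse (c' r) * (t2 / t1) powr \<sigma>' * G_fun \<nu> (v t1) r"
  shows "upper_index n = upper_index (passage (\<lambda>t r. G_fun \<nu> (v t) r) m)" (is "_ = upper_index ?n")
proof (rule antisym)
  show "upper_index ?n \<le> upper_index n"
  proof (rule ccontr)
    assume "\<not> ?thesis"
    then obtain a where a: "a > 0" "upper_index n < ennreal a" "ennreal a < upper_index ?n"
      using ennreal_real_between by (metis not_le)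
    have "eventually (\<lambda>r. ennreal (r powr a) \<le> ?n r) at_0"
      using upper_index_gt[OF a(2)] eventually_pos
    proof eventually_elim
      case (elim r)
      show ?case
      proof (rule passage_ge)
        fix t assume t: "0 < t" "t < r powr a"
        then have "ennreal t < ennreal (r powr a)" by (simp add: ennreal_less_iff)
        then have "Y t r \<le> m" using elim t by (intro passage_below) (auto intro: less_trans)
        moreover have "G_fun \<nu> (v t) r \<le> Y t r"
          unfolding G_fun_def y_fun_def using t elim by (intro sum_mono G1_le_y1 v_nonneg) auto
        ultimately show "G_fun \<nu> (v t) r \<le> m" by simp
      qed
    qed
    then have "upper_index ?n \<le> ennreal a" using a by (intro upper_index_le) auto
    then show False using a by simp
  qed
  show "upper_index n \<le> upper_index ?n"
  proof (rule ccontr)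
    assume "\<not> ?thesis"
    then obtain d where d: "d > 0" "upper_index ?n < ennreal d" "ennreal d < upper_index n"
      using ennreal_real_between by (metis not_le)
    then obtain a where a: "0 < a" "a < d" "upper_index ?n < ennreal a" using exponent_between_above by blast
    \<comment> \<open>As 3 \<epsilon> is the whole gap between a \<sigma> and d \<sigma>, one
      \<epsilon> can go to the slow factor and the constants and one to the passage from tails to
      moments, with \<open>p\<close> still below d \<sigma>.\<close>
    define \<epsilon> where "\<epsilon> = (d - a) * \<sigma> / 3"
    have \<epsilon>: "\<epsilon> > 0" using a \<sigma>_pos by (simp add: \<epsilon>_def)
    define p where "p = a * \<sigma> + 2 * \<epsilon>"
    have p: "0 < a * \<sigma>" "p < d * \<sigma>" using a \<sigma>_pos \<epsilon> by (auto simp: p_def \<epsilon>_def field_simps)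
    obtain t1 where t1: "0 < t1" "t1 \<le> min t0 t0'" "v t1 \<le> \<tau>"
      using small_time[OF v0 \<tau>(1), of "min t0 t0'"] t0_pos t0' by auto
    have vt: "0 \<le> v t1" using v_nonneg t1 by simp
    define K where "K = t1 powr \<sigma> * m"
    have K: "K > 0" using t1 m_pos by (simp add: K_def)
    have slow: "eventually (\<lambda>r. r powr (\<epsilon> / 2) \<le> c' r) at_0"
    proof (rule slow_on_ge_powr[OF c'])
      show "eventually (\<lambda>r. r \<in> {0<..<r0}) at_0" using eventually_pos eventually_below[OF r0] by eventually_elim auto
    qed (use \<epsilon> in simp)
    have e: "\<epsilon> / 2 > 0" "1 / K > 0" using \<epsilon> K by auto
    have tail: "eventually (\<lambda>r. G_fun \<nu> (v t1) r \<le> r powr (- (a * \<sigma> + \<epsilon>))) at_0"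
      using upper_index_gt[OF a(3)] slow eventually_unit eventually_below[OF r0] eventually_powr_less[OF a(1) t1(1)]
        eventually_powr_less[OF e]
    proof eventually_elim
      case (elim r)
      have Gm: "G_fun \<nu> (v (r powr a)) r \<le> m" using elim by (intro passage_below[of _ "\<lambda>t r. G_fun \<nu> (v t) r"]) auto
      have "0 < r powr (\<epsilon> / 2)" using elim by simp
      then have "0 < c' r" using elim by linarith
      then have ic: "0 < inverse (c' r)" "inverse (c' r) \<le> r powr (- (\<epsilon> / 2))"
        using elim le_imp_inverse_le[of "r powr (\<epsilon> / 2)" "c' r"] by (auto simp: powr_minus)
      have "G_fun \<nu> (v t1) r \<le> inverse (c' r) * (t1 / r powr a) powr \<sigma>' * G_fun \<nu> (v (r powr a)) r"
        using elim t1 by (intro G) auto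
      also have "\<dots> \<le> inverse (c' r) * (t1 / r powr a) powr \<sigma>' * m"
        using Gm ic by (intro mult_left_mono) auto
      \<comment> \<open>Here \<sigma>' \<le> \<sigma> enters: the base \<open>t1 / r powr a\<close>
        exceeds 1 for small r.\<close>
      also have "\<dots> \<le> r powr (- (\<epsilon> / 2)) * (t1 / r powr a) powr \<sigma> * m"
        using ic \<sigma>' elim m_pos by (intro mult_mono powr_mono) (auto simp: field_simps)
      also have "(t1 / r powr a) powr \<sigma> = t1 powr \<sigma> * r powr (- (a * \<sigma>))"
        using elim t1 by (simp add: powr_divide powr_powr powr_minus_divide)
      also have "r powr (- (\<epsilon> / 2)) * (t1 powr \<sigma> * r powr (- (a * \<sigma>))) * m = K * r powr (- (\<epsilon> / 2) - a * \<sigma>)"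
      proof -
        have "r powr (- (\<epsilon> / 2) - a * \<sigma>) = r powr (- (\<epsilon> / 2)) * r powr (- (a * \<sigma>))" by (simp flip: powr_add)
        then show ?thesis by (simp add: K_def mult_ac)
      qed
      also have "r powr (- (\<epsilon> / 2) - a * \<sigma>) = r powr (\<epsilon> / 2) * r powr (- (a * \<sigma> + \<epsilon>))"
        by (simp flip: powr_add)
      also have "K * (r powr (\<epsilon> / 2) * r powr (- (a * \<sigma> + \<epsilon>))) = (K * r powr (\<epsilon> / 2)) * r powr (- (a * \<sigma> + \<epsilon>))" by simp
      also have "\<dots> \<le> 1 * r powr (- (a * \<sigma> + \<epsilon>))" using elim K by (intro mult_right_mono) (auto simp: field_simps)
      finally show ?case by simp
    qed
    \<comment> \<open>Every Levy measure has second moments of its small jumps, so larger exponents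
      are cut at 2, the range of the power bound.\<close>
    define q where "q = min p 2"
    have q: "0 < q" "q \<le> 2" "q < d * \<sigma>" using p \<epsilon> by (auto simp: q_def p_def)
    have int1: "integrable (\<nu> i (v t1)) (small_power q)" for i
    proof (cases "p < 2")
      case True
      show ?thesis
      proof (rule levy_measure_integrable_power[OF comp.levy[OF vt], of "a * \<sigma> + \<epsilon>"])
        show "eventually (\<lambda>r. measure (\<nu> i (v t1)) {x. r < \<bar>x\<bar>} \<le> r powr (- (a * \<sigma> + \<epsilon>))) at_0"
          using tail
        proof eventually_elim
          case (elim r)
          have "G1 (\<nu> i) (v t1) r \<le> G_fun \<nu> (v t1) r"
            unfolding G_fun_def by (rule member_le_sum) (auto simp: G1_def)
          then show ?case using elim by (simp add: G1_def)
        qed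
      qed (use True \<epsilon> p in \<open>auto simp: q_def p_def\<close>)
    next
      case False
      then show ?thesis using levy_measure_integrable_square[OF comp.levy[OF vt]] by (simp add: q_def)
    qed
    \<comment> \<open>For q < 1 the small jumps have finite variation at time \<open>v t1\<close>,
      so the drift-free hypothesis makes \<open>\<gamma>0\<close> vanish on an initial interval;
      \<open>t2\<close> is moved back until \<open>v t2\<close> lies in it.\<close>
    have "\<exists>t2. 0 < t2 \<and> t2 \<le> t1 \<and> (q < 1 \<longrightarrow> (\<forall>i s. 0 \<le> s \<longrightarrow> s \<le> v t2 \<longrightarrow> \<gamma>0 (B i) (\<nu> i) s = 0))"
    proof (cases "q < 1")
      case True
      have "integrable (\<nu> i (v t1)) (small_power 1)" for i
        by (rule integrable_small_power_mono[OF comp.sets_levy[OF vt] int1]) (use True in simp)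
      then obtain e where e: "0 < e" "\<And>i s. 0 \<le> s \<Longrightarrow> s \<le> e \<Longrightarrow> \<gamma>0 (B i) (\<nu> i) s = 0"
        using drift_free_time[OF df v_pos[OF t1(1)]] by blast
      obtain t2 where "0 < t2" "t2 \<le> t1" "v t2 \<le> e" using small_time[OF v0 e(1) t1(1)] by blast
      then show ?thesis using e(2) by (intro exI[of _ t2]) auto
    qed (use t1 in \<open>auto intro!: exI[of _ t1]\<close>)
    then obtain t2 where t2: "0 < t2" "t2 \<le> t1"
      "q < 1 \<longrightarrow> (\<forall>i s. 0 \<le> s \<longrightarrow> s \<le> v t2 \<longrightarrow> \<gamma>0 (B i) (\<nu> i) s = 0)" by blast
    have v2: "0 \<le> v t2" "v t2 \<le> v t1" using t2 v_nonneg v_le by auto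
    obtain K2 where K2: "\<And>r. 0 < r \<Longrightarrow> r \<le> 1 \<Longrightarrow> y (v t2) r \<le> K2 * r powr (- q)"
    proof -
      have "integrable (\<nu> i (v t2)) (small_power q)" for i by (rule comp.integrable_mono_time[OF v2 int1]) simp
      moreover have "C i (v t2) = 0" for i using C_eq_0[OF \<tau>(2) v2(1)] v2 t1 by simp
      ultimately have "\<exists>K. \<forall>r. 0 < r \<longrightarrow> r \<le> 1 \<longrightarrow> y (v t2) r \<le> K * r powr (- q)"
        using t2(3) by (intro y_power_bound v2(1) q(1,2)) auto
      then show ?thesis using that by blast
    qed
    have "eventually (\<lambda>r. Y t2 r \<le> K2 * r powr (- q)) at_0" using eventually_unit
      by eventually_elim (rule K2, auto)
    then have "upper_index n \<le> ennreal (q / \<sigma>)"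
      using t1 t2 q by (intro upper_index_le_of_power_bound[of t2 q K2]) auto
    also have "\<dots> \<le> ennreal d" using q \<sigma>_pos by (intro ennreal_leI) (simp add: field_simps)
    finally show False using d(3) by (simp add: not_less[symmetric])
  qed
qed

end

section \<open>Increasing processes\<close>

lemma exp_minus_1_approx:
  fixes z :: complex
  assumes "norm z \<le> 1"
  shows "norm (exp z - 1 - z) \<le> 3 * (norm z)\<^sup>2"
proof -
  have "norm (exp z - (\<Sum>k\<le>1. z ^ k / (fact k))) \<le> exp \<bar>Re z\<bar> * (norm z) ^ Suc 1 / fact 1"
    by (rule Taylor_exp)
  then have "norm (exp z - (1 + z)) \<le> exp \<bar>Re z\<bar> * (norm z)\<^sup>2" by (simp add: power2_eq_square)
  also have "exp \<bar>Re z\<bar> \<le> exp 1" using abs_Re_le_cmod[of z] assms by simp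
  also have "exp 1 \<le> (3 :: real)" by (rule exp_le)
  finally have "norm (exp z - (1 + z)) \<le> 3 * (norm z)\<^sup>2" by (simp add: mult_right_mono)
  then show ?thesis by (simp add: diff_diff_eq)
qed

text \<open>Local invertibility of the exponential at 0, with radius and constant explicit; it
  recovers an increment of the exponent from its characteristic function.\<close>

lemma norm_le_exp_minus_1:
  fixes z :: complex
  assumes "norm z \<le> 1 / 6"
  shows "norm z \<le> 2 * norm (exp z - 1)"
proof -
  have "3 * (norm z)\<^sup>2 \<le> norm z / 2"
    using mult_right_mono[OF assms, of "norm z"] by (simp add: power2_eq_square)
  then have "norm (exp z - 1 - z) \<le> norm z / 2" using exp_minus_1_approx[of z] assms by linarith
  then show ?thesis using norm_triangle_ineq4[of "exp z - 1" "exp z - 1 - z"] by simp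
qed

lemma norm_iexp_minus_1_le: "0 \<le> z \<Longrightarrow> norm (iexp (u * z) - 1) \<le> (2 + \<bar>u\<bar>) * min 1 z"
proof -
  assume z: "0 \<le> z"
  have "norm (iexp (u * z) - 1) \<le> \<bar>u * z\<bar>" using iexp_approx1[of "u * z" 0] by simp
  moreover have "norm (iexp (u * z) - 1) \<le> 2" using norm_triangle_ineq4[of "iexp (u * z)" 1] by simp
  ultimately have "norm (iexp (u * z) - 1) \<le> (if z \<le> 1 then \<bar>u\<bar> * z else 2)" using z by (simp add: abs_mult)
  also have "\<dots> \<le> (2 + \<bar>u\<bar>) * min 1 z" using z by (auto simp: min_def algebra_simps)
  finally show ?thesis .
qed

lemma min_le_one_minus_exp: "0 \<le> z \<Longrightarrow> min 1 z \<le> 2 * (1 - exp (- z))" for z :: real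
proof -
  assume z: "0 \<le> z"
  define w where "w = min 1 z"
  have w: "0 \<le> w" "w \<le> 1" "w \<le> z" using z by (auto simp: w_def)
  have "exp (- z) \<le> exp (- w)" using w by simp
  also have "\<dots> \<le> 1 / (1 + w)" using exp_ge_add_one_self[of w] w by (simp add: exp_minus field_simps)
  also have "\<dots> \<le> 1 - w / 2"
  proof -
    have "w * w \<le> w * 1" using w by (intro mult_left_mono) auto
    then have "1 \<le> (1 - w / 2) * (1 + w)" by (simp add: algebra_simps)
    then show ?thesis using w by (simp add: field_simps)
  qed
  finally show ?thesis by (simp add: w_def[symmetric])
qed

text \<open>The normalised sum of the laws of the Z k, weighted by \<open>w\<close>, is realised as
  the image of a density on the product of {..<n} with the sample space. Its support and its
  characteristic function then come from image measures and Fubini.\<close>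

lemma (in prob_space) weighted_mixture:
  fixes Z :: "nat \<Rightarrow> 'a \<Rightarrow> real" and w :: "real \<Rightarrow> real"
  assumes Zm: "\<And>k. k < n \<Longrightarrow> Z k \<in> borel_measurable M"
    and w [measurable]: "w \<in> borel_measurable borel" and wb: "\<And>x. 0 \<le> w x" "\<And>x. w x \<le> c"
    and S: "S = (\<Sum>k<n. expectation (\<lambda>\<omega>. w (Z k \<omega>)))" "S > 0"
    and Z0: "\<And>k \<omega>. k < n \<Longrightarrow> \<omega> \<in> space M \<Longrightarrow> 0 \<le> Z k \<omega>"
  shows "\<exists>D. real_distribution D \<and> (AE x in D. 0 \<le> x) \<and>
     (\<forall>u. char D u = (\<Sum>k<n. CLINT \<omega>|M. of_real (w (Z k \<omega>)) * iexp (u * Z k \<omega>)) / of_real S)"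
proof -
  let ?I = "count_space {..<n}"
  let ?N = "?I \<Otimes>\<^sub>M M"
  interpret I: sigma_finite_measure ?I by (intro sigma_finite_measure_count_space_finite) simp
  interpret IM: pair_sigma_finite ?I M ..
  define F where "F = (\<lambda>(k, \<omega>). Z k \<omega>)"
  have F [measurable]: "F \<in> borel_measurable ?N"
    unfolding F_def by (rule measurable_pair_measure_countable1) (auto intro: Zm)
  define g where "g x = w (F x) / S" for x
  have g [measurable]: "g \<in> borel_measurable ?N" unfolding g_def by measurable
  have g0: "0 \<le> g x" for x using wb S by (simp add: g_def)
  define Q where "Q = density ?N (\<lambda>x. ennreal (g x))"
  define D where "D = distr Q borel F"
  have FQ [measurable]: "F \<in> measurable Q borel" unfolding Q_def by simp
  have wZ: "integrable M (\<lambda>\<omega>. w (Z k \<omega>))" if "k < n" for k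
    by (rule integrable_const_bound[where B = c]) (use Zm[OF that] wb in \<open>auto intro: measurable_compose\<close>)
  have total: "emeasure Q (space Q) = 1"
  proof -
    have "emeasure Q (space Q) = (\<integral>\<^sup>+x. ennreal (g x) \<partial>?N)"
      unfolding Q_def by (subst emeasure_density) (auto intro!: nn_integral_cong simp: indicator_def)
    also have "\<dots> = (\<integral>\<^sup>+k. \<integral>\<^sup>+\<omega>. ennreal (g (k, \<omega>)) \<partial>M \<partial>?I)" by (rule nn_integral_fst[symmetric]) measurable
    also have "\<dots> = (\<Sum>k<n. \<integral>\<^sup>+\<omega>. ennreal (g (k, \<omega>)) \<partial>M)" by (simp add: nn_integral_count_space_finite)
    also have "\<dots> = (\<Sum>k<n. ennreal (expectation (\<lambda>\<omega>. w (Z k \<omega>)) / S))"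
    proof (rule sum.cong[OF refl])
      fix k assume "k \<in> {..<n}"
      then have "(\<integral>\<^sup>+\<omega>. ennreal (g (k, \<omega>)) \<partial>M) = ennreal (expectation (\<lambda>\<omega>. g (k, \<omega>)))"
        using wZ[of k] g0 by (intro nn_integral_eq_integral) (auto simp: g_def F_def)
      then show "(\<integral>\<^sup>+\<omega>. ennreal (g (k, \<omega>)) \<partial>M) = ennreal (expectation (\<lambda>\<omega>. w (Z k \<omega>)) / S)"
        by (simp add: g_def F_def)
    qed
    also have "\<dots> = ennreal (\<Sum>k<n. expectation (\<lambda>\<omega>. w (Z k \<omega>)) / S)"
      using wb S by (intro sum_ennreal) (auto intro!: divide_nonneg_pos Bochner_Integration.integral_nonneg)
    also have "(\<Sum>k<n. expectation (\<lambda>\<omega>. w (Z k \<omega>)) / S) = 1" using S by (simp flip: sum_divide_distrib)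
    finally show ?thesis by simp
  qed
  have "prob_space Q" by (rule prob_spaceI[OF total])
  then have D: "real_distribution D"
    unfolding D_def real_distribution_def real_distribution_axioms_def by (auto intro: prob_space.prob_space_distr)
  have AE: "AE x in D. 0 \<le> x"
    unfolding D_def
  proof (subst AE_distr_iff[OF FQ])
    show "AE x in Q. 0 \<le> F x"
      unfolding Q_def by (subst AE_density) (auto simp: F_def space_pair_measure intro!: AE_I2 Z0)
  qed simp
  have "char D u = (\<Sum>k<n. CLINT \<omega>|M. of_real (w (Z k \<omega>)) * iexp (u * Z k \<omega>)) / of_real S" for u
  proof -
    let ?f = "\<lambda>x. g x *\<^sub>R iexp (u * F x)"
    have fm: "?f \<in> borel_measurable ?N" by measurable
    have fin: "integrable ?N ?f"
    proof (rule integrableI_bounded[OF fm])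
      have "(\<integral>\<^sup>+x. ennreal (norm (?f x)) \<partial>?N) = (\<integral>\<^sup>+x. ennreal (g x) \<partial>?N)"
        using g0 by (intro nn_integral_cong) simp
      also have "\<dots> = emeasure Q (space Q)"
        unfolding Q_def by (subst emeasure_density) (auto intro!: nn_integral_cong simp: indicator_def)
      finally show "(\<integral>\<^sup>+x. ennreal (norm (?f x)) \<partial>?N) < \<infinity>" using total by simp
    qed
    have "char D u = (CLINT x|Q. iexp (u * F x))" unfolding char_def D_def by (rule integral_distr[OF FQ]) simp
    also have "\<dots> = (CLINT x|?N. ?f x)"
      unfolding Q_def by (rule integral_density) (use g0 in auto)
    also have "\<dots> = (CLINT k|?I. CLINT \<omega>|M. ?f (k, \<omega>))" by (rule IM.integral_fst'[OF fin, symmetric])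
    also have "\<dots> = (\<Sum>k<n. CLINT \<omega>|M. ?f (k, \<omega>))" by (simp add: lebesgue_integral_count_space_finite)
    also have "\<dots> = (\<Sum>k<n. (CLINT \<omega>|M. of_real (w (Z k \<omega>)) * iexp (u * Z k \<omega>)) / of_real S)"
    proof (rule sum.cong[OF refl])
      fix k
      have "(CLINT \<omega>|M. ?f (k, \<omega>)) = (CLINT \<omega>|M. (of_real (w (Z k \<omega>)) * iexp (u * Z k \<omega>)) / of_real S)"
        by (intro Bochner_Integration.integral_cong) (auto simp: g_def F_def scaleR_conv_of_real)
      then show "(CLINT \<omega>|M. ?f (k, \<omega>)) = (CLINT \<omega>|M. of_real (w (Z k \<omega>)) * iexp (u * Z k \<omega>)) / of_real S"
        by (simp only: integral_divide_zero)
    qed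
    finally show ?thesis by (simp add: sum_divide_distrib)
  qed
  then show ?thesis using D AE by blast
qed

lemma integral_halves_diff:
  fixes f g h :: "'a \<Rightarrow> real"
  assumes "integrable M f" "integrable M g" "integrable M h"
  shows "(LINT x|M. f x / 2 + g x / 2 - h x) = (LINT x|M. f x) / 2 + (LINT x|M. g x) / 2 - (LINT x|M. h x)"
  using assms by simp

lemma integral_diff_halves:
  fixes f g h :: "'a \<Rightarrow> real"
  assumes "integrable M f" "integrable M g" "integrable M h"
  shows "(LINT x|M. f x - g x / 2 - h x / 2) = (LINT x|M. f x) - (LINT x|M. g x) / 2 - (LINT x|M. h x) / 2"
  using assms by simp

locale increasing_component = additive_component \<nu> B C P X
  for \<nu> B C and P :: "'w measure" and X +
  assumes increasing: "\<And>\<omega>. \<omega> \<in> space P \<Longrightarrow> mono_on {0..} (\<lambda>t. X t \<omega>)"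
begin

text \<open>The logarithm of the characteristic function prescribed by the characteristics. Being a
  function of t, it telescopes along partitions, which a principal logarithm would not
  guarantee.\<close>

definition psi :: "real \<Rightarrow> real \<Rightarrow> complex" where
  "psi t u = Complex (- re_exponent t u) (im_exponent t u)"

definition inc :: "real \<Rightarrow> nat \<Rightarrow> nat \<Rightarrow> 'w \<Rightarrow> real" where
  "inc t N k \<omega> = X (real (Suc k) * t / real N) \<omega> - X (real k * t / real N) \<omega>"

definition dpsi :: "real \<Rightarrow> nat \<Rightarrow> nat \<Rightarrow> real \<Rightarrow> complex" where
  "dpsi t N k u = psi (real (Suc k) * t / real N) u - psi (real k * t / real N) u"

lemma inc_measurable [measurable]: "0 \<le> t \<Longrightarrow> inc t N k \<in> borel_measurable P"
  unfolding inc_def by (intro borel_measurable_diff rv) auto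

lemma inc_nonneg:
  assumes "0 \<le> t" "\<omega> \<in> space P"
  shows "0 \<le> inc t N k \<omega>"
proof -
  have "real k * t / real N \<le> real (Suc k) * t / real N" using assms by (intro divide_right_mono mult_right_mono) auto
  then show ?thesis using mono_onD[OF increasing[OF assms(2)], of "real k * t / real N" "real (Suc k) * t / real N"] assms
    unfolding inc_def by auto
qed

lemma indep_inc: "0 < t \<Longrightarrow> N > 0 \<Longrightarrow> indep_vars (\<lambda>_. borel) (inc t N) {..<N}"
  unfolding inc_def[abs_def] by (rule indep_increments_Suc) (auto intro: divide_strict_right_mono)

lemma sum_inc: "N > 0 \<Longrightarrow> \<omega> \<in> space P \<Longrightarrow> (\<Sum>k<N. inc t N k \<omega>) = X t \<omega>"
  unfolding inc_def using sum_lessThan_telescope[of "\<lambda>k. X (real k * t / real N) \<omega>" N] by (simp add: X_0)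

lemma sum_dpsi: "N > 0 \<Longrightarrow> (\<Sum>k<N. dpsi t N k u) = psi t u"
  unfolding dpsi_def using sum_lessThan_telescope[of "\<lambda>k. psi (real k * t / real N) u" N]
  by (simp add: psi_def re_exponent_0 im_exponent_0 complex_eq_iff)

lemma integrable_iexp_inc: "0 \<le> t \<Longrightarrow> integrable P (\<lambda>\<omega>. iexp (u * inc t N k \<omega>))"
  by (intro integrable_iexp) auto

lemma char_inc:
  assumes "0 \<le> t"
  shows "(CLINT \<omega>|P. iexp (u * inc t N k \<omega>)) = exp (dpsi t N k u)"
proof -
  have le: "real k * t / real N \<le> real (Suc k) * t / real N" "0 \<le> real k * t / real N"
    using assms by (auto intro!: divide_right_mono mult_right_mono)
  have m: "(\<lambda>\<omega>. X (real (Suc k) * t / real N) \<omega> - X (real k * t / real N) \<omega>) \<in> borel_measurable P"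
    using assms by (intro borel_measurable_diff rv) auto
  have "(CLINT \<omega>|P. iexp (u * inc t N k \<omega>)) = char (distr P borel (\<lambda>\<omega>. X (real (Suc k) * t / real N) \<omega> - X (real k * t / real N) \<omega>)) u"
    unfolding char_def inc_def by (rule integral_distr[OF m, symmetric]) simp
  also have "\<dots> = exp (dpsi t N k u)" unfolding char_increment[OF le(2,1)]
    by (simp add: dpsi_def psi_def complex_diff)
  finally show ?thesis .
qed

definition laplace_exponent :: "real \<Rightarrow> real" where
  "laplace_exponent t = - ln (expectation (\<lambda>\<omega>. exp (- X t \<omega>)))"

lemma integrable_exp_neg:
  assumes [measurable]: "Z \<in> borel_measurable P" and Z: "\<And>\<omega>. \<omega> \<in> space P \<Longrightarrow> 0 \<le> Z \<omega>"
  shows "integrable P (\<lambda>\<omega>. exp (- Z \<omega> :: real))"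
proof (rule integrable_const_bound[where B = 1])
  show "AE \<omega> in P. norm (exp (- Z \<omega>)) \<le> 1" by (rule AE_I2) (use Z in auto)
qed measurable

lemma integrable_min_inc: "0 \<le> t \<Longrightarrow> integrable P (\<lambda>\<omega>. min 1 (inc t N k \<omega>))"
  by (rule integrable_const_bound[where B = 1]) (auto intro!: AE_I2 simp: inc_nonneg)

text \<open>Taking logarithms in the product formula for the Laplace transform bounds the truncated first
  moments of the increments, uniformly over all partitions.\<close>

lemma sum_min_inc_le:
  assumes t: "0 < t" and N: "N > 0"
  shows "(\<Sum>k<N. expectation (\<lambda>\<omega>. min 1 (inc t N k \<omega>))) \<le> 2 * laplace_exponent t"
proof -
  have t0: "0 \<le> t" using t by simp
  define e where "e k = expectation (\<lambda>\<omega>. exp (- inc t N k \<omega>))" for k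
  have ie: "integrable P (\<lambda>\<omega>. exp (- inc t N k \<omega>))" for k
    by (rule integrable_exp_neg) (use t0 in \<open>auto intro: inc_nonneg\<close>)
  have "indep_vars (\<lambda>_. borel) (\<lambda>k \<omega>. exp (- inc t N k \<omega>)) {..<N}"
    by (rule indep_vars_compose2[OF indep_inc[OF t N]]) measurable
  then have "expectation (\<lambda>\<omega>. \<Prod>k<N. exp (- inc t N k \<omega>)) = (\<Prod>k<N. e k)"
    unfolding e_def by (intro indep_vars_lebesgue_integral) (use ie in auto)
  moreover have "expectation (\<lambda>\<omega>. \<Prod>k<N. exp (- inc t N k \<omega>)) = expectation (\<lambda>\<omega>. exp (- X t \<omega>))"
    by (intro Bochner_Integration.integral_cong refl) (simp add: sum_inc[OF N] sum_negf flip: exp_sum)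
  ultimately have prod: "(\<Prod>k<N. e k) = expectation (\<lambda>\<omega>. exp (- X t \<omega>))" by simp
  have e_pos: "e k > 0" for k
  proof -
    have "e k \<ge> 0" unfolding e_def by (intro Bochner_Integration.integral_nonneg) simp
    moreover have "e k \<noteq> 0"
    proof
      assume "e k = 0"
      then have "AE \<omega> in P. exp (- inc t N k \<omega>) = 0"
        unfolding e_def using ie by (subst (asm) integral_nonneg_eq_0_iff_AE) auto
      then show False by simp
    qed
    ultimately show ?thesis by simp
  qed
  have e_nz: "e k \<noteq> 0" for k using e_pos[of k] by simp
  have "ln (\<Prod>k<N. e k) = (\<Sum>k<N. ln (e k))" by (rule ln_prod) (simp_all add: e_nz e_pos)
  then have "laplace_exponent t = (\<Sum>k<N. - ln (e k))"
    unfolding laplace_exponent_def prod[symmetric] sum_negf by simp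
  also have "\<dots> \<ge> (\<Sum>k<N. 1 - e k)"
  proof (rule sum_mono)
    fix k show "1 - e k \<le> - ln (e k)" using ln_le_minus_one[OF e_pos[of k]] by simp
  qed
  finally have L: "(\<Sum>k<N. 1 - e k) \<le> laplace_exponent t" .
  have "(\<Sum>k<N. expectation (\<lambda>\<omega>. min 1 (inc t N k \<omega>))) \<le> (\<Sum>k<N. 2 * (1 - e k))"
  proof (rule sum_mono)
    fix k
    have "expectation (\<lambda>\<omega>. min 1 (inc t N k \<omega>)) \<le> expectation (\<lambda>\<omega>. 2 * (1 - exp (- inc t N k \<omega>)))"
      using ie t0 by (intro integral_mono integrable_min_inc min_le_one_minus_exp inc_nonneg) auto
    also have "\<dots> = 2 * (1 - e k)" unfolding e_def using ie by (simp add: prob_space)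
    finally show "expectation (\<lambda>\<omega>. min 1 (inc t N k \<omega>)) \<le> 2 * (1 - e k)" .
  qed
  also have "\<dots> = 2 * (\<Sum>k<N. 1 - e k)" by (rule sum_distrib_left[symmetric])
  finally show ?thesis using L by linarith
qed

lemma sum_norm_char_le:
  assumes t: "0 < t" and N: "N > 0"
  shows "(\<Sum>k<N. norm (exp (dpsi t N k u) - 1)) \<le> 2 * (2 + \<bar>u\<bar>) * laplace_exponent t"
proof -
  have t0: "0 \<le> t" using t by simp
  have "(\<Sum>k<N. norm (exp (dpsi t N k u) - 1)) \<le> (\<Sum>k<N. (2 + \<bar>u\<bar>) * expectation (\<lambda>\<omega>. min 1 (inc t N k \<omega>)))"
  proof (rule sum_mono)
    fix k
    have "(CLINT \<omega>|P. iexp (u * inc t N k \<omega>) - 1) = (CLINT \<omega>|P. iexp (u * inc t N k \<omega>)) - (CLINT \<omega>|P. 1)"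
      by (rule Bochner_Integration.integral_diff[OF integrable_iexp_inc[OF t0]]) simp
    moreover have "(CLINT \<omega>|P. 1) = 1" by (simp add: prob_space)
    ultimately have eq: "exp (dpsi t N k u) - 1 = (CLINT \<omega>|P. iexp (u * inc t N k \<omega>) - 1)"
      by (simp only: char_inc[OF t0])
    have "norm (exp (dpsi t N k u) - 1) \<le> (LINT \<omega>|P. norm (iexp (u * inc t N k \<omega>) - 1))"
      unfolding eq by (rule integral_norm_bound)
    also have "\<dots> \<le> (LINT \<omega>|P. (2 + \<bar>u\<bar>) * min 1 (inc t N k \<omega>))"
      using t0 by (intro integral_mono integrable_norm Bochner_Integration.integrable_diff integrable_iexp_inc
          integrable_mult_right integrable_min_inc norm_iexp_minus_1_le inc_nonneg) auto
    finally show "norm (exp (dpsi t N k u) - 1) \<le> (2 + \<bar>u\<bar>) * expectation (\<lambda>\<omega>. min 1 (inc t N k \<omega>))" by simp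
  qed
  also have "\<dots> = (2 + \<bar>u\<bar>) * (\<Sum>k<N. expectation (\<lambda>\<omega>. min 1 (inc t N k \<omega>)))" by (rule sum_distrib_left[symmetric])
  also have "\<dots> \<le> (2 + \<bar>u\<bar>) * (2 * laplace_exponent t)" by (intro mult_left_mono sum_min_inc_le t N) auto
  finally show ?thesis by (simp add: algebra_simps)
qed

text \<open>Uniform continuity in time makes all increments of the exponent small at once on a fine
  grid, so that \<open>norm_le_exp_minus_1\<close> applies to each.\<close>

lemma dpsi_small:
  assumes t: "0 < t" and e: "e > 0"
  shows "eventually (\<lambda>N. N > 0 \<and> (\<forall>k<N. norm (dpsi t N k u) \<le> e)) sequentially"
proof -
  have uc: "\<exists>d>0. \<forall>s\<in>{0..t}. \<forall>s'\<in>{0..t}. dist s' s < d \<longrightarrow> dist (f s') (f s) < e / 2"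
    if "continuous_on {0..} f" for f :: "real \<Rightarrow> real"
  proof -
    have "continuous_on {0..t} f" using that by (rule continuous_on_subset) simp
    then have "uniformly_continuous_on {0..t} f" by (rule compact_uniformly_continuous) simp
    moreover have "0 < e / 2" using e by simp
    ultimately show ?thesis unfolding uniformly_continuous_on_def by blast
  qed
  obtain d1 where d1: "d1 > 0" "\<And>s s'. s \<in> {0..t} \<Longrightarrow> s' \<in> {0..t} \<Longrightarrow> dist s' s < d1 \<Longrightarrow> dist (re_exponent s' u) (re_exponent s u) < e / 2"
    using uc[OF continuous_re_exponent[of u]] by blast
  obtain d2 where d2: "d2 > 0" "\<And>s s'. s \<in> {0..t} \<Longrightarrow> s' \<in> {0..t} \<Longrightarrow> dist s' s < d2 \<Longrightarrow> dist (im_exponent s' u) (im_exponent s u) < e / 2"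
    using uc[OF continuous_im_exponent[of u]] by blast
  define d where "d = min d1 d2"
  obtain N0 :: nat where N0: "t / d < real N0" using reals_Archimedean2 by blast
  have "norm (dpsi t N k u) \<le> e" if N: "N \<ge> Suc N0" and k: "k < N" for N k
  proof -
    have d0: "d > 0" using d1 d2 by (simp add: d_def)
    have "t / d < real N" using N0 N by linarith
    then have tN: "t / real N < d" using d0 N by (simp add: field_simps)
    let ?s = "real k * t / real N" and ?s' = "real (Suc k) * t / real N"
    have "real (Suc k) * t \<le> real N * t" using k t by (intro mult_right_mono) auto
    then have s: "?s \<in> {0..t}" "?s' \<in> {0..t}" using t k N by (auto simp: field_simps)
    have "dist ?s' ?s = t / real N" using t N by (simp add: dist_real_def field_simps)
    then have "dist ?s' ?s < d1" "dist ?s' ?s < d2" using tN by (auto simp: d_def)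
    then have "\<bar>re_exponent ?s' u - re_exponent ?s u\<bar> < e / 2" "\<bar>im_exponent ?s' u - im_exponent ?s u\<bar> < e / 2"
      using d1(2)[OF s] d2(2)[OF s] by (simp_all only: dist_real_def)
    moreover have "norm (dpsi t N k u) \<le> \<bar>Re (dpsi t N k u)\<bar> + \<bar>Im (dpsi t N k u)\<bar>" by (rule cmod_le)
    ultimately show ?thesis by (simp add: dpsi_def psi_def abs_minus_commute)
  qed
  then show ?thesis unfolding eventually_sequentially by (intro exI[of _ "Suc N0"]) auto
qed

lemma sum_norm_dpsi_le:
  assumes t: "0 < t" and N: "N > 0" and small: "\<And>k. k < N \<Longrightarrow> norm (dpsi t N k u) \<le> 1 / 6"
  shows "(\<Sum>k<N. norm (dpsi t N k u)) \<le> 4 * (2 + \<bar>u\<bar>) * laplace_exponent t"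
proof -
  have "(\<Sum>k<N. norm (dpsi t N k u)) \<le> (\<Sum>k<N. 2 * norm (exp (dpsi t N k u) - 1))"
    by (intro sum_mono norm_le_exp_minus_1 small) auto
  also have "\<dots> = 2 * (\<Sum>k<N. norm (exp (dpsi t N k u) - 1))" by (rule sum_distrib_left[symmetric])
  also have "\<dots> \<le> 2 * (2 * (2 + \<bar>u\<bar>) * laplace_exponent t)" by (intro mult_left_mono sum_norm_char_le t N) auto
  finally show ?thesis by (simp add: algebra_simps)
qed

text \<open>Growth in u is linear because the increments are nonnegative with summable truncated
  first moments. This one estimate excludes a Gaussian part in \<open>C_zero\<close> and gives
  finite variation in \<open>small_power_1_integrable\<close>.\<close>

lemma norm_psi_le:
  assumes t: "0 < t"
  shows "norm (psi t u) \<le> 4 * (2 + \<bar>u\<bar>) * laplace_exponent t"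
proof -
  obtain N where N: "N > 0" "\<And>k. k < N \<Longrightarrow> norm (dpsi t N k u) \<le> 1 / 6"
    using eventually_happens[OF dpsi_small[OF t, of "1/6" u]] by auto
  have "norm (psi t u) \<le> (\<Sum>k<N. norm (dpsi t N k u))"
    unfolding sum_dpsi[OF N(1), symmetric] by (rule norm_sum)
  also have "\<dots> \<le> 4 * (2 + \<bar>u\<bar>) * laplace_exponent t" by (rule sum_norm_dpsi_le[OF t N])
  finally show ?thesis .
qed

lemma laplace_exponent_nonneg: "0 < t \<Longrightarrow> 0 \<le> laplace_exponent t"
  using order_trans[OF norm_ge_zero norm_psi_le[of t 0]] by simp

text \<open>Replacing each increment of the exponent by its exponential minus 1 costs a quadratic
  error. The sum of the squares is at most the largest increment times the total variation, and the
  latter is bounded by \<open>V\<close> uniformly over fine grids.\<close>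

lemma sum_char_tendsto_psi:
  assumes t: "0 < t"
  shows "(\<lambda>N. \<Sum>k<N. exp (dpsi t N k u) - 1) \<longlonglongrightarrow> psi t u"
proof (rule LIMSEQ_I)
  fix e :: real assume e: "e > 0"
  define V where "V = 4 * (2 + \<bar>u\<bar>) * laplace_exponent t"
  have V: "V \<ge> 0" using laplace_exponent_nonneg[OF t] by (simp add: V_def)
  define d where "d = min (1 / 6) (e / (3 * V + 3))"
  have V3: "0 < 3 * V + 3" using V by simp
  have "d \<le> e / (3 * V + 3)" unfolding d_def by (rule min.cobounded2)
  then have dV: "d * (3 * V + 3) \<le> e" using V3 by (simp only: pos_le_divide_eq)
  have d: "d > 0" "d \<le> 1 / 6"
    unfolding d_def using divide_pos_pos[OF e V3] min.cobounded1[of "1 / 6" "e / (3 * V + 3)"] by auto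
  have dVe: "3 * d * V < e" using dV d(1) unfolding distrib_left by linarith
  have d1: "d \<le> 1" using d(2) by simp
  have "eventually (\<lambda>N. norm ((\<Sum>k<N. exp (dpsi t N k u) - 1) - psi t u) < e) sequentially"
    using dpsi_small[OF t d(1), of u]
  proof eventually_elim
    case (elim N)
    then have N: "N > 0" and small: "\<And>k. k < N \<Longrightarrow> norm (dpsi t N k u) \<le> d" by auto
    have small6: "norm (dpsi t N k u) \<le> 1 / 6" if "k < N" for k using small[OF that] d(2) by linarith
    have "(\<Sum>k<N. exp (dpsi t N k u) - 1) - psi t u = (\<Sum>k<N. exp (dpsi t N k u) - 1 - dpsi t N k u)"
      unfolding sum_dpsi[OF N, of t u, symmetric] by (rule sum_subtractf[symmetric])
    then have "norm ((\<Sum>k<N. exp (dpsi t N k u) - 1) - psi t u) = norm (\<Sum>k<N. exp (dpsi t N k u) - 1 - dpsi t N k u)"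
      by (rule arg_cong)
    also have "\<dots> \<le> (\<Sum>k<N. norm (exp (dpsi t N k u) - 1 - dpsi t N k u))" by (rule norm_sum)
    also have "\<dots> \<le> (\<Sum>k<N. 3 * d * norm (dpsi t N k u))"
    proof (rule sum_mono)
      fix k assume "k \<in> {..<N}"
      then have k: "norm (dpsi t N k u) \<le> d" using small by simp
      then have "norm (dpsi t N k u) \<le> 1" using d1 by linarith
      then have "norm (exp (dpsi t N k u) - 1 - dpsi t N k u) \<le> 3 * (norm (dpsi t N k u))\<^sup>2"
        by (rule exp_minus_1_approx)
      also have "\<dots> \<le> 3 * d * norm (dpsi t N k u)"
        using mult_right_mono[OF k, of "3 * norm (dpsi t N k u)"] by (simp add: power2_eq_square mult_ac)
      finally show "norm (exp (dpsi t N k u) - 1 - dpsi t N k u) \<le> 3 * d * norm (dpsi t N k u)" .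
    qed
    also have "\<dots> = 3 * d * (\<Sum>k<N. norm (dpsi t N k u))" by (rule sum_distrib_left[symmetric])
    also have "\<dots> \<le> 3 * d * V" unfolding V_def
    proof (rule mult_left_mono)
      show "(\<Sum>k<N. norm (dpsi t N k u)) \<le> 4 * (2 + \<bar>u\<bar>) * laplace_exponent t"
        by (rule sum_norm_dpsi_le[OF t N small6])
    qed (use d(1) in simp)
    also have "\<dots> < e" by (rule dVe)
    finally show ?case .
  qed
  then show "\<exists>no. \<forall>N\<ge>no. norm ((\<Sum>k<N. exp (dpsi t N k u) - 1) - psi t u) < e"
    unfolding eventually_sequentially .
qed

text \<open>The Gaussian part contributes \<open>u\<^sup>2 * C t / 2\<close> to a quantity that
  grows only linearly; dividing by u and letting u tend to infinity leaves 0.\<close>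

lemma C_zero:
  assumes t: "0 < t"
  shows "C t = 0"
proof -
  have t0: "0 \<le> t" using t by simp
  define L where "L = laplace_exponent t"
  have L: "L \<ge> 0" using laplace_exponent_nonneg[OF t] by (simp add: L_def)
  have "C t \<le> 24 * L * inverse (real (Suc k))" for k
  proof -
    let ?u = "real (Suc k)"
    have "?u\<^sup>2 * C t / 2 \<le> re_exponent t ?u"
      unfolding re_exponent_def by (simp add: Bochner_Integration.integral_nonneg)
    also have "\<dots> \<le> norm (psi t ?u)" using abs_Re_le_cmod[of "psi t ?u"] by (simp add: psi_def)
    also have "\<dots> \<le> 4 * (2 + \<bar>?u\<bar>) * L" unfolding L_def by (rule norm_psi_le[OF t])
    also have "\<dots> \<le> 4 * (3 * ?u) * L" using L by (intro mult_right_mono) auto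
    finally have "?u * (?u * C t) \<le> ?u * (24 * L)" by (simp add: power2_eq_square algebra_simps)
    then have "?u * C t \<le> 24 * L" by (subst (asm) mult_le_cancel_left_pos) auto
    then show ?thesis by (simp add: field_simps del: of_nat_Suc)
  qed
  moreover have "(\<lambda>k. 24 * L * inverse (real (Suc k))) \<longlonglongrightarrow> 24 * L * 0"
    by (intro tendsto_mult_left LIMSEQ_inverse_real_of_nat)
  ultimately have "C t \<le> 24 * L * 0" by (intro LIMSEQ_le_const[of _ _ "C t"]) auto
  then show ?thesis using C_nonneg[OF t0] by simp
qed

text \<open>This second difference in the frequency cancels the drift and weights the Levy measure
  with 1 - cos (a x), which makes it finite. The right-hand side is therefore the Fourier transform
  of a finite measure.\<close>

lemma psi_second_difference:
  assumes t: "0 < t"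
  shows "psi t u - psi t (u + a) / 2 - psi t (u - a) / 2
     = Complex (LINT x|\<nu> t. cos (u * x) * (1 - cos (a * x))) (LINT x|\<nu> t. sin (u * x) * (1 - cos (a * x)))"
proof -
  have t0: "0 \<le> t" using t by simp
  have ic: "integrable (\<nu> t) (\<lambda>x. 1 - cos (w * x))" for w by (rule integrable_levy[OF t0 levy_dominated_cos])
  have isn: "integrable (\<nu> t) (\<lambda>x. sin (w * x) - w * trunc 1 x)" for w by (rule integrable_levy[OF t0 levy_dominated_sin]) simp
  have "(LINT x|\<nu> t. cos (u * x) * (1 - cos (a * x)))
     = (LINT x|\<nu> t. (1 - cos ((u + a) * x)) / 2 + (1 - cos ((u - a) * x)) / 2 - (1 - cos (u * x)))"
    by (intro Bochner_Integration.integral_cong refl) (simp add: distrib_right left_diff_distrib cos_add cos_diff field_simps)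
  also have "\<dots> = (LINT x|\<nu> t. 1 - cos ((u + a) * x)) / 2 + (LINT x|\<nu> t. 1 - cos ((u - a) * x)) / 2 - (LINT x|\<nu> t. 1 - cos (u * x))"
    by (rule integral_halves_diff[OF ic ic ic])
  finally have re: "(LINT x|\<nu> t. cos (u * x) * (1 - cos (a * x))) = re_exponent t (u + a) / 2 + re_exponent t (u - a) / 2 - re_exponent t u"
    by (simp add: re_exponent_def C_zero[OF t])
  have "(LINT x|\<nu> t. sin (u * x) * (1 - cos (a * x)))
     = (LINT x|\<nu> t. (sin (u * x) - u * trunc 1 x) - (sin ((u + a) * x) - (u + a) * trunc 1 x) / 2 - (sin ((u - a) * x) - (u - a) * trunc 1 x) / 2)"
    by (intro Bochner_Integration.integral_cong refl) (simp add: distrib_right left_diff_distrib sin_add sin_diff field_simps)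
  also have "\<dots> = (LINT x|\<nu> t. sin (u * x) - u * trunc 1 x) - (LINT x|\<nu> t. sin ((u + a) * x) - (u + a) * trunc 1 x) / 2 - (LINT x|\<nu> t. sin ((u - a) * x) - (u - a) * trunc 1 x) / 2"
    by (rule integral_diff_halves[OF isn isn isn])
  finally have im: "(LINT x|\<nu> t. sin (u * x) * (1 - cos (a * x))) = im_exponent t u - im_exponent t (u + a) / 2 - im_exponent t (u - a) / 2"
    by (simp add: im_exponent_def field_simps)
  show ?thesis unfolding re im by (simp add: psi_def complex_eq_iff)
qed

end

section \<open>Sign and variation of the jumps, and comparison with the Laplace exponent\<close>

context increasing_component
begin

text \<open>The same second difference is taken of the characteristic functions of the increments;
  on that side it multiplies their laws by 1 - cos (a x).\<close>

lemma weighted_char_tendsto: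
  assumes t: "0 < t"
  shows "(\<lambda>N. \<Sum>k<N. CLINT \<omega>|P. of_real (1 - cos (a * inc t N k \<omega>)) * iexp (u * inc t N k \<omega>))
     \<longlonglongrightarrow> psi t u - psi t (u + a) / 2 - psi t (u - a) / 2"
proof -
  have t0: "0 \<le> t" using t by simp
  have eq: "(CLINT \<omega>|P. of_real (1 - cos (a * inc t N k \<omega>)) * iexp (u * inc t N k \<omega>))
     = (exp (dpsi t N k u) - 1) - (exp (dpsi t N k (u + a)) - 1) / 2 - (exp (dpsi t N k (u - a)) - 1) / 2" for N k
  proof -
    have c: "of_real (1 - cos (a * z)) * iexp (u * z) = iexp (u * z) - iexp ((u + a) * z) / 2 - iexp ((u - a) * z) / 2" for z
      by (simp add: complex_eq_iff Re_exp Im_exp distrib_right left_diff_distrib cos_add cos_diff sin_add sin_diff field_simps)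
    have "(CLINT \<omega>|P. of_real (1 - cos (a * inc t N k \<omega>)) * iexp (u * inc t N k \<omega>))
       = (CLINT \<omega>|P. iexp (u * inc t N k \<omega>) - iexp ((u + a) * inc t N k \<omega>) / 2 - iexp ((u - a) * inc t N k \<omega>) / 2)"
      by (simp only: c)
    also have "\<dots> = (CLINT \<omega>|P. iexp (u * inc t N k \<omega>) - iexp ((u + a) * inc t N k \<omega>) / 2) - (CLINT \<omega>|P. iexp ((u - a) * inc t N k \<omega>) / 2)"
      by (intro Bochner_Integration.integral_diff Bochner_Integration.integrable_diff integrable_divide_zero integrable_iexp_inc t0)
    also have "(CLINT \<omega>|P. iexp (u * inc t N k \<omega>) - iexp ((u + a) * inc t N k \<omega>) / 2)
       = (CLINT \<omega>|P. iexp (u * inc t N k \<omega>)) - (CLINT \<omega>|P. iexp ((u + a) * inc t N k \<omega>) / 2)"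
      by (intro Bochner_Integration.integral_diff integrable_divide_zero integrable_iexp_inc t0)
    finally show ?thesis by (simp only: integral_divide_zero char_inc[OF t0]) (simp add: field_simps)
  qed
  have "(\<lambda>N. (\<Sum>k<N. exp (dpsi t N k u) - 1) - (\<Sum>k<N. exp (dpsi t N k (u + a)) - 1) / 2 - (\<Sum>k<N. exp (dpsi t N k (u - a)) - 1) / 2)
     \<longlonglongrightarrow> psi t u - psi t (u + a) / 2 - psi t (u - a) / 2"
    by (intro tendsto_diff tendsto_divide sum_char_tendsto_psi[OF t] tendsto_const) simp_all
  moreover have "(\<Sum>k<N. f k - g k / 2 - h k / 2) = (\<Sum>k<N. f k) - (\<Sum>k<N. g k) / 2 - (\<Sum>k<N. h k) / 2"
    for f g h :: "nat \<Rightarrow> complex" and N :: nat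
    by (simp add: sum_subtractf sum_divide_distrib)
  ultimately show ?thesis by (simp only: eq)
qed

lemma expectation_weight:
  assumes "0 \<le> t"
  shows "complex_of_real (expectation (\<lambda>\<omega>. 1 - cos (a * inc t N k \<omega>)))
     = (CLINT \<omega>|P. of_real (1 - cos (a * inc t N k \<omega>)) * iexp (0 * inc t N k \<omega>))"
  by (subst integral_complex_of_real[symmetric]) (simp del: of_real_diff)

text \<open>The measures \<open>(1 - cos (a x)) \<Sum>\<^sub>k P (X(t\<^sub>k\<^sub>+\<^sub>1) - X(t\<^sub>k) \<in> dx)\<close> live on the positive half-line and,
  after normalisation, converge weakly to \<open>(1 - cos (a x)) \<nu>\<^sub>t(dx)\<close> by Levy's continuity theorem.\<close>

lemma cos_eq_1_on_negatives:
  assumes t: "0 < t"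
  shows "AE x in \<nu> t. x < 0 \<longrightarrow> cos (a * x) = 1"
proof -
  have t0: "0 \<le> t" using t by simp
  have sets [measurable_cong]: "sets (\<nu> t) = sets borel" by (rule sets_levy[OF t0])
  define w where "w x = 1 - cos (a * x)" for x :: real
  have w [measurable]: "w \<in> borel_measurable borel" unfolding w_def by measurable
  have w0: "0 \<le> w x" "w x \<le> 2" for x using cos_ge_minus_one[of "a * x"] by (auto simp: w_def)
  have wi: "integrable (\<nu> t) w" unfolding w_def by (rule integrable_levy[OF t0 levy_dominated_cos])
  define S where "S = (LINT x|\<nu> t. w x)"
  show ?thesis
  proof (cases "S = 0")
    case True
    then have "AE x in \<nu> t. w x = 0"
      unfolding S_def using wi w0 by (subst (asm) integral_nonneg_eq_0_iff_AE) auto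
    then show ?thesis by eventually_elim (simp add: w_def)
  next
    case False
    moreover have "S \<ge> 0" unfolding S_def using w0 by (intro Bochner_Integration.integral_nonneg) auto
    ultimately have S: "S > 0" by simp
    define M where "M = density (\<nu> t) (\<lambda>x. ennreal (w x / S))"
    have "emeasure M (space M) = (\<integral>\<^sup>+x. ennreal (w x / S) \<partial>\<nu> t)"
      unfolding M_def by (subst emeasure_density) (auto intro!: nn_integral_cong simp: indicator_def)
    also have "\<dots> = ennreal (LINT x|\<nu> t. w x / S)"
      using wi w0 S by (intro nn_integral_eq_integral) auto
    also have "\<dots> = 1" using S by (simp add: S_def)
    finally have "prob_space M" by (rule prob_spaceI)
    then have M: "real_distribution M"
      unfolding real_distribution_def real_distribution_axioms_def by (simp add: M_def sets)
    interpret M: real_distribution M by (rule M)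
    have char_M: "char M u = (psi t u - psi t (u + a) / 2 - psi t (u - a) / 2) / of_real S" for u
    proof -
      have ci: "integrable (\<nu> t) (\<lambda>x. cos (u * x) * w x)" "integrable (\<nu> t) (\<lambda>x. sin (u * x) * w x)"
        by (rule Bochner_Integration.integrable_bound[OF wi]; (use w0 in \<open>auto simp: abs_mult mult_left_le_one_le\<close>))+
      have "char M u = (CLINT x|\<nu> t. (w x / S) *\<^sub>R iexp (u * x))"
        unfolding char_def M_def by (rule integral_density) (use w0 S in auto)
      also have "\<dots> = (CLINT x|\<nu> t. (of_real (cos (u * x) * w x) + \<i> * of_real (sin (u * x) * w x)) / of_real S)"
        by (intro Bochner_Integration.integral_cong refl)
           (simp add: complex_eq_iff Re_exp Im_exp scaleR_conv_of_real)
      also have "\<dots> = (CLINT x|\<nu> t. of_real (cos (u * x) * w x) + \<i> * of_real (sin (u * x) * w x)) / of_real S"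
        by (rule integral_divide_zero)
      also have "(CLINT x|\<nu> t. of_real (cos (u * x) * w x) + \<i> * of_real (sin (u * x) * w x))
         = (CLINT x|\<nu> t. of_real (cos (u * x) * w x)) + (CLINT x|\<nu> t. \<i> * of_real (sin (u * x) * w x))"
        using ci by (intro Bochner_Integration.integral_add integrable_mult_right integrable_of_real)
      also have "\<dots> = of_real (LINT x|\<nu> t. cos (u * x) * w x) + \<i> * of_real (LINT x|\<nu> t. sin (u * x) * w x)"
        by (simp only: integral_mult_right_zero integral_complex_of_real)
      also have "\<dots> = psi t u - psi t (u + a) / 2 - psi t (u - a) / 2"
        unfolding psi_second_difference[OF t] w_def by (simp add: complex_eq_iff)
      finally show ?thesis .
    qed
    define T where "T N = (\<Sum>k<N. expectation (\<lambda>\<omega>. w (inc t N k \<omega>)))" for N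
    have T_lim: "(\<lambda>N. complex_of_real (T N)) \<longlonglongrightarrow> of_real S"
    proof -
      have "of_real S = psi t 0 - psi t (0 + a) / 2 - psi t (0 - a) / 2"
        using char_M[of 0] M.char_zero S by (simp add: field_simps)
      moreover have "complex_of_real (T N) = (\<Sum>k<N. CLINT \<omega>|P. of_real (1 - cos (a * inc t N k \<omega>)) * iexp (0 * inc t N k \<omega>))" for N
        unfolding T_def of_real_sum w_def by (simp only: expectation_weight[OF t0])
      ultimately show ?thesis using weighted_char_tendsto[OF t, of a 0] by (simp only:)
    qed
    then have "T \<longlonglongrightarrow> S" by (simp add: tendsto_of_real_iff)
    then have "eventually (\<lambda>N. T N > 0) sequentially" using S by (intro order_tendstoD)
    then obtain N0 where N0: "\<And>N. N \<ge> N0 \<Longrightarrow> T N > 0" by (auto simp: eventually_sequentially)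
    \<comment> \<open>The shift \<open>N0\<close> keeps the normalising totals \<open>T\<close>
      positive.\<close>
    have ex: "\<exists>D. real_distribution D \<and> (AE x in D. 0 \<le> x) \<and>
       (\<forall>u. char D u = (\<Sum>k<N + N0. CLINT \<omega>|P. of_real (w (inc t (N + N0) k \<omega>)) * iexp (u * inc t (N + N0) k \<omega>)) / of_real (T (N + N0)))" for N
      using t0 w0 N0[of "N + N0"] by (intro weighted_mixture[where c = 2]) (auto simp: T_def inc_nonneg)
    then obtain D where D: "\<And>N. real_distribution (D N)" "\<And>N. AE x in D N. 0 \<le> x"
      "\<And>N u. char (D N) u = (\<Sum>k<N + N0. CLINT \<omega>|P. of_real (w (inc t (N + N0) k \<omega>)) * iexp (u * inc t (N + N0) k \<omega>)) / of_real (T (N + N0))"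
      by metis
    have "weak_conv_m D M"
    proof (rule levy_continuity[OF D(1) M])
      fix u
      have "(\<lambda>N. (\<Sum>k<N. CLINT \<omega>|P. of_real (w (inc t N k \<omega>)) * iexp (u * inc t N k \<omega>)) / of_real (T N)) \<longlonglongrightarrow> char M u"
        unfolding char_M w_def using S by (intro tendsto_divide weighted_char_tendsto[OF t] T_lim) auto
      then show "(\<lambda>N. char (D N) u) \<longlonglongrightarrow> char M u"
        unfolding D(3) by (rule LIMSEQ_ignore_initial_segment)
    qed
    \<comment> \<open>A bounded continuous test function that is positive exactly on the negative
      half-line. It integrates to 0 under every \<open>D N\<close>, hence under the weak
      limit.\<close>
    define f where "f x = min 1 (max 0 (- x))" for x :: real
    have fm [measurable]: "f \<in> borel_measurable borel" unfolding f_def by measurable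
    have "isCont f x" for x unfolding f_def by (intro continuous_intros)
    then have "(\<lambda>N. integral\<^sup>L (D N) f) \<longlonglongrightarrow> integral\<^sup>L M f"
      by (intro weak_conv_imp_integral_bdd_continuous_conv[OF D(1) M \<open>weak_conv_m D M\<close>, where B = 1])
         (auto simp: f_def)
    moreover have "integral\<^sup>L (D N) f = 0" for N
    proof -
      interpret DN: real_distribution "D N" by (rule D(1))
      have "integral\<^sup>L (D N) f = (LINT x|D N. 0)"
        using D(2)[of N] by (intro integral_cong_AE) (auto simp: f_def elim!: eventually_mono)
      then show ?thesis by simp
    qed
    ultimately have "integral\<^sup>L M f = 0" by (simp add: LIMSEQ_const_iff)
    moreover have "integrable M f" by (rule M.integrable_const_bound[where B = 1]) (auto simp: f_def)
    ultimately have "AE x in M. f x = 0" by (subst (asm) integral_nonneg_eq_0_iff_AE) (auto simp: f_def)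
    then have "AE x in \<nu> t. 0 < ennreal (w x / S) \<longrightarrow> f x = 0" unfolding M_def by (subst (asm) AE_density) auto
    then show ?thesis
    proof eventually_elim
      case (elim x)
      show ?case
      proof
        assume x: "x < 0"
        then have "f x \<noteq> 0" by (auto simp: f_def)
        then have "\<not> 0 < w x" using elim S by (auto simp: ennreal_zero_less_divide)
        then show "cos (a * x) = 1" using cos_le_one[of "a * x"] by (simp add: w_def)
      qed
    qed
  qed
qed

text \<open>Countably many frequencies suffice: for x < 0 and n \<ge> |x|, the product of x with 1 /
  (n + 1) is nonzero and at most 1 in modulus, where the cosine is strictly below 1.\<close>

lemma levy_measure_nonneg:
  assumes t: "0 < t"
  shows "AE x in \<nu> t. 0 \<le> x"
proof -
  have "AE x in \<nu> t. \<forall>n::nat. x < 0 \<longrightarrow> cos (inverse (real (Suc n)) * x) = 1"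
    unfolding AE_all_countable using cos_eq_1_on_negatives[OF t] by blast
  then show ?thesis
  proof eventually_elim
    case (elim x)
    show ?case
    proof (rule ccontr)
      assume x: "\<not> 0 \<le> x"
      obtain n :: nat where n: "\<bar>x\<bar> \<le> real n" using real_arch_simple by blast
      define y where "y = inverse (real (Suc n)) * x"
      have "\<bar>y\<bar> \<le> 1" "y \<noteq> 0" using n x by (auto simp: y_def abs_mult field_simps)
      then have "y\<^sup>2 / 4 \<le> 1 - cos y" "y\<^sup>2 > 0" using one_minus_cos_ge by auto
      then show False using elim x by (auto simp: y_def)
    qed
  qed
qed

text \<open>For x in [0, 1] the function x - sin (u x) / u is nonnegative and tends to x as u grows,
  while its integral is bounded in terms of the imaginary part of \<open>psi\<close> divided by u,
  which stays bounded. Fatou's lemma gives the first moment.\<close>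

lemma small_power_1_integrable:
  assumes t: "0 < t"
  shows "integrable (\<nu> t) (small_power 1)"
proof -
  have t0: "0 \<le> t" using t by simp
  have sets [measurable_cong]: "sets (\<nu> t) = sets borel" by (rule sets_levy[OF t0])
  define L where "L = laplace_exponent t"
  have L: "L \<ge> 0" using laplace_exponent_nonneg[OF t] by (simp add: L_def)
  define b where "b = \<bar>B t\<bar> + 12 * L + G1 \<nu> t 1"
  \<comment> \<open>The tail indicator keeps \<open>f n x\<close> nonnegative for x > 1, where the
    truncated identity is 0 but the sine term may be positive.\<close>
  define f where "f n x = trunc 1 x - sin (real (Suc n) * x) / real (Suc n) + indicator {x. \<bar>x\<bar> > 1} x" for n x
  have f_int: "integrable (\<nu> t) (f n)" "(LINT x|\<nu> t. f n x) \<le> b" for n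
  proof -
    let ?u = "real (Suc n)"
    have i1: "integrable (\<nu> t) (\<lambda>x. sin (?u * x) - ?u * trunc 1 x)" by (rule integrable_levy[OF t0 levy_dominated_sin]) simp
    have i2: "integrable (\<nu> t) (\<lambda>x. indicator {x. \<bar>x\<bar> > 1} x :: real)" by (rule integrable_levy[OF t0 levy_dominated_tail]) simp
    have i3: "integrable (\<nu> t) (\<lambda>x. (- 1 / ?u) * (sin (?u * x) - ?u * trunc 1 x))" using i1 by (rule integrable_mult_right)
    have f: "f n = (\<lambda>x. (- 1 / ?u) * (sin (?u * x) - ?u * trunc 1 x) + indicator {x. \<bar>x\<bar> > 1} x)"
      by (rule ext) (simp add: f_def field_simps)
    show "integrable (\<nu> t) (f n)" unfolding f by (rule Bochner_Integration.integrable_add[OF i3 i2])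
    have "(LINT x|\<nu> t. f n x) = (- 1 / ?u) * (LINT x|\<nu> t. sin (?u * x) - ?u * trunc 1 x) + G1 \<nu> t 1"
      unfolding f Bochner_Integration.integral_add[OF i3 i2] G1_eq[OF t0 zero_less_one] by (simp only: integral_mult_right_zero)
    also have "(LINT x|\<nu> t. sin (?u * x) - ?u * trunc 1 x) = im_exponent t ?u - ?u * B t"
      by (simp add: im_exponent_def)
    also have "(- 1 / ?u) * (im_exponent t ?u - ?u * B t) \<le> \<bar>B t\<bar> + 12 * L"
    proof -
      have "\<bar>im_exponent t ?u\<bar> \<le> norm (psi t ?u)" using abs_Im_le_cmod[of "psi t ?u"] by (simp add: psi_def)
      also have "\<dots> \<le> 4 * (2 + \<bar>?u\<bar>) * L" unfolding L_def by (rule norm_psi_le[OF t])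
      also have "\<dots> \<le> 4 * (3 * ?u) * L" using L by (intro mult_right_mono) auto
      also have "4 * (3 * ?u) * L = ?u * (12 * L)" by simp
      finally have "- im_exponent t ?u \<le> ?u * (12 * L)" by (rule abs_le_D2)
      then have "- im_exponent t ?u / ?u \<le> 12 * L" by (simp add: field_simps del: of_nat_Suc)
      moreover have "(- 1 / ?u) * (im_exponent t ?u - ?u * B t) = - im_exponent t ?u / ?u + B t" by (simp add: field_simps del: of_nat_Suc)
      ultimately show ?thesis by linarith
    qed
    finally show "(LINT x|\<nu> t. f n x) \<le> b" by (simp add: b_def)
  qed
  have f_nonneg: "0 \<le> f n x" if "0 \<le> x" for n x
  proof (cases "x \<le> 1")
    case True
    have "sin (real (Suc n) * x) \<le> real (Suc n) * x" using that by (intro sin_x_le_x) auto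
    then have "sin (real (Suc n) * x) / real (Suc n) \<le> x" by (simp add: field_simps del: of_nat_Suc)
    then show ?thesis using True that by (simp add: f_def trunc_eq)
  next
    case False
    have "sin (real (Suc n) * x) / real (Suc n) \<le> 1"
      using order_trans[OF sin_le_one[of "real (Suc n) * x"], of "real (Suc n)"] by (simp add: field_simps del: of_nat_Suc)
    then show ?thesis using False by (simp add: f_def trunc_eq)
  qed
  have AE: "AE x in \<nu> t. 0 \<le> f n x" for n
    using levy_measure_nonneg[OF t] by eventually_elim (rule f_nonneg)
  have lim: "(\<lambda>n. f n x) \<longlonglongrightarrow> trunc 1 x + indicator {x. \<bar>x\<bar> > 1} x" for x
  proof -
    have "(\<lambda>n. sin (real (Suc n) * x) / real (Suc n)) \<longlonglongrightarrow> 0"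
    proof (rule Lim_null_comparison)
      show "eventually (\<lambda>n. norm (sin (real (Suc n) * x) / real (Suc n)) \<le> inverse (real (Suc n))) sequentially"
        by (intro always_eventually allI) (simp add: inverse_eq_divide divide_right_mono del: of_nat_Suc)
    qed (rule LIMSEQ_inverse_real_of_nat)
    then have "(\<lambda>n. trunc 1 x - sin (real (Suc n) * x) / real (Suc n) + indicator {x. \<bar>x\<bar> > 1} x) \<longlonglongrightarrow> trunc 1 x - 0 + indicator {x. \<bar>x\<bar> > 1} x"
      by (intro tendsto_intros)
    then show ?thesis by (simp add: f_def)
  qed
  have "(\<integral>\<^sup>+x. ennreal (norm (small_power 1 x)) \<partial>\<nu> t) \<le> (\<integral>\<^sup>+x. liminf (\<lambda>n. ennreal (f n x)) \<partial>\<nu> t)"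
  proof (rule nn_integral_mono_AE)
    show "AE x in \<nu> t. ennreal (norm (small_power 1 x)) \<le> liminf (\<lambda>n. ennreal (f n x))"
      using levy_measure_nonneg[OF t]
    proof eventually_elim
      case (elim x)
      have "(\<lambda>n. ennreal (f n x)) \<longlonglongrightarrow> ennreal (trunc 1 x + indicator {x. \<bar>x\<bar> > 1} x)"
        by (rule tendsto_ennrealI[OF lim])
      then have "liminf (\<lambda>n. ennreal (f n x)) = ennreal (trunc 1 x + indicator {x. \<bar>x\<bar> > 1} x)"
        by (intro lim_imp_Liminf) auto
      moreover have "norm (small_power 1 x) \<le> trunc 1 x + indicator {x. \<bar>x\<bar> > 1} x"
        using elim by (auto simp: small_power_def trunc_def indicator_def)
      ultimately show ?case by (simp only: ennreal_leI)
    qed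
  qed
  also have "\<dots> \<le> liminf (\<lambda>n. \<integral>\<^sup>+x. ennreal (f n x) \<partial>\<nu> t)"
    by (rule nn_integral_liminf) (simp add: f_def)
  also have "\<dots> \<le> liminf (\<lambda>n::nat. ennreal b)"
  proof (intro Liminf_mono always_eventually allI)
    fix n
    have "(\<integral>\<^sup>+x. ennreal (f n x) \<partial>\<nu> t) = ennreal (LINT x|\<nu> t. f n x)"
      by (rule nn_integral_eq_integral[OF f_int(1) AE])
    also have "\<dots> \<le> ennreal b" by (rule ennreal_leI[OF f_int(2)])
    finally show "(\<integral>\<^sup>+x. ennreal (f n x) \<partial>\<nu> t) \<le> ennreal b" .
  qed
  also have "\<dots> = ennreal b" by (intro Liminf_const) simp
  finally have "(\<integral>\<^sup>+x. ennreal (norm (small_power 1 x)) \<partial>\<nu> t) < \<infinity>" using le_less_trans ennreal_less_top by (metis infinity_ennreal_def)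
  then show ?thesis by (simp add: integrable_iff_bounded)
qed

definition g1 :: "real \<Rightarrow> real \<Rightarrow> real" where
  "g1 t u = (LINT x:{0<..}|\<nu> t. 1 - exp (- (u * x)))"

lemma one_minus_exp_le_min: "0 \<le> z \<Longrightarrow> 1 - exp (- z) \<le> min 1 z" for z :: real
  using exp_ge_add_one_self[of "- z"] by simp

text \<open>With nonnegative jumps, \<open>\<gamma>0\<close> equal to 0 and no Gaussian part,
  \<open>y1\<close> is one integral, whose integrand lies between min 1 (x / r) and twice that. The
  integrand 1 - exp (- x / r) of \<open>g1\<close> lies between half of min 1 (x / r) and the whole
  of it; hence the constants 1 and 4.\<close>

lemma y1_g1_comparable:
  assumes t: "0 < t" and r: "0 < r" "r \<le> 1" and df: "\<And>s. 0 \<le> s \<Longrightarrow> s \<le> t \<Longrightarrow> \<gamma>0 B \<nu> s = 0"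
  shows "g1 t (1 / r) \<le> y1 B C \<nu> t r" "y1 B C \<nu> t r \<le> 4 * g1 t (1 / r)"
proof -
  have t0: "0 \<le> t" using t by simp
  have sets [measurable_cong]: "sets (\<nu> t) = sets borel" by (rule sets_levy[OF t0])
  have int: "integrable (\<nu> t) (small_power 1)" by (rule small_power_1_integrable[OF t])
  have it: "integrable (\<nu> t) (trunc r)" by (rule integrable_trunc[OF t0 int r])
  have ii: "integrable (\<nu> t) (\<lambda>x. indicator {x. \<bar>x\<bar> > r} x :: real)" by (rule integrable_levy[OF t0 levy_dominated_tail[OF r(1)]])
  have isq: "integrable (\<nu> t) (\<lambda>x. x\<^sup>2 * indicator {x. \<bar>x\<bar> \<le> r} x)" by (rule integrable_levy[OF t0 levy_dominated_square[OF r(1)]])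
  define J where "J = (LINT x|\<nu> t. trunc r x) / r"
  have drift: "drift s r = (LINT x|\<nu> s. trunc r x)" if "0 \<le> s" "s \<le> t" for s
    using df[OF that] drift_eq_\<gamma>0[OF that(1) integrable_mono_time[OF that int] r] by simp
  have AEs: "AE x in \<nu> s. 0 \<le> x" if "0 \<le> s" "s \<le> t" for s
  proof -
    have [measurable_cong]: "sets (\<nu> s) = sets borel" by (rule sets_levy[OF that(1)])
    have "emeasure (\<nu> t) {x. x < 0} = 0"
      using levy_measure_nonneg[OF t] AE_iff_measurable[of "{x. x < 0}" "\<nu> t" "\<lambda>x. 0 \<le> x"]
      by (simp add: sets space_levy[OF t0] not_le)
    then have "emeasure (\<nu> s) {x. x < 0} = 0" using mono[OF that, of "{x. x < 0}"] by simp
    then show ?thesis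
      by (intro AE_I[of _ _ "{x. x < 0}"]) (auto simp: space_levy[OF that(1)] sets_levy[OF that(1)])
  qed
  have drift_nonneg: "0 \<le> drift s r" "drift s r \<le> drift t r" if s: "0 \<le> s" "s \<le> t" for s
  proof -
    have e: "(LINT x|\<nu> w. trunc r x) = (LINT x|\<nu> w. \<bar>trunc r x\<bar>)" if w: "0 \<le> w" "w \<le> t" for w
    proof (rule integral_cong_AE)
      have [measurable_cong]: "sets (\<nu> w) = sets borel" by (rule sets_levy[OF w(1)])
      show "trunc r \<in> borel_measurable (\<nu> w)" "(\<lambda>x. \<bar>trunc r x\<bar>) \<in> borel_measurable (\<nu> w)" by measurable
      show "AE x in \<nu> w. trunc r x = \<bar>trunc r x\<bar>" using AEs[OF w] by eventually_elim (auto simp: trunc_eq)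
    qed
    have nn: "ennreal (LINT x|\<nu> w. \<bar>trunc r x\<bar>) = (\<integral>\<^sup>+x. ennreal \<bar>trunc r x\<bar> \<partial>\<nu> w)" if w: "0 \<le> w" "w \<le> t" for w
      by (rule nn_integral_eq_integral[symmetric])
         (use integrable_abs[OF integrable_trunc[OF w(1) integrable_mono_time[OF w int] r]] in auto)
    show "0 \<le> drift s r" unfolding drift[OF s] e[OF s] by (intro Bochner_Integration.integral_nonneg) simp
    have "ennreal (LINT x|\<nu> s. \<bar>trunc r x\<bar>) \<le> ennreal (LINT x|\<nu> t. \<bar>trunc r x\<bar>)"
      unfolding nn[OF s] nn[OF t0 order_refl] by (rule nn_integral_levy_mono[OF s])
    then show "drift s r \<le> drift t r" unfolding drift[OF s] drift[OF t0 order_refl] e[OF s] e[OF t0 order_refl]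
      by (subst (asm) ennreal_le_iff) (auto intro: Bochner_Integration.integral_nonneg)
  qed
  \<comment> \<open>The truncated drift is nonnegative and increasing in time, so the maximum is
    attained at t.\<close>
  have M: "M1_star B \<nu> t r = J"
  proof (rule antisym)
    show "M1_star B \<nu> t r \<le> J"
    proof (rule M1_star_least[OF t0])
      fix s assume s: "0 \<le> s" "s \<le> t"
      show "M1 B \<nu> s r \<le> J" unfolding M1_eq[OF s(1) r(1)] J_def drift[OF t0 order_refl, symmetric]
        using drift_nonneg[OF s] r by (intro divide_right_mono) auto
    qed
    show "J \<le> M1_star B \<nu> t r" using M1_le_star[OF r(1) t0 order_refl] drift_nonneg[OF t0 order_refl]
      by (simp add: M1_eq[OF t0 r(1)] J_def drift[OF t0 order_refl])
  qed
  have J: "J = (LINT x|\<nu> t. (1 / r) * trunc r x)" by (simp add: J_def)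
  have y: "y1 B C \<nu> t r = (LINT x|\<nu> t. indicator {x. \<bar>x\<bar> > r} x + 1 / r\<^sup>2 * (x\<^sup>2 * indicator {x. \<bar>x\<bar> \<le> r} x) + (1 / r) * trunc r x)"
  proof -
    have "(LINT x|\<nu> t. indicator {x. \<bar>x\<bar> > r} x + 1 / r\<^sup>2 * (x\<^sup>2 * indicator {x. \<bar>x\<bar> \<le> r} x) + (1 / r) * trunc r x)
       = (LINT x|\<nu> t. indicator {x. \<bar>x\<bar> > r} x) + (LINT x|\<nu> t. 1 / r\<^sup>2 * (x\<^sup>2 * indicator {x. \<bar>x\<bar> \<le> r} x)) + (LINT x|\<nu> t. (1 / r) * trunc r x)"
      by (subst Bochner_Integration.integral_add[OF Bochner_Integration.integrable_add[OF ii integrable_mult_right[OF isq]] integrable_mult_right[OF it]],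
          subst Bochner_Integration.integral_add[OF ii integrable_mult_right[OF isq]]) (rule refl)
    also have "\<dots> = G1 \<nu> t r + 1 / r\<^sup>2 * (LINT x|\<nu> t. x\<^sup>2 * indicator {x. \<bar>x\<bar> \<le> r} x) + J"
      unfolding G1_eq[OF t0 r(1)] J by (simp only: integral_mult_right_zero)
    finally show ?thesis unfolding y1_def K1_eq M C_zero[OF t] by simp
  qed
  let ?g = "\<lambda>x. indicator {0<..} x * (1 - exp (- (1 / r * x)))"
  let ?k = "\<lambda>x. indicator {x. \<bar>x\<bar> > r} x + 1 / r\<^sup>2 * (x\<^sup>2 * indicator {x. \<bar>x\<bar> \<le> r} x) + (1 / r) * trunc r x"
  have ik: "integrable (\<nu> t) ?k"
    by (rule Bochner_Integration.integrable_add[OF Bochner_Integration.integrable_add[OF ii integrable_mult_right[OF isq]] integrable_mult_right[OF it]])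
  have le1: "?g x \<le> ?k x" if "0 \<le> x" for x
    using one_minus_exp_le_min[of "1 / r * x"] that r
    by (auto simp: indicator_def trunc_eq intro: add_increasing)
  have le2: "?k x \<le> 4 * ?g x" if "0 \<le> x" for x
  proof (cases "x = 0")
    case False
    then have x: "x > 0" using that by simp
    have m: "min 1 (x / r) \<le> 2 * (1 - exp (- (x / r)))" using x r by (intro min_le_one_minus_exp) auto
    have "?k x \<le> 2 * min 1 (x / r)"
    proof (cases "x \<le> r")
      case True
      then have "x / r \<le> 1" using r by simp
      then have "x / r * (x / r) \<le> x / r * 1" using x r by (intro mult_left_mono) auto
      then have "(x / r)\<^sup>2 \<le> x / r" by (simp only: power2_eq_square mult_1_right)
      moreover have "?k x = (x / r)\<^sup>2 + x / r" using True x by (simp add: trunc_eq power_divide)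
      moreover have "min 1 (x / r) = x / r" using \<open>x / r \<le> 1\<close> by simp
      ultimately show ?thesis by linarith
    next
      case False
      then have "x / r \<ge> 1" using r by simp
      then show ?thesis using False x r by (simp add: trunc_eq)
    qed
    then show ?thesis using m x by simp
  qed (use r in \<open>simp add: trunc_eq\<close>)
  have g_nonneg: "0 \<le> ?g x" for x using r by (auto simp: indicator_def)
  have ig: "integrable (\<nu> t) ?g"
  proof (rule Bochner_Integration.integrable_bound[OF ik])
    show "AE x in \<nu> t. norm (?g x) \<le> norm (?k x)"
      using levy_measure_nonneg[OF t]
    proof eventually_elim
      case (elim x)
      then show ?case using le1[of x] g_nonneg[of x] by (simp only: real_norm_def abs_of_nonneg order_trans[OF g_nonneg le1])
    qed
  qed measurable
  have g: "g1 t (1 / r) = (LINT x|\<nu> t. ?g x)" unfolding g1_def set_lebesgue_integral_def by simp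
  have AE1: "AE x in \<nu> t. ?g x \<le> ?k x" using levy_measure_nonneg[OF t] by eventually_elim (rule le1)
  have AE2: "AE x in \<nu> t. ?k x \<le> 4 * ?g x" using levy_measure_nonneg[OF t] by eventually_elim (rule le2)
  show "g1 t (1 / r) \<le> y1 B C \<nu> t r" unfolding g y by (rule integral_mono_AE[OF ig ik AE1])
  have "y1 B C \<nu> t r \<le> (LINT x|\<nu> t. 4 * ?g x)" unfolding y
    by (rule integral_mono_AE[OF ik integrable_mult_right[OF ig] AE2])
  then show "y1 B C \<nu> t r \<le> 4 * g1 t (1 / r)" unfolding g by (simp only: integral_mult_right_zero)
qed

end

section \<open>The indices in terms of the Laplace exponent\<close>

text \<open>The frequency r corresponds to the radius s = 1 / r, which brings limits at infinity
  back to the filter at 0.\<close>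

lemma tendsto_powr_mult_at_top_iff:
  fixes f :: "real \<Rightarrow> ennreal"
  shows "((\<lambda>r. ennreal (r powr \<eta>) * f r) \<longlongrightarrow> L) at_top
     \<longleftrightarrow> ((\<lambda>s. ennreal (s powr (- \<eta>)) * f (1 / s)) \<longlongrightarrow> L) at_0"
proof -
  have "((\<lambda>r. ennreal (r powr \<eta>) * f r) \<longlongrightarrow> L) at_top
     \<longleftrightarrow> ((\<lambda>s. ennreal (inverse s powr \<eta>) * f (inverse s)) \<longlongrightarrow> L) at_0"
    by (rule filterlim_at_top_to_right)
  also have "\<dots> \<longleftrightarrow> ((\<lambda>s. ennreal (s powr (- \<eta>)) * f (1 / s)) \<longlongrightarrow> L) at_0"
  proof (rule tendsto_cong)
    show "eventually (\<lambda>s. ennreal (inverse s powr \<eta>) * f (inverse s) = ennreal (s powr (- \<eta>)) * f (1 / s)) at_0"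
      using eventually_pos by eventually_elim (simp add: powr_minus inverse_powr inverse_eq_divide powr_divide)
  qed
  finally show ?thesis .
qed

lemma ennreal_powr_mult:
  assumes "0 < s" shows "ennreal (s powr a) * ennreal (s powr b) = ennreal (s powr (a + b))"
  by (simp add: ennreal_mult' powr_add)

context growth_function
begin

section \<open>Passage times of a function comparable with Y at the reciprocal argument\<close>

context
  fixes g :: "real \<Rightarrow> real \<Rightarrow> real" and A t1 :: real
  assumes A: "A > 0" and t1: "t1 > 0"
    and g_le: "\<And>t r. 0 < t \<Longrightarrow> t \<le> t1 \<Longrightarrow> 0 < r \<Longrightarrow> r \<le> 1 \<Longrightarrow> g t (1 / r) \<le> Y t r"
    and g_ge: "\<And>t r. 0 < t \<Longrightarrow> t \<le> t1 \<Longrightarrow> 0 < r \<Longrightarrow> r \<le> 1 \<Longrightarrow> Y t r \<le> A * g t (1 / r)"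
begin

abbreviation (input) n' :: "real \<Rightarrow> ennreal" where "n' \<equiv> passage g m"

text \<open>The comparison constant changes the level from m to A m. The gap between d and c absorbs
  this, because \<open>large_value\<close> pushes Y above any fixed level.\<close>

lemma n'_le:
  assumes "0 < d" "d < c"
  shows "eventually (\<lambda>s. n s \<le> ennreal (s powr c) \<longrightarrow> n' (1 / s) \<le> ennreal (s powr d)) at_0"
proof -
  obtain \<kappa> where \<kappa>: "\<kappa> > 0" "eventually (\<lambda>r. n r \<le> ennreal (r powr c) \<longrightarrow> r powr (- \<kappa>) \<le> Y (r powr d) r) at_0"
    using large_value[OF assms] by blast
  have "1 / (A * m) > 0" using A m_pos by simp
  show ?thesis
    using \<kappa>(2) eventually_unit eventually_powr_less[OF \<kappa>(1) \<open>1 / (A * m) > 0\<close>] eventually_powr_less[OF assms(1) t1]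
  proof eventually_elim
    case (elim s)
    show ?case
    proof
      assume "n s \<le> ennreal (s powr c)"
      then have Y: "s powr (- \<kappa>) \<le> Y (s powr d) s" using elim by simp
      have "A * m < s powr (- \<kappa>)" using elim A m_pos by (simp add: powr_minus field_simps)
      also note Y
      also have "Y (s powr d) s \<le> A * g (s powr d) (1 / s)" using elim by (intro g_ge) auto
      finally have "m < g (s powr d) (1 / s)" using A by simp
      then show "n' (1 / s) \<le> ennreal (s powr d)" using elim by (intro passage_le) auto
    qed
  qed
qed

lemma n'_ge:
  assumes "0 < c"
  shows "eventually (\<lambda>s. ennreal (s powr c) < n s \<longrightarrow> ennreal (s powr c) \<le> n' (1 / s)) at_0"
  using eventually_unit eventually_powr_less[OF assms t1]
proof eventually_elim
  case (elim s)
  show ?case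
  proof
    assume n: "ennreal (s powr c) < n s"
    show "ennreal (s powr c) \<le> n' (1 / s)"
    proof (rule passage_ge)
      fix t assume t: "0 < t" "t < s powr c"
      then have "ennreal t < n s" using n by (meson ennreal_leI less_imp_le order_le_less_trans)
      then have "Y t s \<le> m" using t by (intro passage_below) auto
      moreover have "g t (1 / s) \<le> Y t s" using elim t by (intro g_le) auto
      ultimately show "g t (1 / s) \<le> m" by simp
    qed
  qed
qed

lemma n'_less:
  assumes "0 < c"
  shows "eventually (\<lambda>s. n' (1 / s) < ennreal (s powr c) \<longrightarrow> n s \<le> ennreal (s powr c)) at_0"
  using n'_ge[OF assms] by eventually_elim (use not_le in blast)

text \<open>The product \<open>s powr (- \<eta>) * n' (1 / s)\<close> tends to 0 exactly when, up to
  the borderline exponent, the passage time is eventually below \<open>s powr \<eta>\<close>. This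
  is a condition on all small s, and it characterises exponents below the lower index.\<close>

lemma lower_index_eq_passage_g:
  "Sup (ennreal ` {\<eta>. \<eta> \<ge> 0 \<and> ((\<lambda>r. ennreal (r powr \<eta>) * n' r) \<longlongrightarrow> 0) at_top}) = lower_index n"
  unfolding tendsto_powr_mult_at_top_iff
proof (rule Sup_ennreal_eqI)
  fix \<eta> :: real assume \<eta>: "0 < \<eta>" "ennreal \<eta> < lower_index n"
  then obtain c where c: "\<eta> < c" "ennreal c < lower_index n" using exponent_between_below by (metis less_imp_le)
  define d where "d = (\<eta> + c) / 2"
  have d: "\<eta> < d" "d < c" "0 < d" "0 \<le> c" using c \<eta> by (auto simp: d_def)
  have "eventually (\<lambda>s. ennreal (s powr (- \<eta>)) * n' (1 / s) < ennreal e) at_0" if e: "e > 0" for e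
  proof -
    have "d - \<eta> > 0" using d by simp
    show ?thesis
      using lower_index_lt[OF d(4) c(2)] n'_le[OF d(3,2)] eventually_unit eventually_powr_less[OF \<open>d - \<eta> > 0\<close> e]
    proof eventually_elim
      case (elim s)
      then have "ennreal (s powr (- \<eta>)) * n' (1 / s) \<le> ennreal (s powr (- \<eta>)) * ennreal (s powr d)"
        by (intro mult_left_mono) auto
      also have "\<dots> = ennreal (s powr (d - \<eta>))" using elim by (simp add: ennreal_powr_mult)
      also have "\<dots> < ennreal e" using elim e by (simp add: ennreal_less_iff)
      finally show ?case .
    qed
  qed
  then show "\<eta> \<in> {\<eta>. \<eta> \<ge> 0 \<and> ((\<lambda>s. ennreal (s powr (- \<eta>)) * n' (1 / s)) \<longlongrightarrow> 0) at_0}"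
    using \<eta> by (simp add: tendsto_ennreal_0_iff)
next
  fix \<eta> assume "\<eta> \<in> {\<eta>. \<eta> \<ge> 0 \<and> ((\<lambda>s. ennreal (s powr (- \<eta>)) * n' (1 / s)) \<longlongrightarrow> 0) at_0}"
  then have \<eta>: "0 \<le> \<eta>" and lim: "((\<lambda>s. ennreal (s powr (- \<eta>)) * n' (1 / s)) \<longlongrightarrow> 0) at_0" by auto
  show "ennreal \<eta> \<le> lower_index n"
  proof (rule ccontr)
    assume "\<not> ?thesis"
    then obtain c where c: "0 < c" "c < \<eta>" "lower_index n < ennreal c" using exponent_between_above by (metis not_le)
    have "eventually (\<lambda>s. ennreal (s powr (- \<eta>)) * n' (1 / s) < ennreal 1) at_0"
      using lim unfolding tendsto_ennreal_0_iff by (metis zero_less_one)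
    then have "eventually (\<lambda>s. \<not> ennreal (s powr c) < n s) at_0"
      using n'_less[OF c(1)] eventually_unit
    proof eventually_elim
      case (elim s)
      have "n' (1 / s) = ennreal (s powr \<eta>) * (ennreal (s powr (- \<eta>)) * n' (1 / s))"
        using elim by (simp add: mult.assoc[symmetric] ennreal_powr_mult)
      also have "\<dots> \<le> ennreal (s powr \<eta>) * ennreal 1" using elim by (intro mult_left_mono) auto
      also have "\<dots> < ennreal (s powr c)" using powr_less_mono'[of s c \<eta>] elim c by (simp add: ennreal_less_iff)
      finally show ?case using elim by simp
    qed
    then show False using lower_index_gt[OF c(3)] by (rule frequently_eventually_contradiction[rotated])
  qed
qed

lemma upper_index_eq_passage_g:
  "Inf (ennreal ` {\<eta>. \<eta> \<ge> 0 \<and> ((\<lambda>r. ennreal (r powr \<eta>) * n' r) \<longlongrightarrow> \<infinity>) at_top}) = upper_index n"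
  unfolding tendsto_powr_mult_at_top_iff
proof (rule Inf_ennreal_eqI)
  fix \<eta> :: real assume \<eta>: "0 < \<eta>" "upper_index n < ennreal \<eta>"
  then obtain c where c: "0 < c" "c < \<eta>" "upper_index n < ennreal c" using exponent_between_above by blast
  have "eventually (\<lambda>s. ennreal l < ennreal (s powr (- \<eta>)) * n' (1 / s)) at_0" if l: "l \<ge> 0" for l
  proof -
    have e: "\<eta> - c > 0" "1 / (l + 1) > 0" using c l by auto
    show ?thesis
      using upper_index_gt[OF c(3)] n'_ge[OF c(1)] eventually_unit eventually_powr_less[OF e]
    proof eventually_elim
      case (elim s)
      have "l + 1 < s powr (- (\<eta> - c))" using elim l by (simp only: powr_minus) (simp add: field_simps)
      then have "ennreal l < ennreal (s powr (- \<eta> + c))" using l by (simp add: ennreal_less_iff)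
      also have "\<dots> = ennreal (s powr (- \<eta>)) * ennreal (s powr c)" using elim by (intro ennreal_powr_mult[symmetric]) simp
      also have "\<dots> \<le> ennreal (s powr (- \<eta>)) * n' (1 / s)" using elim by (intro mult_left_mono) auto
      finally show ?case .
    qed
  qed
  then show "\<eta> \<in> {\<eta>. \<eta> \<ge> 0 \<and> ((\<lambda>s. ennreal (s powr (- \<eta>)) * n' (1 / s)) \<longlongrightarrow> \<infinity>) at_0}"
    using \<eta> by (simp add: tendsto_top_iff_ennreal)
next
  fix \<eta> assume "\<eta> \<in> {\<eta>. \<eta> \<ge> 0 \<and> ((\<lambda>s. ennreal (s powr (- \<eta>)) * n' (1 / s)) \<longlongrightarrow> \<infinity>) at_0}"
  then have \<eta>: "0 \<le> \<eta>" and lim: "((\<lambda>s. ennreal (s powr (- \<eta>)) * n' (1 / s)) \<longlongrightarrow> top) at_0" by auto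
  show "upper_index n \<le> ennreal \<eta>"
  proof (rule ccontr)
    assume "\<not> ?thesis"
    then obtain c where c: "\<eta> < c" "ennreal c < upper_index n" using exponent_between_below \<eta> by (metis not_le)
    define d where "d = (\<eta> + c) / 2"
    have d: "\<eta> < d" "d < c" "0 < d" "0 \<le> c" using c \<eta> by (auto simp: d_def)
    have "eventually (\<lambda>s. ennreal 1 < ennreal (s powr (- \<eta>)) * n' (1 / s)) at_0"
      using lim unfolding tendsto_top_iff_ennreal by (metis zero_le_one)
    then have "eventually (\<lambda>s. \<not> n s \<le> ennreal (s powr c)) at_0"
      using n'_le[OF d(3,2)] eventually_unit
    proof eventually_elim
      case (elim s)
      show ?case
      proof
        assume "n s \<le> ennreal (s powr c)"
        then have "ennreal (s powr (- \<eta>)) * n' (1 / s) \<le> ennreal (s powr (- \<eta>)) * ennreal (s powr d)"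
          using elim by (intro mult_left_mono) auto
        also have "\<dots> = ennreal (s powr (- \<eta> + d))" using elim by (simp add: ennreal_powr_mult)
        also have "\<dots> \<le> ennreal 1" using powr_mono'[of 0 "- \<eta> + d" s] d elim by (intro ennreal_leI) simp
        finally show False using elim by simp
      qed
    qed
    then show False using upper_index_lt[OF d(4) c(2)] by (rule frequently_eventually_contradiction[rotated])
  qed
qed

end
end

context time_changed_vector
begin

text \<open>Increasing components have finite variation of small jumps at time 1, so the drift-free
  hypothesis applies to all of them and gives a common initial interval for the componentwise
  comparison.\<close>

lemma increasing_comparison:
  assumes v0: "(v \<longlongrightarrow> 0) at_0" and df: "drift_free_initially B \<nu>"
    and inc: "\<And>i \<omega>. \<omega> \<in> space P \<Longrightarrow> mono_on {0..} (\<lambda>t. X t \<omega> $ i)"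
  obtains t1 where "0 < t1" "\<And>t r. 0 < t \<Longrightarrow> t \<le> t1 \<Longrightarrow> 0 < r \<Longrightarrow> r \<le> 1 \<Longrightarrow> g_fun \<nu> (v t) (1 / r) \<le> Y t r"
    "\<And>t r. 0 < t \<Longrightarrow> t \<le> t1 \<Longrightarrow> 0 < r \<Longrightarrow> r \<le> 1 \<Longrightarrow> Y t r \<le> 4 * g_fun \<nu> (v t) (1 / r)"
proof -
  have ic: "increasing_component (\<nu> i) (B i) (C i) P (\<lambda>t \<omega>. X t \<omega> $ i)" for i
    by unfold_locales (rule inc)
  have "integrable (\<nu> i 1) (small_power 1)" for i
    by (rule increasing_component.small_power_1_integrable[OF ic]) simp
  then obtain e where e: "0 < e" "\<And>i s. 0 \<le> s \<Longrightarrow> s \<le> e \<Longrightarrow> \<gamma>0 (B i) (\<nu> i) s = 0"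
    using drift_free_time[OF df zero_less_one] by blast
  obtain t1 where t1: "0 < t1" "v t1 \<le> e" using small_time[OF v0 e(1) zero_less_one] by blast
  have g: "g_fun \<nu> s u = (\<Sum>i\<in>UNIV. increasing_component.g1 (\<nu> i) s u)" for s u
    unfolding g_fun_def increasing_component.g1_def[OF ic] ..
  have *: "increasing_component.g1 (\<nu> i) (v t) (1 / r) \<le> y1 (B i) (C i) (\<nu> i) (v t) r"
     "y1 (B i) (C i) (\<nu> i) (v t) r \<le> 4 * increasing_component.g1 (\<nu> i) (v t) (1 / r)"
    if "0 < t" "t \<le> t1" "0 < r" "r \<le> 1" for t r i
  proof -
    have v: "0 < v t" "v t \<le> e" using v_pos[of t] v_le[of t t1] that t1 by auto
    have d: "\<gamma>0 (B i) (\<nu> i) s = 0" if "0 \<le> s" "s \<le> v t" for s using e(2) that v by simp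
    show "increasing_component.g1 (\<nu> i) (v t) (1 / r) \<le> y1 (B i) (C i) (\<nu> i) (v t) r"
      by (rule increasing_component.y1_g1_comparable(1)[OF ic v(1) that(3,4) d])
    show "y1 (B i) (C i) (\<nu> i) (v t) r \<le> 4 * increasing_component.g1 (\<nu> i) (v t) (1 / r)"
      by (rule increasing_component.y1_g1_comparable(2)[OF ic v(1) that(3,4) d])
  qed
  show ?thesis
  proof (rule that[OF t1(1)])
    fix t r :: real assume "0 < t" "t \<le> t1" "0 < r" "r \<le> 1"
    then show "g_fun \<nu> (v t) (1 / r) \<le> Y t r" "Y t r \<le> 4 * g_fun \<nu> (v t) (1 / r)"
      unfolding g y_fun_def sum_distrib_left by (auto intro!: sum_mono *)
  qed
qed

lemma index_eq_laplace_passage: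
  assumes "(v \<longlongrightarrow> 0) at_0" "drift_free_initially B \<nu>"
    and "\<And>i \<omega>. \<omega> \<in> space P \<Longrightarrow> mono_on {0..} (\<lambda>t. X t \<omega> $ i)"
  defines "n_hat \<equiv> passage (\<lambda>t r. g_fun \<nu> (v t) r) m"
  shows "lower_index n = Sup (ennreal ` {\<eta>. \<eta> \<ge> 0 \<and> ((\<lambda>r. ennreal (r powr \<eta>) * n_hat r) \<longlongrightarrow> 0) at_top})"
    "upper_index n = Inf (ennreal ` {\<eta>. \<eta> \<ge> 0 \<and> ((\<lambda>r. ennreal (r powr \<eta>) * n_hat r) \<longlongrightarrow> \<infinity>) at_top})"
proof -
  obtain t1 where t1: "0 < t1" "\<And>t r. 0 < t \<Longrightarrow> t \<le> t1 \<Longrightarrow> 0 < r \<Longrightarrow> r \<le> 1 \<Longrightarrow> g_fun \<nu> (v t) (1 / r) \<le> Y t r"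
    "\<And>t r. 0 < t \<Longrightarrow> t \<le> t1 \<Longrightarrow> 0 < r \<Longrightarrow> r \<le> 1 \<Longrightarrow> Y t r \<le> 4 * g_fun \<nu> (v t) (1 / r)"
    using increasing_comparison[OF assms(1,2,3)] by blast
  show "lower_index n = Sup (ennreal ` {\<eta>. \<eta> \<ge> 0 \<and> ((\<lambda>r. ennreal (r powr \<eta>) * n_hat r) \<longlongrightarrow> 0) at_top})"
    unfolding n_hat_def
    by (rule lower_index_eq_passage_g[of 4 t1 "\<lambda>t r. g_fun \<nu> (v t) r", symmetric]) (use t1 in auto)
  show "upper_index n = Inf (ennreal ` {\<eta>. \<eta> \<ge> 0 \<and> ((\<lambda>r. ennreal (r powr \<eta>) * n_hat r) \<longlongrightarrow> \<infinity>) at_top})"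
    unfolding n_hat_def
    by (rule upper_index_eq_passage_g[of 4 t1 "\<lambda>t r. g_fun \<nu> (v t) r", symmetric]) (use t1 in auto)
qed

end

theorem theorem3p2:
  fixes P :: "'w measure"
    and X :: "real \<Rightarrow> 'w \<Rightarrow> real ^ 'n"
    and B C :: "'n \<Rightarrow> real \<Rightarrow> real"
    and \<nu> :: "'n \<Rightarrow> real \<Rightarrow> real measure"
    and v \<phi> c :: "real \<Rightarrow> real"
    and b t0 \<sigma> m l :: real
  assumes prob: "prob_space P"
    and additive: "\<And>i. additive_process P (\<lambda>t \<omega>. X t \<omega> $ i)"
    and chars: "\<And>i. has_characteristics P (\<lambda>t \<omega>. X t \<omega> $ i) (B i) (C i) (\<nu> i)"
    and b_pos: "b > 0"
    and phi: "quasiconvex \<phi>"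
    and v_pos: "\<And>t. t > 0 \<Longrightarrow> v t > 0"
    and v_mono: "mono_on {0<..} v"
    and v_phi: "eventually (\<lambda>t. y_fun B C \<nu> (v t) b = \<phi> t) (at_right 0)"
    and t0_pos: "t0 > 0"
    and sigma_pos: "\<sigma> > 0"
    and c_slow: "slow_on {0<..b} c"
    and y_quasiconvex: "\<And>t1 t2 r. 0 < t1 \<Longrightarrow> t1 < t2 \<Longrightarrow> t2 \<le> t0 \<Longrightarrow> r \<in> {0<..b} \<Longrightarrow>
           y_fun B C \<nu> (v t2) r / y_fun B C \<nu> (v t1) r \<ge> c r * (t2 / t1) powr \<sigma>"
    and m_pos: "m > 0"
    and m_less: "m < min (1 / 2 * y_fun B C \<nu> (v t0) b)
                         (inverse ((3 + sqrt 5) / 2 * K_dim CARD('n)))"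
    and l: "l \<in> {0<..t0}"
  shows
    "let Y = (\<lambda>t r. y_fun B C \<nu> (v t) r);
         \<delta> = lower_index (passage Y m);
         \<beta> = upper_index (passage Y m)
     in
      (delta1 Y = \<delta> \<and> delta2 Y = \<delta> \<and> delta_P P X v l = \<delta> \<and> delta_E P X v l = \<delta> \<and>
       beta1 Y = \<beta> \<and> beta2 Y = \<beta> \<and> beta_P P X v l = \<beta>)
    \<and>
      ((v \<longlongrightarrow> 0) (at_right 0) \<longrightarrow>
       (\<exists>\<tau>>0. (\<Sum>j\<in>UNIV. small_jump_variation (\<nu> j) \<tau>) < \<infinity> \<and> (\<Sum>j\<in>UNIV. C j \<tau>) = 0) \<longrightarrow>
       \<beta> \<le> ennreal (1 / \<sigma>))
    \<and>
      ((v \<longlongrightarrow> 0) (at_right 0) \<longrightarrow>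
       drift_free_initially B \<nu> \<longrightarrow>
       (\<exists>\<tau>>0. (\<Sum>j\<in>UNIV. C j \<tau>) = 0) \<longrightarrow>
       (\<exists>t0'>0. \<exists>r0>0. \<exists>\<sigma>'\<le>\<sigma>. \<exists>c'. slow_on {0<..<r0} c' \<and>
          (\<forall>t1 t2 r. 0 < t1 \<longrightarrow> t1 < t2 \<longrightarrow> t2 \<le> t0' \<longrightarrow> r \<in> {0<..<r0} \<longrightarrow>
             G_fun \<nu> (v t2) r \<le> inverse (c' r) * (t2 / t1) powr \<sigma>' * G_fun \<nu> (v t1) r)) \<longrightarrow>
       \<beta> = upper_index (passage (\<lambda>t r. G_fun \<nu> (v t) r) m))
    \<and>
      ((v \<longlongrightarrow> 0) (at_right 0) \<longrightarrow>
       drift_free_initially B \<nu> \<longrightarrow>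
       (\<forall>i. \<forall>\<omega>\<in>space P. mono_on {0..} (\<lambda>t. X t \<omega> $ i)) \<longrightarrow>
       (let n_hat = passage (\<lambda>t r. g_fun \<nu> (v t) r) m in
          \<delta> = Sup (ennreal ` {\<eta>. \<eta> \<ge> 0 \<and>
                ((\<lambda>r. ennreal (r powr \<eta>) * n_hat r) \<longlongrightarrow> 0) at_top}) \<and>
          \<beta> = Inf (ennreal ` {\<eta>. \<eta> \<ge> 0 \<and>
                ((\<lambda>r. ennreal (r powr \<eta>) * n_hat r) \<longlongrightarrow> \<infinity>) at_top})))"
proof -
  interpret additive_vector P X B C \<nu>
    by (intro additive_vector.intro additive_vector_axioms.intro prob additive chars)
  have pos: "0 < y_fun B C \<nu> (v t) b" if t: "t > 0" for t
  proof -
    obtain d where d: "d > 0" "\<And>t. 0 < t \<Longrightarrow> t < d \<Longrightarrow> y_fun B C \<nu> (v t) b = \<phi> t"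
      using v_phi eventually_at_right[of 0 "1::real"] by auto
    \<comment> \<open>The identity with \<phi> is assumed near 0 only; positivity is taken at an
      earlier time s in that range and carried to t by monotonicity of \<open>v\<close> and of
      \<open>y\<close> in time.\<close>
    define s where "s = min t (d / 2)"
    have s: "0 < s" "s \<le> t" "s < d" using d t by (auto simp: s_def)
    have "0 < y_fun B C \<nu> (v s) b" using d(2)[OF s(1,3)] phi s by (simp add: quasiconvex_def)
    also have "\<dots> \<le> y_fun B C \<nu> (v t) b"
      using s v_mono v_pos[OF s(1)] by (intro y_le b_pos) (auto simp: mono_on_def)
    finally show ?thesis .
  qed
  interpret time_changed_vector P X B C \<nu> v c b t0 \<sigma> m
    by unfold_locales
       (use b_pos t0_pos sigma_pos m_pos v_pos v_mono pos c_slow y_quasiconvex m_less in auto)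
  have l': "0 < l" "l \<le> t0" using l by auto
  show ?thesis
    unfolding Let_def
  proof (intro conjI impI)
    show "delta1 Y = lower_index n" by (rule delta1_eq)
    show "delta2 Y = lower_index n" by (rule delta2_eq)
    show "delta_P P X v l = lower_index n" by (rule delta_P_eq[OF l'])
    show "delta_E P X v l = lower_index n" by (rule delta_E_eq[OF l'])
    show "beta1 Y = upper_index n" by (rule beta1_eq)
    show "beta2 Y = upper_index n" by (rule beta2_eq)
    show "beta_P P X v l = upper_index n" by (rule beta_P_eq[OF l'])
  next
    assume "(v \<longlongrightarrow> 0) (at_right 0)"
      "\<exists>\<tau>>0. (\<Sum>j\<in>UNIV. small_jump_variation (\<nu> j) \<tau>) < \<infinity> \<and> (\<Sum>j\<in>UNIV. C j \<tau>) = 0"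
    then show "upper_index n \<le> ennreal (1 / \<sigma>)" using upper_index_le_of_finite_variation by blast
  next
    assume *: "(v \<longlongrightarrow> 0) (at_right 0)" "drift_free_initially B \<nu>" "\<exists>\<tau>>0. (\<Sum>j\<in>UNIV. C j \<tau>) = 0"
      "\<exists>t0'>0. \<exists>r0>0. \<exists>\<sigma>'\<le>\<sigma>. \<exists>c'. slow_on {0<..<r0} c' \<and>
          (\<forall>t1 t2 r. 0 < t1 \<longrightarrow> t1 < t2 \<longrightarrow> t2 \<le> t0' \<longrightarrow> r \<in> {0<..<r0} \<longrightarrow>
             G_fun \<nu> (v t2) r \<le> inverse (c' r) * (t2 / t1) powr \<sigma>' * G_fun \<nu> (v t1) r)"
    obtain \<tau> where \<tau>: "\<tau> > 0" "(\<Sum>j\<in>UNIV. C j \<tau>) = 0" using *(3) by blast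
    obtain t0' r0 \<sigma>' c' where G: "t0' > 0" "r0 > 0" "\<sigma>' \<le> \<sigma>" "slow_on {0<..<r0} c'"
      "\<And>t1 t2 r. 0 < t1 \<Longrightarrow> t1 < t2 \<Longrightarrow> t2 \<le> t0' \<Longrightarrow> r \<in> {0<..<r0} \<Longrightarrow>
             G_fun \<nu> (v t2) r \<le> inverse (c' r) * (t2 / t1) powr \<sigma>' * G_fun \<nu> (v t1) r"
      using *(4) by blast
    show "upper_index n = upper_index (passage (\<lambda>t r. G_fun \<nu> (v t) r) m)"
      by (rule upper_index_eq_tail_passage[OF *(1,2) \<tau> G])
  next
    assume *: "(v \<longlongrightarrow> 0) (at_right 0)" "drift_free_initially B \<nu>"
      "\<forall>i. \<forall>\<omega>\<in>space P. mono_on {0..} (\<lambda>t. X t \<omega> $ i)"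
    have inc: "\<And>i \<omega>. \<omega> \<in> space P \<Longrightarrow> mono_on {0..} (\<lambda>t. X t \<omega> $ i)" using *(3) by blast
    show "lower_index n = Sup (ennreal ` {\<eta>. \<eta> \<ge> 0 \<and>
        ((\<lambda>r. ennreal (r powr \<eta>) * passage (\<lambda>t r. g_fun \<nu> (v t) r) m r) \<longlongrightarrow> 0) at_top})"
      by (rule index_eq_laplace_passage(1)[OF *(1,2) inc])
    show "upper_index n = Inf (ennreal ` {\<eta>. \<eta> \<ge> 0 \<and>
        ((\<lambda>r. ennreal (r powr \<eta>) * passage (\<lambda>t r. g_fun \<nu> (v t) r) m r) \<longlongrightarrow> \<infinity>) at_top})"
      by (rule index_eq_laplace_passage(2)[OF *(1,2) inc])
  qed
qed

end
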